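(* Let $n\geqslant 3$, $\alpha\in(0,2]$, let $D\subset\mathbb R^n$ be a domain, let $A_1\subset D$ be relatively closed in $D$, and let $A_2:=D^c=\mathbb R^n\setminus D$, where $c_\alpha(A_1)>0$, $c_\alpha(A_2)>0$ and $A_2$ is not $\alpha$-thin at infinity; write $\mathbf A=(A_1,A_2)$. Let $f$ be an external field satisfying Case I or Case II (see context), and let $\xi\in\mathfrak C(A_1;\mathbb R^n)$ be a constraint. Assume that $$G_{\alpha,f}^{\xi}(\mathbf A,\mathbf 1;\mathbb R^n):=\inf_{\mu\in\mathcal E_{\alpha,f}^\xi(\mathbf A,\mathbf 1;\mathbb R^n)}G_{\alpha,f}(\mu)<\infty ,$$ and that $\xi$ is bounded, i.e. $\xi(A_1)<\infty$. Then there exists one and only one measure $\lambda_{\mathbf A}^\xi\in\mathcal E_{\alpha,f}^\xi(\mathbf A,\mathbf 1;\mathbb R^n)$ with $$G_{\alpha,f}(\lambda_{\mathbf A}^\xi)=G_{\alpha,f}^{\xi}(\mathbf A,\mathbf 1;\mathbb R^n).$$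
   Context: Measures. For a locally compact space $X$ ($X=\mathbb R^n$ or $X=D$), $\mathfrak M(X)$ is the space of signed Radon measures on $X$, $\mathfrak M^+(X)$ the cone of positive ones; $\mu=\mu^+-\mu^-$ is the Hahn--Jordan decomposition, $|\mu|=\mu^++\mu^-$. A positive Radon measure $\mu$ is carried by $Q\subset X$ if $X\setminus Q$ is $\mu$-negligible. Positive Radon measures $\mu$ on $\mathbb R^n$ are tacitly assumed to have potential $U_\alpha^\mu$ not identically infinite. Riesz kernel. $\kappa_\alpha(x,y)=|x-y|^{\alpha-n}$ on $\mathbb R^n$; $U_\alpha^\mu(x)=\int|x-y|^{\alpha-n}\,d\mu(y)$, $E_\alpha(\mu,\nu)=\iint|x-y|^{\alpha-n}\,d\mu(x)\,d\nu(y)$, $E_\alpha(\mu)=E_\alpha(\mu,\mu)=\|\mu\|_\alpha^2$. $\mathcal E_\alpha(\mathbb R^n)$ is the set of signed Radon measures $\mu$ with $E_\alpha(|\mu|)<\infty$. $\mathcal E_\alpha^+(Q;\mathbb R^n)$ is the set of positive measures in $\mathcal E_\alpha(\mathbb R^n)$ carried by $Q$. Inner capacity: $c_\alpha(Q)=[\inf E_\alpha(\mu)]^{-1}$, the infimum over $\mu\in\mathcal E_\alpha^+(Q;\mathbb R^n)$ with $\mu(Q)=1$ ($\inf\varnothing=+\infty$, $1/(+\infty)=0$, $1/0=+\infty$). "n.e. on $Q$" means: for all $x\in Q$ outside a set $N$ with $c_\alpha(N)=0$. A measure $\mu$ is $c_\alpha$-absolutely continuous if $\mu(K)=0$ for every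 compact $K$ with $c_\alpha(K)=0$. Thinness at infinity. For closed $F\subset\mathbb R^n$, a point $x_0\in F$ is $\alpha$-irregular for $F$ if $\sum_{k\geqslant1}c_\alpha(F_k)\,q^{-k(n-\alpha)}<\infty$, where $q\in(0,1)$ is fixed and $F_k=\{x\in F:\ q^{k+1}<|x-x_0|\leqslant q^k\}$ (Wiener criterion). $F$ is $\alpha$-thin at infinity if either $F$ is compact, or $0$ is an $\alpha$-irregular point of the inverse $\{0\}\cup\{x/|x|^2:\ x\in F\setminus\{0\}\}$ of $F$ with respect to the unit sphere. Extendible measures and balayage. $\nu\in\mathfrak M(D)$ is extendible if $\nu^\pm$ extend by $0$ off $D$ to positive Radon measures on $\mathbb R^n$ satisfying $\int_{|y|>1}|y|^{\alpha-n}\,d\nu^\pm(y)<\infty$; $\nu$ is identified with its extension. Its ($\alpha$-Riesz) balayage $\nu'=\nu^{D^c}$ onto $D^c$ is the unique $c_\alpha$-absolutely continuous signed measure on $\mathbb R^n$ supported by $D^c$ with $U_\alpha^{\nu'}=U_\alpha^{\nu}$ n.e. on $D^c$. External field. Case I: $f:\mathbb R^n\to[0,\infty]$ is lower semicontinuous and $f=0$ n.e. on $A_2$. Case II: $f=U_\alpha^{\zeta-\zeta'}$, where $\zeta$ is a signed extendible Radon measure on $D$ with $\zeta\in\mathcal E_\alpha(\mathbb R^n)$. Constraint and admissible measures. $\mathfrak C(A_1;\mathbb R^n)$ is the set of $\xi\in\mathcal E_\alpha^+(A_1;\mathbb R^n)$ with $\xi(A_1)>1$. $\mathcal E_\alpha(\mathbf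 A,\mathbf 1;\mathbb R^n)$ is the set of $\mu\in\mathcal E_\alpha(\mathbb R^n)$ such that $\mu^+$ is carried by $A_1$, $\mu^-$ is carried by $A_2$, and $\mu^+(A_1)=\mu^-(A_2)=1$. $\mathcal E_{\alpha,f}^\xi(\mathbf A,\mathbf 1;\mathbb R^n)$ is the set of $\mu\in\mathcal E_\alpha(\mathbf A,\mathbf 1;\mathbb R^n)$ with $\mu^+\leqslant\xi$ for which $f$ is $|\mu|$-integrable. The weighted energy is $G_{\alpha,f}(\mu)=\|\mu\|_\alpha^2+2\int f\,d\mu$. *)

theory Defs
  imports "HOL-Analysis.Analysis"
begin

section \<open>Positive and signed Radon measures\<close>

definition measure_add :: "'a measure \<Rightarrow> 'a measure \<Rightarrow> 'a measure" where
  "measure_add M N = measure_of (space M) (sets M) (\<lambda>B. emeasure M B + emeasure N B)"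

lemma sets_measure_add [simp]: "sets (measure_add M N) = sets M"
  by (simp add: measure_add_def sets.sigma_sets_eq)

lemma space_measure_add [simp]: "space (measure_add M N) = space M"
  by (simp add: measure_add_def)

lemma emeasure_measure_add:
  assumes sets: "sets N = sets M" and B: "B \<in> sets M"
  shows "emeasure (measure_add M N) B = emeasure M B + emeasure N B"
  unfolding measure_add_def
proof (rule emeasure_measure_of_sigma)
  show "sigma_algebra (space M) (sets M)"
    by (rule sets.sigma_algebra_axioms)
  show "positive (sets M) (\<lambda>B. emeasure M B + emeasure N B)"
    by (simp add: positive_def)
  show "countably_additive (sets M) (\<lambda>B. emeasure M B + emeasure N B)"
  proof (rule countably_additiveI)
    fix A :: "nat \<Rightarrow> 'a set"
    assume A: "range A \<subseteq> sets M" "disjoint_family A"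
    have "(\<Sum>i. emeasure M (A i) + emeasure N (A i))
        = (\<Sum>i. emeasure M (A i)) + (\<Sum>i. emeasure N (A i))"
      by (rule suminf_add[symmetric]) auto
    also have "\<dots> = emeasure M (\<Union>i. A i) + emeasure N (\<Union>i. A i)"
      using A sets by (simp add: suminf_emeasure)
    finally show "(\<Sum>i. emeasure M (A i) + emeasure N (A i))
        = emeasure M (\<Union>i. A i) + emeasure N (\<Union>i. A i)" .
  qed
qed (use B in auto)

text \<open>The complement of \<open>Q\<close> is negligible. The set \<open>Q\<close> need not be Borel: the quantifier
  \<open>AE\<close> asks only that the complement be contained in a Borel null set.\<close>
definition carried_by :: "'a measure \<Rightarrow> 'a set \<Rightarrow> bool" where
  "carried_by M Q \<longleftrightarrow> (AE x in M. x \<in> Q)"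

text \<open>A signed Radon measure may take the value \<open>\<infinity> - \<infinity>\<close> on unbounded sets, so it is not a function
  on Borel sets. It is represented by its Hahn--Jordan decomposition: a pair of mutually
  singular positive Radon measures (see \<open>signed_radon\<close> below), which determines it uniquely.\<close>
type_synonym 'a smeasure = "'a measure \<times> 'a measure"

abbreviation pos_part :: "'a smeasure \<Rightarrow> 'a measure" where "pos_part \<equiv> fst"
abbreviation neg_part :: "'a smeasure \<Rightarrow> 'a measure" where "neg_part \<equiv> snd"

definition total_var :: "'a smeasure \<Rightarrow> 'a measure" where
  "total_var \<mu> = measure_add (pos_part \<mu>) (neg_part \<mu>)"

text \<open>The value of a signed Radon measure on a bounded Borel set.\<close>
definition smeasure_val :: "'a smeasure \<Rightarrow> 'a set \<Rightarrow> real" where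
  "smeasure_val \<mu> B = measure (pos_part \<mu>) B - measure (neg_part \<mu>) B"

text \<open>The Hahn--Jordan decomposition of \<open>\<mu> - \<nu>\<close> when \<open>\<mu>\<close> and \<open>\<nu>\<close> are carried by disjoint Borel
  sets. It is used only for \<open>\<zeta> - \<zeta>'\<close>, where \<open>\<zeta>\<close> is carried by \<open>D\<close> and \<open>\<zeta>'\<close> by its complement.\<close>
definition smeasure_diff :: "'a smeasure \<Rightarrow> 'a smeasure \<Rightarrow> 'a smeasure" where
  "smeasure_diff \<mu> \<nu> =
     (measure_add (pos_part \<mu>) (neg_part \<nu>), measure_add (neg_part \<mu>) (pos_part \<nu>))"


section \<open>Riesz kernel, potentials, energies\<close>

text \<open>The case distinction is needed because \<open>0 powr a = 0\<close>, while the kernel is infinite on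
  the diagonal.\<close>
definition riesz_kernel :: "real \<Rightarrow> 'a::euclidean_space \<Rightarrow> 'a \<Rightarrow> ennreal" where
  "riesz_kernel \<alpha> x y =
     (if x = y then \<infinity> else ennreal (norm (x - y) powr (\<alpha> - real DIM('a))))"

definition riesz_pot :: "real \<Rightarrow> 'a::euclidean_space measure \<Rightarrow> 'a \<Rightarrow> ennreal" where
  "riesz_pot \<alpha> M x = (\<integral>\<^sup>+ y. riesz_kernel \<alpha> x y \<partial>M)"

definition mutual_energy ::
    "real \<Rightarrow> 'a::euclidean_space measure \<Rightarrow> 'a measure \<Rightarrow> ennreal" where
  "mutual_energy \<alpha> M N = (\<integral>\<^sup>+ x. (\<integral>\<^sup>+ y. riesz_kernel \<alpha> x y \<partial>N) \<partial>M)"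

abbreviation energy :: "real \<Rightarrow> 'a::euclidean_space measure \<Rightarrow> ennreal" where
  "energy \<alpha> M \<equiv> mutual_energy \<alpha> M M"

text \<open>The last conjunct is the standing assumption that potentials of positive measures are
  not identically infinite.\<close>
definition pos_radon :: "real \<Rightarrow> 'a::euclidean_space measure \<Rightarrow> bool" where
  "pos_radon \<alpha> M \<longleftrightarrow>
     sets M = sets borel \<and> (\<forall>K. compact K \<longrightarrow> emeasure M K < \<infinity>) \<and> (\<exists>x. riesz_pot \<alpha> M x < \<infinity>)"

definition signed_radon :: "real \<Rightarrow> 'a::euclidean_space smeasure \<Rightarrow> bool" where
  "signed_radon \<alpha> \<mu> \<longleftrightarrow>
     pos_radon \<alpha> (pos_part \<mu>) \<and> pos_radon \<alpha> (neg_part \<mu>) \<and>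
     (\<exists>P\<in>sets borel. emeasure (pos_part \<mu>) (- P) = 0 \<and> emeasure (neg_part \<mu>) P = 0)"

definition pot_defined :: "real \<Rightarrow> 'a::euclidean_space smeasure \<Rightarrow> 'a \<Rightarrow> bool" where
  "pot_defined \<alpha> \<mu> x \<longleftrightarrow>
     \<not> (riesz_pot \<alpha> (pos_part \<mu>) x = \<infinity> \<and> riesz_pot \<alpha> (neg_part \<mu>) x = \<infinity>)"

text \<open>Meaningful only where \<open>pot_defined\<close> holds.\<close>
definition signed_pot :: "real \<Rightarrow> 'a::euclidean_space smeasure \<Rightarrow> 'a \<Rightarrow> ereal" where
  "signed_pot \<alpha> \<mu> x =
     enn2ereal (riesz_pot \<alpha> (pos_part \<mu>) x) - enn2ereal (riesz_pot \<alpha> (neg_part \<mu>) x)"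

definition finite_energy :: "real \<Rightarrow> 'a::euclidean_space smeasure set" where
  "finite_energy \<alpha> = {\<mu>. signed_radon \<alpha> \<mu> \<and> energy \<alpha> (total_var \<mu>) < \<infinity>}"

definition finite_energy_pos :: "real \<Rightarrow> 'a::euclidean_space set \<Rightarrow> 'a measure set" where
  "finite_energy_pos \<alpha> Q = {M. pos_radon \<alpha> M \<and> energy \<alpha> M < \<infinity> \<and> carried_by M Q}"

text \<open>The energy integral of \<open>\<mu> \<otimes> \<mu>\<close> for a signed measure \<open>\<mu>\<close>, that is, the squared energy norm; for
  \<open>\<mu> \<in> finite_energy \<alpha>\<close> all four terms are finite.\<close>
definition signed_energy :: "real \<Rightarrow> 'a::euclidean_space smeasure \<Rightarrow> real" where
  "signed_energy \<alpha> \<mu> =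
     enn2real (mutual_energy \<alpha> (pos_part \<mu>) (pos_part \<mu>))
   - enn2real (mutual_energy \<alpha> (pos_part \<mu>) (neg_part \<mu>))
   - enn2real (mutual_energy \<alpha> (neg_part \<mu>) (pos_part \<mu>))
   + enn2real (mutual_energy \<alpha> (neg_part \<mu>) (neg_part \<mu>))"


section \<open>Inner capacity, thinness at infinity\<close>

text \<open>The completion occurs because \<open>Q\<close> is arbitrary, and \<open>emeasure M Q = 0\<close> for non-Borel \<open>Q\<close>;
  every \<open>Q\<close> carrying \<open>M\<close> is measurable for the completion.\<close>
definition capacity :: "real \<Rightarrow> 'a::euclidean_space set \<Rightarrow> ennreal" where
  "capacity \<alpha> Q =
     inverse (INF M\<in>{M \<in> finite_energy_pos \<alpha> Q. emeasure (completion M) Q = 1}. energy \<alpha> M)"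

definition nearly_everywhere_on ::
    "real \<Rightarrow> 'a::euclidean_space set \<Rightarrow> ('a \<Rightarrow> bool) \<Rightarrow> bool" where
  "nearly_everywhere_on \<alpha> Q P \<longleftrightarrow> (\<exists>N. capacity \<alpha> N = 0 \<and> (\<forall>x\<in>Q - N. P x))"

definition cap_abs_continuous :: "real \<Rightarrow> 'a::euclidean_space smeasure \<Rightarrow> bool" where
  "cap_abs_continuous \<alpha> \<mu> \<longleftrightarrow>
     (\<forall>K. compact K \<and> capacity \<alpha> K = 0 \<longrightarrow> smeasure_val \<mu> K = 0)"

text \<open>Here \<open>q \<in> (0,1)\<close> is the fixed ratio in the Wiener criterion.\<close>
definition irregular_point ::
    "real \<Rightarrow> real \<Rightarrow> 'a::euclidean_space set \<Rightarrow> 'a \<Rightarrow> bool" where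
  "irregular_point \<alpha> q F x0 \<longleftrightarrow> x0 \<in> F \<and>
     (\<Sum>k. capacity \<alpha> {x \<in> F. q ^ (Suc k + 1) < norm (x - x0) \<and> norm (x - x0) \<le> q ^ Suc k}
           * ennreal (q powr (- real (Suc k) * (real DIM('a) - \<alpha>)))) < \<infinity>"

definition unit_inversion :: "'a::euclidean_space \<Rightarrow> 'a" where
  "unit_inversion x = x /\<^sub>R (norm x)\<^sup>2"

definition thin_at_infinity :: "real \<Rightarrow> real \<Rightarrow> 'a::euclidean_space set \<Rightarrow> bool" where
  "thin_at_infinity \<alpha> q F \<longleftrightarrow>
     compact F \<or> irregular_point \<alpha> q ({0} \<union> unit_inversion ` (F - {0})) 0"


section \<open>Extendible measures, balayage, external fields\<close>

text \<open>An extendible signed Radon measure on \<open>D\<close>, identified with its extension by \<open>0\<close> to the whole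
  space.\<close>
definition extendible :: "real \<Rightarrow> 'a::euclidean_space set \<Rightarrow> 'a smeasure \<Rightarrow> bool" where
  "extendible \<alpha> D \<nu> \<longleftrightarrow> signed_radon \<alpha> \<nu> \<and>
     (\<forall>M\<in>{pos_part \<nu>, neg_part \<nu>}. carried_by M D \<and>
        (\<integral>\<^sup>+ y\<in>{y. norm y > 1}. ennreal (norm y powr (\<alpha> - real DIM('a))) \<partial>M) < \<infinity>)"

text \<open>\<open>\<nu>'\<close> is the balayage of \<open>\<nu>\<close> onto the complement of \<open>D\<close>. That set is closed, so being supported
  by it and being carried by it are the same.\<close>
definition is_balayage ::
    "real \<Rightarrow> 'a::euclidean_space set \<Rightarrow> 'a smeasure \<Rightarrow> 'a smeasure \<Rightarrow> bool" where
  "is_balayage \<alpha> D \<nu> \<nu>' \<longleftrightarrow>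
     signed_radon \<alpha> \<nu>' \<and> cap_abs_continuous \<alpha> \<nu>' \<and>
     carried_by (pos_part \<nu>') (- D) \<and> carried_by (neg_part \<nu>') (- D) \<and>
     nearly_everywhere_on \<alpha> (- D)
       (\<lambda>x. pot_defined \<alpha> \<nu>' x \<and> pot_defined \<alpha> \<nu> x \<and> signed_pot \<alpha> \<nu>' x = signed_pot \<alpha> \<nu> x)"

definition lower_semicontinuous :: "('a::topological_space \<Rightarrow> ereal) \<Rightarrow> bool" where
  "lower_semicontinuous f \<longleftrightarrow> (\<forall>t. open {x. t < f x})"

definition field_case_I ::
    "real \<Rightarrow> 'a::euclidean_space set \<Rightarrow> ('a \<Rightarrow> ereal) \<Rightarrow> bool" where
  "field_case_I \<alpha> A2 f \<longleftrightarrow>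
     (\<forall>x. 0 \<le> f x) \<and> lower_semicontinuous f \<and> nearly_everywhere_on \<alpha> A2 (\<lambda>x. f x = 0)"

text \<open>The potential of \<open>\<zeta> - \<zeta>'\<close> is defined only nearly everywhere; nothing is required of \<open>f\<close> on the
  exceptional set.\<close>
definition field_case_II ::
    "real \<Rightarrow> 'a::euclidean_space set \<Rightarrow> ('a \<Rightarrow> ereal) \<Rightarrow> bool" where
  "field_case_II \<alpha> D f \<longleftrightarrow>
     (\<exists>\<zeta> \<zeta>'. extendible \<alpha> D \<zeta> \<and> \<zeta> \<in> finite_energy \<alpha> \<and> is_balayage \<alpha> D \<zeta> \<zeta>' \<and>
        (\<forall>x. pot_defined \<alpha> (smeasure_diff \<zeta> \<zeta>') x \<longrightarrow>
             f x = signed_pot \<alpha> (smeasure_diff \<zeta> \<zeta>') x))"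


section \<open>The constrained weighted minimum energy problem\<close>

text \<open>Integrability of extended real functions, measurability being understood with respect to
  the completion.\<close>
definition ereal_integrable :: "'a measure \<Rightarrow> ('a \<Rightarrow> ereal) \<Rightarrow> bool" where
  "ereal_integrable M f \<longleftrightarrow>
     f \<in> borel_measurable (completion M) \<and> (\<integral>\<^sup>+ x. e2ennreal \<bar>f x\<bar> \<partial>completion M) < \<infinity>"

definition ereal_integral :: "'a measure \<Rightarrow> ('a \<Rightarrow> ereal) \<Rightarrow> real" where
  "ereal_integral M f = (LINT x|completion M. real_of_ereal (f x))"

definition sintegral :: "'a smeasure \<Rightarrow> ('a \<Rightarrow> ereal) \<Rightarrow> real" where
  "sintegral \<mu> f = ereal_integral (pos_part \<mu>) f - ereal_integral (neg_part \<mu>) f"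

definition constraints :: "real \<Rightarrow> 'a::euclidean_space set \<Rightarrow> 'a measure set" where
  "constraints \<alpha> A1 = {\<xi> \<in> finite_energy_pos \<alpha> A1. emeasure \<xi> A1 > 1}"

definition unit_condenser_measures ::
    "real \<Rightarrow> 'a::euclidean_space set \<Rightarrow> 'a set \<Rightarrow> 'a smeasure set" where
  "unit_condenser_measures \<alpha> A1 A2 =
     {\<mu> \<in> finite_energy \<alpha>.
        carried_by (pos_part \<mu>) A1 \<and> carried_by (neg_part \<mu>) A2 \<and>
        emeasure (pos_part \<mu>) A1 = 1 \<and> emeasure (neg_part \<mu>) A2 = 1}"

definition admissible ::
    "real \<Rightarrow> ('a::euclidean_space \<Rightarrow> ereal) \<Rightarrow> 'a measure \<Rightarrow> 'a set \<Rightarrow> 'a set \<Rightarrow> 'a smeasure set"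
  where
  "admissible \<alpha> f \<xi> A1 A2 =
     {\<mu> \<in> unit_condenser_measures \<alpha> A1 A2.
        (\<forall>B\<in>sets borel. emeasure (pos_part \<mu>) B \<le> emeasure \<xi> B) \<and>
        ereal_integrable (total_var \<mu>) f}"

definition weighted_energy ::
    "real \<Rightarrow> ('a::euclidean_space \<Rightarrow> ereal) \<Rightarrow> 'a smeasure \<Rightarrow> real" where
  "weighted_energy \<alpha> f \<mu> = signed_energy \<alpha> \<mu> + 2 * sintegral \<mu> f"

definition weighted_energy_inf ::
    "real \<Rightarrow> ('a::euclidean_space \<Rightarrow> ereal) \<Rightarrow> 'a measure \<Rightarrow> 'a set \<Rightarrow> 'a set \<Rightarrow> ereal" where
  "weighted_energy_inf \<alpha> f \<xi> A1 A2 =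
     (INF \<mu>\<in>admissible \<alpha> f \<xi> A1 A2. ereal (weighted_energy \<alpha> f \<mu>))"

end

theory Submission
  imports Defs "HOL-Probability.Probability"
begin

text \<open>A positive measure on \<open>A\<^sub>1\<close> below \<open>\<xi>\<close> has a density \<open>h\<close> with \<open>0 \<le> h \<le> 1\<close>, and such densities do not
  lose mass in the limit because \<open>\<xi>\<close> is finite. The negative part \<open>\<tau>\<close> may lose mass at infinity,
  so the condition \<open>\<tau>(A\<^sub>2) = 1\<close> is first relaxed to \<open>\<tau>(A\<^sub>2) \<le> 1\<close>. Writing the Riesz kernel as a time
  integral of heat kernels turns the energy of \<open>\<mu> = \<sigma> - \<tau>\<close> into the squared \<open>L\<^sup>2\<close> norm of its heat
  potential; it is therefore convex, lower semicontinuous under vague convergence (Fatou) and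
  vanishes only for \<open>\<mu> = 0\<close>. This gives a minimizer of the relaxed problem and uniqueness.

  If the minimizing \<open>\<tau>\<close> had mass less than 1, then adding small masses on \<open>A\<^sub>2\<close> would show that the
  potential of \<open>\<tau>\<close> dominates that of \<open>\<sigma>\<close> on \<open>A\<^sub>2\<close>, tested against measures of finite energy.
  Far away the potential of \<open>\<sigma>\<close> behaves like \<open>|x|\<^sup>\<alpha>\<^sup>-\<^sup>n\<close>, which \<open>\<tau>\<close> can only match by
  its mass in the annulus around \<open>|x|\<close>. After inversion this bounds the terms of the Wiener series by the masses
  of boundedly overlapping annuli, so \<open>A\<^sub>2\<close> would be thin at infinity.

  In Case II the domination principle shows that \<open>f\<close> is bounded below by \<open>-U\<^sup>\<zeta>\<^sup>-\<close> off a polar set,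
  so the field term is bounded below as well.\<close>

section \<open>Riesz kernels and potentials\<close>

text \<open>Infinite values shape the proof. Energies and field integrals live in
  \<open>ennreal\<close>, where subtraction truncates; so \<open>energy_dist\<close> integrates
  squared real differences of heat potentials, which are finite because the measures compared are
  finite, identities are stated additively, and the field is made nonnegative by adding a
  \<xi>-integrable function.

  The field need not be continuous and may be infinite, so vague convergence of the positive parts
  would not control its integral. Almost everywhere convergence of the densities does, through
  Fatou; this is what their strong convergence is for.

  The domination principle rests on an identity V = S + p * V for every potential V, with S its
  short-time part and p a symmetric kernel of mass at most 1. Tested against the excess of one
  potential over another, the term with p is absorbed because convolution with p contracts L2. Only
  short times remain, and there the first measure does not see the excess, which vanishes almost
  everywhere with respect to it.\<close>

lemma riesz_kernel_sym: "riesz_kernel \<alpha> x y = riesz_kernel \<alpha> y x"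
  by (auto simp: riesz_kernel_def norm_minus_commute)

lemma riesz_kernel_diff: "riesz_kernel \<alpha> x y = riesz_kernel \<alpha> (x - y) 0"
  by (auto simp: riesz_kernel_def)

text \<open>In this form the diagonal is not special: \<open>inverse 0 = \<top>\<close> in
  \<open>ennreal\<close>, and the kernel becomes a continuous function of the distance.\<close>

lemma riesz_kernel_eq_inverse:
  fixes x y :: "'a::euclidean_space"
  assumes "\<alpha> < real DIM('a)"
  shows "riesz_kernel \<alpha> x y = inverse (ennreal (norm (x - y) powr (real DIM('a) - \<alpha>)))"
proof (cases "x = y")
  case False
  then have "0 < norm (x - y) powr (real DIM('a) - \<alpha>)" by simp
  then show ?thesis using False
    by (simp add: riesz_kernel_def inverse_ennreal powr_minus[symmetric])
qed (simp add: riesz_kernel_def)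

lemma borel_measurable_riesz_kernel [measurable]:
  fixes f g :: "'b \<Rightarrow> 'a::euclidean_space"
  assumes [measurable]: "f \<in> borel_measurable N" "g \<in> borel_measurable N"
  shows "(\<lambda>x. riesz_kernel \<alpha> (f x) (g x)) \<in> borel_measurable N"
proof -
  have "(\<lambda>x. if norm (f x - g x) = 0 then \<infinity> else ennreal (norm (f x - g x) powr (\<alpha> - real DIM('a))))
      \<in> borel_measurable N"
    by measurable
  then show ?thesis by (simp add: riesz_kernel_def)
qed

lemma tonelli:
  assumes "sigma_finite_measure M" "sigma_finite_measure N"
    and [measurable]: "case_prod f \<in> borel_measurable (M \<Otimes>\<^sub>M N)"
  shows "(\<integral>\<^sup>+x. \<integral>\<^sup>+y. f x y \<partial>N \<partial>M) = (\<integral>\<^sup>+y. \<integral>\<^sup>+x. f x y \<partial>M \<partial>N)"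
proof -
  interpret pair_sigma_finite M N using assms by (simp add: pair_sigma_finite_def)
  show ?thesis using Fubini[of "case_prod f"] by (simp add: case_prod_beta')
qed

lemma borel_measurable_riesz_pot:
  fixes M :: "'a::euclidean_space measure"
  assumes "sigma_finite_measure M" and [measurable_cong]: "sets M = sets borel"
  shows "riesz_pot \<alpha> M \<in> borel_measurable borel"
proof -
  interpret sigma_finite_measure M by fact
  show ?thesis unfolding riesz_pot_def[abs_def] by measurable
qed

lemma mutual_energy_pot: "mutual_energy \<alpha> M N = (\<integral>\<^sup>+x. riesz_pot \<alpha> N x \<partial>M)"
  by (simp add: mutual_energy_def riesz_pot_def)

lemma mutual_energy_commute:
  fixes M :: "'a::euclidean_space measure"
  assumes "sigma_finite_measure M" "sigma_finite_measure N"
    and [measurable_cong]: "sets M = sets borel" "sets N = sets borel"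
  shows "mutual_energy \<alpha> M N = mutual_energy \<alpha> N M"
  unfolding mutual_energy_def
  by (subst tonelli) (use assms in \<open>auto simp: riesz_kernel_sym\<close>)

lemma riesz_kernel_le_scale:
  fixes x y x' :: "'a::euclidean_space"
  assumes "\<alpha> < real DIM('a)" "c > 0" "norm (x' - y) \<le> c * norm (x - y)"
  shows "riesz_kernel \<alpha> x y \<le> ennreal (c powr (real DIM('a) - \<alpha>)) * riesz_kernel \<alpha> x' y"
proof (cases "x' = y")
  case True
  then show ?thesis using assms by (simp add: riesz_kernel_def ennreal_mult_top)
next
  case False
  then have "0 < c * norm (x - y)" using assms(3) by (smt (verit) zero_less_norm_iff right_minus_eq)
  then have xy: "x \<noteq> y" by auto
  let ?g = "real DIM('a) - \<alpha>"
  have "norm (x' - y) powr ?g \<le> (c * norm (x - y)) powr ?g"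
    using assms by (intro powr_mono2) auto
  also have "\<dots> = c powr ?g * norm (x - y) powr ?g" using assms by (simp add: powr_mult)
  finally have *: "norm (x' - y) powr ?g \<le> c powr ?g * norm (x - y) powr ?g" .
  have e: "norm z powr (\<alpha> - real DIM('a)) = inverse (norm z powr ?g)" for z :: 'a
    by (simp add: powr_minus[symmetric])
  have "norm (x - y) powr (\<alpha> - real DIM('a)) \<le> c powr ?g * norm (x' - y) powr (\<alpha> - real DIM('a))"
    unfolding e using * False xy by (simp add: field_simps)
  then show ?thesis using False xy
    by (simp add: riesz_kernel_def ennreal_mult[symmetric] ennreal_leI)
qed

lemma tendsto_riesz_kernel:
  fixes x y :: "'a::euclidean_space"
  assumes "\<alpha> < real DIM('a)" "(X \<longlongrightarrow> x) F"
  shows "((\<lambda>n. riesz_kernel \<alpha> (X n) y) \<longlongrightarrow> riesz_kernel \<alpha> x y) F"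
proof -
  have c: "continuous_on UNIV (\<lambda>z::ennreal. inverse z)"
    by (intro continuous_intros)
  have "((\<lambda>n. ennreal (norm (X n - y) powr (real DIM('a) - \<alpha>))) \<longlongrightarrow> ennreal (norm (x - y) powr (real DIM('a) - \<alpha>))) F"
    using assms by (intro tendsto_ennrealI tendsto_powr' tendsto_intros) auto
  from continuous_on_tendsto_compose[OF c this]
  show ?thesis unfolding riesz_kernel_eq_inverse[OF assms(1)] by simp
qed

lemma riesz_pot_lsc:
  fixes M :: "'a::euclidean_space measure"
  assumes "\<alpha> < real DIM('a)" and [measurable_cong]: "sets M = sets borel" and "X \<longlonglongrightarrow> x"
  shows "riesz_pot \<alpha> M x \<le> liminf (\<lambda>n. riesz_pot \<alpha> M (X n))"
proof -
  have "riesz_pot \<alpha> M x = (\<integral>\<^sup>+y. liminf (\<lambda>n. riesz_kernel \<alpha> (X n) y) \<partial>M)"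
    unfolding riesz_pot_def
    using tendsto_riesz_kernel[OF assms(1,3)] by (intro nn_integral_cong lim_imp_Liminf[symmetric]) auto
  also have "\<dots> \<le> liminf (\<lambda>n. riesz_pot \<alpha> M (X n))"
    unfolding riesz_pot_def by (intro nn_integral_liminf) auto
  finally show ?thesis .
qed

lemma closed_sublevel_lsc:
  fixes u :: "'a::metric_space \<Rightarrow> 'b::{complete_linorder,linorder_topology}"
  assumes "\<And>X x. X \<longlonglongrightarrow> x \<Longrightarrow> u x \<le> liminf (\<lambda>n. u (X n))"
  shows "closed {x. u x \<le> c}"
  unfolding closed_sequential_limits
proof (intro allI impI, elim conjE)
  fix X x assume X: "\<forall>n::nat. X n \<in> {x. u x \<le> c}" "X \<longlonglongrightarrow> x"
  have "u x \<le> liminf (\<lambda>n. u (X n))" using assms X by auto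
  also have "\<dots> \<le> liminf (\<lambda>n. c)" using X by (intro Liminf_mono) auto
  also have "\<dots> = c" by (intro Liminf_const) simp
  finally show "x \<in> {x. u x \<le> c}" by simp
qed

lemma closed_riesz_pot_le:
  fixes M :: "'a::euclidean_space measure"
  assumes "\<alpha> < real DIM('a)" "sets M = sets borel"
  shows "closed {x. riesz_pot \<alpha> M x \<le> c}"
  by (intro closed_sublevel_lsc riesz_pot_lsc assms)

text \<open>Weak maximum principle: compare \<open>x\<close> with the nearest point of the support.\<close>
lemma weak_max_principle:
  fixes M :: "'a::euclidean_space measure"
  assumes "\<alpha> < real DIM('a)" and [measurable_cong]: "sets M = sets borel"
    and "closed S" "AE y in M. y \<in> S" "\<And>x. x \<in> S \<Longrightarrow> riesz_pot \<alpha> M x \<le> c"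
  shows "riesz_pot \<alpha> M x \<le> ennreal (2 powr (real DIM('a) - \<alpha>)) * c"
proof (cases "S = {}")
  case True
  then have "AE y in M. riesz_kernel \<alpha> x y = 0" using assms(4) by auto
  then show ?thesis unfolding riesz_pot_def by (subst nn_integral_cong_AE[where v="\<lambda>_. 0"]) auto
next
  case False
  obtain x' where x': "x' \<in> S" "\<And>y. y \<in> S \<Longrightarrow> dist x x' \<le> dist x y"
    using distance_attains_inf[OF \<open>closed S\<close> False] by blast
  have "AE y in M. riesz_kernel \<alpha> x y \<le> ennreal (2 powr (real DIM('a) - \<alpha>)) * riesz_kernel \<alpha> x' y"
    using assms(4)
  proof eventually_elim
    fix y assume "y \<in> S"
    \<comment> \<open>As x' is the point of S nearest to x, |x' - y| \<le> |x' - x| + |x - y| \<le>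
      2 |x - y|; this is the origin of the factor 2.\<close>
    then have "norm (x' - y) \<le> 2 * norm (x - y)"
      using x'(2)[of y] dist_triangle[of x' y x] by (simp add: dist_norm[symmetric] dist_commute)
    then show "riesz_kernel \<alpha> x y \<le> ennreal (2 powr (real DIM('a) - \<alpha>)) * riesz_kernel \<alpha> x' y"
      by (intro riesz_kernel_le_scale assms) auto
  qed
  then have "riesz_pot \<alpha> M x \<le> (\<integral>\<^sup>+y. ennreal (2 powr (real DIM('a) - \<alpha>)) * riesz_kernel \<alpha> x' y \<partial>M)"
    unfolding riesz_pot_def by (rule nn_integral_mono_AE)
  also have "\<dots> = ennreal (2 powr (real DIM('a) - \<alpha>)) * riesz_pot \<alpha> M x'"
    unfolding riesz_pot_def by (intro nn_integral_cmult) auto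
  also have "\<dots> \<le> ennreal (2 powr (real DIM('a) - \<alpha>)) * c"
    using assms(5) x'(1) by (intro mult_left_mono) auto
  finally show ?thesis .
qed

section \<open>Positive Radon measures, their densities and sums\<close>

lemma pos_radonD:
  assumes "pos_radon \<alpha> (M::'a::euclidean_space measure)"
  shows "sets M = sets borel" "space M = UNIV" "sigma_finite_measure M" "\<And>K. compact K \<Longrightarrow> emeasure M K < \<infinity>"
proof -
  show s: "sets M = sets borel" and k: "\<And>K. compact K \<Longrightarrow> emeasure M K < \<infinity>"
    using assms by (auto simp: pos_radon_def)
  show sp: "space M = UNIV" using sets_eq_imp_space_eq[OF s] by simp
  show "sigma_finite_measure M"
  proof
    have "(\<Union>n::nat. cball (0::'a) (real n)) = UNIV"
      by (auto simp: real_arch_simple)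
    then show "\<exists>A. countable A \<and> A \<subseteq> sets M \<and> \<Union>A = space M \<and> (\<forall>a\<in>A. emeasure M a \<noteq> \<infinity>)"
      using k by (intro exI[of _ "range (\<lambda>n::nat. cball 0 (real n))"]) (auto simp: s sp less_top)
  qed
qed

lemma riesz_pot_density:
  fixes M :: "'a::euclidean_space measure"
  assumes [measurable_cong]: "sets M = sets borel" and [measurable]: "f \<in> borel_measurable borel"
  shows "riesz_pot \<alpha> (density M f) x = (\<integral>\<^sup>+y. f y * riesz_kernel \<alpha> x y \<partial>M)"
  unfolding riesz_pot_def by (intro nn_integral_density) auto

lemma riesz_pot_density_le:
  fixes M :: "'a::euclidean_space measure"
  assumes [measurable_cong]: "sets M = sets borel" and [measurable]: "f \<in> borel_measurable borel"
    and "\<And>x. f x \<le> 1"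
  shows "riesz_pot \<alpha> (density M f) x \<le> riesz_pot \<alpha> M x"
proof -
  have "f y * riesz_kernel \<alpha> x y \<le> 1 * riesz_kernel \<alpha> x y" for y
    using assms(3) by (intro mult_right_mono) auto
  then show ?thesis unfolding riesz_pot_density[OF assms(1,2)]
    by (auto simp: riesz_pot_def intro!: nn_integral_mono)
qed

lemma nn_integral_density_le:
  assumes [measurable]: "f \<in> borel_measurable M" "u \<in> borel_measurable M" and "\<And>x. f x \<le> (1::ennreal)"
  shows "(\<integral>\<^sup>+x. u x \<partial>density M f) \<le> (\<integral>\<^sup>+x. u x \<partial>M)"
proof -
  have "f y * u y \<le> 1 * u y" for y
    using assms(3) by (intro mult_right_mono) auto
  then show ?thesis by (subst nn_integral_density) (auto intro!: nn_integral_mono)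
qed

lemma energy_density_le:
  fixes M :: "'a::euclidean_space measure"
  assumes "sigma_finite_measure M" and [measurable_cong]: "sets M = sets borel"
    and [measurable]: "f \<in> borel_measurable borel" and "\<And>x. f x \<le> 1"
  shows "energy \<alpha> (density M f) \<le> energy \<alpha> M"
proof -
  note [measurable] = borel_measurable_riesz_pot[OF assms(1,2)]
  have "energy \<alpha> (density M f) \<le> (\<integral>\<^sup>+x. riesz_pot \<alpha> M x \<partial>density M f)"
    unfolding mutual_energy_pot using assms by (intro nn_integral_mono riesz_pot_density_le) auto
  also have "\<dots> \<le> energy \<alpha> M"
    unfolding mutual_energy_pot using assms by (intro nn_integral_density_le) auto
  finally show ?thesis .
qed

lemma nn_integral_measure_add:
  assumes "sets N = sets M" and [measurable]: "f \<in> borel_measurable M"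
  shows "(\<integral>\<^sup>+x. f x \<partial>measure_add M N) = (\<integral>\<^sup>+x. f x \<partial>M) + (\<integral>\<^sup>+x. f x \<partial>N)"
proof -
  note [measurable_cong] = assms(1)
  have [measurable_cong]: "sets (measure_add M N) = sets M" by simp
  have *: "sets M = sets N" "space M = space N" using assms(1) sets_eq_imp_space_eq[OF assms(1)] by auto
  show ?thesis using assms(2)
  proof (induction rule: borel_measurable_induct)
    case (cong f g)
    have e: "(\<integral>\<^sup>+x. f x \<partial>K) = (\<integral>\<^sup>+x. g x \<partial>K)" if "space K = space M" for K
      using cong(3) that by (intro nn_integral_cong) auto
    show ?case using cong(4) e[of M] e[of N] e[of "measure_add M N"] *(2) by simp
  next
    case (set A)
    then have "A \<in> sets N" "A \<in> sets (measure_add M N)" using assms(1) by auto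
    then show ?case using set emeasure_measure_add[OF assms(1), of A] by simp
  next
    case (mult u c)
    note [measurable] = mult(2)
    have "u \<in> borel_measurable M" "u \<in> borel_measurable N" "u \<in> borel_measurable (measure_add M N)" by measurable
    then show ?case using mult(4) by (simp add: nn_integral_cmult distrib_left)
  next
    case (add u v)
    have [measurable]: "u \<in> borel_measurable M" "v \<in> borel_measurable M" using add by auto
    have "u \<in> borel_measurable M" "u \<in> borel_measurable N" "u \<in> borel_measurable (measure_add M N)"
      "v \<in> borel_measurable M" "v \<in> borel_measurable N" "v \<in> borel_measurable (measure_add M N)" by measurable
    then show ?case using add by (simp add: nn_integral_add ac_simps)
  next
    case (seq U)
    have [measurable]: "U i \<in> borel_measurable M" for i using seq by auto
    have m: "U i \<in> borel_measurable N" "U i \<in> borel_measurable (measure_add M N)" for i by measurable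
    have "(\<integral>\<^sup>+x. (SUP i. U i x) \<partial>measure_add M N) = (SUP i. \<integral>\<^sup>+x. U i x \<partial>measure_add M N)"
      using seq m by (intro nn_integral_monotone_convergence_SUP) auto
    also have "\<dots> = (SUP i. (\<integral>\<^sup>+x. U i x \<partial>M) + (\<integral>\<^sup>+x. U i x \<partial>N))" using seq by simp
    also have "\<dots> = (SUP i. \<integral>\<^sup>+x. U i x \<partial>M) + (SUP i. \<integral>\<^sup>+x. U i x \<partial>N)"
      using seq by (intro ennreal_SUP_add) (auto simp: incseq_def le_fun_def intro!: nn_integral_mono)
    also have "\<dots> = (\<integral>\<^sup>+x. (SUP i. U i x) \<partial>M) + (\<integral>\<^sup>+x. (SUP i. U i x) \<partial>N)"
      using seq m by (simp add: nn_integral_monotone_convergence_SUP)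
    finally show ?case by (simp add: image_comp)
  qed
qed

lemma riesz_pot_measure_add:
  fixes M :: "'a::euclidean_space measure"
  assumes [measurable_cong]: "sets M = sets borel" "sets N = sets borel"
  shows "riesz_pot \<alpha> (measure_add M N) x = riesz_pot \<alpha> M x + riesz_pot \<alpha> N x"
  unfolding riesz_pot_def using assms by (intro nn_integral_measure_add) auto

lemma space_eq_UNIV: "sets M = sets borel \<Longrightarrow> space M = (UNIV::'a::topological_space set)"
  using sets_eq_imp_space_eq[of M borel] by simp

section \<open>The heat kernel and subordination\<close>

text \<open>The centred Gaussian density of variance \<open>s/2\<close> in each coordinate, so that
  \<open>heat s\<close> is a convolution semigroup.\<close>
definition heat :: "real \<Rightarrow> 'a::euclidean_space \<Rightarrow> real" where
  "heat s x = (\<Prod>b\<in>Basis. normal_density 0 (sqrt (s / 2)) (x \<bullet> b))"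

lemma heat_nonneg [simp]: "0 \<le> heat s x"
  by (simp add: heat_def prod_nonneg)

lemma borel_measurable_heat [measurable]:
  fixes g :: "'b \<Rightarrow> 'a::euclidean_space"
  assumes [measurable]: "f \<in> borel_measurable N" "g \<in> borel_measurable N"
  shows "(\<lambda>x. heat (f x) (g x)) \<in> borel_measurable N"
  unfolding heat_def normal_density_def by measurable

lemma heat_eq:
  fixes x :: "'a::euclidean_space"
  assumes "0 < s"
  shows "heat s x = (1 / sqrt (pi * s)) ^ DIM('a) * exp (- (norm x)\<^sup>2 / s)"
proof -
  have "normal_density 0 (sqrt (s / 2)) t = 1 / sqrt (pi * s) * exp (- t\<^sup>2 / s)" for t
    using assms by (simp add: normal_density_def)
  moreover have "(norm x)\<^sup>2 = (\<Sum>b\<in>Basis. (x \<bullet> b)\<^sup>2)"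
    unfolding power2_norm_eq_inner by (subst euclidean_inner) (simp add: power2_eq_square)
  ultimately show ?thesis
    by (simp add: heat_def prod.distrib prod_dividef exp_sum[symmetric] sum_negf sum_divide_distrib power_divide)
qed

lemma heat_pos: "0 < s \<Longrightarrow> 0 < heat s (x::'a::euclidean_space)"
  by (simp add: heat_eq)

lemma heat_minus [simp]: "heat s (- x) = heat s x"
  by (simp add: heat_def normal_density_def)

lemma heat_commute: "heat s (x - y) = heat s (y - x)"
  using heat_minus[of s "y - x"] by simp

lemma heat_le_0:
  fixes x :: "'a::euclidean_space"
  assumes "0 < s" shows "heat s x \<le> heat s (0::'a)"
  using assms by (simp add: heat_eq divide_simps)

lemma nn_integral_lborel_affine:
  fixes t :: "'a::euclidean_space"
  assumes [measurable]: "f \<in> borel_measurable borel" and "c \<noteq> 0"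
  shows "(\<integral>\<^sup>+x. f x \<partial>lborel) = ennreal (\<bar>c\<bar> ^ DIM('a)) * (\<integral>\<^sup>+x. f (t + c *\<^sub>R x) \<partial>lborel)"
  by (subst lborel_affine[OF \<open>c \<noteq> 0\<close>, of t])
     (simp add: nn_integral_density nn_integral_distr nn_integral_cmult)

lemma nn_integral_lborel_reflect:
  fixes t :: "'a::euclidean_space"
  assumes [measurable]: "f \<in> borel_measurable borel"
  shows "(\<integral>\<^sup>+x. f (t - x) \<partial>lborel) = (\<integral>\<^sup>+x. f x \<partial>lborel)"
  by (subst (2) nn_integral_lborel_affine[of _ "-1" t]) auto

lemma nn_integral_lborel_shift:
  fixes t :: "'a::euclidean_space"
  assumes [measurable]: "f \<in> borel_measurable borel"
  shows "(\<integral>\<^sup>+x. f (x - t) \<partial>lborel) = (\<integral>\<^sup>+x. f x \<partial>lborel)"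
  by (subst (2) nn_integral_lborel_affine[of _ "1" "-t"]) auto

lemma nn_integral_normal_density:
  assumes "0 < \<sigma>" shows "(\<integral>\<^sup>+x. ennreal (normal_density 0 \<sigma> x) \<partial>lborel) = 1"
proof -
  interpret prob_space "density lborel (normal_density 0 \<sigma>)"
    using assms by (rule prob_space_normal_density)
  show ?thesis using emeasure_space_1 by (simp add: emeasure_density)
qed

lemma nn_integral_heat:
  assumes "0 < s" shows "(\<integral>\<^sup>+x. ennreal (heat s (x::'a::euclidean_space)) \<partial>lborel) = 1"
proof -
  have "(\<integral>\<^sup>+x. ennreal (heat s (x::'a)) \<partial>lborel)
      = (\<integral>\<^sup>+x. (\<Prod>b\<in>Basis. ennreal (normal_density 0 (sqrt (s / 2)) ((x::'a) \<bullet> b))) \<partial>lborel)"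
    by (simp add: heat_def prod_ennreal)
  also have "\<dots> = (\<Prod>b\<in>(Basis::'a set). (\<integral>\<^sup>+x. ennreal (normal_density 0 (sqrt (s / 2)) x) \<partial>lborel))"
    by (rule nn_integral_lborel_prod) auto
  also have "\<dots> = 1" using assms by (simp add: nn_integral_normal_density)
  finally show ?thesis .
qed

lemma nn_integral_heat_diff:
  assumes "0 < s"
  shows "(\<integral>\<^sup>+y. ennreal (heat s (x - y :: 'a::euclidean_space)) \<partial>lborel) = 1"
    "(\<integral>\<^sup>+y. ennreal (heat s (y - x :: 'a::euclidean_space)) \<partial>lborel) = 1"
  using nn_integral_lborel_reflect[of "\<lambda>y. ennreal (heat s y)" x]
    nn_integral_lborel_shift[of "\<lambda>y. ennreal (heat s y)" x] nn_integral_heat[OF assms, where 'a='a]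
  by auto

text \<open>The kernel is a product over the coordinates, so this is the addition of variances for
  centred normal densities on the line.\<close>

lemma heat_convolution_0:
  fixes x :: "'a::euclidean_space"
  assumes "0 < s" "0 < t"
  shows "(\<integral>\<^sup>+z. ennreal (heat s (x - z)) * ennreal (heat t z) \<partial>lborel) = ennreal (heat (s + t) x)"
proof -
  let ?n = "\<lambda>s. normal_density 0 (sqrt (s / 2))"
  have "(\<integral>\<^sup>+z. ennreal (heat s (x - z)) * ennreal (heat t z) \<partial>lborel)
     = (\<integral>\<^sup>+z. (\<Prod>b\<in>Basis. ennreal (?n s (x \<bullet> b - z \<bullet> b) * ?n t (z \<bullet> b))) \<partial>lborel)"
    by (simp add: heat_def prod_ennreal ennreal_mult[symmetric] prod_nonneg prod.distrib inner_diff_left)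
  also have "\<dots> = (\<Prod>b\<in>Basis. (\<integral>\<^sup>+z. ennreal (?n s (x \<bullet> b - z) * ?n t z) \<partial>lborel))"
    by (rule nn_integral_lborel_prod) auto
  also have "\<dots> = (\<Prod>b\<in>Basis. ennreal (?n (s + t) (x \<bullet> b)))"
  proof (intro prod.cong refl)
    fix b :: 'a
    have *: "(\<lambda>u. \<integral>\<^sup>+z. ennreal (?n s (u - z) * ?n t z) \<partial>lborel) = normal_density 0 (sqrt ((sqrt (s / 2))\<^sup>2 + (sqrt (t / 2))\<^sup>2))"
      using assms by (intro conv_normal_density_zero_mean) auto
    have **: "(sqrt (s / 2))\<^sup>2 + (sqrt (t / 2))\<^sup>2 = (s + t) / 2" using assms by (simp add: add_divide_distrib)
    show "(\<integral>\<^sup>+z. ennreal (?n s (x \<bullet> b - z) * ?n t z) \<partial>lborel) = ennreal (?n (s + t) (x \<bullet> b))"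
      using fun_cong[OF *, of "x \<bullet> b"] unfolding ** .
  qed
  also have "\<dots> = ennreal (heat (s + t) x)" by (simp add: heat_def prod_ennreal)
  finally show ?thesis .
qed

lemma heat_convolution:
  fixes x y :: "'a::euclidean_space"
  assumes "0 < s" "0 < t"
  shows "(\<integral>\<^sup>+z. ennreal (heat s (x - z)) * ennreal (heat t (z - y)) \<partial>lborel) = ennreal (heat (s + t) (x - y))"
  using nn_integral_lborel_shift[of "\<lambda>z. ennreal (heat s (x - y - z)) * ennreal (heat t z)" y]
  by (simp add: heat_convolution_0[OF assms, symmetric] algebra_simps)

text \<open>Parabolic scaling. It is the source of the homogeneity of the time integral in
  \<open>riesz_subordination\<close>.\<close>

lemma heat_scale:
  fixes x :: "'a::euclidean_space"
  assumes "0 < s" "0 < r"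
  shows "heat (r\<^sup>2 * s) (r *\<^sub>R x) = heat s x / r ^ DIM('a)"
proof -
  have "sqrt (pi * (r\<^sup>2 * s)) = r * sqrt (pi * s)" using assms by (simp add: real_sqrt_mult)
  then show ?thesis using assms by (simp add: heat_eq power_mult_distrib power_divide)
qed

section \<open>Heat potentials of measures\<close>

definition heat_pot :: "real \<Rightarrow> 'a::euclidean_space measure \<Rightarrow> 'a \<Rightarrow> ennreal" where
  "heat_pot s M z = (\<integral>\<^sup>+y. ennreal (heat s (z - y)) \<partial>M)"

lemma borel_measurable_heat_pot [measurable (raw)]:
  fixes M :: "'a::euclidean_space measure"
  assumes "sigma_finite_measure M" and [measurable_cong]: "sets M = sets borel"
    and [measurable]: "f \<in> borel_measurable N" "g \<in> borel_measurable N"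
  shows "(\<lambda>x. heat_pot (f x) M (g x)) \<in> borel_measurable N"
proof -
  interpret sigma_finite_measure M by fact
  show ?thesis unfolding heat_pot_def by measurable
qed

lemma heat_pot_add:
  fixes M :: "'a::euclidean_space measure"
  assumes "sigma_finite_measure M" and [measurable_cong]: "sets M = sets borel" and "0 < s" "0 < t"
  shows "heat_pot (s + t) M x = (\<integral>\<^sup>+z. ennreal (heat s (x - z)) * heat_pot t M z \<partial>lborel)"
proof -
  have "(\<integral>\<^sup>+z. ennreal (heat s (x - z)) * heat_pot t M z \<partial>lborel)
      = (\<integral>\<^sup>+z. \<integral>\<^sup>+y. ennreal (heat s (x - z)) * ennreal (heat t (z - y)) \<partial>M \<partial>lborel)"
    unfolding heat_pot_def by (intro nn_integral_cong nn_integral_cmult[symmetric]) auto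
  also have "\<dots> = (\<integral>\<^sup>+y. \<integral>\<^sup>+z. ennreal (heat s (x - z)) * ennreal (heat t (z - y)) \<partial>lborel \<partial>M)"
    using assms by (intro tonelli sigma_finite_lborel) auto
  also have "\<dots> = heat_pot (s + t) M x"
    using assms by (simp add: heat_convolution heat_pot_def)
  finally show ?thesis by simp
qed

lemma heat_pot_pairing:
  fixes M :: "'a::euclidean_space measure"
  assumes "sigma_finite_measure M" and [measurable_cong]: "sets M = sets borel"
    and [measurable]: "u \<in> borel_measurable borel"
  shows "(\<integral>\<^sup>+x. \<integral>\<^sup>+z. ennreal (heat s (x - z)) * u z \<partial>lborel \<partial>M) = (\<integral>\<^sup>+z. heat_pot s M z * u z \<partial>lborel)"
proof -
  have "(\<integral>\<^sup>+x. \<integral>\<^sup>+z. ennreal (heat s (x - z)) * u z \<partial>lborel \<partial>M)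
      = (\<integral>\<^sup>+z. \<integral>\<^sup>+x. ennreal (heat s (x - z)) * u z \<partial>M \<partial>lborel)"
    using assms by (intro tonelli sigma_finite_lborel) auto
  also have "\<dots> = (\<integral>\<^sup>+z. heat_pot s M z * u z \<partial>lborel)"
    unfolding heat_pot_def
    by (intro nn_integral_cong) (subst nn_integral_multc, auto simp: heat_commute)
  finally show ?thesis .
qed

text \<open>The semigroup property splits the time, and the symmetry of the kernel moves one factor
  to the other measure. The result is an inner product in L2, which is where the positivity of the
  energy comes from.\<close>

lemma heat_energy_split:
  fixes M N :: "'a::euclidean_space measure"
  assumes "sigma_finite_measure M" "sigma_finite_measure N"
    and s: "sets M = sets borel" "sets N = sets borel" and "0 < s" "0 < t"
  shows "(\<integral>\<^sup>+x. heat_pot (s + t) N x \<partial>M) = (\<integral>\<^sup>+z. heat_pot s M z * heat_pot t N z \<partial>lborel)"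
  using assms by (simp add: heat_pot_add heat_pot_pairing borel_measurable_heat_pot)

section \<open>Subordination of the Riesz kernel to the heat kernel\<close>

definition riesz_time :: "real \<Rightarrow> real measure" where
  "riesz_time \<alpha> = density lborel (\<lambda>s. ennreal (indicator {0<..} s * s powr (\<alpha> / 2 - 1)))"

lemma sets_riesz_time [simp, measurable_cong]: "sets (riesz_time \<alpha>) = sets borel"
  by (simp add: riesz_time_def)

lemma AE_riesz_time: "AE s in riesz_time \<alpha>. 0 < s"
  unfolding riesz_time_def by (subst AE_density) (auto simp: indicator_def split: if_splits)

lemma sigma_finite_riesz_time: "sigma_finite_measure (riesz_time \<alpha>)"
  unfolding riesz_time_def
  by (subst sigma_finite_measure.sigma_finite_iff_density_finite[OF sigma_finite_lborel]) auto

lemma nn_integral_riesz_time: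
  "f \<in> borel_measurable borel \<Longrightarrow>
    (\<integral>\<^sup>+s. f s \<partial>riesz_time \<alpha>) = (\<integral>\<^sup>+s. ennreal (indicator {0<..} s * s powr (\<alpha> / 2 - 1)) * f s \<partial>lborel)"
  unfolding riesz_time_def by (intro nn_integral_density) auto

text \<open>A unit vector is inserted because the Riesz kernel is 1 at distance 1; the heat kernel
  is radial, so any other unit vector gives the same value.\<close>

definition riesz_const :: "real \<Rightarrow> 'a::euclidean_space itself \<Rightarrow> ennreal" where
  "riesz_const \<alpha> _ = (\<integral>\<^sup>+s. ennreal (heat s (SOME b. b \<in> (Basis::'a set))) \<partial>riesz_time \<alpha>)"

lemma heat_cong_norm:
  fixes x y :: "'a::euclidean_space"
  assumes "norm x = norm y" shows "0 < s \<Longrightarrow> heat s x = heat s y"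
  using assms by (simp add: heat_eq)

lemma riesz_const_pos: "0 < riesz_const \<alpha> TYPE('a::euclidean_space)"
proof (rule ccontr)
  let ?e = "SOME b. b \<in> (Basis::'a set)"
  assume "\<not> ?thesis"
  then have "(\<integral>\<^sup>+s. ennreal (indicator {0<..} s * s powr (\<alpha> / 2 - 1)) * ennreal (heat s ?e) \<partial>lborel) = 0"
    by (simp add: riesz_const_def nn_integral_riesz_time)
  then have "AE s in lborel. ennreal (indicator {0<..} s * s powr (\<alpha> / 2 - 1)) * ennreal (heat s ?e) = 0"
    by (subst (asm) nn_integral_0_iff_AE) auto
  then have "AE s in lborel. s \<notin> {0<..<1::real}"
    by eventually_elim (auto simp: ennreal_mult[symmetric] mult_le_0_iff heat_pos ennreal_eq_0_iff
       dest: heat_pos[of _ ?e])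
  then have "emeasure lborel {0<..<1::real} = 0"
    by (subst (asm) AE_iff_measurable[of "{0<..<1::real}"]) auto
  then show False by simp
qed

text \<open>Near time 0 the Gaussian factor beats every power of 1/s; for large times the integrand
  decays like s powr (\<alpha>/2 - 1 - n/2), which is integrable at infinity because \<alpha> <
  n.\<close>

lemma riesz_const_finite:
  assumes "0 < \<alpha>" "\<alpha> < real DIM('a)"
  shows "riesz_const \<alpha> TYPE('a::euclidean_space) < \<infinity>"
proof -
  let ?e = "SOME b. b \<in> (Basis::'a set)" and ?n = "DIM('a)"
  have "?e \<in> Basis" using nonempty_Basis by (auto simp: some_in_eq)
  then have e: "norm ?e = 1" by simp
  \<comment> \<open>With u = 1/s, the time density contributes at most one factor u and the Gaussian
    prefactor at most n of them. The resulting u ^ m * exp (- u) is bounded by m ^ m, as follows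
    from (1 + u/m) ^ m \<le> exp u.\<close>
  define m where "m = Suc ?n"
  define w where "w s = s powr (\<alpha> / 2 - 1) * heat s ?e" for s
  have small: "w s \<le> real m ^ m" if "0 < s" "s \<le> 1" for s
  proof -
    define u where "u = 1 / s"
    have u: "1 \<le> u" "0 < u" using that by (auto simp: u_def)
    have "s powr (\<alpha> / 2 - 1) \<le> s powr (-1)" using that assms by (intro powr_mono') auto
    also have "\<dots> = u" using that by (simp add: u_def powr_minus divide_inverse)
    finally have 1: "s powr (\<alpha> / 2 - 1) \<le> u" .
    have "s\<^sup>2 \<le> pi * s" using that pi_ge_two by (simp add: power2_eq_square)
    then have "s \<le> sqrt (pi * s)" by (rule real_le_rsqrt)
    then have "1 / sqrt (pi * s) \<le> u" using that by (simp add: u_def frac_le)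
    then have 2: "(1 / sqrt (pi * s)) ^ ?n \<le> u ^ ?n" using that by (intro power_mono) auto
    have "(u / real m) ^ m \<le> (1 + u / real m) ^ m" using u by (intro power_mono) auto
    also have "\<dots> \<le> exp u" using u by (intro exp_ge_one_plus_x_over_n_power_n) (auto simp: m_def)
    finally have "u ^ m \<le> real m ^ m * exp u"
      by (simp add: power_divide divide_le_eq m_def mult.commute del: power_Suc)
    then have "u ^ m * exp (- u) \<le> real m ^ m * exp u * exp (- u)" by (intro mult_right_mono) auto
    then have 3: "u ^ m * exp (- u) \<le> real m ^ m"
      by (simp add: mult.assoc exp_add[symmetric])
    have "w s = s powr (\<alpha> / 2 - 1) * ((1 / sqrt (pi * s)) ^ ?n * exp (- u))"
      using that by (simp add: w_def heat_eq e u_def)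
    also have "\<dots> \<le> u * (u ^ ?n * exp (- u))" using 1 2 u that by (intro mult_mono) auto
    also have "\<dots> = u ^ m * exp (- u)" by (simp add: m_def)
    finally show ?thesis using 3 by linarith
  qed
  let ?p = "\<alpha> / 2 - 1 - ?n / 2"
  have large: "w s \<le> s powr ?p" if "1 \<le> s" for s
  proof -
    have "heat s ?e \<le> (1 / sqrt (pi * s)) ^ ?n * 1"
      using that by (simp only: heat_eq) (intro mult_left_mono, auto)
    also have "\<dots> \<le> (1 / sqrt s) ^ ?n"
    proof -
      have "s * 1 \<le> s * pi" using that pi_ge_two by (intro mult_left_mono) auto
      then have "sqrt s \<le> sqrt (pi * s)" by (simp add: mult.commute)
      then have "1 / sqrt (pi * s) \<le> 1 / sqrt s" using that by (intro divide_left_mono) auto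
      then show ?thesis using that by (simp only: mult_1_right) (intro power_mono, auto)
    qed
    also have "1 / sqrt s = s powr (- 1 / 2)" using that
      by (simp add: powr_minus_divide powr_half_sqrt)
    also have "\<dots> ^ ?n = s powr (- ?n / 2)" using that by (simp add: powr_powr powr_realpow[symmetric])
    finally have "heat s ?e \<le> s powr (- ?n / 2)" .
    then have "w s \<le> s powr (\<alpha> / 2 - 1) * s powr (- ?n / 2)" by (auto simp: w_def intro: mult_left_mono)
    then show ?thesis by (simp add: powr_add[symmetric] field_simps)
  qed
  have "riesz_const \<alpha> TYPE('a) = (\<integral>\<^sup>+s. ennreal (indicator {0<..} s * s powr (\<alpha> / 2 - 1)) * ennreal (heat s ?e) \<partial>lborel)"
    by (simp add: riesz_const_def nn_integral_riesz_time)
  also have "\<dots> \<le> (\<integral>\<^sup>+s. ennreal (real m ^ m) * indicator {0..1} s + ennreal (s powr ?p) * indicator {1..} s \<partial>lborel)"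
  proof (intro nn_integral_mono)
    fix s :: real
    show "ennreal (indicator {0<..} s * s powr (\<alpha> / 2 - 1)) * ennreal (heat s ?e)
       \<le> ennreal (real m ^ m) * indicator {0..1} s + ennreal (s powr ?p) * indicator {1..} s"
      using small[of s] large[of s]
      by (cases "0 < s"; cases "s < 1"; cases "s = 1")
         (auto simp: ennreal_mult[symmetric] w_def ennreal_leI add_increasing2)
  qed
  also have "\<dots> = ennreal (real m ^ m) + (\<integral>\<^sup>+s. ennreal (s powr ?p) * indicator {1..} s \<partial>lborel)"
    by (subst nn_integral_add) (auto simp: nn_integral_cmult)
  also have "(\<integral>\<^sup>+s. ennreal (s powr ?p) * indicator {1..} s \<partial>lborel) = ennreal (-(1 powr (?p + 1)) / (?p + 1))"
    using assms by (intro nn_integral_has_integral_lebesgue' has_integral_powr_to_inf) auto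
  also have "ennreal (real m ^ m) + \<dots> < \<infinity>" by simp
  finally show ?thesis .
qed

text \<open>For x \<noteq> 0 the substitution s = |x|^2 u and parabolic scaling split off the power
  |x| powr (\<alpha> - n).\<close>

lemma riesz_subordination:
  fixes x :: "'a::euclidean_space"
  assumes "0 < \<alpha>" "\<alpha> < real DIM('a)"
  shows "(\<integral>\<^sup>+s. ennreal (heat s x) \<partial>riesz_time \<alpha>) = riesz_const \<alpha> TYPE('a) * riesz_kernel \<alpha> x 0"
proof -
  let ?e = "SOME b. b \<in> (Basis::'a set)" and ?n = "DIM('a)"
  have "?e \<in> Basis" using nonempty_Basis by (auto simp: some_in_eq)
  then have e: "norm ?e = 1" by simp
  have main: "(\<integral>\<^sup>+s. ennreal (heat s x) \<partial>riesz_time \<alpha>) = ennreal (norm x powr (\<alpha> - real DIM('a))) * riesz_const \<alpha> TYPE('a)"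
    if "x \<noteq> 0" for x :: 'a
  proof -
    define r where "r = norm x"
    have r: "r > 0" using that by (simp add: r_def)
    let ?f = "\<lambda>s. ennreal (indicator {0<..} s * s powr (\<alpha> / 2 - 1)) * ennreal (heat s x)"
    have eq: "?f (0 + r\<^sup>2 * u) = ennreal (r powr (\<alpha> - 2 - ?n)) * (ennreal (indicator {0<..} u * u powr (\<alpha> / 2 - 1)) * ennreal (heat u ?e))" for u
    proof (cases "u > 0")
      case True
      have "heat (r\<^sup>2 * u) x = heat (r\<^sup>2 * u) (r *\<^sub>R ?e)"
        using True r e by (intro heat_cong_norm) (auto simp: r_def)
      also have "\<dots> = heat u ?e / r ^ ?n" using True r by (intro heat_scale)
      also have "\<dots> = heat u ?e * r powr (- ?n)" using r by (simp add: powr_minus powr_realpow divide_inverse)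
      finally have h: "heat (r\<^sup>2 * u) x = heat u ?e * r powr (- ?n)" .
      have "(r\<^sup>2 * u) powr (\<alpha> / 2 - 1) = (r powr 2) powr (\<alpha> / 2 - 1) * u powr (\<alpha> / 2 - 1)"
        using r True by (simp add: powr_mult powr_numeral)
      also have "(r powr 2) powr (\<alpha> / 2 - 1) = r powr (\<alpha> - 2)" by (simp add: powr_powr algebra_simps)
      finally have p: "(r\<^sup>2 * u) powr (\<alpha> / 2 - 1) = r powr (\<alpha> - 2) * u powr (\<alpha> / 2 - 1)" .
      have q: "r powr (\<alpha> - 2 - ?n) = r powr (\<alpha> - 2) * r powr (- ?n)" by (simp add: powr_add[symmetric])
      have "?f (0 + r\<^sup>2 * u) = ennreal ((r powr (\<alpha> - 2) * u powr (\<alpha> / 2 - 1)) * (heat u ?e * r powr (- ?n)))"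
        using True r by (simp add: h p ennreal_mult)
      also have "\<dots> = ennreal ((r powr (\<alpha> - 2) * r powr (- ?n)) * (u powr (\<alpha> / 2 - 1) * heat u ?e))"
        by (simp only: ac_simps)
      finally show ?thesis using True by (simp add: q ennreal_mult)
    next
      case False
      then have "\<not> 0 < r\<^sup>2 * u" using r by (simp add: zero_less_mult_iff)
      with False show ?thesis by simp
    qed
    have "(\<integral>\<^sup>+s. ennreal (heat s x) \<partial>riesz_time \<alpha>) = (\<integral>\<^sup>+s. ?f s \<partial>lborel)"
      by (simp add: nn_integral_riesz_time)
    also have "\<dots> = ennreal \<bar>r\<^sup>2\<bar> * (\<integral>\<^sup>+u. ?f (0 + r\<^sup>2 * u) \<partial>lborel)"
      using r by (intro nn_integral_real_affine) auto
    also have "\<dots> = ennreal (r\<^sup>2) * (ennreal (r powr (\<alpha> - 2 - ?n)) * riesz_const \<alpha> TYPE('a))"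
      unfolding eq by (subst nn_integral_cmult) (auto simp: riesz_const_def nn_integral_riesz_time)
    also have "\<dots> = ennreal (r\<^sup>2 * r powr (\<alpha> - 2 - ?n)) * riesz_const \<alpha> TYPE('a)"
      by (simp add: ennreal_mult mult.assoc)
    also have "r\<^sup>2 * r powr (\<alpha> - 2 - ?n) = r powr (\<alpha> - ?n)"
      using r powr_add[of r 2 "\<alpha> - 2 - ?n"] by (simp add: powr_numeral)
    finally show ?thesis by (simp add: r_def)
  qed
  show ?thesis
  proof (cases "x = 0")
    case False then show ?thesis using main[of x] by (simp add: riesz_kernel_def mult.commute)
  next
    case True
    let ?T = "\<lambda>x. (\<integral>\<^sup>+s. ennreal (heat s (x::'a)) \<partial>riesz_time \<alpha>)"
    \<comment> \<open>At the origin the substitution breaks down. There the integral dominates its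
      value at every point r e, hence r powr (\<alpha> - n) times the constant for all r > 0, and so
      it is infinite.\<close>
    have ge: "ennreal (r powr (\<alpha> - ?n)) * riesz_const \<alpha> TYPE('a) \<le> ?T 0" if "r > 0" for r
    proof -
      have "ennreal (r powr (\<alpha> - ?n)) * riesz_const \<alpha> TYPE('a) = ?T (r *\<^sub>R ?e)"
      proof -
        have "?e \<noteq> 0" using e by (metis norm_zero zero_neq_one)
        then show ?thesis using main[of "r *\<^sub>R ?e"] e that by simp
      qed
      also have "\<dots> \<le> ?T 0" using AE_riesz_time[of \<alpha>]
        by (intro nn_integral_mono_AE) (auto elim!: eventually_mono intro!: ennreal_leI heat_le_0)
      finally show ?thesis .
    qed
    have "?T 0 = \<infinity>"
    proof (rule ccontr)
      assume fin: "?T 0 \<noteq> \<infinity>"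
      define c where "c = enn2real (riesz_const \<alpha> TYPE('a))"
      have c: "riesz_const \<alpha> TYPE('a) = ennreal c" "c > 0"
        using riesz_const_finite[OF assms] riesz_const_pos[of \<alpha>, where 'a='a]
        by (auto simp: c_def enn2real_positive_iff less_top)
      define t where "t = enn2real (?T 0)"
      have t: "?T 0 = ennreal t" "t \<ge> 0" using fin by (auto simp: t_def less_top)
      define r where "r = ((t + 1) / c) powr (1 / (\<alpha> - ?n))"
      have r: "r > 0" using c t by (simp add: r_def)
      have "r powr (\<alpha> - ?n) = (t + 1) / c" using c t assms by (simp add: r_def powr_powr)
      then have "t + 1 \<le> t" using ge[OF r] c t by (simp add: ennreal_mult[symmetric])
      then show False by simp
    qed
    then show ?thesis using True riesz_const_pos[of \<alpha>, where 'a='a]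
      by (simp add: riesz_kernel_def ennreal_mult_top)
  qed
qed

lemma riesz_pot_subordination:
  fixes M :: "'a::euclidean_space measure"
  assumes "0 < \<alpha>" "\<alpha> < real DIM('a)" "sigma_finite_measure M" and [measurable_cong]: "sets M = sets borel"
  shows "riesz_const \<alpha> TYPE('a) * riesz_pot \<alpha> M x = (\<integral>\<^sup>+s. heat_pot s M x \<partial>riesz_time \<alpha>)"
proof -
  have "riesz_const \<alpha> TYPE('a) * riesz_pot \<alpha> M x = (\<integral>\<^sup>+y. riesz_const \<alpha> TYPE('a) * riesz_kernel \<alpha> (x - y) 0 \<partial>M)"
    unfolding riesz_pot_def
    by (subst nn_integral_cmult[symmetric]) (auto intro!: nn_integral_cong simp: riesz_kernel_diff[of \<alpha> x])
  also have "\<dots> = (\<integral>\<^sup>+y. \<integral>\<^sup>+s. ennreal (heat s (x - y)) \<partial>riesz_time \<alpha> \<partial>M)"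
    by (simp add: riesz_subordination assms)
  also have "\<dots> = (\<integral>\<^sup>+s. \<integral>\<^sup>+y. ennreal (heat s (x - y)) \<partial>M \<partial>riesz_time \<alpha>)"
    using assms by (intro tonelli sigma_finite_riesz_time) auto
  finally show ?thesis by (simp add: heat_pot_def)
qed

text \<open>Half of each time goes to either measure, so that every time slice is an L2 inner
  product of two heat potentials.\<close>

lemma mutual_energy_heat:
  fixes M N :: "'a::euclidean_space measure"
  assumes "0 < \<alpha>" "\<alpha> < real DIM('a)" and sf: "sigma_finite_measure M" "sigma_finite_measure N"
    and s [measurable_cong]: "sets M = sets borel" "sets N = sets borel"
  shows "riesz_const \<alpha> TYPE('a) * mutual_energy \<alpha> M N
    = (\<integral>\<^sup>+s. \<integral>\<^sup>+z. heat_pot (s / 2) M z * heat_pot (s / 2) N z \<partial>lborel \<partial>riesz_time \<alpha>)"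
proof -
  note [measurable] = borel_measurable_riesz_pot[OF sf(2) s(2)] borel_measurable_heat_pot[OF sf(2) s(2)]
  have "riesz_const \<alpha> TYPE('a) * mutual_energy \<alpha> M N = (\<integral>\<^sup>+x. riesz_const \<alpha> TYPE('a) * riesz_pot \<alpha> N x \<partial>M)"
    unfolding mutual_energy_pot by (intro nn_integral_cmult[symmetric]) auto
  also have "\<dots> = (\<integral>\<^sup>+x. \<integral>\<^sup>+s. heat_pot s N x \<partial>riesz_time \<alpha> \<partial>M)"
    using assms by (simp add: riesz_pot_subordination)
  also have "\<dots> = (\<integral>\<^sup>+s. \<integral>\<^sup>+x. heat_pot s N x \<partial>M \<partial>riesz_time \<alpha>)"
    using assms by (intro tonelli sigma_finite_riesz_time) auto
  also have "\<dots> = (\<integral>\<^sup>+s. \<integral>\<^sup>+z. heat_pot (s / 2) M z * heat_pot (s / 2) N z \<partial>lborel \<partial>riesz_time \<alpha>)"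
  proof (intro nn_integral_cong_AE, use AE_riesz_time[of \<alpha>] in eventually_elim)
    fix t :: real assume "0 < t"
    then show "(\<integral>\<^sup>+x. heat_pot t N x \<partial>M) = (\<integral>\<^sup>+z. heat_pot (t / 2) M z * heat_pot (t / 2) N z \<partial>lborel)"
      using heat_energy_split[OF sf s, of "t / 2" "t / 2"] by simp
  qed
  finally show ?thesis .
qed

section \<open>First passage of the stable subordinator\<close>

definition hitting_const :: "real \<Rightarrow> ennreal" where
  "hitting_const \<beta> = (\<integral>\<^sup>+x. ennreal (indicator {0<..} x * (x powr (- \<beta>) / (1 + x))) \<partial>lborel)"

lemma hitting_const_bounds:
  assumes "0 < \<beta>" "\<beta> < 1"
  shows "0 < hitting_const \<beta>" "hitting_const \<beta> < \<infinity>"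
proof -
  define c where "c = (1 / 2 :: real)"
  have c0: "0 < c" by (simp add: c_def)
  have "ennreal c = (\<integral>\<^sup>+x. ennreal c * indicator {0<..<1::real} x \<partial>lborel)"
    by (simp add: nn_integral_cmult)
  also have "\<dots> \<le> hitting_const \<beta>"
    unfolding hitting_const_def
  proof (intro nn_integral_mono)
    fix x :: real
    have "c \<le> x powr (- \<beta>) / (1 + x)" if "0 < x" "x < 1"
    proof -
      have "1 \<le> x powr (- \<beta>)" using that assms powr_mono'[of "-\<beta>" 0 x] by simp
      then show ?thesis using that unfolding c_def by (intro frac_le) auto
    qed
    then show "ennreal c * indicator {0<..<1} x \<le> ennreal (indicator {0<..} x * (x powr (- \<beta>) / (1 + x)))"
      by (auto simp: indicator_def intro!: ennreal_leI)
  qed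
  finally show "0 < hitting_const \<beta>" by (rule order.strict_trans2[rotated]) (simp add: c0)
  have "hitting_const \<beta> \<le> (\<integral>\<^sup>+x. ennreal (x powr (- \<beta>)) * indicator {0..1} x
      + ennreal (x powr (- \<beta> - 1)) * indicator {1..} x \<partial>lborel)"
    unfolding hitting_const_def
  proof (intro nn_integral_mono)
    fix x :: real
    have "x powr (- \<beta>) / (1 + x) \<le> x powr (- \<beta>)" if "0 < x"
      using that by (simp add: divide_le_eq mult_le_cancel_left1)
    moreover have "x powr (- \<beta>) / (1 + x) \<le> x powr (- \<beta> - 1)" if "0 < x"
    proof -
      have "x powr (- \<beta>) / (1 + x) \<le> x powr (- \<beta>) / x" using that by (intro divide_left_mono) auto
      also have "\<dots> = x powr (- \<beta> - 1)" using that by (simp add: powr_diff)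
      finally show ?thesis .
    qed
    ultimately show "ennreal (indicator {0<..} x * (x powr (- \<beta>) / (1 + x))) \<le>
       ennreal (x powr (- \<beta>)) * indicator {0..1} x + ennreal (x powr (- \<beta> - 1)) * indicator {1..} x"
      by (cases "x \<le> 0"; cases "x \<le> 1") (auto intro!: ennreal_leI add_increasing2)
  qed
  also have "\<dots> = (\<integral>\<^sup>+x. ennreal (x powr (- \<beta>)) * indicator {0..1} x \<partial>lborel)
      + (\<integral>\<^sup>+x. ennreal (x powr (- \<beta> - 1)) * indicator {1..} x \<partial>lborel)"
    by (intro nn_integral_add) auto
  also have "(\<integral>\<^sup>+x. ennreal (x powr (- \<beta>)) * indicator {0..1} x \<partial>lborel) = ennreal (1 powr (- \<beta> + 1) / (- \<beta> + 1))"
    using assms by (intro nn_integral_has_integral_lebesgue' has_integral_powr_from_0) auto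
  also have "(\<integral>\<^sup>+x. ennreal (x powr (- \<beta> - 1)) * indicator {1..} x \<partial>lborel) = ennreal (-(1 powr (- \<beta> - 1 + 1)) / (- \<beta> - 1 + 1))"
    using assms by (intro nn_integral_has_integral_lebesgue' has_integral_powr_to_inf) auto
  finally show "hitting_const \<beta> < \<infinity>" by (auto simp: less_top[symmetric] top_unique)
qed

text \<open>The substitution is \<open>x = u (r - t) / (t (u - r))\<close>.\<close>
lemma hitting_integral:
  fixes \<beta> t u :: real
  assumes \<beta>: "0 < \<beta>" "\<beta> < 1" and tu: "0 < t" "t < u"
  shows "(\<integral>\<^sup>+r. ennreal (indicator {t<..<u} r * ((r - t) powr (- \<beta>) / r * (u - r) powr (\<beta> - 1))) \<partial>lborel)
    = ennreal (t powr (- \<beta>) * u powr (\<beta> - 1)) * hitting_const \<beta>"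
proof -
  \<comment> \<open>The inverse of the substitution: g increases from t at 0 to u at
    infinity.\<close>
  define g where "g x = u * t * (1 + x) / (u + x * t)" for x
  define g' where "g' x = u * t * (u - t) / (u + x * t)\<^sup>2" for x
  define f where "f r = (r - t) powr (- \<beta>) / r * (u - r) powr (\<beta> - 1)" for r
  define c where "c = t powr (- \<beta>) * u powr (\<beta> - 1)"
  have pos: "u + x * t > 0" if "0 < x" for x using that tu by (simp add: add_pos_pos)
  have gt: "g x - t = t * x * (u - t) / (u + x * t)" "u - g x = u * (u - t) / (u + x * t)" if "0 < x" for x
    using pos[OF that] by (auto simp: g_def field_simps)
  have g_in: "t < g x" "g x < u" if "0 < x" for x
  proof -
    have "0 < g x - t" "0 < u - g x" unfolding gt[OF that] using that tu pos[OF that] by auto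
    then show "t < g x" "g x < u" by auto
  qed
  have fg: "f (g x) * g' x = c * (x powr (- \<beta>) / (1 + x))" if x: "0 < x" for x
  proof -
    define w where "w = u + x * t"
    have w: "w > 0" using pos[OF x] by (simp add: w_def)
    have 1: "(g x - t) powr (- \<beta>) = t powr (- \<beta>) * x powr (- \<beta>) * (u - t) powr (- \<beta>) * w powr \<beta>"
      using x tu w unfolding gt[OF x] w_def[symmetric]
      by (simp add: powr_mult powr_divide powr_minus divide_inverse inverse_powr)
    have 2: "(u - g x) powr (\<beta> - 1) = u powr (\<beta> - 1) * (u - t) powr (\<beta> - 1) * w powr (1 - \<beta>)"
      using x tu w unfolding gt[OF x] w_def[symmetric]
      by (simp add: powr_mult powr_divide powr_diff)
    have "(u - t) powr (- \<beta>) * (u - t) powr (\<beta> - 1) = (u - t) powr (- 1)"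
      by (simp only: powr_add[symmetric]) simp
    then have 3: "w powr \<beta> * w powr (1 - \<beta>) = w" "(u - t) powr (- \<beta>) * (u - t) powr (\<beta> - 1) = 1 / (u - t)"
      using w tu by (auto simp: powr_add[symmetric] powr_neg_one)
    have "f (g x) * g' x = (t powr (- \<beta>) * x powr (- \<beta>) * u powr (\<beta> - 1)) *
        ((u - t) powr (- \<beta>) * (u - t) powr (\<beta> - 1)) * (w powr \<beta> * w powr (1 - \<beta>)) * g' x / g x"
      unfolding f_def 1 2 by (simp add: ac_simps)
    also have "\<dots> = (t powr (- \<beta>) * x powr (- \<beta>) * u powr (\<beta> - 1)) * (1 / (u - t) * w * g' x / g x)"
      unfolding 3 by simp
    also have "1 / (u - t) * w * g' x / g x = 1 / (1 + x)"
    proof -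
      have "1 / d * w * (a * d / w\<^sup>2) / (a * y / w) = 1 / y" if "d \<noteq> 0" "a \<noteq> 0" "y \<noteq> 0" for a d y
        using that w by (simp add: power2_eq_square field_simps)
      from this[of "u - t" "u * t" "1 + x"] show ?thesis
        using x tu by (simp add: g'_def g_def w_def)
    qed
    finally show ?thesis by (simp add: c_def)
  qed
  have int0: "set_integrable lborel (einterval (ereal 0) \<infinity>) (\<lambda>x. x powr (- \<beta>) / (1 + x))"
  proof -
    have "integrable lborel (\<lambda>x. indicator {0<..} x * (x powr (- \<beta>) / (1 + x)))"
      using hitting_const_bounds[OF \<beta>]
      by (intro integrableI_nonneg) (auto simp: hitting_const_def indicator_def)
    then show ?thesis by (simp add: set_integrable_def einterval_def greaterThan_def)
  qed
  have int: "set_integrable lborel (einterval (ereal 0) \<infinity>) (\<lambda>x. f (g x) * g' x)"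
  proof -
    have "set_integrable lborel (einterval (ereal 0) \<infinity>) (\<lambda>x. c * (x powr (- \<beta>) / (1 + x)))"
      using int0 by (intro set_integrable_mult_right) auto
    then show ?thesis
      by (subst set_integrable_cong[OF refl refl]) (auto simp: fg einterval_def)
  qed
  have geq: "g x = u - u * (u - t) / (u + x * t)" if "0 < x" for x using gt(2)[OF that] by simp
  have lim0: "(g \<longlongrightarrow> t) (at_right 0)"
  proof -
    have "isCont g 0" unfolding g_def using tu by (intro continuous_intros) auto
    then show ?thesis using tu by (simp add: isCont_def g_def filterlim_at_split)
  qed
  have lim1: "(g \<longlongrightarrow> u) at_top"
  proof -
    have "filterlim (\<lambda>x. u + x * t) at_top at_top"
      using tu by (intro filterlim_tendsto_add_at_top tendsto_const filterlim_at_top_mult_tendsto_pos[OF tendsto_const]) (auto simp: filterlim_ident)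
    then have "((\<lambda>x. u * (u - t) / (u + x * t)) \<longlongrightarrow> 0) at_top"
      by (intro tendsto_divide_0[OF tendsto_const] filterlim_at_top_imp_at_infinity)
    then have "((\<lambda>x. u - u * (u - t) / (u + x * t)) \<longlongrightarrow> u - 0) at_top"
      by (intro tendsto_intros)
    then have "((\<lambda>x. u - u * (u - t) / (u + x * t)) \<longlongrightarrow> u) at_top" by simp
    then show ?thesis
      by (rule Lim_transform_eventually)
         (auto intro!: eventually_mono[OF eventually_gt_at_top[of 0]] simp: geq)
  qed
  have sub: "set_integrable lborel (einterval (ereal t) (ereal u)) f"
    "(LBINT r=ereal t..ereal u. f r) = (LBINT x=ereal 0..\<infinity>. f (g x) * g' x)"
  proof (rule_tac [1-2] interval_integral_substitution_nonneg[where g=g and g'=g' and a="ereal 0" and b="\<infinity>"])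
    show "DERIV g x :> g' x" if "ereal 0 < ereal x" for x
      unfolding g_def[abs_def] g'_def using pos[of x] that
      by (auto intro!: derivative_eq_intros simp: power2_eq_square field_simps)
    then show "DERIV g x :> g' x" if "ereal 0 < ereal x" for x using that by auto
    show c1: "isCont f (g x)" if "ereal 0 < ereal x" for x
      unfolding f_def[abs_def] using g_in[of x] that tu by (intro continuous_intros) auto
    then show "isCont f (g x)" if "ereal 0 < ereal x" for x using that by auto
    show c2: "isCont g' x" if "ereal 0 < ereal x" for x
      unfolding g'_def[abs_def] using pos[of x] that by (intro continuous_intros) auto
    then show "isCont g' x" if "ereal 0 < ereal x" for x using that by auto
    show c3: "0 \<le> f (g x)" if "ereal 0 < ereal x" for x
      unfolding f_def using g_in[of x] that tu by auto
    then show "0 \<le> f (g x)" if "ereal 0 < ereal x" for x using that by auto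
    show c4: "0 \<le> g' x" if "ereal 0 \<le> ereal x" for x
      unfolding g'_def using tu by auto
    then show "0 \<le> g' x" if "ereal 0 \<le> ereal x" for x using that by auto
    show c5: "((ereal \<circ> g \<circ> real_of_ereal) \<longlongrightarrow> ereal t) (at_right (ereal 0))"
      using lim0 by (simp add: ereal_tendsto_simps)
    then show "((ereal \<circ> g \<circ> real_of_ereal) \<longlongrightarrow> ereal t) (at_right (ereal 0))" .
    show c6: "((ereal \<circ> g \<circ> real_of_ereal) \<longlongrightarrow> ereal u) (at_left \<infinity>)"
      using lim1 by (simp add: ereal_tendsto_simps)
    then show "((ereal \<circ> g \<circ> real_of_ereal) \<longlongrightarrow> ereal u) (at_left \<infinity>)" .
  qed (use int in auto)
  have F: "integrable lborel (\<lambda>r. indicator {t<..<u} r * f r)"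
    using sub(1) by (simp add: set_integrable_def einterval_eq)
  have "(\<integral>\<^sup>+r. ennreal (indicator {t<..<u} r * f r) \<partial>lborel) = ennreal (LINT r|lborel. indicator {t<..<u} r * f r)"
    using F tu by (intro nn_integral_eq_integral) (auto simp: f_def indicator_def)
  also have "(LINT r|lborel. indicator {t<..<u} r * f r) = (LBINT r=ereal t..ereal u. f r)"
    using tu by (simp add: interval_lebesgue_integral_def set_lebesgue_integral_def einterval_eq)
  also have "\<dots> = (LINT x|lborel. indicator {0<..} x * (f (g x) * g' x))"
    unfolding sub(2) by (simp add: interval_lebesgue_integral_def set_lebesgue_integral_def einterval_def greaterThan_def)
  also have "\<dots> = (LINT x|lborel. c * (indicator {0<..} x * (x powr (- \<beta>) / (1 + x))))"
    by (intro Bochner_Integration.integral_cong) (auto simp: indicator_def fg)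
  also have "ennreal \<dots> = (\<integral>\<^sup>+x. ennreal (c * (indicator {0<..} x * (x powr (- \<beta>) / (1 + x)))) \<partial>lborel)"
    using int0 tu
    by (intro nn_integral_eq_integral[symmetric] integrable_mult_right)
       (auto simp: set_integrable_def einterval_def greaterThan_def c_def indicator_def)
  also have "\<dots> = (\<integral>\<^sup>+x. ennreal c * ennreal (indicator {0<..} x * (x powr (- \<beta>) / (1 + x))) \<partial>lborel)"
    using tu by (intro nn_integral_cong ennreal_mult) (auto simp: c_def indicator_def)
  also have "\<dots> = ennreal c * hitting_const \<beta>"
    unfolding hitting_const_def by (intro nn_integral_cmult) auto
  finally show ?thesis by (simp add: f_def c_def)
qed

text \<open>Decomposition of the time measure at the first passage over the level \<open>t\<close> of the subordinator
  with potential measure \<open>riesz_time \<alpha>\<close>; \<open>R\<close> is the law of the position after that passage. It is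
  the only place where \<open>\<alpha> \<le> 2\<close> enters.\<close>
lemma hitting_law:
  assumes "0 < \<alpha>" "\<alpha> \<le> 2" "0 < t"
  shows "\<exists>R. sets R = sets borel \<and> emeasure R UNIV \<le> 1 \<and> (AE r in R. 0 < r) \<and>
    (\<forall>\<phi>\<in>borel_measurable borel. (\<integral>\<^sup>+s. \<phi> s \<partial>riesz_time \<alpha>)
      = (\<integral>\<^sup>+s. \<phi> s * indicator {..<t} s \<partial>riesz_time \<alpha>) + (\<integral>\<^sup>+r. \<integral>\<^sup>+s. \<phi> (r + s) \<partial>riesz_time \<alpha> \<partial>R))"
proof -
  define w where "w s = ennreal (indicator {0<..} s * s powr (\<alpha> / 2 - 1))" for s
  have [measurable]: "w \<in> borel_measurable borel" unfolding w_def by measurable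
  have rt: "(\<integral>\<^sup>+s. f s \<partial>riesz_time \<alpha>) = (\<integral>\<^sup>+s. w s * f s \<partial>lborel)" if "f \<in> borel_measurable borel" for f
    using that unfolding w_def by (rule nn_integral_riesz_time)
  have split: "(\<integral>\<^sup>+s. w s * \<phi> s \<partial>lborel) = (\<integral>\<^sup>+s. w s * (\<phi> s * indicator {..<t} s) \<partial>lborel)
      + (\<integral>\<^sup>+s. w s * indicator {t<..} s * \<phi> s \<partial>lborel)" if [measurable]: "\<phi> \<in> borel_measurable borel" for \<phi>
  proof -
    have "(\<integral>\<^sup>+s. w s * \<phi> s \<partial>lborel) = (\<integral>\<^sup>+s. w s * (\<phi> s * indicator {..<t} s) + w s * indicator {t<..} s * \<phi> s \<partial>lborel)"
      using AE_lborel_singleton[of t]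
      by (intro nn_integral_cong_AE) (auto elim!: eventually_mono simp: indicator_def)
    then show ?thesis by (simp add: nn_integral_add)
  qed
  consider "\<alpha> = 2" | "\<alpha> < 2" using assms by linarith
  then show ?thesis
  proof cases
    case 1
    \<comment> \<open>For \<alpha> = 2 the time measure is Lebesgue measure on the half-line, that
      is, the subordinator is uniform motion; it passes the level t without a jump.\<close>
    show ?thesis
    proof (intro exI[of _ "return borel t"] conjI ballI)
      fix \<phi> :: "real \<Rightarrow> ennreal" assume [measurable]: "\<phi> \<in> borel_measurable borel"
      interpret sigma_finite_measure "riesz_time \<alpha>" by (rule sigma_finite_riesz_time)
      have "(\<integral>\<^sup>+r. \<integral>\<^sup>+s. \<phi> (r + s) \<partial>riesz_time \<alpha> \<partial>return borel t) = (\<integral>\<^sup>+s. \<phi> (t + s) \<partial>riesz_time \<alpha>)"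
        by (intro nn_integral_return) auto
      also have "\<dots> = (\<integral>\<^sup>+s. w s * \<phi> (t + 1 * s) \<partial>lborel)" by (simp add: rt)
      also have "\<dots> = (\<integral>\<^sup>+s. w (t + 1 * s) * indicator {t<..} (t + 1 * s) * \<phi> (t + 1 * s) \<partial>lborel)"
        using 1 assms by (intro nn_integral_cong) (auto simp: w_def indicator_def)
      also have "\<dots> = (\<integral>\<^sup>+s. w s * indicator {t<..} s * \<phi> s \<partial>lborel)"
        using nn_integral_real_affine[of "\<lambda>s. w s * indicator {t<..} s * \<phi> s" 1 t] by simp
      finally show "(\<integral>\<^sup>+s. \<phi> s \<partial>riesz_time \<alpha>) = (\<integral>\<^sup>+s. \<phi> s * indicator {..<t} s \<partial>riesz_time \<alpha>)
         + (\<integral>\<^sup>+r. \<integral>\<^sup>+s. \<phi> (r + s) \<partial>riesz_time \<alpha> \<partial>return borel t)"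
        using split[of \<phi>] by (simp add: rt)
    qed (use assms in \<open>auto simp: AE_return\<close>)
  next
    case 2
    define \<beta> where "\<beta> = \<alpha> / 2"
    have \<beta>: "0 < \<beta>" "\<beta> < 1" using assms 2 by (auto simp: \<beta>_def)
    define b where "b = enn2real (hitting_const \<beta>)"
    have b: "hitting_const \<beta> = ennreal b" "b > 0"
      using hitting_const_bounds[OF \<beta>] by (auto simp: b_def enn2real_positive_iff less_top)
    \<comment> \<open>The classical law of the position right after passing t. Its usual
      normalization sin(pi \<beta>) / pi appears as 1 / b, since b is the Beta integral with
      parameters 1 - \<beta> and \<beta>.\<close>
    define \<rho> where "\<rho> r = ennreal (indicator {t<..} r * ((r - t) powr (- \<beta>) / r) * (t powr \<beta> / b))" for r
    have [measurable]: "\<rho> \<in> borel_measurable borel" unfolding \<rho>_def by measurable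
    define R where "R = density lborel \<rho>"
    have R: "(\<integral>\<^sup>+r. f r \<partial>R) = (\<integral>\<^sup>+r. \<rho> r * f r \<partial>lborel)" if "f \<in> borel_measurable borel" for f
      using that unfolding R_def by (intro nn_integral_density) auto
    \<comment> \<open>The renewal identity: restarting the subordinator from its position after the
      passage reproduces the potential density beyond t.\<close>
    have inner: "(\<integral>\<^sup>+r. \<rho> r * w (u - r) \<partial>lborel) = w u * indicator {t<..} u" for u
    proof (cases "t < u")
      case True
      have "(\<integral>\<^sup>+r. \<rho> r * w (u - r) \<partial>lborel) = (\<integral>\<^sup>+r. ennreal (t powr \<beta> / b) *
          ennreal (indicator {t<..<u} r * ((r - t) powr (- \<beta>) / r * (u - r) powr (\<beta> - 1))) \<partial>lborel)"
        using assms b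
        by (intro nn_integral_cong)
           (auto simp: \<rho>_def w_def indicator_def ennreal_mult[symmetric] \<beta>_def mult_ac)
      also have "\<dots> = ennreal (t powr \<beta> / b) * (ennreal (t powr (- \<beta>) * u powr (\<beta> - 1)) * ennreal b)"
        unfolding hitting_integral[OF \<beta> \<open>0 < t\<close> True, unfolded b(1), symmetric] by (rule nn_integral_cmult) auto
      also have "\<dots> = ennreal (u powr (\<beta> - 1))"
        using assms b by (simp add: ennreal_mult[symmetric] powr_minus field_simps)
      finally show ?thesis using True assms by (simp add: w_def \<beta>_def)
    next
      case False
      then have z: "(\<lambda>r. \<rho> r * w (u - r)) = (\<lambda>_. 0)" by (auto simp: \<rho>_def w_def indicator_def)
      show ?thesis unfolding z using False by simp
    qed
    have main: "(\<integral>\<^sup>+s. \<phi> s \<partial>riesz_time \<alpha>) = (\<integral>\<^sup>+s. \<phi> s * indicator {..<t} s \<partial>riesz_time \<alpha>)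
         + (\<integral>\<^sup>+r. \<integral>\<^sup>+s. \<phi> (r + s) \<partial>riesz_time \<alpha> \<partial>R)" if [measurable]: "\<phi> \<in> borel_measurable borel" for \<phi>
    proof -
      interpret sigma_finite_measure "riesz_time \<alpha>" by (rule sigma_finite_riesz_time)
      have "(\<integral>\<^sup>+r. \<integral>\<^sup>+s. \<phi> (r + s) \<partial>riesz_time \<alpha> \<partial>R) = (\<integral>\<^sup>+r. \<rho> r * (\<integral>\<^sup>+s. w s * \<phi> (r + s) \<partial>lborel) \<partial>lborel)"
        by (subst R) (auto simp: rt)
      also have "\<dots> = (\<integral>\<^sup>+r. \<rho> r * (\<integral>\<^sup>+u. w (u - r) * \<phi> u \<partial>lborel) \<partial>lborel)"
      proof -
        have "(\<integral>\<^sup>+s. w s * \<phi> (r + s) \<partial>lborel) = (\<integral>\<^sup>+u. w (u - r) * \<phi> u \<partial>lborel)" for r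
          using nn_integral_real_affine[of "\<lambda>u. w (u - r) * \<phi> u" 1 r] by simp
        then show ?thesis by simp
      qed
      also have "\<dots> = (\<integral>\<^sup>+r. \<integral>\<^sup>+u. \<rho> r * w (u - r) * \<phi> u \<partial>lborel \<partial>lborel)"
        by (simp add: nn_integral_cmult[symmetric] mult.assoc)
      also have "\<dots> = (\<integral>\<^sup>+u. \<integral>\<^sup>+r. \<rho> r * w (u - r) * \<phi> u \<partial>lborel \<partial>lborel)"
        by (intro tonelli sigma_finite_lborel) auto
      also have "\<dots> = (\<integral>\<^sup>+u. w u * indicator {t<..} u * \<phi> u \<partial>lborel)"
        by (simp add: nn_integral_multc inner)
      finally show ?thesis using split[of \<phi>] by (simp add: rt)
    qed
    \<comment> \<open>The density w is decreasing, so w u \<le> w (u - r). Together with the renewal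
      identity at u this bounds the mass of R below u by 1.\<close>
    have le: "emeasure R {..<u} \<le> 1" if "t < u" for u
    proof -
      have wpos: "0 < w u" "w u < \<infinity>" using that assms by (auto simp: w_def)
      have "emeasure R {..<u} * w u = (\<integral>\<^sup>+r. \<rho> r * indicator {..<u} r * w u \<partial>lborel)"
        unfolding R_def by (simp add: emeasure_density nn_integral_multc)
      also have "\<dots> \<le> (\<integral>\<^sup>+r. \<rho> r * w (u - r) \<partial>lborel)"
      proof (intro nn_integral_mono)
        fix r
        show "\<rho> r * indicator {..<u} r * w u \<le> \<rho> r * w (u - r)"
        proof (cases "t < r \<and> r < u")
          case True
          then have "u powr (\<alpha> / 2 - 1) \<le> (u - r) powr (\<alpha> / 2 - 1)"
            using assms by (intro powr_mono2') auto
          then show ?thesis using True assms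
            by (intro mult_mono) (auto simp: w_def intro!: ennreal_leI)
        qed (auto simp: \<rho>_def indicator_def)
      qed
      also have "\<dots> = 1 * w u" using that by (simp add: inner)
      finally show ?thesis
        using wpos by (metis ennreal_mult_le_mult_iff mult.commute less_irrefl infinity_ennreal_def)
    qed
    have "emeasure R UNIV = (SUP k. emeasure R {..<real k})"
    proof -
      have "(\<Union>k. {..<real k}) = UNIV" using reals_Archimedean2 by auto
      moreover have "range (\<lambda>k. {..<real k}) \<subseteq> sets R" by (auto simp: R_def)
      moreover have "incseq (\<lambda>k. {..<real k})" by (auto simp: incseq_def)
      ultimately show ?thesis using SUP_emeasure_incseq[of "\<lambda>k. {..<real k}" R] by simp
    qed
    also have "\<dots> \<le> 1"
    proof (rule SUP_least)
      fix k :: nat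
      have "emeasure R {..<real k} \<le> emeasure R {..<max (real k) (t + 1)}"
        by (intro emeasure_mono) (auto simp: R_def)
      also have "\<dots> \<le> 1" by (rule le) auto
      finally show "emeasure R {..<real k} \<le> 1" .
    qed
    finally have mass: "emeasure R UNIV \<le> 1" .
    have "AE r in R. 0 < r"
      unfolding R_def using assms by (subst AE_density) (auto simp: \<rho>_def indicator_def split: if_splits)
    then show ?thesis
    proof (intro exI[of _ R] conjI ballI)
      show "sets R = sets borel" by (simp add: R_def)
    qed (assumption | rule mass main)+
  qed
qed

section \<open>The domination principle\<close>

definition heat_avg :: "real \<Rightarrow> ('a::euclidean_space \<Rightarrow> ennreal) \<Rightarrow> 'a \<Rightarrow> ennreal" where
  "heat_avg s u x = (\<integral>\<^sup>+z. ennreal (heat s (x - z)) * u z \<partial>lborel)"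

lemma borel_measurable_heat_avg [measurable (raw)]:
  fixes u :: "'a::euclidean_space \<Rightarrow> ennreal"
  assumes [measurable]: "u \<in> borel_measurable borel" "f \<in> borel_measurable N" "g \<in> borel_measurable N"
  shows "(\<lambda>x. heat_avg (f x) u (g x)) \<in> borel_measurable N"
  unfolding heat_avg_def by measurable

lemma heat_avg_mono: "(\<And>z. u z \<le> v z) \<Longrightarrow> heat_avg s u x \<le> heat_avg s v x"
  unfolding heat_avg_def by (intro nn_integral_mono mult_left_mono) auto

lemma heat_avg_const:
  fixes x :: "'a::euclidean_space"
  assumes "0 < s" shows "heat_avg s (\<lambda>_. c) x = c"
  unfolding heat_avg_def by (subst nn_integral_multc) (auto simp: nn_integral_heat_diff assms)

lemma heat_avg_add:
  fixes u v :: "'a::euclidean_space \<Rightarrow> ennreal"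
  assumes [measurable]: "u \<in> borel_measurable borel" "v \<in> borel_measurable borel"
  shows "heat_avg s (\<lambda>z. u z + v z) x = heat_avg s u x + heat_avg s v x"
  unfolding heat_avg_def by (subst nn_integral_add[symmetric]) (auto simp: distrib_left)

text \<open>The Gaussian weight becomes independent of s, and s survives only in the argument of u.
  Limits as s tends to 0 then follow from Fatou or from dominated convergence.\<close>

lemma heat_avg_rescale:
  fixes x :: "'a::euclidean_space"
  assumes [measurable]: "u \<in> borel_measurable borel" and s: "0 < s"
  shows "heat_avg s u x = (\<integral>\<^sup>+y. ennreal (heat 1 y) * u (x - sqrt s *\<^sub>R y) \<partial>lborel)"
proof -
  have "heat_avg s u x = ennreal (\<bar>- sqrt s\<bar> ^ DIM('a)) *
      (\<integral>\<^sup>+y. ennreal (heat s (x - (x + (- sqrt s) *\<^sub>R y))) * u (x + (- sqrt s) *\<^sub>R y) \<partial>lborel)"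
    unfolding heat_avg_def using s by (intro nn_integral_lborel_affine) auto
  also have "\<dots> = (\<integral>\<^sup>+y. ennreal (\<bar>- sqrt s\<bar> ^ DIM('a)) * (ennreal (heat s (sqrt s *\<^sub>R y)) * u (x - sqrt s *\<^sub>R y)) \<partial>lborel)"
    by (subst nn_integral_cmult[symmetric]) auto
  also have "\<dots> = (\<integral>\<^sup>+y. ennreal (heat 1 y) * u (x - sqrt s *\<^sub>R y) \<partial>lborel)"
  proof (intro nn_integral_cong)
    fix y :: 'a
    have "heat s (sqrt s *\<^sub>R y) = heat 1 y / sqrt s ^ DIM('a)"
      using heat_scale[of 1 "sqrt s" y] s by simp
    then have "ennreal (\<bar>- sqrt s\<bar> ^ DIM('a)) * ennreal (heat s (sqrt s *\<^sub>R y)) = ennreal (heat 1 y)"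
      using s by (simp add: ennreal_mult[symmetric])
    then show "ennreal (\<bar>- sqrt s\<bar> ^ DIM('a)) * (ennreal (heat s (sqrt s *\<^sub>R y)) * u (x - sqrt s *\<^sub>R y)) = ennreal (heat 1 y) * u (x - sqrt s *\<^sub>R y)"
      by (simp add: mult.assoc[symmetric])
  qed
  finally show ?thesis .
qed

lemma heat_avg_lsc:
  fixes u :: "'a::euclidean_space \<Rightarrow> ennreal"
  assumes [measurable]: "u \<in> borel_measurable borel"
    and lsc: "\<And>X x. X \<longlonglongrightarrow> x \<Longrightarrow> u x \<le> liminf (\<lambda>n. u (X n))"
    and s: "\<And>k. 0 < s k" "s \<longlonglongrightarrow> 0"
  shows "u x \<le> liminf (\<lambda>k. heat_avg (s k) u x)"
proof -
  have "u x = (\<integral>\<^sup>+y. ennreal (heat 1 (y::'a)) * u x \<partial>lborel)"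
    by (subst nn_integral_multc) (auto simp: nn_integral_heat)
  also have "\<dots> \<le> (\<integral>\<^sup>+y. liminf (\<lambda>k. ennreal (heat 1 y) * u (x - sqrt (s k) *\<^sub>R y)) \<partial>lborel)"
  proof (intro nn_integral_mono)
    fix y :: 'a
    have "(\<lambda>k. x - sqrt (s k) *\<^sub>R y) \<longlonglongrightarrow> x - sqrt 0 *\<^sub>R y" by (intro tendsto_intros s)
    then have "u x \<le> liminf (\<lambda>k. u (x - sqrt (s k) *\<^sub>R y))" by (intro lsc) simp
    then have "ennreal (heat 1 y) * u x \<le> ennreal (heat 1 y) * liminf (\<lambda>k. u (x - sqrt (s k) *\<^sub>R y))"
      by (intro mult_left_mono) auto
    also have "\<dots> = liminf (\<lambda>k. ennreal (heat 1 y) * u (x - sqrt (s k) *\<^sub>R y))"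
      by (intro Liminf_compose_continuous_mono[symmetric] monoI mult_left_mono)
         (auto simp: continuous_on_def intro!: ennreal_tendsto_cmult)
    finally show "ennreal (heat 1 y) * u x \<le> liminf (\<lambda>k. ennreal (heat 1 y) * u (x - sqrt (s k) *\<^sub>R y))" .
  qed
  also have "\<dots> \<le> liminf (\<lambda>k. \<integral>\<^sup>+y. ennreal (heat 1 y) * u (x - sqrt (s k) *\<^sub>R y) \<partial>lborel)"
    by (intro nn_integral_liminf) auto
  also have "\<dots> = liminf (\<lambda>k. heat_avg (s k) u x)"
    using s by (simp add: heat_avg_rescale)
  finally show ?thesis .
qed

lemma ennreal_two_mult_le: "2 * (a * b) \<le> a * a + (b * b :: ennreal)"
proof (cases "a = \<top> \<or> b = \<top>")
  case False
  then obtain r q where r: "a = ennreal r" "b = ennreal q" "0 \<le> r" "0 \<le> q" by (metis ennreal_cases)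
  have 1: "2 * (a * b) = ennreal (2 * (r * q))" using r by (simp add: ennreal_mult)
  have 2: "a * a + b * b = ennreal (r * r + q * q)" using r by (simp add: ennreal_mult)
  have "2 * (r * q) \<le> r * r + q * q"
    using zero_le_square[of "r - q"] by (simp add: algebra_simps)
  then show ?thesis unfolding 1 2 by (rule ennreal_leI)
qed (auto simp: ennreal_top_mult ennreal_mult_top)

text \<open>Schur's test for a symmetric kernel: 2 u(x) u(y) \<le> u(x)^2 + u(y)^2, and in either
  square the other variable integrates out to at most 1.\<close>

lemma convolution_contraction:
  fixes u q :: "'a::euclidean_space \<Rightarrow> ennreal"
  assumes [measurable]: "u \<in> borel_measurable borel" "q \<in> borel_measurable borel"
    and even: "\<And>z. q (- z) = q z" and mass: "\<And>x. (\<integral>\<^sup>+y. q (x - y) \<partial>lborel) \<le> 1"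
  shows "(\<integral>\<^sup>+x. u x * (\<integral>\<^sup>+y. q (x - y) * u y \<partial>lborel) \<partial>lborel) \<le> (\<integral>\<^sup>+x. u x * u x \<partial>lborel)"
proof -
  let ?I = "\<integral>\<^sup>+x. u x * (\<integral>\<^sup>+y. q (x - y) * u y \<partial>lborel) \<partial>lborel"
  have q': "q (x - y) = q (y - x)" for x y using even[of "y - x"] by simp
  have "2 * ?I = (\<integral>\<^sup>+x. \<integral>\<^sup>+y. q (x - y) * (2 * (u x * u y)) \<partial>lborel \<partial>lborel)"
    by (simp add: nn_integral_cmult[symmetric] ac_simps)
  also have "\<dots> \<le> (\<integral>\<^sup>+x. \<integral>\<^sup>+y. q (x - y) * (u x * u x) + q (x - y) * (u y * u y) \<partial>lborel \<partial>lborel)"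
    by (intro nn_integral_mono) (auto simp: distrib_left[symmetric] intro!: mult_left_mono ennreal_two_mult_le)
  also have "\<dots> = (\<integral>\<^sup>+x. \<integral>\<^sup>+y. q (x - y) * (u x * u x) \<partial>lborel \<partial>lborel) + (\<integral>\<^sup>+x. \<integral>\<^sup>+y. q (x - y) * (u y * u y) \<partial>lborel \<partial>lborel)"
    by (simp add: nn_integral_add)
  also have "(\<integral>\<^sup>+x. \<integral>\<^sup>+y. q (x - y) * (u y * u y) \<partial>lborel \<partial>lborel) = (\<integral>\<^sup>+y. \<integral>\<^sup>+x. q (x - y) * (u y * u y) \<partial>lborel \<partial>lborel)"
    by (intro tonelli sigma_finite_lborel) auto
  also have "\<dots> = (\<integral>\<^sup>+x. \<integral>\<^sup>+y. q (x - y) * (u x * u x) \<partial>lborel \<partial>lborel)"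
    by (intro nn_integral_cong) (auto simp: q')
  also have "(\<integral>\<^sup>+x. \<integral>\<^sup>+y. q (x - y) * (u x * u x) \<partial>lborel \<partial>lborel) \<le> (\<integral>\<^sup>+x. u x * u x \<partial>lborel)"
  proof (intro nn_integral_mono)
    fix x
    have "(\<integral>\<^sup>+y. q (x - y) * (u x * u x) \<partial>lborel) = (\<integral>\<^sup>+y. q (x - y) \<partial>lborel) * (u x * u x)"
      by (rule nn_integral_multc) auto
    also have "\<dots> \<le> 1 * (u x * u x)" using mass by (intro mult_right_mono) auto
    finally show "(\<integral>\<^sup>+y. q (x - y) * (u x * u x) \<partial>lborel) \<le> u x * u x" by simp
  qed
  finally have "2 * ?I \<le> 2 * (\<integral>\<^sup>+x. u x * u x \<partial>lborel)"
    by (simp add: mult_2 add_mono)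
  then show ?thesis by (simp add: ennreal_mult_le_mult_iff)
qed

section \<open>Short-time potentials and the comparison of excesses\<close>

lemma heat_pot_density:
  fixes u :: "'a::euclidean_space \<Rightarrow> ennreal"
  assumes [measurable]: "u \<in> borel_measurable borel"
  shows "heat_pot s (density lborel u) x = heat_avg s u x"
  unfolding heat_pot_def heat_avg_def by (subst nn_integral_density) (auto simp: mult.commute)

text \<open>Writing the time t + r as r/2 + (t + r/2) exhibits the left side as the pairing of the
  heat potential at time r/2 with its own heat average over time t; that averaging contracts
  L2.\<close>

lemma heat_energy_decreasing:
  fixes M :: "'a::euclidean_space measure"
  assumes sf: "sigma_finite_measure M" and s: "sets M = sets borel" and "0 < r" "0 < t"
  shows "(\<integral>\<^sup>+x. heat_pot (t + r) M x \<partial>M) \<le> (\<integral>\<^sup>+x. heat_pot r M x \<partial>M)"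
proof -
  note [measurable] = borel_measurable_heat_pot[OF sf s]
  let ?u = "heat_pot (r / 2) M"
  have "(\<integral>\<^sup>+x. heat_pot (r / 2 + (t + r / 2)) M x \<partial>M) = (\<integral>\<^sup>+z. ?u z * heat_pot (t + r / 2) M z \<partial>lborel)"
    using assms by (intro heat_energy_split) auto
  also have "\<dots> = (\<integral>\<^sup>+z. ?u z * (\<integral>\<^sup>+y. ennreal (heat t (z - y)) * ?u y \<partial>lborel) \<partial>lborel)"
    using assms by (simp add: heat_pot_add)
  also have "\<dots> \<le> (\<integral>\<^sup>+z. ?u z * ?u z \<partial>lborel)"
    using assms by (intro convolution_contraction) (auto simp: nn_integral_heat_diff)
  also have "\<dots> = (\<integral>\<^sup>+x. heat_pot (r / 2 + r / 2) M x \<partial>M)"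
    using assms by (intro heat_energy_split[symmetric]) auto
  finally show ?thesis by (simp add: algebra_simps)
qed

text \<open>The part of the potential, times \<open>riesz_const\<close>, that is due to times before \<open>t\<close>.\<close>
definition short_pot :: "real \<Rightarrow> real \<Rightarrow> 'a::euclidean_space measure \<Rightarrow> 'a \<Rightarrow> ennreal" where
  "short_pot \<alpha> t M x = (\<integral>\<^sup>+s. heat_pot s M x * indicator {..<t} s \<partial>riesz_time \<alpha>)"

abbreviation scaled_pot :: "real \<Rightarrow> 'a::euclidean_space measure \<Rightarrow> 'a \<Rightarrow> ennreal" where
  "scaled_pot \<alpha> M x \<equiv> riesz_const \<alpha> TYPE('a) * riesz_pot \<alpha> M x"

text \<open>The decomposition of time in \<open>hitting_law\<close>, integrated against heat
  potentials: p is the heat kernel averaged over the law R. One and the same p serves all measures,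
  so that potentials of different measures can be compared.\<close>

lemma excessive_step:
  assumes "0 < \<alpha>" "\<alpha> \<le> 2" "\<alpha> < real DIM('a::euclidean_space)" "0 < t"
  obtains p :: "'a::euclidean_space \<Rightarrow> ennreal" where "p \<in> borel_measurable borel" "\<And>z. p (- z) = p z"
    "\<And>x. (\<integral>\<^sup>+y. p (x - y) \<partial>lborel) \<le> 1"
    "\<And>M x. sigma_finite_measure M \<Longrightarrow> sets M = sets borel \<Longrightarrow>
       scaled_pot \<alpha> M x = short_pot \<alpha> t M x + (\<integral>\<^sup>+y. p (x - y) * scaled_pot \<alpha> M y \<partial>lborel)"
proof -
  obtain R where sR [measurable_cong]: "sets R = sets borel" and mass: "emeasure R UNIV \<le> 1" and pos: "AE r in R. 0 < r"
    and hit: "\<And>\<phi>. \<phi> \<in> borel_measurable borel \<Longrightarrow> (\<integral>\<^sup>+s. \<phi> s \<partial>riesz_time \<alpha>)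
      = (\<integral>\<^sup>+s. \<phi> s * indicator {..<t} s \<partial>riesz_time \<alpha>) + (\<integral>\<^sup>+r. \<integral>\<^sup>+s. \<phi> (r + s) \<partial>riesz_time \<alpha> \<partial>R)"
    using hitting_law[OF assms(1,2,4)] by blast
  have spR: "space R = UNIV" using sR by (rule space_eq_UNIV)
  interpret R: finite_measure R
    using mass by (intro finite_measureI) (auto simp: spR top_unique)
  have sfR: "sigma_finite_measure R" by unfold_locales
  define p where "p z = (\<integral>\<^sup>+r. ennreal (heat r z) \<partial>R)" for z :: 'a
  have pm [measurable]: "p \<in> borel_measurable borel" unfolding p_def by measurable
  show thesis
  proof (rule that[of p])
    show "(\<integral>\<^sup>+y. p (x - y) \<partial>lborel) \<le> 1" for x
    proof -
      have "(\<integral>\<^sup>+y. p (x - y) \<partial>lborel) = (\<integral>\<^sup>+r. \<integral>\<^sup>+y. ennreal (heat r (x - y)) \<partial>lborel \<partial>R)"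
        unfolding p_def by (intro tonelli sigma_finite_lborel sfR) auto
      also have "\<dots> = (\<integral>\<^sup>+r. 1 \<partial>R)"
        using pos by (intro nn_integral_cong_AE) (auto elim!: eventually_mono simp: nn_integral_heat_diff)
      finally show ?thesis using mass by (simp add: spR)
    qed
    fix M :: "'a measure" and x
    assume sf: "sigma_finite_measure M" and s [measurable_cong]: "sets M = sets borel"
    note [measurable] = borel_measurable_heat_pot[OF sf s] borel_measurable_riesz_pot[OF sf s]
    have sub: "scaled_pot \<alpha> M y = (\<integral>\<^sup>+s. heat_pot s M y \<partial>riesz_time \<alpha>)" for y
      using assms sf s by (intro riesz_pot_subordination) auto
    interpret T: sigma_finite_measure "riesz_time \<alpha>" by (rule sigma_finite_riesz_time)
    have "(\<integral>\<^sup>+r. \<integral>\<^sup>+s. heat_pot (r + s) M x \<partial>riesz_time \<alpha> \<partial>R)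
        = (\<integral>\<^sup>+r. \<integral>\<^sup>+s. \<integral>\<^sup>+z. ennreal (heat r (x - z)) * heat_pot s M z \<partial>lborel \<partial>riesz_time \<alpha> \<partial>R)"
    proof (intro nn_integral_cong_AE, use pos in eventually_elim, intro nn_integral_cong_AE, use AE_riesz_time[of \<alpha>] in eventually_elim)
      fix r s :: real assume "0 < r" "0 < s"
      then show "heat_pot (r + s) M x = (\<integral>\<^sup>+z. ennreal (heat r (x - z)) * heat_pot s M z \<partial>lborel)"
        by (rule heat_pot_add[OF sf s])
    qed
    also have "\<dots> = (\<integral>\<^sup>+r. \<integral>\<^sup>+z. \<integral>\<^sup>+s. ennreal (heat r (x - z)) * heat_pot s M z \<partial>riesz_time \<alpha> \<partial>lborel \<partial>R)"
      by (intro nn_integral_cong tonelli sigma_finite_lborel sigma_finite_riesz_time) auto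
    also have "\<dots> = (\<integral>\<^sup>+r. \<integral>\<^sup>+z. ennreal (heat r (x - z)) * scaled_pot \<alpha> M z \<partial>lborel \<partial>R)"
      unfolding sub by (intro nn_integral_cong nn_integral_cmult) auto
    also have "\<dots> = (\<integral>\<^sup>+z. \<integral>\<^sup>+r. ennreal (heat r (x - z)) * scaled_pot \<alpha> M z \<partial>R \<partial>lborel)"
      by (intro tonelli sigma_finite_lborel sfR) auto
    also have "\<dots> = (\<integral>\<^sup>+z. p (x - z) * scaled_pot \<alpha> M z \<partial>lborel)"
      unfolding p_def by (intro nn_integral_cong nn_integral_multc) auto
    finally show "scaled_pot \<alpha> M x = short_pot \<alpha> t M x + (\<integral>\<^sup>+y. p (x - y) * scaled_pot \<alpha> M y \<partial>lborel)"
      using hit[of "\<lambda>s. heat_pot s M x"] by (simp add: sub[of x] short_pot_def)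
  qed (auto simp: p_def)
qed

lemma short_pot_pairing:
  fixes M :: "'a::euclidean_space measure"
  assumes sf: "sigma_finite_measure M" and s [measurable_cong]: "sets M = sets borel"
    and [measurable]: "u \<in> borel_measurable borel"
  shows "(\<integral>\<^sup>+x. u x * short_pot \<alpha> t M x \<partial>lborel)
     = (\<integral>\<^sup>+s. (\<integral>\<^sup>+x. heat_avg s u x \<partial>M) * indicator {..<t} s \<partial>riesz_time \<alpha>)"
proof -
  note [measurable] = borel_measurable_heat_pot[OF sf s]
  have "(\<integral>\<^sup>+x. u x * short_pot \<alpha> t M x \<partial>lborel)
      = (\<integral>\<^sup>+x. \<integral>\<^sup>+s. u x * (heat_pot s M x * indicator {..<t} s) \<partial>riesz_time \<alpha> \<partial>lborel)"
    unfolding short_pot_def by (intro nn_integral_cong nn_integral_cmult[symmetric]) auto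
  also have "\<dots> = (\<integral>\<^sup>+s. \<integral>\<^sup>+x. u x * (heat_pot s M x * indicator {..<t} s) \<partial>lborel \<partial>riesz_time \<alpha>)"
    by (intro tonelli sigma_finite_lborel sigma_finite_riesz_time) auto
  also have "\<dots> = (\<integral>\<^sup>+s. (\<integral>\<^sup>+x. heat_pot s M x * u x \<partial>lborel) * indicator {..<t} s \<partial>riesz_time \<alpha>)"
    by (intro nn_integral_cong) (subst nn_integral_multc[symmetric], auto simp: ac_simps)
  also have "\<dots> = (\<integral>\<^sup>+s. (\<integral>\<^sup>+x. heat_avg s u x \<partial>M) * indicator {..<t} s \<partial>riesz_time \<alpha>)"
    unfolding heat_avg_def heat_pot_pairing[OF sf s assms(3)] ..
  finally show ?thesis .
qed

lemma riesz_time_initial: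
  assumes "0 < \<alpha>" "0 < t"
  shows "0 < (\<integral>\<^sup>+s. indicator {..<t} s \<partial>riesz_time \<alpha>)" "(\<integral>\<^sup>+s. indicator {..<t} s \<partial>riesz_time \<alpha>) < \<infinity>"
proof -
  have eq: "(\<integral>\<^sup>+s. indicator {..<t} s \<partial>riesz_time \<alpha>) = (\<integral>\<^sup>+s. ennreal (s powr (\<alpha> / 2 - 1)) * indicator {0<..<t} s \<partial>lborel)"
    by (subst nn_integral_riesz_time) (auto intro!: nn_integral_cong simp: indicator_def)
  show "(\<integral>\<^sup>+s. indicator {..<t} s \<partial>riesz_time \<alpha>) < \<infinity>"
  proof -
    have "(\<integral>\<^sup>+s. ennreal (s powr (\<alpha> / 2 - 1)) * indicator {0<..<t} s \<partial>lborel) \<le> (\<integral>\<^sup>+s. ennreal (s powr (\<alpha> / 2 - 1)) * indicator {0..t} s \<partial>lborel)"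
      by (intro nn_integral_mono) (auto simp: indicator_def)
    also have "\<dots> = ennreal (t powr (\<alpha> / 2 - 1 + 1) / (\<alpha> / 2 - 1 + 1))"
      using assms by (intro nn_integral_has_integral_lebesgue' has_integral_powr_from_0) auto
    finally show ?thesis by (auto simp: eq less_top[symmetric] top_unique)
  qed
  show "0 < (\<integral>\<^sup>+s. indicator {..<t} s \<partial>riesz_time \<alpha>)"
  proof (rule ccontr)
    assume "\<not> ?thesis"
    then have "AE s in lborel. ennreal (s powr (\<alpha> / 2 - 1)) * indicator {0<..<t} s = 0"
      unfolding eq by (subst nn_integral_0_iff_AE[symmetric]) auto
    then have "AE s in lborel. s \<notin> {0<..<t}"
      by eventually_elim (auto simp: ennreal_eq_0_iff)
    then have "emeasure lborel {0<..<t} = 0"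
      by (subst (asm) AE_iff_measurable[of "{0<..<t}"]) auto
    then show False using assms by simp
  qed
qed

lemma riesz_pot_vanishes:
  fixes M :: "'a::euclidean_space measure"
  assumes "\<alpha> < real DIM('a)" "finite_measure M" and [measurable_cong]: "sets M = sets borel"
    and supp: "AE y in M. norm y \<le> \<rho>" and \<epsilon>: "0 < \<epsilon>"
  shows "\<exists>L. \<forall>x. L < norm x \<longrightarrow> riesz_pot \<alpha> M x \<le> ennreal \<epsilon>"
proof -
  interpret finite_measure M by fact
  have sp: "space M = UNIV" using assms(3) by (rule space_eq_UNIV)
  define m where "m = measure M UNIV"
  have m0: "m \<ge> 0" by (simp add: m_def)
  define g where "g = real DIM('a) - \<alpha>"
  have g: "g > 0" using assms by (simp add: g_def)
  \<comment> \<open>At distance at least l from the support the potential is at most m * l powr (-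
    g), and l is chosen to make this at most \<epsilon>.\<close>
  define l where "l = ((m + 1) / \<epsilon>) powr (1 / g)"
  have l: "l > 0" using m0 \<epsilon> by (simp add: l_def)
  have "l powr g = (m + 1) / \<epsilon>" using m0 \<epsilon> g by (simp add: l_def powr_powr)
  then have "l powr (- g) = \<epsilon> / (m + 1)" by (simp add: powr_minus)
  then have lg: "m * l powr (- g) \<le> \<epsilon>" using m0 \<epsilon> by (simp add: divide_le_eq algebra_simps)
  have "riesz_pot \<alpha> M x \<le> ennreal \<epsilon>" if x: "\<rho> + l < norm x" for x
  proof -
    have "AE y in M. riesz_kernel \<alpha> x y \<le> ennreal (l powr (- g))" using supp
    proof eventually_elim
      fix y :: 'a assume "norm y \<le> \<rho>"
      then have n: "l \<le> norm (x - y)" using x norm_triangle_ineq2[of x y] by linarith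
      then have "norm (x - y) powr (- g) \<le> l powr (- g)" using l g by (intro powr_mono2') auto
      then show "riesz_kernel \<alpha> x y \<le> ennreal (l powr (- g))"
        using n l by (auto simp: riesz_kernel_def g_def intro!: ennreal_leI)
    qed
    then have "riesz_pot \<alpha> M x \<le> (\<integral>\<^sup>+y. ennreal (l powr (- g)) \<partial>M)"
      unfolding riesz_pot_def by (rule nn_integral_mono_AE)
    also have "\<dots> = ennreal (l powr (- g) * m)" by (simp add: m_def sp emeasure_eq_measure ennreal_mult)
    also have "\<dots> \<le> ennreal \<epsilon>" using lg by (intro ennreal_leI) (simp add: mult.commute)
    finally show ?thesis .
  qed
  then show ?thesis by blast
qed

lemma heat_pot_lsc:
  fixes M :: "'a::euclidean_space measure"
  assumes [measurable_cong]: "sets M = sets borel" and "X \<longlonglongrightarrow> x" "0 < s"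
  shows "heat_pot s M x \<le> liminf (\<lambda>n. heat_pot s M (X n))"
proof -
  have "(\<lambda>n. ennreal (heat s (X n - y))) \<longlonglongrightarrow> ennreal (heat s (x - y))" for y
    unfolding heat_eq[OF \<open>0 < s\<close>] using assms(3) by (intro tendsto_ennrealI tendsto_intros assms) auto
  then have "heat_pot s M x = (\<integral>\<^sup>+y. liminf (\<lambda>n. ennreal (heat s (X n - y))) \<partial>M)"
    unfolding heat_pot_def by (intro nn_integral_cong lim_imp_Liminf[symmetric]) auto
  also have "\<dots> \<le> liminf (\<lambda>n. heat_pot s M (X n))"
    unfolding heat_pot_def by (intro nn_integral_liminf) auto
  finally show ?thesis .
qed

lemma heat_pot_pos:
  fixes M :: "'a::euclidean_space measure"
  assumes [measurable_cong]: "sets M = sets borel" and "0 < s" "emeasure M UNIV \<noteq> 0"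
  shows "0 < heat_pot s M x"
proof (rule ccontr)
  assume "\<not> ?thesis"
  then have "AE y in M. ennreal (heat s (x - y)) = 0"
    unfolding heat_pot_def by (subst nn_integral_0_iff_AE[symmetric]) auto
  then have "AE y in M. False"
    by (rule eventually_mono) (simp add: ennreal_eq_0_iff, metis heat_pos[OF \<open>0 < s\<close>] not_le)
  then have "emeasure M (space M) = 0" using emeasure_eq_0_AE[of "\<lambda>_. True" M] by simp
  then show False using assms space_eq_UNIV[OF assms(1)] by simp
qed

lemma liminf_min_ge:
  fixes u v :: "nat \<Rightarrow> ennreal"
  assumes "a \<le> liminf (\<lambda>n. u n)" "b \<le> liminf (\<lambda>n. v n)"
  shows "min (a) (b) \<le> liminf (\<lambda>n. min (u n) (v n))"
  unfolding le_Liminf_iff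
proof (intro allI impI)
  fix y assume y: "y < min (a) (b)"
  then have "eventually (\<lambda>n. y < u n) sequentially" "eventually (\<lambda>n. y < v n) sequentially"
    using assms by (auto simp: le_Liminf_iff)
  then show "eventually (\<lambda>n. y < min (u n) (v n)) sequentially" by eventually_elim simp
qed

lemma liminf_add_ge:
  fixes u v :: "nat \<Rightarrow> ennreal"
  assumes "a \<le> liminf (\<lambda>n. u n)" "b \<le> liminf (\<lambda>n. v n)"
  shows "a + b \<le> liminf (\<lambda>n. u n + v n)"
proof -
  have *: "liminf f = (SUP n. INF m\<in>{n..}. f m)" for f :: "nat \<Rightarrow> ennreal" by (rule liminf_SUP_INF)
  have "a + b \<le> liminf (\<lambda>n. u n) + liminf (\<lambda>n. v n)" using assms by (rule add_mono)
  also have "\<dots> = (SUP n. (INF m\<in>{n..}. u m) + (INF m\<in>{n..}. v m))"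
    unfolding * by (intro ennreal_SUP_add[symmetric]) (auto simp: incseq_def intro!: INF_superset_mono)
  also have "\<dots> \<le> liminf (\<lambda>n. u n + v n)"
    unfolding * by (intro SUP_mono') (auto intro!: INF_greatest add_mono INF_lower)
  finally show ?thesis .
qed

lemma liminf_cmult_ge:
  fixes u :: "nat \<Rightarrow> ennreal"
  assumes "a \<le> liminf (\<lambda>n. u n)" "c < \<top>"
  shows "c * a \<le> liminf (\<lambda>n. c * u n)"
proof -
  have "c * a \<le> c * liminf (\<lambda>n. u n)" using assms by (intro mult_left_mono) auto
  also have "\<dots> = liminf (\<lambda>n. c * u n)"
    using assms by (intro Liminf_compose_continuous_mono[symmetric] monoI mult_left_mono)
      (auto simp: continuous_on_def intro!: ennreal_tendsto_cmult)
  finally show ?thesis .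
qed

lemma heat_pot_le:
  fixes M :: "'a::euclidean_space measure"
  assumes [measurable_cong]: "sets M = sets borel" and "0 < s"
  shows "heat_pot s M x \<le> ennreal (heat s (0::'a)) * emeasure M UNIV"
proof -
  have "heat_pot s M x \<le> (\<integral>\<^sup>+y. ennreal (heat s (0::'a)) \<partial>M)"
    unfolding heat_pot_def using assms by (intro nn_integral_mono ennreal_leI heat_le_0)
  then show ?thesis by (simp add: space_eq_UNIV[OF assms(1)])
qed

text \<open>Heat operators commute with the formation of potentials. In \<open>domination_ae\<close>
  the regularized measure is a strict comparison term: its density is positive everywhere, and its
  potential inherits the upper bound for that of M.\<close>

lemma scaled_pot_regularized:
  fixes M :: "'a::euclidean_space measure"
  assumes \<alpha>: "0 < \<alpha>" "\<alpha> < real DIM('a)" and fin: "finite_measure M" and s [measurable_cong]: "sets M = sets borel"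
  shows "sigma_finite_measure (density lborel (heat_pot 1 M))"
    "scaled_pot \<alpha> (density lborel (heat_pot 1 M)) x = heat_avg 1 (scaled_pot \<alpha> M) x"
proof -
  interpret M: finite_measure M by fact
  have sf: "sigma_finite_measure M" by unfold_locales
  note [measurable] = borel_measurable_heat_pot[OF sf s] borel_measurable_riesz_pot[OF sf s]
  have "heat_pot 1 M z \<noteq> \<infinity>" for z
    using heat_pot_le[OF s, of 1 z] M.emeasure_finite[of UNIV]
    by (auto simp: top_unique ennreal_mult_eq_top_iff)
  then show sf': "sigma_finite_measure (density lborel (heat_pot 1 M))"
    by (subst sigma_finite_measure.sigma_finite_iff_density_finite[OF sigma_finite_lborel]) auto
  have "scaled_pot \<alpha> (density lborel (heat_pot 1 M)) x = (\<integral>\<^sup>+t. heat_avg t (heat_pot 1 M) x \<partial>riesz_time \<alpha>)"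
    using \<alpha> sf' by (simp add: riesz_pot_subordination heat_pot_density)
  also have "\<dots> = (\<integral>\<^sup>+t. \<integral>\<^sup>+z. ennreal (heat 1 (x - z)) * heat_pot t M z \<partial>lborel \<partial>riesz_time \<alpha>)"
  proof (intro nn_integral_cong_AE, use AE_riesz_time[of \<alpha>] in eventually_elim)
    fix t :: real assume "0 < t"
    then show "heat_avg t (heat_pot 1 M) x = (\<integral>\<^sup>+z. ennreal (heat 1 (x - z)) * heat_pot t M z \<partial>lborel)"
      using heat_pot_add[OF sf s, of t 1 x] heat_pot_add[OF sf s, of 1 t x] by (simp add: heat_avg_def add.commute)
  qed
  also have "\<dots> = (\<integral>\<^sup>+z. \<integral>\<^sup>+t. ennreal (heat 1 (x - z)) * heat_pot t M z \<partial>riesz_time \<alpha> \<partial>lborel)"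
    by (intro tonelli sigma_finite_lborel sigma_finite_riesz_time) auto
  also have "\<dots> = heat_avg 1 (scaled_pot \<alpha> M) x"
    unfolding heat_avg_def using \<alpha> sf s by (simp add: nn_integral_cmult riesz_pot_subordination)
  finally show "scaled_pot \<alpha> (density lborel (heat_pot 1 M)) x = heat_avg 1 (scaled_pot \<alpha> M) x" .
qed

text \<open>The step \<open>V = short_pot + p * V\<close> tested against \<open>v = (V - N)\<^sup>+\<close>, using that convolution with \<open>p\<close>
  contracts \<open>L\<^sup>2\<close>.\<close>
lemma excess_test:
  fixes M N L :: "'a::euclidean_space measure" and e :: ennreal
  assumes \<alpha>: "0 < \<alpha>" "\<alpha> \<le> 2" "\<alpha> < real DIM('a)" and t: "0 < t"
    and M: "sigma_finite_measure M" "sets M = sets borel"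
    and N: "sigma_finite_measure N" "sets N = sets borel"
    and L: "sigma_finite_measure L" "sets L = sets borel"
  defines "n \<equiv> \<lambda>x. scaled_pot \<alpha> N x + (e + e * scaled_pot \<alpha> L x)"
  defines "v \<equiv> \<lambda>x. scaled_pot \<alpha> M x - n x"
  assumes fin: "\<And>x. scaled_pot \<alpha> M x < \<infinity>" and v2: "(\<integral>\<^sup>+x. v x * v x \<partial>lborel) < \<infinity>"
  shows "e * (\<integral>\<^sup>+x. v x * short_pot \<alpha> t L x \<partial>lborel) \<le> (\<integral>\<^sup>+x. v x * short_pot \<alpha> t M x \<partial>lborel)"
proof -
  let ?V = "scaled_pot \<alpha> M" and ?W = "scaled_pot \<alpha> N" and ?U = "scaled_pot \<alpha> L"
  note [measurable] = borel_measurable_riesz_pot[OF M] borel_measurable_riesz_pot[OF N] borel_measurable_riesz_pot[OF L]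
    borel_measurable_heat_pot[OF M] borel_measurable_heat_pot[OF L]
  interpret T: sigma_finite_measure "riesz_time \<alpha>" by (rule sigma_finite_riesz_time)
  have [measurable]: "short_pot \<alpha> t M \<in> borel_measurable borel" "short_pot \<alpha> t L \<in> borel_measurable borel"
    unfolding short_pot_def[abs_def] by measurable
  have nm [measurable]: "n \<in> borel_measurable borel" unfolding n_def by measurable
  have vm [measurable]: "v \<in> borel_measurable borel" unfolding v_def by measurable
  obtain p :: "'a \<Rightarrow> ennreal" where [measurable]: "p \<in> borel_measurable borel" and even: "\<And>z. p (- z) = p z"
    and mass: "\<And>x. (\<integral>\<^sup>+y. p (x - y) \<partial>lborel) \<le> 1"
    and step: "\<And>M x. sigma_finite_measure M \<Longrightarrow> sets M = sets borel \<Longrightarrow>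
       scaled_pot \<alpha> M x = short_pot \<alpha> t M x + (\<integral>\<^sup>+y. p (x - y) * scaled_pot \<alpha> M y \<partial>lborel)"
    using excessive_step[OF \<alpha> t] by blast
  define P where "P u x = (\<integral>\<^sup>+y. p (x - y) * u y \<partial>lborel)" for u x
  have [measurable]: "P u \<in> borel_measurable borel" if "u \<in> borel_measurable borel" for u
    using that unfolding P_def by measurable
  have Padd: "P (\<lambda>y. u y + w y) x = P u x + P w x" if "u \<in> borel_measurable borel" "w \<in> borel_measurable borel" for u w x
    using that unfolding P_def by (simp add: distrib_left nn_integral_add)
  have Pcm: "P (\<lambda>y. e * u y) x = e * P u x" if "u \<in> borel_measurable borel" for u x
    using that unfolding P_def by (simp add: nn_integral_cmult[symmetric] ac_simps)
  \<comment> \<open>Where v is positive, v + n = V \<le> \<open>short_pot \<alpha> t M\<close> + P n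
    + P v. On the other hand P n + e * \<open>short_pot \<alpha> t L\<close> \<le> n, because n is
    built from potentials and a constant and P has mass at most 1. The finite term P n
    cancels.\<close>
  have point: "v x * v x + e * (v x * short_pot \<alpha> t L x) \<le> v x * short_pot \<alpha> t M x + v x * P v x" for x
  proof (cases "v x = 0")
    case False
    have lt: "n x < ?V x"
    proof (rule ccontr)
      assume "\<not> n x < ?V x"
      then have "v x = 0" unfolding v_def using fin[of x] by (intro diff_eq_0_ennreal) auto
      with False show False ..
    qed
    have vn: "v x + n x = ?V x" unfolding v_def by (rule diff_add_cancel_ennreal[OF less_imp_le[OF lt]])
    have "P n x = P ?W x + (P (\<lambda>_. e) x + e * P ?U x)"
      unfolding n_def by (simp add: Padd Pcm)
    also have "P (\<lambda>_. e) x \<le> e"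
    proof -
      have "P (\<lambda>_. e) x = (\<integral>\<^sup>+y. p (x - y) \<partial>lborel) * e" unfolding P_def by (rule nn_integral_multc) auto
      also have "\<dots> \<le> 1 * e" using mass by (intro mult_right_mono) auto
      finally show ?thesis by simp
    qed
    finally have "P n x + e * short_pot \<alpha> t L x \<le> P ?W x + (e + e * P ?U x) + e * short_pot \<alpha> t L x"
      by (simp add: add_mono)
    also have "\<dots> = P ?W x + (e + e * (short_pot \<alpha> t L x + P ?U x))"
      by (simp add: distrib_left ac_simps)
    also have "\<dots> \<le> ?W x + (e + e * ?U x)"
      using step[OF L, of x] step[OF N, of x] by (intro add_mono) (auto simp: P_def add_increasing)
    finally have 1: "P n x + e * short_pot \<alpha> t L x \<le> n x" by (simp add: n_def)
    have "?V y \<le> n y + v y" for y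
    proof -
      have "?V y - n y \<le> v y" by (simp add: v_def)
      then show ?thesis unfolding ennreal_minus_le_iff by blast
    qed
    then have "P ?V x \<le> P (\<lambda>y. n y + v y) x"
      unfolding P_def by (intro nn_integral_mono mult_left_mono) auto
    then have 2: "?V x \<le> short_pot \<alpha> t M x + (P n x + P v x)"
      using step[OF M, of x] by (simp add: Padd P_def[symmetric] add_left_mono)
    have "P n x + (v x + e * short_pot \<alpha> t L x) \<le> v x + n x"
      using add_left_mono[OF 1, of "v x"] by (simp only: ac_simps)
    also have "\<dots> \<le> P n x + (short_pot \<alpha> t M x + P v x)" unfolding vn using 2 by (simp only: ac_simps)
    finally have "P n x + (v x + e * short_pot \<alpha> t L x) \<le> P n x + (short_pot \<alpha> t M x + P v x)" .
    moreover have "P n x < \<infinity>"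
      using 1 lt fin[of x] by (meson le_iff_add order.strict_trans1 order.strict_trans)
    ultimately have "v x + e * short_pot \<alpha> t L x \<le> short_pot \<alpha> t M x + P v x"
      by (auto simp: ennreal_add_left_cancel_le)
    then have "v x * (v x + e * short_pot \<alpha> t L x) \<le> v x * (short_pot \<alpha> t M x + P v x)"
      by (intro mult_left_mono) auto
    then show ?thesis by (simp add: distrib_left ac_simps)
  qed simp
  have "(\<integral>\<^sup>+x. v x * v x \<partial>lborel) + e * (\<integral>\<^sup>+x. v x * short_pot \<alpha> t L x \<partial>lborel)
     = (\<integral>\<^sup>+x. v x * v x + e * (v x * short_pot \<alpha> t L x) \<partial>lborel)"
    by (simp add: nn_integral_add nn_integral_cmult)
  also have "\<dots> \<le> (\<integral>\<^sup>+x. v x * short_pot \<alpha> t M x + v x * P v x \<partial>lborel)"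
    by (intro nn_integral_mono point)
  also have "\<dots> = (\<integral>\<^sup>+x. v x * short_pot \<alpha> t M x \<partial>lborel) + (\<integral>\<^sup>+x. v x * P v x \<partial>lborel)"
    by (simp add: nn_integral_add)
  also have "\<dots> \<le> (\<integral>\<^sup>+x. v x * short_pot \<alpha> t M x \<partial>lborel) + (\<integral>\<^sup>+x. v x * v x \<partial>lborel)"
    unfolding P_def by (intro add_left_mono convolution_contraction even mass) auto
  finally show ?thesis using v2 by (auto simp: add.commute[of _ "\<integral>\<^sup>+x. v x * v x \<partial>lborel"] ennreal_add_left_cancel_le)
qed

text \<open>The constant in the majorant n makes the excess v vanish near infinity, so that it is
  square integrable; the multiple of the potential of \<Lambda> makes \<open>excess_test\<close>
  strict. For short times its M side tends to 0, as v vanishes M-almost everywhere, while its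
  \<Lambda> side is asymptotically at least the integral of v h with h > 0 everywhere. Hence v = 0
  almost everywhere.\<close>

lemma domination_ae:
  fixes M N :: "'a::euclidean_space measure"
  assumes \<alpha>: "0 < \<alpha>" "\<alpha> \<le> 2" "\<alpha> < real DIM('a)"
    and fM: "finite_measure M" and sM [measurable_cong]: "sets M = sets borel" and M0: "emeasure M UNIV \<noteq> 0"
    and N: "sigma_finite_measure N" "sets N = sets borel"
    and supp: "AE y in M. norm y \<le> \<rho>"
    and c: "0 \<le> c" "\<And>x. scaled_pot \<alpha> M x \<le> ennreal c"
    and le: "AE x in M. riesz_pot \<alpha> M x \<le> riesz_pot \<alpha> N x"
    and \<epsilon>: "0 < \<epsilon>"
  shows "AE x in lborel. scaled_pot \<alpha> M x \<le> scaled_pot \<alpha> N x + ennreal (\<epsilon> * (1 + c))"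
proof -
  interpret M: finite_measure M by fact
  have sf: "sigma_finite_measure M" by unfold_locales
  define \<Lambda> where "\<Lambda> = density lborel (heat_pot 1 M)"
  note reg = scaled_pot_regularized[OF \<alpha>(1,3) fM sM, folded \<Lambda>_def]
  have sL [measurable_cong]: "sets \<Lambda> = sets borel" by (simp add: \<Lambda>_def)
  define h where "h = heat_pot 1 M"
  define e where "e = ennreal \<epsilon>"
  define V where "V = scaled_pot \<alpha> M"
  define n where "n x = scaled_pot \<alpha> N x + (e + e * scaled_pot \<alpha> \<Lambda> x)" for x
  define v where "v x = V x - n x" for x
  define m where "m x = min (V x) (n x)" for x
  note [measurable] = borel_measurable_riesz_pot[OF sf sM] borel_measurable_riesz_pot[OF N]
    borel_measurable_riesz_pot[OF reg(1) sL] borel_measurable_heat_pot[OF sf sM] borel_measurable_heat_pot[OF reg(1) sL]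
  have [measurable]: "V \<in> borel_measurable borel" unfolding V_def by measurable
  have [measurable]: "n \<in> borel_measurable borel" unfolding n_def by measurable
  have [measurable]: "v \<in> borel_measurable borel" unfolding v_def by measurable
  have [measurable]: "m \<in> borel_measurable borel" unfolding m_def by measurable
  have [measurable]: "h \<in> borel_measurable borel" unfolding h_def by measurable
  have Vc: "V x \<le> ennreal c" for x using c by (simp add: V_def)
  have Vfin: "V x < \<infinity>" for x using Vc[of x] by (auto simp: less_top[symmetric] top_unique)
  have vV: "v x \<le> V x" for x by (simp add: v_def)
  have vm: "V x = m x + v x" for x
  proof (cases "V x \<le> n x")
    case True then show ?thesis using Vfin[of x] by (simp add: m_def v_def min_absorb1 diff_eq_0_ennreal)
  next
    case False then show ?thesis by (simp add: m_def v_def min_absorb2 add_diff_inverse_ennreal)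
  qed
  have Lc: "scaled_pot \<alpha> \<Lambda> x \<le> ennreal c" for x
  proof -
    have "scaled_pot \<alpha> \<Lambda> x \<le> heat_avg 1 (\<lambda>_. ennreal c) x"
      unfolding reg(2) using c by (intro heat_avg_mono)
    then show ?thesis by (simp add: heat_avg_const)
  qed
  have nle: "n x \<le> scaled_pot \<alpha> N x + ennreal (\<epsilon> * (1 + c))" for x
  proof -
    have "e + e * scaled_pot \<alpha> \<Lambda> x \<le> e + e * ennreal c" using Lc by (intro add_left_mono mult_left_mono) auto
    also have "\<dots> = ennreal (\<epsilon> * (1 + c))" using \<epsilon> c by (simp add: e_def ennreal_mult[symmetric] ennreal_plus[symmetric] algebra_simps del: ennreal_plus)
    finally show ?thesis unfolding n_def by (intro add_left_mono)
  qed
  have Cfin: "riesz_const \<alpha> TYPE('a) < \<top>" using riesz_const_finite[OF \<alpha>(1,3)] by simp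
  obtain B where B: "\<And>x. B < norm x \<Longrightarrow> v x = 0"
  proof -
    define C where "C = enn2real (riesz_const \<alpha> TYPE('a))"
    have C: "riesz_const \<alpha> TYPE('a) = ennreal C" "C > 0"
      using riesz_const_finite[OF \<alpha>(1,3)] riesz_const_pos[of \<alpha>, where 'a='a]
      by (auto simp: C_def enn2real_positive_iff less_top)
    obtain B where B: "\<And>x. B < norm x \<Longrightarrow> riesz_pot \<alpha> M x \<le> ennreal (\<epsilon> / C)"
      using riesz_pot_vanishes[OF \<alpha>(3) fM sM supp, of "\<epsilon> / C"] \<epsilon> C by auto
    have "v x = 0" if "B < norm x" for x
    proof -
      have "V x \<le> ennreal C * ennreal (\<epsilon> / C)" unfolding V_def C(1) using B[OF that] by (intro mult_left_mono) auto
      also have "\<dots> = e" using C \<epsilon> by (simp add: e_def ennreal_mult[symmetric])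
      also have "\<dots> \<le> n x" by (simp add: n_def add_increasing add_increasing2)
      finally show ?thesis unfolding v_def using Vfin[of x] by (intro diff_eq_0_ennreal) auto
    qed
    then show thesis by (rule that)
  qed
  have v2: "(\<integral>\<^sup>+x. v x * v x \<partial>lborel) < \<infinity>"
  proof -
    have "(\<integral>\<^sup>+x. v x * v x \<partial>lborel) \<le> (\<integral>\<^sup>+x. ennreal (c * c) * indicator (cball (0::'a) B) x \<partial>lborel)"
    proof (intro nn_integral_mono)
      fix x
      have "v x * v x \<le> ennreal c * ennreal c" using vV Vc by (intro mult_mono) (auto intro: order_trans)
      then show "v x * v x \<le> ennreal (c * c) * indicator (cball (0::'a) B) x"
        using B[of x] c by (cases "B < norm x") (auto simp: ennreal_mult)
    qed
    also have "\<dots> = ennreal (c * c) * emeasure lborel (cball (0::'a) B)" by (rule nn_integral_cmult_indicator) auto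
    also have "\<dots> < \<infinity>" using emeasure_lborel_cball_finite[of "0::'a" B] by (simp add: ennreal_mult_less_top)
    finally show ?thesis .
  qed
  have test: "e * (\<integral>\<^sup>+x. v x * short_pot \<alpha> t \<Lambda> x \<partial>lborel) \<le> (\<integral>\<^sup>+x. v x * short_pot \<alpha> t M x \<partial>lborel)" if "0 < t" for t
    using excess_test[OF \<alpha> that sf sM N reg(1) sL, of e] Vfin v2
    unfolding v_def n_def V_def by blast
  define A where "A s = (\<integral>\<^sup>+x. heat_avg s v x \<partial>M)" for s
  define A' where "A' s = (\<integral>\<^sup>+x. heat_avg s v x \<partial>\<Lambda>)" for s
  have [measurable]: "A \<in> borel_measurable borel" unfolding A_def by measurable
  interpret L: sigma_finite_measure \<Lambda> by (rule reg(1))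
  have [measurable]: "A' \<in> borel_measurable borel" unfolding A'_def by measurable
  have testA: "e * (\<integral>\<^sup>+s. A' s * indicator {..<t} s \<partial>riesz_time \<alpha>) \<le> (\<integral>\<^sup>+s. A s * indicator {..<t} s \<partial>riesz_time \<alpha>)" if "0 < t" for t
    using test[OF that] unfolding A_def A'_def by (simp add: short_pot_pairing sf sM reg(1) sL)
  define J where "J = (\<integral>\<^sup>+x. V x \<partial>M)"
  have Jfin: "J < \<infinity>"
  proof -
    have "J \<le> (\<integral>\<^sup>+x. ennreal c \<partial>M)" unfolding J_def by (intro nn_integral_mono Vc)
    also have "\<dots> < \<infinity>" using M.emeasure_finite[of "space M", unfolded top.not_eq_extremum] by (simp add: ennreal_mult_less_top)
    finally show ?thesis .
  qed
  define Am where "Am s = (\<integral>\<^sup>+x. heat_avg s m x \<partial>M)" for s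
  \<comment> \<open>The two terms add up to the integral over M of the heat average of V, which is
    the energy with all times shifted by s; by \<open>heat_energy_decreasing\<close> the shift
    cannot increase it.\<close>
  have AJ: "A s + Am s \<le> J" if s: "0 < s" for s
  proof -
    have Vmv: "V = (\<lambda>x. m x + v x)" using vm by (intro ext)
    have "A s + Am s = (\<integral>\<^sup>+x. heat_avg s m x + heat_avg s v x \<partial>M)"
      unfolding A_def Am_def by (simp add: nn_integral_add add.commute)
    also have "\<dots> = (\<integral>\<^sup>+x. heat_avg s V x \<partial>M)"
      by (subst Vmv, intro nn_integral_cong heat_avg_add[symmetric]) auto
    also have "\<dots> = (\<integral>\<^sup>+x. \<integral>\<^sup>+r. heat_pot (s + r) M x \<partial>riesz_time \<alpha> \<partial>M)"
    proof (intro nn_integral_cong)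
      fix x
      have "heat_avg s V x = (\<integral>\<^sup>+z. \<integral>\<^sup>+r. ennreal (heat s (x - z)) * heat_pot r M z \<partial>riesz_time \<alpha> \<partial>lborel)"
        unfolding heat_avg_def V_def riesz_pot_subordination[OF \<alpha>(1,3) sf sM]
        by (intro nn_integral_cong nn_integral_cmult[symmetric]) auto
      also have "\<dots> = (\<integral>\<^sup>+r. \<integral>\<^sup>+z. ennreal (heat s (x - z)) * heat_pot r M z \<partial>lborel \<partial>riesz_time \<alpha>)"
        by (intro tonelli sigma_finite_lborel sigma_finite_riesz_time) auto
      also have "\<dots> = (\<integral>\<^sup>+r. heat_pot (s + r) M x \<partial>riesz_time \<alpha>)"
        by (intro nn_integral_cong_AE, use AE_riesz_time[of \<alpha>] in eventually_elim)
           (simp add: heat_pot_add[OF sf sM s])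
      finally show "heat_avg s V x = (\<integral>\<^sup>+r. heat_pot (s + r) M x \<partial>riesz_time \<alpha>)" .
    qed
    also have "\<dots> = (\<integral>\<^sup>+r. \<integral>\<^sup>+x. heat_pot (s + r) M x \<partial>M \<partial>riesz_time \<alpha>)"
      by (intro tonelli sf sigma_finite_riesz_time) auto
    also have "\<dots> \<le> (\<integral>\<^sup>+r. \<integral>\<^sup>+x. heat_pot r M x \<partial>M \<partial>riesz_time \<alpha>)"
      by (intro nn_integral_mono_AE, use AE_riesz_time[of \<alpha>] in eventually_elim)
         (intro heat_energy_decreasing sf sM s)
    also have "\<dots> = (\<integral>\<^sup>+x. \<integral>\<^sup>+r. heat_pot r M x \<partial>riesz_time \<alpha> \<partial>M)"
      by (intro tonelli sf sigma_finite_riesz_time) auto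
    also have "\<dots> = J" unfolding J_def V_def riesz_pot_subordination[OF \<alpha>(1,3) sf sM] ..
    finally show ?thesis .
  qed
  \<comment> \<open>An inequality between integrals over all times below t yields a single time at
    which the integrands obey it up to t; otherwise the finite integral of A would be strictly
    smaller than itself.\<close>
  have ex: "\<exists>s. 0 < s \<and> s < t \<and> e * A' s \<le> A s + ennreal t" if t: "0 < t" for t
  proof (rule ccontr)
    assume "\<not> ?thesis"
    then have lt: "A s + ennreal t \<le> e * A' s" if "0 < s" "s < t" for s
      using that by (auto simp: not_le intro: less_imp_le)
    let ?c = "\<integral>\<^sup>+s. indicator {..<t} s \<partial>riesz_time \<alpha>"
    let ?A = "\<integral>\<^sup>+s. A s * indicator {..<t} s \<partial>riesz_time \<alpha>"
    have "?A \<le> (\<integral>\<^sup>+s. J * indicator {..<t} s \<partial>riesz_time \<alpha>)"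
    proof (intro nn_integral_mono_AE, use AE_riesz_time[of \<alpha>] in eventually_elim)
      fix s :: real assume "0 < s"
      then have "A s \<le> J" using AJ[of s] by (meson le_iff_add order_trans)
      then show "A s * indicator {..<t} s \<le> J * indicator {..<t} s" by (intro mult_right_mono) auto
    qed
    also have "\<dots> = J * ?c" by (intro nn_integral_cmult) auto
    also have "\<dots> < \<infinity>" using Jfin riesz_time_initial[OF \<alpha>(1) t] by (simp add: ennreal_mult_less_top)
    finally have Afin: "?A < \<infinity>" .
    have "?A + ennreal t * ?c = (\<integral>\<^sup>+s. (A s + ennreal t) * indicator {..<t} s \<partial>riesz_time \<alpha>)"
      by (simp add: distrib_right nn_integral_add nn_integral_cmult)
    also have "\<dots> \<le> (\<integral>\<^sup>+s. e * (A' s * indicator {..<t} s) \<partial>riesz_time \<alpha>)"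
      by (intro nn_integral_mono_AE, use AE_riesz_time[of \<alpha>] in eventually_elim)
         (auto simp: indicator_def lt)
    also have "\<dots> = e * (\<integral>\<^sup>+s. A' s * indicator {..<t} s \<partial>riesz_time \<alpha>)" by (intro nn_integral_cmult) auto
    also have "\<dots> \<le> ?A" by (rule testA[OF t])
    finally have "?A + ennreal t * ?c \<le> ?A + 0" by simp
    then have "ennreal t * ?c = 0" using Afin by (auto simp: ennreal_add_left_cancel_le)
    then show False using riesz_time_initial[OF \<alpha>(1) t] t by auto
  qed
  have "\<exists>s. \<forall>k::nat. 0 < s k \<and> s k < 1 / real (Suc k) \<and> e * A' (s k) \<le> A (s k) + ennreal (1 / real (Suc k))"
    by (intro choice allI ex) auto
  then obtain s where s: "\<And>k::nat. 0 < s k" "\<And>k. s k < 1 / real (Suc k)" "\<And>k. e * A' (s k) \<le> A (s k) + ennreal (1 / real (Suc k))"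
    by blast
  have inv0: "(\<lambda>k. 1 / real (Suc k)) \<longlonglongrightarrow> 0" using LIMSEQ_inverse_real_of_nat by (simp add: inverse_eq_divide)
  have s0: "s \<longlonglongrightarrow> 0"
    by (rule tendsto_sandwich[OF _ _ tendsto_const inv0]) (use s in \<open>auto intro!: eventuallyI less_imp_le\<close>)
  have Vlsc: "V x \<le> liminf (\<lambda>k. V (X k))" if "X \<longlonglongrightarrow> x" for X x
    unfolding V_def using riesz_pot_lsc[OF \<alpha>(3) sM that] Cfin by (rule liminf_cmult_ge)
  have nlsc: "n x \<le> liminf (\<lambda>k. n (X k))" if "X \<longlonglongrightarrow> x" for X x
    unfolding n_def
    using riesz_pot_lsc[OF \<alpha>(3) N(2) that] riesz_pot_lsc[OF \<alpha>(3) sL that] Cfin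
    by (intro liminf_add_ge liminf_cmult_ge) (auto simp: e_def Liminf_const)
  have mlsc: "m x \<le> liminf (\<lambda>k. m (X k))" if "X \<longlonglongrightarrow> x" for X x
    unfolding m_def using Vlsc[OF that] nlsc[OF that] by (rule liminf_min_ge)
  \<comment> \<open>Since V \<le> n holds M-almost everywhere, J is also the integral of m = min V
    n. As m is lower semicontinuous, Fatou shows that Am asymptotically takes up all of J, and by
    \<open>AJ\<close> nothing is left for A.\<close>
  have J_le: "J \<le> liminf (\<lambda>k. Am (s k))"
  proof -
    have "J = (\<integral>\<^sup>+x. m x \<partial>M)"
      unfolding J_def
    proof (intro nn_integral_cong_AE, use le in eventually_elim)
      fix x assume "riesz_pot \<alpha> M x \<le> riesz_pot \<alpha> N x"
      then have "V x \<le> scaled_pot \<alpha> N x" unfolding V_def by (intro mult_left_mono) auto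
      also have "\<dots> \<le> n x" by (simp add: n_def)
      finally show "V x = m x" by (simp add: m_def min_absorb1)
    qed
    also have "\<dots> \<le> (\<integral>\<^sup>+x. liminf (\<lambda>k. heat_avg (s k) m x) \<partial>M)"
      by (intro nn_integral_mono heat_avg_lsc mlsc s s0) auto
    also have "\<dots> \<le> liminf (\<lambda>k. Am (s k))" unfolding Am_def by (intro nn_integral_liminf) auto
    finally show ?thesis .
  qed
  have A0: "(\<lambda>k. A (s k)) \<longlonglongrightarrow> 0"
  proof (rule order_tendstoI)
    fix a :: ennreal assume a: "0 < a"
    obtain d where d: "0 < d" "ennreal d < a"
      using a by (metis ennreal_0 ennreal_less_zero_iff dense ennreal_cases less_top order_less_imp_not_less top.not_eq_extremum ennreal_less_iff less_le_trans not_less_iff_gr_or_eq)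
    show "eventually (\<lambda>k. A (s k) < a) sequentially"
    proof (cases "J \<le> ennreal d")
      case True
      have "A (s k) < a" for k
        using AJ[OF s(1)[of k]] True d by (meson le_iff_add order_trans le_less_trans)
      then show ?thesis by simp
    next
      case False
      obtain j where j: "J = ennreal j" "0 \<le> j" using Jfin by (cases J) auto
      then have "d < j" using False d by (simp add: not_le ennreal_less_iff)
      then have Jd: "J - ennreal d < J" using j d by (simp add: ennreal_minus ennreal_less_iff)
      then have "eventually (\<lambda>k. J - ennreal d < Am (s k)) sequentially"
        using J_le by (auto simp: le_Liminf_iff)
      then show ?thesis
      proof eventually_elim
        fix k assume k: "J - ennreal d < Am (s k)"
        have "J \<le> ennreal d + Am (s k)" using k by (auto simp: ennreal_minus_le_iff less_imp_le dest: less_imp_le)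
        then have "Am (s k) + A (s k) \<le> Am (s k) + ennreal d" using AJ[OF s(1)[of k]] by (metis add.commute order_trans)
        moreover have "Am (s k) \<noteq> \<infinity>" using AJ[OF s(1)[of k]] Jfin by (auto simp: top_unique)
        ultimately have "A (s k) \<le> ennreal d" by (auto simp: ennreal_add_left_cancel_le)
        then show "A (s k) < a" using d by simp
      qed
    qed
  qed simp
  have vh: "(\<integral>\<^sup>+x. v x * h x \<partial>lborel) \<le> liminf (\<lambda>k. A' (s k))"
  proof -
    have hlsc: "h x \<le> liminf (\<lambda>k. h (X k))" if "X \<longlonglongrightarrow> x" for X x
      unfolding h_def by (rule heat_pot_lsc[OF sM that]) simp
    have "(\<integral>\<^sup>+x. v x * h x \<partial>lborel) \<le> (\<integral>\<^sup>+x. liminf (\<lambda>k. v x * heat_avg (s k) h x) \<partial>lborel)"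
      using Vfin vV by (intro nn_integral_mono liminf_cmult_ge heat_avg_lsc hlsc s s0) (auto intro: le_less_trans)
    also have "\<dots> \<le> liminf (\<lambda>k. \<integral>\<^sup>+x. v x * heat_avg (s k) h x \<partial>lborel)" by (intro nn_integral_liminf) auto
    also have "(\<lambda>k. \<integral>\<^sup>+x. v x * heat_avg (s k) h x \<partial>lborel) = (\<lambda>k. A' (s k))"
    proof
      fix k
      have "heat_pot (s k) \<Lambda> x = heat_avg (s k) h x" for x
        unfolding \<Lambda>_def h_def by (intro heat_pot_density) auto
      then show "(\<integral>\<^sup>+x. v x * heat_avg (s k) h x \<partial>lborel) = A' (s k)"
        unfolding A'_def heat_avg_def[of _ v] by (subst heat_pot_pairing[OF reg(1) sL]) (auto simp: mult.commute)
    qed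
    finally show ?thesis .
  qed
  have "(\<integral>\<^sup>+x. v x * h x \<partial>lborel) = 0"
  proof (rule ccontr)
    assume "\<not> ?thesis"
    then obtain y where y: "0 < y" "y < (\<integral>\<^sup>+x. v x * h x \<partial>lborel)" by (metis dense not_gr_zero)
    then have "eventually (\<lambda>k. y < A' (s k)) sequentially"
      using vh by (auto simp: le_Liminf_iff)
    then have ev: "eventually (\<lambda>k. e * y \<le> A (s k) + ennreal (1 / real (Suc k))) sequentially"
      by eventually_elim (use s(3) in \<open>meson less_imp_le mult_left_mono order_trans zero_le\<close>)
    have "(\<lambda>k. A (s k) + ennreal (1 / real (Suc k))) \<longlonglongrightarrow> 0 + ennreal 0"
      by (intro tendsto_add A0 tendsto_ennrealI inv0)
    then have "e * y \<le> 0 + ennreal 0" using ev by (rule tendsto_lowerbound) simp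
    then show False using y \<epsilon> by (auto simp: e_def)
  qed
  then have "AE x in lborel. v x * h x = 0" by (subst (asm) nn_integral_0_iff_AE) auto
  then show ?thesis
  proof eventually_elim
    fix x assume "v x * h x = 0"
    then have "v x = 0" using heat_pot_pos[OF sM _ M0, of 1 x] by (auto simp: h_def)
    then have "V x \<le> n x" using vm[of x] by (simp add: m_def min_def split: if_splits)
    then show "scaled_pot \<alpha> M x \<le> scaled_pot \<alpha> N x + ennreal (\<epsilon> * (1 + c))"
      using nle[of x] by (simp add: V_def)
  qed
qed

lemma short_pot_tendsto_0:
  fixes M :: "'a::euclidean_space measure"
  assumes "0 < \<alpha>" "\<alpha> < real DIM('a)" and sf: "sigma_finite_measure M" and s: "sets M = sets borel"
    and fin: "scaled_pot \<alpha> M x < \<infinity>"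
  shows "(\<lambda>k. short_pot \<alpha> (1 / real (Suc k)) M x) \<longlonglongrightarrow> 0"
proof -
  note [measurable] = borel_measurable_heat_pot[OF sf s]
  have "(\<lambda>k. \<integral>\<^sup>+s. heat_pot s M x * indicator {..<1 / real (Suc k)} s \<partial>riesz_time \<alpha>) \<longlonglongrightarrow> (\<integral>\<^sup>+s. 0 \<partial>riesz_time \<alpha>)"
  proof (rule nn_integral_dominated_convergence[where w="\<lambda>s. heat_pot s M x"])
    show "(\<integral>\<^sup>+s. heat_pot s M x \<partial>riesz_time \<alpha>) < \<infinity>"
      using fin riesz_pot_subordination[OF assms(1-3) s] by simp
    show "AE s in riesz_time \<alpha>. (\<lambda>k. heat_pot s M x * indicator {..<1 / real (Suc k)} s) \<longlonglongrightarrow> 0"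
      using AE_riesz_time[of \<alpha>]
    proof eventually_elim
      fix s :: real assume s: "0 < s"
      have "eventually (\<lambda>k. 1 / real (Suc k) < s) sequentially"
        using order_tendstoD(2)[OF LIMSEQ_inverse_real_of_nat s] by (simp add: inverse_eq_divide)
      then have "eventually (\<lambda>k. heat_pot s M x * indicator {..<1 / real (Suc k)} s = 0) sequentially"
        by eventually_elim auto
      then show "(\<lambda>k. heat_pot s M x * indicator {..<1 / real (Suc k)} s) \<longlonglongrightarrow> 0"
        by (rule tendsto_eventually)
    qed
  qed (auto simp: indicator_def)
  then show ?thesis by (simp add: short_pot_def)
qed

lemma riesz_pot_null_measure:
  assumes "sets M = sets borel" "emeasure M UNIV = 0"
  shows "riesz_pot \<alpha> M x = 0"
proof -
  have "UNIV \<in> null_sets M" using assms space_eq_UNIV[OF assms(1)] by (auto simp: null_sets_def)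
  then have "AE y in M. riesz_kernel \<alpha> x y = 0" by (rule AE_I') auto
  then show ?thesis unfolding riesz_pot_def by (subst nn_integral_cong_AE[where v="\<lambda>_. 0"]) auto
qed

text \<open>From almost everywhere to everywhere: after \<epsilon> tends to 0, the almost everywhere
  inequality enters the convolution term of \<open>excessive_step\<close>, and the short-time part
  of the potential of M then tends to 0.\<close>

lemma domination_bounded:
  fixes M N :: "'a::euclidean_space measure"
  assumes \<alpha>: "0 < \<alpha>" "\<alpha> \<le> 2" "\<alpha> < real DIM('a)"
    and fM: "finite_measure M" and sM: "sets M = sets borel"
    and N: "sigma_finite_measure N" "sets N = sets borel"
    and supp: "AE y in M. norm y \<le> \<rho>"
    and b: "\<And>x. riesz_pot \<alpha> M x \<le> ennreal b"
    and le: "AE x in M. riesz_pot \<alpha> M x \<le> riesz_pot \<alpha> N x"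
  shows "riesz_pot \<alpha> M x \<le> riesz_pot \<alpha> N x"
proof (cases "emeasure M UNIV = 0")
  case True
  then show ?thesis using sM by (simp add: riesz_pot_null_measure)
next
  case False
  interpret M: finite_measure M by fact
  have sf: "sigma_finite_measure M" by unfold_locales
  note [measurable] = borel_measurable_riesz_pot[OF sf sM] borel_measurable_riesz_pot[OF N]
  define C where "C = enn2real (riesz_const \<alpha> TYPE('a))"
  have C: "riesz_const \<alpha> TYPE('a) = ennreal C" "C > 0"
    using riesz_const_finite[OF \<alpha>(1,3)] riesz_const_pos[of \<alpha>, where 'a='a]
    by (auto simp: C_def enn2real_positive_iff less_top)
  define c where "c = C * max 0 b"
  have c: "0 \<le> c" using C by (simp add: c_def)
  have Vc: "scaled_pot \<alpha> M x \<le> ennreal c" for x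
  proof -
    have "scaled_pot \<alpha> M x \<le> ennreal C * ennreal (max 0 b)"
      unfolding C(1) by (intro mult_left_mono order_trans[OF b] ennreal_leI) auto
    then show ?thesis using C by (simp add: c_def ennreal_mult)
  qed
  have "AE x in lborel. \<forall>k::nat. scaled_pot \<alpha> M x \<le> scaled_pot \<alpha> N x + ennreal (1 / real (Suc k) * (1 + c))"
    unfolding AE_all_countable
    by (intro allI domination_ae[OF \<alpha> fM sM False N supp c Vc le]) auto
  then have ae: "AE x in lborel. scaled_pot \<alpha> M x \<le> scaled_pot \<alpha> N x"
  proof eventually_elim
    fix x assume k: "\<forall>k::nat. scaled_pot \<alpha> M x \<le> scaled_pot \<alpha> N x + ennreal (1 / real (Suc k) * (1 + c))"
    have "(\<lambda>k. 1 / real (Suc k) * (1 + c)) \<longlonglongrightarrow> 0 * (1 + c)"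
      using LIMSEQ_inverse_real_of_nat by (intro tendsto_mult_right) (simp add: inverse_eq_divide)
    then have "(\<lambda>k. scaled_pot \<alpha> N x + ennreal (1 / real (Suc k) * (1 + c))) \<longlonglongrightarrow> scaled_pot \<alpha> N x + ennreal 0"
      by (intro tendsto_add tendsto_const tendsto_ennrealI) simp
    then show "scaled_pot \<alpha> M x \<le> scaled_pot \<alpha> N x"
      using k by (intro tendsto_lowerbound[of _ "scaled_pot \<alpha> N x" sequentially]) auto
  qed
  have "scaled_pot \<alpha> M x \<le> short_pot \<alpha> (1 / real (Suc k)) M x + scaled_pot \<alpha> N x" for k
  proof -
    have t: "0 < 1 / real (Suc k)" by simp
    obtain p :: "'a \<Rightarrow> ennreal" where [measurable]: "p \<in> borel_measurable borel"
      and step: "\<And>M x. sigma_finite_measure M \<Longrightarrow> sets M = sets borel \<Longrightarrow>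
       scaled_pot \<alpha> M x = short_pot \<alpha> (1 / real (Suc k)) M x + (\<integral>\<^sup>+y. p (x - y) * scaled_pot \<alpha> M y \<partial>lborel)"
      using excessive_step[OF \<alpha> t] by metis
    have "(\<integral>\<^sup>+y. p (x - y) * scaled_pot \<alpha> M y \<partial>lborel) \<le> (\<integral>\<^sup>+y. p (x - y) * scaled_pot \<alpha> N y \<partial>lborel)"
      by (intro nn_integral_mono_AE, use ae in eventually_elim) (auto intro: mult_left_mono)
    also have "\<dots> \<le> scaled_pot \<alpha> N x" unfolding step[OF N, of x] by simp
    finally show ?thesis unfolding step[OF sf sM, of x] by (intro add_left_mono)
  qed
  moreover have "(\<lambda>k. short_pot \<alpha> (1 / real (Suc k)) M x + scaled_pot \<alpha> N x) \<longlonglongrightarrow> 0 + scaled_pot \<alpha> N x"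
    using Vc[of x] by (intro tendsto_add tendsto_const short_pot_tendsto_0 \<alpha> sf sM) (auto simp: top_unique less_top[symmetric])
  ultimately have "scaled_pot \<alpha> M x \<le> 0 + scaled_pot \<alpha> N x"
    by (intro tendsto_lowerbound[of _ "0 + scaled_pot \<alpha> N x" sequentially]) auto
  then show ?thesis using C by (simp add: ennreal_mult_le_mult_iff)
qed

section \<open>Removal of the boundedness assumptions\<close>

lemma sigma_finite_of_compact:
  fixes M :: "'a::euclidean_space measure"
  assumes "sets M = sets borel" "\<And>K. compact K \<Longrightarrow> emeasure M K < \<infinity>"
  shows "sigma_finite_measure M"
proof
  have "(\<Union>n::nat. cball (0::'a) (real n)) = UNIV"
    by (auto simp: real_arch_simple)
  then show "\<exists>A. countable A \<and> A \<subseteq> sets M \<and> \<Union>A = space M \<and> (\<forall>a\<in>A. emeasure M a \<noteq> \<infinity>)"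
    using assms space_eq_UNIV[OF assms(1)]
    by (intro exI[of _ "range (\<lambda>n::nat. cball 0 (real n))"]) (auto simp: less_top)
qed

lemma riesz_pot_restrict_le:
  fixes M :: "'a::euclidean_space measure"
  assumes "sets M = sets borel" "S \<in> sets borel"
  shows "riesz_pot \<alpha> (density M (indicator S)) x \<le> riesz_pot \<alpha> M x"
  using assms by (intro riesz_pot_density_le) (auto simp: indicator_def)

text \<open>Compact sets exhausting the set of finite potential. By the weak maximum principle the
  restriction of M to each of them has a potential bounded on the whole space.\<close>

definition pot_piece :: "real \<Rightarrow> 'a::euclidean_space measure \<Rightarrow> nat \<Rightarrow> 'a set" where
  "pot_piece \<alpha> M k = {x. riesz_pot \<alpha> M x \<le> of_nat k} \<inter> cball 0 (real k)"

lemma pot_piece: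
  fixes M :: "'a::euclidean_space measure"
  assumes "\<alpha> < real DIM('a)" "sets M = sets borel"
  shows "compact (pot_piece \<alpha> M k)" "incseq (pot_piece \<alpha> M)"
    "(\<Union>k. pot_piece \<alpha> M k) = {x. riesz_pot \<alpha> M x < \<infinity>}"
proof -
  show "compact (pot_piece \<alpha> M k)"
    unfolding pot_piece_def using closed_riesz_pot_le[OF assms] by (intro closed_Int_compact) auto
  show "incseq (pot_piece \<alpha> M)"
  proof (intro monoI subsetI)
    fix m n :: nat and x assume "m \<le> n" "x \<in> pot_piece \<alpha> M m"
    moreover have "(of_nat m :: ennreal) \<le> of_nat n" using \<open>m \<le> n\<close> by simp
    ultimately show "x \<in> pot_piece \<alpha> M n" by (auto simp: pot_piece_def intro: order_trans)
  qed
  show "(\<Union>k. pot_piece \<alpha> M k) = {x. riesz_pot \<alpha> M x < \<infinity>}"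
  proof (intro equalityI subsetI)
    fix x assume "x \<in> (\<Union>k. pot_piece \<alpha> M k)"
    then show "x \<in> {x. riesz_pot \<alpha> M x < \<infinity>}"
      by (auto simp: pot_piece_def intro: le_less_trans[OF _ of_nat_less_top])
  next
    fix x assume "x \<in> {x. riesz_pot \<alpha> M x < \<infinity>}"
    then obtain r where r: "riesz_pot \<alpha> M x = ennreal r" "0 \<le> r" by (cases "riesz_pot \<alpha> M x") auto
    obtain k where k: "max r (norm x) \<le> real k" using real_arch_simple by blast
    then have "ennreal r \<le> ennreal (real k)" by (intro ennreal_leI) auto
    then show "x \<in> (\<Union>k. pot_piece \<alpha> M k)"
      using k r by (auto simp: pot_piece_def ennreal_of_nat_eq_real_of_nat)
  qed
qed

lemma pot_piece_bounded:
  fixes M :: "'a::euclidean_space measure"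
  assumes "\<alpha> < real DIM('a)" and s [measurable_cong]: "sets M = sets borel"
  shows "riesz_pot \<alpha> (density M (indicator (pot_piece \<alpha> M k))) x \<le> ennreal (2 powr (real DIM('a) - \<alpha>) * real k)"
proof -
  have c: "closed (pot_piece \<alpha> M k)" using pot_piece(1)[OF assms] by (rule compact_imp_closed)
  have [measurable]: "pot_piece \<alpha> M k \<in> sets borel" using c by (rule borel_closed)
  let ?M = "density M (indicator (pot_piece \<alpha> M k))"
  have "riesz_pot \<alpha> ?M x \<le> ennreal (2 powr (real DIM('a) - \<alpha>)) * of_nat k"
  proof (rule weak_max_principle[OF assms(1) _ c])
    show "AE y in ?M. y \<in> pot_piece \<alpha> M k"
      by (subst AE_density) (auto simp: indicator_def split: if_splits)
    fix y assume "y \<in> pot_piece \<alpha> M k"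
    then have "riesz_pot \<alpha> M y \<le> of_nat k" by (simp add: pot_piece_def)
    moreover have Sm: "pot_piece \<alpha> M k \<in> sets borel" by measurable
    ultimately show "riesz_pot \<alpha> ?M y \<le> of_nat k"
      using riesz_pot_restrict_le[OF s Sm, of \<alpha> y] by (auto intro: order_trans)
  qed (simp add: s)
  then show ?thesis by (simp add: ennreal_mult ennreal_of_nat_eq_real_of_nat)
qed

lemma AE_density_indicator:
  assumes "S \<in> sets M"
  shows "(AE x in density M (indicator S). P x) \<longleftrightarrow> (AE x in M. x \<in> S \<longrightarrow> P x)"
  using assms by (subst AE_density) (auto simp: indicator_def)

lemma finite_density_compact:
  fixes M :: "'a::euclidean_space measure"
  assumes "sets M = sets borel" "emeasure M K < \<infinity>" "K \<in> sets borel"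
  shows "finite_measure (density M (indicator K))"
  using assms space_eq_UNIV[OF assms(1)]
  by (intro finite_measureI) (auto simp: emeasure_density)

text \<open>The bounded case applies to the restrictions of M to \<open>pot_piece\<close>; as the
  potential is finite M-almost everywhere, these increase to M, and monotone convergence
  concludes.\<close>

theorem domination_principle:
  fixes M N :: "'a::euclidean_space measure"
  assumes \<alpha>: "0 < \<alpha>" "\<alpha> \<le> 2" "\<alpha> < real DIM('a)"
    and sM [measurable_cong]: "sets M = sets borel" and cM: "\<And>K. compact K \<Longrightarrow> emeasure M K < \<infinity>"
    and N: "sigma_finite_measure N" "sets N = sets borel"
    and fin: "AE x in M. riesz_pot \<alpha> M x < \<infinity>"
    and le: "AE x in M. riesz_pot \<alpha> M x \<le> riesz_pot \<alpha> N x"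
  shows "riesz_pot \<alpha> M x \<le> riesz_pot \<alpha> N x"
proof -
  let ?S = "pot_piece \<alpha> M"
  let ?M = "\<lambda>k. density M (indicator (?S k))"
  note S = pot_piece[OF \<alpha>(3) sM]
  have [measurable]: "?S k \<in> sets borel" for k using S(1) by (intro borel_closed compact_imp_closed)
  then have Sb: "?S k \<in> sets borel" and Sm: "?S k \<in> sets M" for k by (auto simp: sM)
  have sf: "sigma_finite_measure M" by (rule sigma_finite_of_compact[OF sM cM])
  note [measurable] = borel_measurable_riesz_pot[OF sf sM] borel_measurable_riesz_pot[OF N]
  have k: "riesz_pot \<alpha> (?M k) x \<le> riesz_pot \<alpha> N x" for k
  proof (rule domination_bounded[OF \<alpha> finite_density_compact[OF sM cM[OF S(1)]] _ N, where \<rho>="real k"])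
    show "AE y in ?M k. norm y \<le> real k"
      by (subst AE_density_indicator) (auto simp: sM pot_piece_def)
    show "riesz_pot \<alpha> (?M k) y \<le> ennreal (2 powr (real DIM('a) - \<alpha>) * real k)" for y
      by (rule pot_piece_bounded[OF \<alpha>(3) sM])
    show "AE y in ?M k. riesz_pot \<alpha> (?M k) y \<le> riesz_pot \<alpha> N y"
      unfolding AE_density_indicator[OF Sm] using le
    proof (eventually_elim, intro impI)
      fix y assume "riesz_pot \<alpha> M y \<le> riesz_pot \<alpha> N y"
      then show "riesz_pot \<alpha> (?M k) y \<le> riesz_pot \<alpha> N y"
        using riesz_pot_restrict_le[OF sM Sb[of k], of \<alpha> y] by (auto intro: order_trans)
    qed
  qed (simp_all add: sM)
  have "riesz_pot \<alpha> M x = (\<integral>\<^sup>+y. (SUP k. indicator (?S k) y * riesz_kernel \<alpha> x y) \<partial>M)"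
    unfolding riesz_pot_def
  proof (intro nn_integral_cong_AE, use fin in eventually_elim)
    fix y assume "riesz_pot \<alpha> M y < \<infinity>"
    then obtain k where k: "y \<in> ?S k" using S(3) by blast
    show "riesz_kernel \<alpha> x y = (SUP k. indicator (?S k) y * riesz_kernel \<alpha> x y)"
    proof (rule antisym)
      show "riesz_kernel \<alpha> x y \<le> (SUP k. indicator (?S k) y * riesz_kernel \<alpha> x y)"
        using k by (intro SUP_upper2[of k]) auto
      show "(SUP k. indicator (?S k) y * riesz_kernel \<alpha> x y) \<le> riesz_kernel \<alpha> x y"
        by (intro SUP_least) (auto simp: indicator_def)
    qed
  qed
  also have "\<dots> = (SUP k. \<integral>\<^sup>+y. indicator (?S k) y * riesz_kernel \<alpha> x y \<partial>M)"
  proof (intro nn_integral_monotone_convergence_SUP)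
    show "incseq (\<lambda>k y. indicator (?S k) y * riesz_kernel \<alpha> x y)"
    proof (intro incseq_SucI le_funI mult_right_mono)
      fix k y have "?S k \<subseteq> ?S (Suc k)" using S(2) by (rule incseq_SucD)
      then show "indicator (?S k) y \<le> (indicator (?S (Suc k)) y :: ennreal)" by (auto simp: indicator_def)
    qed simp
  qed measurable
  also have "\<dots> = (SUP k. riesz_pot \<alpha> (?M k) x)" by (simp add: riesz_pot_density[OF sM])
  also have "\<dots> \<le> riesz_pot \<alpha> N x" using k by (intro SUP_least)
  finally show ?thesis .
qed

section \<open>Polar sets\<close>

text \<open>Exceptional sets enter as Borel sets that are null for every measure of finite energy, a
  class visibly closed under finite unions. Its relation to capacity zero is given by
  \<open>capacity_zero_imp_polar\<close> and \<open>polar_compact_capacity\<close>.\<close>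

definition polar :: "real \<Rightarrow> 'a::euclidean_space set \<Rightarrow> bool" where
  "polar \<alpha> N \<longleftrightarrow> N \<in> sets borel \<and> (\<forall>M. pos_radon \<alpha> M \<and> energy \<alpha> M < \<infinity> \<longrightarrow> emeasure M N = 0)"

lemma polar_Un: "polar \<alpha> A \<Longrightarrow> polar \<alpha> B \<Longrightarrow> polar \<alpha> (A \<union> B)"
  unfolding polar_def
proof (intro conjI allI impI)
  fix M :: "'a measure"
  assume a: "A \<in> sets borel \<and> (\<forall>M. pos_radon \<alpha> M \<and> energy \<alpha> M < \<infinity> \<longrightarrow> emeasure M A = 0)"
    "B \<in> sets borel \<and> (\<forall>M. pos_radon \<alpha> M \<and> energy \<alpha> M < \<infinity> \<longrightarrow> emeasure M B = 0)"
    "pos_radon \<alpha> M \<and> energy \<alpha> M < \<infinity>"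
  then have "A \<in> null_sets M" "B \<in> null_sets M" by (auto simp: null_sets_def pos_radonD)
  then show "emeasure M (A \<union> B) = 0" by (meson null_sets.Un null_setsD1)
qed auto

lemma pos_radon_density:
  fixes M :: "'a::euclidean_space measure"
  assumes M: "pos_radon \<alpha> M" and [measurable]: "f \<in> borel_measurable borel" and f: "\<And>x. f x \<le> c" and c: "c < \<infinity>"
  shows "pos_radon \<alpha> (density M f)" "energy \<alpha> (density M f) \<le> c * (c * energy \<alpha> M)"
proof -
  note M' = pos_radonD[OF M]
  note [measurable_cong] = M'(1)
  note [measurable] = borel_measurable_riesz_pot[OF M'(3,1)]
  have pot: "riesz_pot \<alpha> (density M f) x \<le> c * riesz_pot \<alpha> M x" for x
  proof -
    have "riesz_pot \<alpha> (density M f) x \<le> (\<integral>\<^sup>+y. c * riesz_kernel \<alpha> x y \<partial>M)"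
      unfolding riesz_pot_density[OF M'(1) assms(2)] by (intro nn_integral_mono mult_right_mono f) auto
    then show ?thesis unfolding riesz_pot_def by (simp add: nn_integral_cmult)
  qed
  obtain x0 where x0: "riesz_pot \<alpha> M x0 < \<infinity>" using M by (auto simp: pos_radon_def)
  have "riesz_pot \<alpha> (density M f) x0 < \<infinity>"
    using pot[of x0] x0 c by (auto intro: le_less_trans simp: ennreal_mult_less_top)
  moreover have "emeasure (density M f) K < \<infinity>" if "compact K" for K
  proof -
    have [measurable]: "K \<in> sets borel" using that by (simp add: borel_closed compact_imp_closed)
    have "emeasure (density M f) K = (\<integral>\<^sup>+x. f x * indicator K x \<partial>M)" by (simp add: emeasure_density M')
    also have "\<dots> \<le> (\<integral>\<^sup>+x. c * indicator K x \<partial>M)" using f by (intro nn_integral_mono mult_right_mono) auto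
    also have "\<dots> = c * emeasure M K" by (simp add: nn_integral_cmult M')
    also have "\<dots> < \<infinity>" using c M'(4)[OF that] by (simp add: ennreal_mult_less_top)
    finally show ?thesis .
  qed
  ultimately show "pos_radon \<alpha> (density M f)" using M' by (auto simp: pos_radon_def)
  have "energy \<alpha> (density M f) \<le> (\<integral>\<^sup>+x. c * riesz_pot \<alpha> M x \<partial>density M f)"
    unfolding mutual_energy_pot by (intro nn_integral_mono pot)
  also have "\<dots> = (\<integral>\<^sup>+x. f x * (c * riesz_pot \<alpha> M x) \<partial>M)" by (intro nn_integral_density) auto
  also have "\<dots> \<le> (\<integral>\<^sup>+x. c * (c * riesz_pot \<alpha> M x) \<partial>M)" by (intro nn_integral_mono mult_right_mono f) auto
  also have "\<dots> = c * (c * energy \<alpha> M)" unfolding mutual_energy_pot by (simp add: nn_integral_cmult)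
  finally show "energy \<alpha> (density M f) \<le> c * (c * energy \<alpha> M)" .
qed

text \<open>A measure of finite energy charging N could be restricted to a bounded part of N and
  normalized; this would be a competitor of finite energy in the definition of the capacity of
  Q.\<close>

lemma capacity_zero_imp_polar:
  fixes Q N :: "'a::euclidean_space set"
  assumes cap: "capacity \<alpha> Q = 0" and [measurable]: "N \<in> sets borel" and "N \<subseteq> Q"
  shows "polar \<alpha> N"
  unfolding polar_def
proof (intro conjI allI impI)
  fix M :: "'a measure" assume M: "pos_radon \<alpha> M \<and> energy \<alpha> M < \<infinity>"
  note M' = pos_radonD[OF conjunct1[OF M]]
  note [measurable_cong] = M'(1)
  show "emeasure M N = 0"
  proof (rule ccontr)
    assume N0: "emeasure M N \<noteq> 0"
    have "\<exists>k::nat. emeasure M (N \<inter> cball 0 (real k)) \<noteq> 0"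
    proof (rule ccontr)
      assume "\<not> ?thesis"
      then have "(\<Union>k::nat. N \<inter> cball 0 (real k)) \<in> null_sets M"
        by (intro null_sets_UN) (auto simp: null_sets_def M')
      moreover have "(\<Union>k::nat. N \<inter> cball 0 (real k)) = N" by (auto simp: real_arch_simple)
      ultimately show False using N0 by (auto simp: null_sets_def)
    qed
    then obtain k :: nat where k: "emeasure M (N \<inter> cball 0 (real k)) \<noteq> 0" by blast
    define B where "B = N \<inter> cball 0 (real k)"
    have [measurable]: "B \<in> sets borel" by (simp add: B_def)
    have "emeasure M B \<le> emeasure M (cball 0 (real k))" by (intro emeasure_mono) (auto simp: B_def M')
    then have Bfin: "emeasure M B < \<infinity>" using M'(4)[of "cball 0 (real k)"] by (auto intro: le_less_trans)
    define c where "c = inverse (emeasure M B)"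
    have c: "c < \<infinity>" "c * emeasure M B = 1"
    proof -
      obtain r where r: "emeasure M B = ennreal r" "0 \<le> r"
        using Bfin by (cases "emeasure M B") auto
      have "r \<noteq> 0" using k r by (auto simp: B_def)
      then have "0 < r" using r by simp
      with r(1) show "c < \<infinity>" "c * emeasure M B = 1" by (simp_all add: c_def inverse_ennreal ennreal_mult[symmetric])
    qed
    define M1 where "M1 = density M (\<lambda>x. c * indicator B x)"
    have cB: "c * indicator B x \<le> c" for x by (simp add: indicator_def)
    have cm: "(\<lambda>x. c * indicator B x) \<in> borel_measurable borel" by measurable
    note M1 = pos_radon_density[where f="\<lambda>x. c * indicator B x", OF conjunct1[OF M] cm cB c(1), folded M1_def]
    have "energy \<alpha> M1 < \<infinity>" using M1(2) M c(1) by (auto intro: le_less_trans simp: ennreal_mult_less_top)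
    moreover have "AE x in M1. x \<in> B"
      unfolding M1_def by (subst AE_density) (auto simp: indicator_def split: if_splits)
    then have car: "carried_by M1 Q" unfolding carried_by_def
      by (rule eventually_mono) (use \<open>N \<subseteq> Q\<close> in \<open>auto simp: B_def\<close>)
    ultimately have in1: "M1 \<in> finite_energy_pos \<alpha> Q" using M1(1) by (simp add: finite_energy_pos_def)
    have s1: "sets M1 = sets borel" "space M1 = UNIV" by (auto simp: M1_def M')
    have B1: "emeasure M1 B = 1"
    proof -
      have "emeasure M1 B = (\<integral>\<^sup>+x. c * indicator B x * indicator B x \<partial>M)"
        unfolding M1_def by (intro emeasure_density) (auto simp: M')
      also have "\<dots> = (\<integral>\<^sup>+x. c * indicator B x \<partial>M)" by (intro nn_integral_cong) (auto simp: indicator_def)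
      also have "\<dots> = 1" using c by (subst nn_integral_cmult_indicator) (auto simp: M')
      finally show ?thesis .
    qed
    have nul: "- B \<in> null_sets M1"
      using \<open>AE x in M1. x \<in> B\<close> by (subst AE_iff_null_sets) (auto simp: s1)
    have "- B \<in> null_sets (completion M1)" using nul by (rule null_sets_completionI)
    \<comment> \<open>Q is an arbitrary set; it becomes measurable for the completion because it
      differs from the Borel set B by a subset of a null set.\<close>
    then have "Q - B \<in> null_sets (completion M1)" by (rule null_sets_completion_subset[rotated]) auto
    then have "emeasure (completion M1) (B \<union> (Q - B)) = emeasure (completion M1) B"
      by (intro emeasure_Un_null_set) (auto simp: s1)
    moreover have "B \<union> (Q - B) = Q" using \<open>N \<subseteq> Q\<close> by (auto simp: B_def)
    ultimately have "emeasure (completion M1) Q = 1" using B1 by (simp add: s1)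
    then have "(INF M\<in>{M \<in> finite_energy_pos \<alpha> Q. emeasure (completion M) Q = 1}. energy \<alpha> M) \<le> energy \<alpha> M1"
      using in1 by (intro INF_lower) auto
    then have "(INF M\<in>{M \<in> finite_energy_pos \<alpha> Q. emeasure (completion M) Q = 1}. energy \<alpha> M) < \<top>"
      by (rule le_less_trans) (use \<open>energy \<alpha> M1 < \<infinity>\<close> in simp)
    then show False using cap unfolding capacity_def ennreal_inverse_eq_0_iff by (metis less_irrefl)
  qed
qed simp

text \<open>No measure competes, so the infimum is \<top>, and its inverse is 0.\<close>

lemma polar_compact_capacity:
  assumes "polar \<alpha> N" "compact K" "K \<subseteq> N"
  shows "capacity \<alpha> K = 0"
proof -
  have e: "{M \<in> finite_energy_pos \<alpha> K. emeasure (completion M) K = 1} = {}"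
  proof (intro equals0I)
    fix M assume M: "M \<in> {M \<in> finite_energy_pos \<alpha> K. emeasure (completion M) K = 1}"
    then have pr: "pos_radon \<alpha> M" "energy \<alpha> M < \<infinity>" by (auto simp: finite_energy_pos_def)
    have "K \<in> sets M" using pos_radonD(1)[OF pr(1)] assms(2) by (simp add: borel_closed compact_imp_closed)
    then have "emeasure M K = 1" using M by simp
    moreover have "emeasure M K \<le> emeasure M N"
      using assms pos_radonD(1)[OF pr(1)] by (intro emeasure_mono) (auto simp: polar_def)
    ultimately show False using assms(1) pr by (auto simp: polar_def)
  qed
  show ?thesis unfolding capacity_def e by simp
qed

lemma sets_borel_cball [measurable, simp]: "cball x r \<in> sets borel"
  by (simp add: borel_closed)

text \<open>\<open>cap_abs_continuous\<close> speaks of the difference a - b and of compact sets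
  only. On a Hahn set P the measure b vanishes, and after restriction to a ball inner regularity
  finds a compact part of N and P that a charges.\<close>

lemma polar_null_Hahn_part:
  fixes a b :: "'a::euclidean_space measure"
  assumes a: "pos_radon \<alpha> a" and b: "pos_radon \<alpha> b" and [measurable]: "P \<in> sets borel"
    and P: "emeasure a (- P) = 0" "emeasure b P = 0"
    and cac: "\<And>K. compact K \<Longrightarrow> capacity \<alpha> K = 0 \<Longrightarrow> measure a K = measure b K"
    and N: "polar \<alpha> N"
  shows "emeasure a N = 0"
proof (rule ccontr)
  note a' = pos_radonD[OF a] and b' = pos_radonD[OF b]
  note [measurable_cong] = a'(1)
  have [measurable]: "N \<in> sets borel" using N by (simp add: polar_def)
  assume N0: "emeasure a N \<noteq> 0"
  have "\<exists>k::nat. emeasure a (N \<inter> P \<inter> cball 0 (real k)) \<noteq> 0"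
  proof (rule ccontr)
    assume "\<not> ?thesis"
    then have "(\<Union>k::nat. N \<inter> P \<inter> cball 0 (real k)) \<in> null_sets a"
      by (intro null_sets_UN) (auto simp: null_sets_def a')
    moreover have "- P \<in> null_sets a" using P by (auto simp: null_sets_def a')
    ultimately have "(\<Union>k::nat. N \<inter> P \<inter> cball 0 (real k)) \<union> - P \<in> null_sets a" by (rule null_sets.Un)
    moreover have "N \<subseteq> (\<Union>k::nat. N \<inter> P \<inter> cball 0 (real k)) \<union> - P" by (auto simp: real_arch_simple)
    ultimately have "N \<in> null_sets a" using null_sets_subset a'(1) \<open>N \<in> sets borel\<close> by metis
    then show False using N0 by (auto simp: null_sets_def)
  qed
  then obtain k :: nat where k: "emeasure a (N \<inter> P \<inter> cball 0 (real k)) \<noteq> 0" by blast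
  define T where "T = N \<inter> P \<inter> cball 0 (real k)"
  have Tm [measurable]: "T \<in> sets borel" by (simp add: T_def)
  define a1 where "a1 = density a (indicator (cball 0 (real k)))"
  have s1: "sets a1 = sets borel" by (simp add: a1_def a')
  interpret a1: finite_measure a1
    unfolding a1_def using a'(4)[of "cball 0 (real k)"] by (intro finite_density_compact a') auto
  have em: "emeasure a1 X = emeasure a X" if "X \<subseteq> cball 0 (real k)" "X \<in> sets borel" for X
  proof -
    have "emeasure a1 X = (\<integral>\<^sup>+x. indicator (cball 0 (real k)) x * indicator X x \<partial>a)"
      unfolding a1_def using that by (intro emeasure_density) (auto simp: a' intro!: borel_measurable_indicator)
    also have "\<dots> = (\<integral>\<^sup>+x. indicator X x \<partial>a)" using that by (intro nn_integral_cong) (auto simp: indicator_def)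
    finally show ?thesis using that by (simp add: a')
  qed
  have "emeasure a1 T = (SUP K\<in>{K. K \<subseteq> T \<and> compact K}. emeasure a1 K)"
    using s1 a1.emeasure_finite Tm by (intro inner_regular) auto
  moreover have "emeasure a1 T \<noteq> 0" using k em[of T] by (auto simp: T_def)
  ultimately obtain K where K: "K \<subseteq> T" "compact K" "emeasure a1 K \<noteq> 0"
    by (metis (mono_tags, lifting) SUP_bot_conv(1) bot_ennreal mem_Collect_eq)
  have [measurable]: "K \<in> sets borel" using K by (simp add: borel_closed compact_imp_closed)
  have "emeasure a K \<noteq> 0" using K em[of K] by (auto simp: T_def)
  moreover have "emeasure a K < \<infinity>" using K a'(4) by blast
  moreover have "capacity \<alpha> K = 0" using K by (intro polar_compact_capacity[OF N]) (auto simp: T_def)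
  then have "measure a K = measure b K" using cac K by blast
  moreover have "emeasure b K \<le> emeasure b P" using K b' by (intro emeasure_mono) (auto simp: T_def)
  then have "emeasure b K = 0" using P by simp
  ultimately show False by (simp add: measure_def enn2real_eq_0_iff)
qed

lemma polar_null_cac:
  assumes nu: "signed_radon \<alpha> \<nu>" and cac: "cap_abs_continuous \<alpha> \<nu>" and N: "polar \<alpha> N"
  shows "emeasure (pos_part \<nu>) N = 0" "emeasure (neg_part \<nu>) N = 0"
proof -
  obtain P where P: "P \<in> sets borel" "emeasure (pos_part \<nu>) (- P) = 0" "emeasure (neg_part \<nu>) P = 0"
    and pr: "pos_radon \<alpha> (pos_part \<nu>)" "pos_radon \<alpha> (neg_part \<nu>)"
    using nu by (auto simp: signed_radon_def)
  have c: "measure (pos_part \<nu>) K = measure (neg_part \<nu>) K" if "compact K" "capacity \<alpha> K = 0" for K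
    using cac that by (auto simp: cap_abs_continuous_def smeasure_val_def)
  show "emeasure (pos_part \<nu>) N = 0" by (rule polar_null_Hahn_part[OF pr P c N])
  have P': "- P \<in> sets borel" "emeasure (neg_part \<nu>) (- (- P)) = 0" using P by (auto intro: borel_comp)
  show "emeasure (neg_part \<nu>) N = 0" by (rule polar_null_Hahn_part[OF pr(2,1) P' P(2) c[symmetric] N])
qed

text \<open>Let M1 be the part of M on a piece where its potential is bounded. By symmetry the
  integral of the potential of b against M1 is that of the potential of M1 against b; near the
  origin the latter potential is bounded, and far away it is comparable to the kernel with pole x0,
  where b has finite potential.\<close>

lemma polar_infinite_pot:
  fixes b :: "'a::euclidean_space measure"
  assumes \<alpha>: "\<alpha> < real DIM('a)" and b: "pos_radon \<alpha> b"
  shows "polar \<alpha> {x. riesz_pot \<alpha> b x = \<infinity>}"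
  unfolding polar_def
proof (intro conjI allI impI)
  note b' = pos_radonD[OF b]
  note [measurable_cong] = b'(1)
  note bm [measurable] = borel_measurable_riesz_pot[OF b'(3,1)]
  show m: "{x. riesz_pot \<alpha> b x = \<infinity>} \<in> sets borel" using bm by measurable
  fix M :: "'a measure" assume M: "pos_radon \<alpha> M \<and> energy \<alpha> M < \<infinity>"
  note M' = pos_radonD[OF conjunct1[OF M]]
  note [measurable_cong] = M'(1)
  note Mm [measurable] = borel_measurable_riesz_pot[OF M'(3,1)]
  obtain x0 where x0: "riesz_pot \<alpha> b x0 < \<infinity>" using b by (auto simp: pos_radon_def)
  let ?S = "pot_piece \<alpha> M"
  note S = pot_piece[OF \<alpha> M'(1)]
  have Sb [measurable]: "?S k \<in> sets borel" for k using S(1) by (intro borel_closed compact_imp_closed)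
  have piece: "AE x in M. x \<in> ?S k \<longrightarrow> riesz_pot \<alpha> b x \<noteq> \<infinity>" for k
  proof -
    define M1 where "M1 = density M (indicator (?S k))"
    interpret M1: finite_measure M1
      unfolding M1_def by (rule finite_density_compact[OF M'(1) M'(4)[OF S(1)] Sb])
    have s1 [measurable_cong]: "sets M1 = sets borel" by (simp add: M1_def M')
    have sf1: "sigma_finite_measure M1" by unfold_locales
    note [measurable] = borel_measurable_riesz_pot[OF sf1 s1]
    define c where "c = 2 powr (real DIM('a) - \<alpha>) * real k"
    \<comment> \<open>If |y| > R, then x0 and all z in the piece have norm below |y| / 2, which
      gives |x0 - y| \<le> 4 |z - y|.\<close>
    define R where "R = 2 * max (real k) (norm x0)"
    let ?d = "ennreal (4 powr (real DIM('a) - \<alpha>)) * emeasure M1 UNIV"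
    have far: "riesz_pot \<alpha> M1 y \<le> ?d * riesz_kernel \<alpha> x0 y" if y: "R < norm y" for y
    proof -
      have "AE z in M1. riesz_kernel \<alpha> y z \<le> ennreal (4 powr (real DIM('a) - \<alpha>)) * riesz_kernel \<alpha> x0 y"
        unfolding M1_def
      proof (subst AE_density_indicator, simp add: M', intro AE_I2 impI)
        fix z assume "z \<in> ?S k"
        then have "norm z \<le> real k" by (simp add: pot_piece_def)
        then have "norm (x0 - y) \<le> 4 * norm (z - y)"
          using y norm_triangle_ineq4[of x0 y] norm_triangle_ineq2[of y z] by (simp add: R_def norm_minus_commute)
        then show "riesz_kernel \<alpha> y z \<le> ennreal (4 powr (real DIM('a) - \<alpha>)) * riesz_kernel \<alpha> x0 y"
          unfolding riesz_kernel_sym[of \<alpha> y z] by (intro riesz_kernel_le_scale \<alpha>) auto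
      qed
      then have "riesz_pot \<alpha> M1 y \<le> (\<integral>\<^sup>+z. ennreal (4 powr (real DIM('a) - \<alpha>)) * riesz_kernel \<alpha> x0 y \<partial>M1)"
        unfolding riesz_pot_def by (rule nn_integral_mono_AE)
      then show ?thesis by (simp add: space_eq_UNIV[OF s1] ac_simps)
    qed
    have "(\<integral>\<^sup>+x. riesz_pot \<alpha> b x \<partial>M1) = (\<integral>\<^sup>+y. riesz_pot \<alpha> M1 y \<partial>b)"
      using mutual_energy_commute[OF sf1 b'(3) s1 b'(1), of \<alpha>] by (simp add: mutual_energy_pot)
    also have "\<dots> \<le> (\<integral>\<^sup>+y. ennreal c * indicator (cball 0 R) y + ?d * riesz_kernel \<alpha> x0 y \<partial>b)"
    proof (intro nn_integral_mono)
      fix y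
      show "riesz_pot \<alpha> M1 y \<le> ennreal c * indicator (cball 0 R) y + ?d * riesz_kernel \<alpha> x0 y"
        using far[of y] pot_piece_bounded[OF \<alpha> M'(1), of k y]
        by (cases "R < norm y") (auto simp: M1_def[symmetric] c_def[symmetric] intro: add_increasing2)
    qed
    also have "\<dots> = ennreal c * emeasure b (cball 0 R) + ?d * riesz_pot \<alpha> b x0"
      unfolding riesz_pot_def by (subst nn_integral_add) (auto simp: nn_integral_cmult b')
    also have "\<dots> < \<infinity>"
      using b'(4)[of "cball 0 R"] x0 M1.emeasure_finite[of UNIV, unfolded top.not_eq_extremum]
      by (simp add: ennreal_mult_less_top)
    finally have "AE x in M1. riesz_pot \<alpha> b x \<noteq> \<infinity>" by (intro nn_integral_PInf_AE) auto
    then show ?thesis unfolding M1_def by (subst (asm) AE_density_indicator) (simp_all add: M')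
  qed
  have "AE x in M. riesz_pot \<alpha> M x \<noteq> \<infinity>"
    using M by (intro nn_integral_PInf_AE) (auto simp: mutual_energy_pot)
  moreover have "AE x in M. \<forall>k. x \<in> ?S k \<longrightarrow> riesz_pot \<alpha> b x \<noteq> \<infinity>"
    unfolding AE_all_countable using piece by blast
  ultimately have "AE x in M. riesz_pot \<alpha> b x \<noteq> \<infinity>"
  proof eventually_elim
    fix x assume "riesz_pot \<alpha> M x \<noteq> \<infinity>" "\<forall>k. x \<in> ?S k \<longrightarrow> riesz_pot \<alpha> b x \<noteq> \<infinity>"
    then show "riesz_pot \<alpha> b x \<noteq> \<infinity>" using S(3) by (auto simp: less_top)
  qed
  then show "emeasure M {x. riesz_pot \<alpha> b x = \<infinity>} = 0"
    using m by (subst (asm) AE_iff_measurable[of "{x. riesz_pot \<alpha> b x = \<infinity>}"]) (auto simp: M')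
qed

section \<open>Estimates for mutual energies\<close>

lemma mutual_energy_le:
  fixes M N :: "'a::euclidean_space measure"
  assumes "0 < \<alpha>" "\<alpha> < real DIM('a)" and sf: "sigma_finite_measure M" "sigma_finite_measure N"
    and s: "sets M = sets borel" "sets N = sets borel"
  shows "2 * mutual_energy \<alpha> M N \<le> energy \<alpha> M + energy \<alpha> N"
proof -
  note [measurable] = borel_measurable_heat_pot[OF sf(1) s(1)] borel_measurable_heat_pot[OF sf(2) s(2)]
  let ?F = "\<lambda>M s z. heat_pot (s / 2) M (z::'a)"
  have "riesz_const \<alpha> TYPE('a) * (2 * mutual_energy \<alpha> M N)
     = (\<integral>\<^sup>+s. \<integral>\<^sup>+z. 2 * (?F M s z * ?F N s z) \<partial>lborel \<partial>riesz_time \<alpha>)"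
    using mutual_energy_heat[OF assms] by (simp add: nn_integral_cmult mult.left_commute[of _ 2])
  also have "\<dots> \<le> (\<integral>\<^sup>+s. \<integral>\<^sup>+z. ?F M s z * ?F M s z + ?F N s z * ?F N s z \<partial>lborel \<partial>riesz_time \<alpha>)"
    by (intro nn_integral_mono ennreal_two_mult_le)
  also have "\<dots> = riesz_const \<alpha> TYPE('a) * (energy \<alpha> M + energy \<alpha> N)"
    using mutual_energy_heat[OF assms(1,2) sf(1) sf(1) s(1) s(1)] mutual_energy_heat[OF assms(1,2) sf(2) sf(2) s(2) s(2)]
    by (simp add: nn_integral_add distrib_left)
  finally show ?thesis
    using riesz_const_finite[OF assms(1,2)] riesz_const_pos[of \<alpha>, where 'a='a]
    by (subst (asm) ennreal_mult_le_mult_iff) auto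
qed

lemma mutual_energy_finite:
  fixes M N :: "'a::euclidean_space measure"
  assumes "0 < \<alpha>" "\<alpha> < real DIM('a)" and sf: "sigma_finite_measure M" "sigma_finite_measure N"
    and s: "sets M = sets borel" "sets N = sets borel" and "energy \<alpha> M < \<infinity>" "energy \<alpha> N < \<infinity>"
  shows "mutual_energy \<alpha> M N < \<infinity>"
proof -
  have "2 * mutual_energy \<alpha> M N < \<infinity>"
    using mutual_energy_le[OF assms(1-6)] assms(7,8) by (auto intro: le_less_trans)
  then show ?thesis by (auto simp: ennreal_mult_less_top)
qed

lemma energy_measure_add:
  fixes M N :: "'a::euclidean_space measure"
  assumes sf: "sigma_finite_measure M" "sigma_finite_measure N" and s: "sets M = sets borel" "sets N = sets borel"
  shows "energy \<alpha> (measure_add M N)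
    = mutual_energy \<alpha> M M + mutual_energy \<alpha> M N + (mutual_energy \<alpha> N M + mutual_energy \<alpha> N N)"
proof -
  note [measurable] = borel_measurable_riesz_pot[OF sf(1) s(1)] borel_measurable_riesz_pot[OF sf(2) s(2)]
  note [measurable_cong] = s
  have "energy \<alpha> (measure_add M N) = (\<integral>\<^sup>+x. riesz_pot \<alpha> M x + riesz_pot \<alpha> N x \<partial>measure_add M N)"
    unfolding mutual_energy_pot by (intro nn_integral_cong riesz_pot_measure_add s)
  also have "\<dots> = (\<integral>\<^sup>+x. riesz_pot \<alpha> M x + riesz_pot \<alpha> N x \<partial>M) + (\<integral>\<^sup>+x. riesz_pot \<alpha> M x + riesz_pot \<alpha> N x \<partial>N)"
    using s by (intro nn_integral_measure_add) auto
  finally show ?thesis by (simp add: nn_integral_add mutual_energy_pot)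
qed

section \<open>External fields\<close>

lemma sigma_finite_measure_add:
  fixes M N :: "'a::euclidean_space measure"
  assumes "pos_radon \<alpha> M" "pos_radon \<alpha> N"
  shows "sigma_finite_measure (measure_add M N)"
proof (rule sigma_finite_of_compact)
  note M = pos_radonD[OF assms(1)] and N = pos_radonD[OF assms(2)]
  show "sets (measure_add M N) = sets borel" by (simp add: M)
  fix K :: "'a set" assume K: "compact K"
  then have "K \<in> sets M" by (simp add: M borel_closed compact_imp_closed)
  then show "emeasure (measure_add M N) K < \<infinity>"
    using M(4)[OF K] N(4)[OF K] by (subst emeasure_measure_add) (auto simp: M N)
qed

lemma energy_total_var_finite:
  fixes \<mu> :: "'a::euclidean_space smeasure"
  assumes "\<mu> \<in> finite_energy \<alpha>"
  shows "pos_radon \<alpha> (pos_part \<mu>)" "pos_radon \<alpha> (neg_part \<mu>)"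
    "energy \<alpha> (pos_part \<mu>) < \<infinity>" "energy \<alpha> (neg_part \<mu>) < \<infinity>"
proof -
  show p: "pos_radon \<alpha> (pos_part \<mu>)" "pos_radon \<alpha> (neg_part \<mu>)"
    using assms by (auto simp: finite_energy_def signed_radon_def)
  have "energy \<alpha> (total_var \<mu>) < \<infinity>" using assms by (simp add: finite_energy_def)
  then show "energy \<alpha> (pos_part \<mu>) < \<infinity>" "energy \<alpha> (neg_part \<mu>) < \<infinity>"
    unfolding total_var_def using pos_radonD[OF p(1)] pos_radonD[OF p(2)]
    by (subst (asm) energy_measure_add; simp)+
qed

text \<open>This removes the difference between the two cases, the exceptional sets and the missing
  measurability of f. In Case I, \<psi> = 0. In Case II write \<zeta> = p - q and \<zeta>' = a - b;
  then \<phi> is the difference of the potentials of p + b and q + a, and the domination principle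
  bounds the potential of a by that of p + b, so that \<phi> is at least minus the potential of
  q.\<close>

lemma regular_field:
  fixes D A2 :: "'a::euclidean_space set" and f :: "'a \<Rightarrow> ereal"
  assumes \<alpha>: "0 < \<alpha>" "\<alpha> \<le> 2" "\<alpha> < real DIM('a)"
    and D: "open D" "A2 = - D"
    and field: "field_case_I \<alpha> A2 f \<or> field_case_II \<alpha> D f"
    and \<xi>: "pos_radon \<alpha> \<xi>" "energy \<alpha> \<xi> < \<infinity>"
  obtains \<phi> :: "'a \<Rightarrow> ereal" and \<psi> :: "'a \<Rightarrow> real" and Z where
    "polar \<alpha> Z" "\<phi> \<in> borel_measurable borel" "\<psi> \<in> borel_measurable borel"
    "\<And>x. 0 \<le> \<psi> x" "(\<integral>\<^sup>+x. ennreal (\<psi> x) \<partial>\<xi>) < \<infinity>" "\<And>x. ereal (- \<psi> x) \<le> \<phi> x"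
    "\<And>x. x \<in> A2 \<Longrightarrow> \<phi> x = 0" "\<And>x. x \<notin> Z \<Longrightarrow> f x = \<phi> x"
proof -
  have A2 [measurable]: "A2 \<in> sets borel" using D by (simp add: borel_closed closed_def)
  show thesis using field
  proof
    assume I: "field_case_I \<alpha> A2 f"
    have fm [measurable]: "f \<in> borel_measurable borel"
      using I by (intro borel_measurableI_greater) (auto simp: field_case_I_def lower_semicontinuous_def)
    obtain N where N: "capacity \<alpha> N = 0" "\<And>x. x \<in> A2 - N \<Longrightarrow> f x = 0"
      using I by (auto simp: field_case_I_def nearly_everywhere_on_def)
    define Z where "Z = {x \<in> space borel. f x > 0} \<inter> A2"
    have [measurable]: "Z \<in> sets borel" unfolding Z_def by measurable
    have f0: "0 \<le> f x" for x using I by (simp add: field_case_I_def)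
    have "polar \<alpha> Z"
      by (rule capacity_zero_imp_polar[OF N(1)]) (use N(2) f0 in \<open>force simp: Z_def\<close>)+
    then show thesis
    proof (rule that[of Z "\<lambda>x. if x \<in> Z then 0 else f x" "\<lambda>_. 0"])
      show "(if x \<in> Z then 0 else f x) = 0" if "x \<in> A2" for x
        using that f0[of x] by (auto simp: Z_def not_less intro: antisym)
    qed (auto simp: f0 zero_ereal_def[symmetric])
  next
    assume II: "field_case_II \<alpha> D f"
    then obtain \<zeta> \<zeta>' where z: "\<zeta> \<in> finite_energy \<alpha>" "is_balayage \<alpha> D \<zeta> \<zeta>'"
      and fz: "\<And>x. pot_defined \<alpha> (smeasure_diff \<zeta> \<zeta>') x \<Longrightarrow> f x = signed_pot \<alpha> (smeasure_diff \<zeta> \<zeta>') x"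
      by (auto simp: field_case_II_def)
    define p q a b where "p = pos_part \<zeta>" and "q = neg_part \<zeta>" and "a = pos_part \<zeta>'" and "b = neg_part \<zeta>'"
    note defs = p_def q_def a_def b_def
    have p: "pos_radon \<alpha> p" and q: "pos_radon \<alpha> q" and Eq: "energy \<alpha> q < \<infinity>"
      using energy_total_var_finite[OF z(1)] by (auto simp: defs)
    have sz': "signed_radon \<alpha> \<zeta>'" and cz': "cap_abs_continuous \<alpha> \<zeta>'"
      using z(2) by (auto simp: is_balayage_def)
    have ca: "AE x in a. x \<in> A2"
      using z(2) unfolding a_def D(2) is_balayage_def carried_by_def by blast
    have a: "pos_radon \<alpha> a" and b: "pos_radon \<alpha> b" using sz' by (auto simp: signed_radon_def defs)
    let ?U = "riesz_pot \<alpha>"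
    have Um [measurable]: "?U p \<in> borel_measurable borel" "?U q \<in> borel_measurable borel"
      "?U a \<in> borel_measurable borel" "?U b \<in> borel_measurable borel"
      using pos_radonD[OF p] pos_radonD[OF q] pos_radonD[OF a] pos_radonD[OF b] by (auto intro: borel_measurable_riesz_pot)
    obtain N where N: "capacity \<alpha> N = 0" and NP: "\<And>x. x \<in> A2 - N \<Longrightarrow> signed_pot \<alpha> \<zeta>' x = signed_pot \<alpha> \<zeta> x"
      using z(2) D by (auto simp: is_balayage_def nearly_everywhere_on_def)
    define I where "I = {x. ?U p x = \<infinity>} \<union> {x. ?U q x = \<infinity>} \<union> {x. ?U a x = \<infinity>} \<union> {x. ?U b x = \<infinity>}"
    have I: "polar \<alpha> I"
      unfolding I_def by (intro polar_Un polar_infinite_pot \<alpha> p q a b)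
    then have Im [measurable]: "I \<in> sets borel" by (simp add: polar_def)
    \<comment> \<open>The Borel set on which the balayage identity fails, with all terms moved to
      the side where they are positive. The exceptional set N from the definition need not be Borel,
      but it contains B.\<close>
    define B where "B = {x \<in> space borel. ?U a x + ?U q x < ?U b x + ?U p x \<or> ?U b x + ?U p x < ?U a x + ?U q x} \<inter> (A2 - I)"
    have Bm: "B \<in> sets borel" unfolding B_def by measurable
    define Z where "Z = B \<union> I"
    have fin: "\<exists>rp rq ra rb. ?U p x = ennreal rp \<and> ?U q x = ennreal rq \<and> ?U a x = ennreal ra \<and> ?U b x = ennreal rb
        \<and> 0 \<le> rp \<and> 0 \<le> rq \<and> 0 \<le> ra \<and> 0 \<le> rb" if "x \<notin> I" for x
      using that by (cases "?U p x"; cases "?U q x"; cases "?U a x"; cases "?U b x") (auto simp: I_def)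
    have "B \<subseteq> N"
    proof
      fix x assume x: "x \<in> B"
      show "x \<in> N"
      proof (rule ccontr)
        assume "x \<notin> N"
        then have e: "signed_pot \<alpha> \<zeta>' x = signed_pot \<alpha> \<zeta> x" using x NP by (auto simp: B_def)
        have "x \<notin> I" using x by (auto simp: B_def)
        from fin[OF this] obtain rp rq ra rb where r: "?U p x = ennreal rp" "?U q x = ennreal rq"
          "?U a x = ennreal ra" "?U b x = ennreal rb" "0 \<le> rp" "0 \<le> rq" "0 \<le> ra" "0 \<le> rb" by blast
        have "ra - rb = rp - rq" using e r by (simp add: signed_pot_def defs[symmetric] enn2ereal_ennreal)
        then have "ra + rq = rb + rp" by simp
        then have "?U a x + ?U q x = ?U b x + ?U p x" using r by (simp add: ennreal_plus[symmetric] del: ennreal_plus)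
        then show False using x by (auto simp: B_def)
      qed
    qed
    then have "polar \<alpha> B" using capacity_zero_imp_polar[OF N Bm] by blast
    then have Z: "polar \<alpha> Z" unfolding Z_def using I by (rule polar_Un)
    then have Zm [measurable]: "Z \<in> sets borel" by (simp add: polar_def)
    have aZ: "AE x in a. x \<notin> Z"
    proof (rule AE_not_in)
      show "Z \<in> null_sets a"
        using polar_null_cac(1)[OF sz' cz' Z] Zm pos_radonD(1)[OF a] by (auto simp: null_sets_def a_def)
    qed
    note sets' = pos_radonD(1)[OF p] pos_radonD(1)[OF q] pos_radonD(1)[OF a] pos_radonD(1)[OF b]
    have eqA: "?U a x + ?U q x = ?U b x + ?U p x" if "x \<in> A2" "x \<notin> Z" for x
      using that by (auto simp: Z_def B_def not_less intro: antisym)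
    \<comment> \<open>On \<open>A2\<close> off Z the balayage identity gives the inequality. This is
      almost everywhere for a, which is carried by \<open>A2\<close> and charges no polar set; the
      domination principle extends it to all points.\<close>
    have dom: "?U a x \<le> ?U b x + ?U p x" for x
    proof -
      have "?U a x \<le> ?U (measure_add b p) x"
      proof (rule domination_principle[OF \<alpha> pos_radonD(1)[OF a] pos_radonD(4)[OF a] sigma_finite_measure_add[OF b p]])
        show "AE x in a. ?U a x < \<infinity>"
          using aZ by eventually_elim (auto simp: Z_def I_def less_top)
        show "AE x in a. ?U a x \<le> ?U (measure_add b p) x"
          using aZ ca
        proof eventually_elim
          fix x assume "x \<notin> Z" "x \<in> A2"
          then have "?U a x \<le> ?U b x + ?U p x" using eqA[of x] by (metis le_iff_add)
          then show "?U a x \<le> ?U (measure_add b p) x" by (simp add: riesz_pot_measure_add sets')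
        qed
      qed (simp_all add: sets')
      then show ?thesis by (simp add: riesz_pot_measure_add sets')
    qed
    define \<phi> where "\<phi> x = (if x \<in> Z then 0 else enn2ereal (?U p x + ?U b x) - enn2ereal (?U q x + ?U a x))" for x
    define \<psi> where "\<psi> x = (if x \<in> Z then 0 else enn2real (?U q x))" for x
    have val: "\<exists>rp rq ra rb. \<phi> x = ereal (rp + rb - (rq + ra)) \<and> \<psi> x = rq \<and> ra \<le> rb + rp \<and> (x \<in> A2 \<longrightarrow> ra + rq = rb + rp) \<and> f x = \<phi> x" if "x \<notin> Z" for x
    proof -
      have "x \<notin> I" using that by (simp add: Z_def)
      from fin[OF this] obtain rp rq ra rb where r: "?U p x = ennreal rp" "?U q x = ennreal rq"
        "?U a x = ennreal ra" "?U b x = ennreal rb" "0 \<le> rp" "0 \<le> rq" "0 \<le> ra" "0 \<le> rb" by blast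
      have e: "?U p x + ?U b x = ennreal (rp + rb)" "?U q x + ?U a x = ennreal (rq + ra)"
        using r by auto
      have 1: "\<phi> x = ereal (rp + rb - (rq + ra))" unfolding \<phi>_def e using that r by (simp add: enn2ereal_ennreal del: ennreal_plus)
      have 2: "\<psi> x = rq" using that r by (simp add: \<psi>_def)
      have 3: "ra \<le> rb + rp" using dom[of x] r by (simp add: ennreal_plus[symmetric] del: ennreal_plus)
      have 4: "x \<in> A2 \<longrightarrow> ra + rq = rb + rp"
        using eqA[of x] that r by (auto simp: ennreal_plus[symmetric] simp del: ennreal_plus)
      have pd: "pot_defined \<alpha> (smeasure_diff \<zeta> \<zeta>') x"
        unfolding pot_defined_def smeasure_diff_def using e by (simp add: riesz_pot_measure_add sets' defs[symmetric])
      have 5: "f x = \<phi> x"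
        unfolding fz[OF pd] using that
        by (simp add: signed_pot_def smeasure_diff_def riesz_pot_measure_add sets' defs[symmetric] \<phi>_def)
      show ?thesis using 1 2 3 4 5 by blast
    qed
    show thesis
    proof (rule that[of Z \<phi> \<psi>])
      show "\<phi> \<in> borel_measurable borel" unfolding \<phi>_def by measurable
      show "\<psi> \<in> borel_measurable borel" unfolding \<psi>_def by measurable
      show "0 \<le> \<psi> x" for x by (simp add: \<psi>_def)
      show "ereal (- \<psi> x) \<le> \<phi> x" for x
      proof (cases "x \<in> Z")
        case True
        then show ?thesis by (simp add: \<phi>_def \<psi>_def zero_ereal_def[symmetric])
      next
        case False
        from val[OF this] obtain rp rq ra rb where
          "\<phi> x = ereal (rp + rb - (rq + ra))" "\<psi> x = rq" "ra \<le> rb + rp" by blast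
        then show ?thesis by simp
      qed
      show "\<phi> x = 0" if "x \<in> A2" for x
      proof (cases "x \<in> Z")
        case False
        from val[OF this] that obtain rp rq ra rb where
          "\<phi> x = ereal (rp + rb - (rq + ra))" "ra + rq = rb + rp" by blast
        then show ?thesis by (simp add: zero_ereal_def)
      qed (simp add: \<phi>_def)
      show "f x = \<phi> x" if "x \<notin> Z" for x using val[OF that] by blast
      have "(\<integral>\<^sup>+x. ennreal (\<psi> x) \<partial>\<xi>) \<le> (\<integral>\<^sup>+x. ?U q x \<partial>\<xi>)"
        by (intro nn_integral_mono) (auto simp: \<psi>_def ennreal_enn2real_if)
      also have "\<dots> = mutual_energy \<alpha> \<xi> q" by (simp add: mutual_energy_pot)
      also have "\<dots> < \<infinity>"
        by (rule mutual_energy_finite[OF \<alpha>(1,3) pos_radonD(3)[OF \<xi>(1)] pos_radonD(3)[OF q]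
              pos_radonD(1)[OF \<xi>(1)] pos_radonD(1)[OF q] \<xi>(2) Eq])
      finally show "(\<integral>\<^sup>+x. ennreal (\<psi> x) \<partial>\<xi>) < \<infinity>" .
    qed (rule Z)
  qed
qed

section \<open>Vague compactness\<close>

text \<open>A homeomorphism onto the open unit ball with inverse \<open>unsquash\<close>: escape to
  infinity becomes approach to the unit sphere.\<close>

definition squash :: "'a::euclidean_space \<Rightarrow> 'a" where
  "squash x = x /\<^sub>R (1 + norm x)"

definition unsquash :: "'a::euclidean_space \<Rightarrow> 'a" where
  "unsquash u = u /\<^sub>R (1 - norm u)"

lemma norm_squash: "norm (squash x) < 1"
  by (simp add: squash_def divide_simps add_pos_nonneg)

lemma unsquash_squash [simp]: "unsquash (squash x) = x"
proof -
  have p: "1 + norm x > 0" by (simp add: add_pos_nonneg)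
  have "1 - norm (squash x) = 1 / (1 + norm x)" using p by (simp add: squash_def divide_simps)
  then show ?thesis using p by (simp add: unsquash_def squash_def)
qed

lemma squash_unsquash: "norm u < 1 \<Longrightarrow> squash (unsquash u) = u"
proof -
  assume u: "norm u < 1"
  have "1 + norm (unsquash u) = 1 / (1 - norm u)" using u by (simp add: unsquash_def divide_simps)
  then show ?thesis using u by (simp add: unsquash_def squash_def)
qed

lemma continuous_squash: "continuous_on S squash"
proof -
  have "1 + norm x \<noteq> 0" for x :: 'a by (metis add_pos_nonneg less_irrefl norm_ge_zero zero_less_one)
  then show ?thesis unfolding squash_def[abs_def] by (intro continuous_intros) auto
qed

lemma continuous_unsquash: "continuous_on (ball 0 1) unsquash"
  unfolding unsquash_def[abs_def] by (intro continuous_intros) (auto simp: dist_norm)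

section \<open>Coding of points by real numbers\<close>

definition binary_digit :: "real \<Rightarrow> nat \<Rightarrow> real" where
  "binary_digit y k = real_of_int (\<lfloor>2 ^ Suc k * y\<rfloor> - 2 * \<lfloor>2 ^ k * y\<rfloor>)"

lemma binary_digit: "binary_digit y k = 0 \<or> binary_digit y k = 1"
proof -
  let ?x = "2 ^ k * y"
  have e: "2 ^ Suc k * y = 2 * ?x" by simp
  have "of_int (2 * \<lfloor>?x\<rfloor>) \<le> 2 * ?x" by simp
  then have 1: "2 * \<lfloor>?x\<rfloor> \<le> \<lfloor>2 * ?x\<rfloor>" unfolding le_floor_iff .
  have "2 * ?x < of_int (2 * \<lfloor>?x\<rfloor> + 2)" using real_of_int_floor_add_one_gt[of ?x]
    by (simp only: of_int_add of_int_mult of_int_numeral)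
  then have 2: "\<lfloor>2 * ?x\<rfloor> < 2 * \<lfloor>?x\<rfloor> + 2" unfolding floor_less_iff .
  have "\<lfloor>2 * ?x\<rfloor> - 2 * \<lfloor>?x\<rfloor> = 0 \<or> \<lfloor>2 * ?x\<rfloor> - 2 * \<lfloor>?x\<rfloor> = 1" using 1 2 by linarith
  then show ?thesis unfolding binary_digit_def e by (metis of_int_0 of_int_1)
qed

lemma binary_digits_close:
  assumes y: "0 \<le> y" "y < 1" "0 \<le> z" "z < 1"
    and eq: "\<And>k. k < K \<Longrightarrow> binary_digit y k = binary_digit z k"
  shows "\<bar>y - z\<bar> \<le> 1 / 2 ^ K"
proof -
  have "\<lfloor>2 ^ k * y\<rfloor> = \<lfloor>2 ^ k * z\<rfloor>" if "k \<le> K" for k using that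
  proof (induction k)
    case 0
    have "\<lfloor>y\<rfloor> = 0" "\<lfloor>z\<rfloor> = 0" using y by (simp_all add: floor_eq_iff)
    then show ?case by simp
  next
    case (Suc k)
    then have "real_of_int \<lfloor>2 ^ Suc k * y\<rfloor> = real_of_int \<lfloor>2 ^ Suc k * z\<rfloor>"
      using eq[of k] by (simp add: binary_digit_def)
    then show ?case by (simp only: of_int_eq_iff)
  qed
  then have "\<lfloor>2 ^ K * y\<rfloor> = \<lfloor>2 ^ K * z\<rfloor>" by simp
  then have "\<bar>2 ^ K * y - 2 ^ K * z\<bar> \<le> 1" by linarith
  then have "\<bar>2 ^ K * (y - z)\<bar> \<le> 1" by (simp only: right_diff_distrib)
  then have "2 ^ K * \<bar>y - z\<bar> \<le> 1" by (simp only: abs_mult) simp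
  then show ?thesis by (simp add: field_simps)
qed

lemma ternary_summable:
  fixes a :: "nat \<Rightarrow> real"
  assumes "\<And>i. \<bar>a i\<bar> \<le> 1"
  shows "summable (\<lambda>i. a i / 3 ^ Suc i)"
proof (rule summable_comparison_test')
  show "summable (\<lambda>i. (1 / 3) ^ Suc i :: real)" by (simp only: summable_Suc_iff) (rule summable_geometric, simp)
  show "norm (a i / 3 ^ Suc i) \<le> (1 / 3) ^ Suc i" if "0 \<le> i" for i
    using assms[of i] by (simp add: power_divide divide_right_mono)
qed

text \<open>Only the digits 0 and 1 occur. At the first place j where they differ the sums differ by
  1 / 3 ^ (j + 1), and all later places together make up at most half of this. Base 3 thus excludes
  the carries that make binary expansions ambiguous.\<close>

lemma ternary_digits_agree:
  fixes a b :: "nat \<Rightarrow> real"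
  assumes a: "\<And>i. a i = 0 \<or> a i = 1" and b: "\<And>i. b i = 0 \<or> b i = 1"
    and close: "\<bar>(\<Sum>i. a i / 3 ^ Suc i) - (\<Sum>i. b i / 3 ^ Suc i)\<bar> < 1 / (2 * 3 ^ m)"
  shows "\<forall>i<m. a i = b i"
proof (rule ccontr)
  assume "\<not> ?thesis"
  then have ex: "\<exists>i. i < m \<and> a i \<noteq> b i" by blast
  define j where "j = (LEAST i. i < m \<and> a i \<noteq> b i)"
  have j: "j < m" "a j \<noteq> b j" using LeastI_ex[OF ex] by (auto simp: j_def)
  have lt: "a i = b i" if "i < j" for i using not_less_Least[of i "\<lambda>i. i < m \<and> a i \<noteq> b i"] that j by (auto simp: j_def)
  define c where "c i = a i - b i" for i
  have c: "\<bar>c i\<bar> \<le> 1" for i using a[of i] b[of i] by (auto simp: c_def)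
  have a1: "\<bar>a i\<bar> \<le> 1" "\<bar>b i\<bar> \<le> 1" for i using a[of i] b[of i] by auto
  note sm = ternary_summable[of c, OF c] ternary_summable[of a, OF a1(1)] ternary_summable[of b, OF a1(2)]
  have eq: "(\<Sum>i. a i / 3 ^ Suc i) - (\<Sum>i. b i / 3 ^ Suc i) = (\<Sum>i. c i / 3 ^ Suc i)"
    using suminf_diff[OF sm(2,3)] by (simp add: c_def diff_divide_distrib)
  have "(\<Sum>i. c i / 3 ^ Suc i) = (\<Sum>i. c (i + Suc j) / 3 ^ Suc (i + Suc j)) + (\<Sum>i<Suc j. c i / 3 ^ Suc i)"
    by (rule suminf_split_initial_segment[OF sm(1)])
  also have "(\<Sum>i<Suc j. c i / 3 ^ Suc i) = c j / 3 ^ Suc j"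
    using lt by (simp add: c_def)
  finally have split: "(\<Sum>i. c i / 3 ^ Suc i) = (\<Sum>i. c (i + Suc j) / 3 ^ Suc (i + Suc j)) + c j / 3 ^ Suc j" .
  have geo: "(\<lambda>i. (1 / 3) ^ i * (1 / 3 ^ (j + 2))) sums (1 / (1 - 1 / 3) * (1 / 3 ^ (j + 2)) :: real)"
    by (intro sums_mult2 geometric_sums) simp
  have tail: "\<bar>\<Sum>i. c (i + Suc j) / 3 ^ Suc (i + Suc j)\<bar> \<le> 1 / (2 * 3 ^ Suc j)"
  proof -
    have le: "norm (c (i + Suc j) / 3 ^ Suc (i + Suc j)) \<le> (1 / 3) ^ i * (1 / 3 ^ (j + 2))" for i
      using c[of "i + Suc j"] by (simp add: power_add power_divide divide_simps)
    have "norm (\<Sum>i. c (i + Suc j) / 3 ^ Suc (i + Suc j)) \<le> (\<Sum>i. (1 / 3) ^ i * (1 / 3 ^ (j + 2)))"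
      by (rule norm_suminf_le[OF le sums_summable[OF geo]])
    also have "\<dots> = 1 / (2 * 3 ^ Suc j)" using sums_unique[OF geo] by simp
    finally show ?thesis by simp
  qed
  have "\<bar>c j\<bar> = 1" using a[of j] b[of j] j by (auto simp: c_def)
  then have cj: "\<bar>c j / 3 ^ Suc j\<bar> = 1 / 3 ^ Suc j" by simp
  have "1 / (2 * 3 ^ m) \<le> 1 / (2 * 3 ^ Suc j :: real)"
    using j by (intro divide_left_mono mult_left_mono power_increasing) auto
  also have "1 / (2 * 3 ^ Suc j) = 1 / 3 ^ Suc j - 1 / (2 * 3 ^ Suc j :: real)" by simp
  also have "\<dots> \<le> \<bar>\<Sum>i. c i / 3 ^ Suc i\<bar>"
    using tail cj unfolding split by linarith
  finally show False using close unfolding eq by linarith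
qed

text \<open>A Borel code \<open>\<psi>\<close> of the points of the space by reals: the binary digits of the coordinates of
  \<open>squash x\<close> are interleaved and read in base 3, so that \<open>squash\<close> is uniformly continuous in the code.\<close>
lemma real_code_exists:
  obtains \<psi> :: "'a::euclidean_space \<Rightarrow> real" and \<Phi> :: "real \<Rightarrow> 'a" where
    "\<psi> \<in> borel_measurable borel" "\<And>x. 0 \<le> \<psi> x" "\<And>x. \<psi> x \<le> 1"
    "continuous_on UNIV \<Phi>" "\<And>x. \<Phi> (\<psi> x) = squash x" "norm (\<Phi> (- 1)) = 1"
proof -
  let ?n = "DIM('a)"
  obtain e where e: "bij_betw e {0..<?n} (Basis :: 'a set)"
    using ex_bij_betw_nat_finite[of "Basis :: 'a set"] by auto
  define y where "y b x = (squash x \<bullet> b + 1) / 2" for b x :: 'a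
  have y01: "0 \<le> y b x" "y b x < 1" if "b \<in> Basis" for b x
  proof -
    have "\<bar>squash x \<bullet> b\<bar> \<le> norm (squash x)" using that by (rule Basis_le_norm)
    then have "\<bar>squash x \<bullet> b\<bar> < 1" using norm_squash[of x] by linarith
    then have "- 1 < squash x \<bullet> b" "squash x \<bullet> b < 1" by linarith+
    then show "0 \<le> y b x" "y b x < 1" by (simp_all add: y_def)
  qed
  have eB: "e (i mod ?n) \<in> Basis" for i using e by (auto simp: bij_betw_def)
  define d where "d x i = binary_digit (y (e (i mod ?n)) x) (i div ?n)" for x i
  have d: "d x i = 0 \<or> d x i = 1" for x i unfolding d_def by (rule binary_digit)
  then have d1: "\<bar>d x i\<bar> \<le> 1" "0 \<le> d x i" "d x i \<le> 1" for x i by (metis abs_zero abs_one zero_le_one order_refl)+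
  define \<psi> where "\<psi> x = (\<Sum>i. d x i / 3 ^ Suc i)" for x
  have sm: "summable (\<lambda>i. d x i / 3 ^ Suc i)" for x using d1 by (intro ternary_summable)
  have [measurable]: "squash \<in> borel_measurable borel" by (intro borel_measurable_continuous_onI continuous_squash)
  have "d \<in> UNIV \<rightarrow> UNIV" by simp
  have dm: "(\<lambda>x. d x i) \<in> borel_measurable borel" for i
    unfolding d_def binary_digit_def y_def by measurable
  have pm: "\<psi> \<in> borel_measurable borel" unfolding \<psi>_def using dm by measurable
  have p0: "0 \<le> \<psi> x" for x unfolding \<psi>_def using sm d1 by (intro suminf_nonneg) auto
  have p1: "\<psi> x \<le> 1" for x
  proof -
    have geo: "(\<lambda>i. (1 / 3) ^ i * (1 / 3)) sums (1 / (1 - 1 / 3) * (1 / 3) :: real)"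
      by (intro sums_mult2 geometric_sums) simp
    have le: "d x i / 3 ^ Suc i \<le> (1 / 3) ^ i * (1 / 3)" for i
    proof -
      have "d x i / 3 ^ Suc i \<le> 1 / 3 ^ Suc i" using d1(3) by (rule divide_right_mono) simp
      then show ?thesis by (simp add: power_divide mult.commute)
    qed
    have "\<psi> x \<le> (\<Sum>i. (1 / 3) ^ i * (1 / 3))"
      unfolding \<psi>_def by (rule suminf_le[OF le sm sums_summable[OF geo]])
    also have "\<dots> \<le> 1" using sums_unique[OF geo] by simp
    finally show ?thesis .
  qed
  have unif: "\<exists>\<delta>>0. \<forall>x x'. \<bar>\<psi> x - \<psi> x'\<bar> < \<delta> \<longrightarrow> norm (squash x - squash x') < \<epsilon>" if \<epsilon>: "0 < \<epsilon>" for \<epsilon>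
  proof -
    \<comment> \<open>K binary digits for each of the n coordinates, hence K * n digits of the code.
      The factor 2 undoes the scaling of the coordinates of \<open>squash x\<close> from [-1, 1] to
      [0, 1], and n bounds the norm by the sum of the coordinates.\<close>
    obtain K where K: "(1 / 2) ^ K < \<epsilon> / (2 * real ?n)"
      using real_arch_pow_inv[of "\<epsilon> / (2 * real ?n)" "1 / 2"] \<epsilon> by auto
    show ?thesis
    proof (intro exI[of _ "1 / (2 * 3 ^ (K * ?n))"] conjI allI impI)
      fix x x' assume "\<bar>\<psi> x - \<psi> x'\<bar> < 1 / (2 * 3 ^ (K * ?n))"
      then have ag: "\<forall>i<K * ?n. d x i = d x' i" unfolding \<psi>_def by (intro ternary_digits_agree d)
      have coord: "\<bar>(squash x - squash x') \<bullet> b\<bar> \<le> 2 * (1 / 2 ^ K)" if b: "b \<in> Basis" for b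
      proof -
        have "b \<in> e ` {0..<?n}" using b e by (simp add: bij_betw_def)
        then obtain j where j: "j < ?n" "e j = b" by auto
        have "\<bar>y b x - y b x'\<bar> \<le> 1 / 2 ^ K"
        proof (rule binary_digits_close[OF y01[OF b] y01[OF b]])
          fix k assume k: "k < K"
          have "k * ?n + j < Suc k * ?n" using j by simp
          also have "\<dots> \<le> K * ?n" using k by (intro mult_le_mono1) auto
          finally have "d x (k * ?n + j) = d x' (k * ?n + j)" using ag by blast
          then show "binary_digit (y b x) k = binary_digit (y b x') k" using j by (simp add: d_def)
        qed
        moreover have "(squash x - squash x') \<bullet> b = 2 * (y b x - y b x')"
          by (simp add: y_def inner_diff_left field_simps)
        ultimately show ?thesis by (simp only: abs_mult) simp
      qed
      have "norm (squash x - squash x') \<le> (\<Sum>b\<in>Basis. \<bar>(squash x - squash x') \<bullet> b\<bar>)" by (rule norm_le_l1)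
      also have "\<dots> \<le> (\<Sum>b\<in>(Basis::'a set). 2 * (1 / 2 ^ K))" using coord by (intro sum_mono)
      also have "\<dots> = 2 * real ?n * (1 / 2) ^ K" by (simp add: power_divide)
      also have "\<dots> < \<epsilon>" using K by (simp add: field_simps)
      finally show "norm (squash x - squash x') < \<epsilon>" .
    qed simp
  qed
  define \<Phi>0 where "\<Phi>0 t = squash (inv \<psi> t)" for t
  have inv: "\<psi> (inv \<psi> t) = t" if "t \<in> range \<psi>" for t using that by (rule f_inv_into_f)
  have uc: "uniformly_continuous_on (range \<psi>) \<Phi>0"
    unfolding uniformly_continuous_on_def
  proof (intro allI impI)
    fix \<epsilon> :: real assume "0 < \<epsilon>"
    from unif[OF this] obtain \<delta> where \<delta>: "\<delta> > 0" "\<And>x x'. \<bar>\<psi> x - \<psi> x'\<bar> < \<delta> \<Longrightarrow> norm (squash x - squash x') < \<epsilon>" by blast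
    then show "\<exists>d>0. \<forall>x\<in>range \<psi>. \<forall>x'\<in>range \<psi>. dist x' x < d \<longrightarrow> dist (\<Phi>0 x') (\<Phi>0 x) < \<epsilon>"
      by (intro exI[of _ \<delta>]) (auto simp: \<Phi>0_def dist_norm inv dest!: \<delta>(2)[of "inv \<psi> _" "inv \<psi> _", unfolded inv])
  qed
  have \<Phi>0: "\<Phi>0 (\<psi> x) = squash x" for x
  proof (rule ccontr)
    assume "\<Phi>0 (\<psi> x) \<noteq> squash x"
    then have "0 < norm (\<Phi>0 (\<psi> x) - squash x)" by simp
    from unif[OF this] show False unfolding \<Phi>0_def by (metis diff_self abs_zero inv less_irrefl rangeI)
  qed
  obtain g where g: "uniformly_continuous_on (closure (range \<psi>)) g" "\<And>t. t \<in> range \<psi> \<Longrightarrow> \<Phi>0 t = g t"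
    using uniformly_continuous_on_extension_on_closure[OF uc] by metis
  obtain b where b: "b \<in> (Basis :: 'a set)" using nonempty_Basis by blast
  have "closure (range \<psi>) \<subseteq> {0..}" using p0 by (intro closure_minimal) auto
  then have m1: "- 1 \<notin> closure (range \<psi>)" by auto
  \<comment> \<open>The codes are nonnegative, so the value at -1 is free. A unit vector is
    prescribed there, because in \<open>vague_compactness\<close> the point -1 represents
    infinity.\<close>
  have "continuous_on ({- 1} \<union> closure (range \<psi>)) (\<lambda>t. if t = - 1 then b else g t)"
    by (rule continuous_on_cases[OF _ closed_closure continuous_on_const uniformly_continuous_imp_continuous[OF g(1)]])
       (use m1 in auto)
  then obtain \<Phi> where \<Phi>: "continuous_on UNIV \<Phi>"
    "\<And>t. t \<in> {- 1} \<union> closure (range \<psi>) \<Longrightarrow> \<Phi> t = (if t = - 1 then b else g t)"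
    by (rule Tietze_unbounded[of _ _ UNIV]) (auto simp: closed_insert)
  have 1: "\<Phi> (\<psi> x) = squash x" for x
  proof -
    have "\<psi> x \<in> closure (range \<psi>)" by (rule subsetD[OF closure_subset rangeI])
    then show ?thesis using \<Phi>(2)[of "\<psi> x"] m1 g(2)[of "\<psi> x"] \<Phi>0[of x] by auto
  qed
  have 2: "norm (\<Phi> (- 1)) = 1" using \<Phi>(2)[of "-1"] b by simp
  show thesis by (rule that[OF pm p0 p1 \<Phi>(1) 1 2])
qed

text \<open>Compact superlevel sets say that g vanishes at infinity, and this is the continuity of
  the extension on the unit sphere.\<close>

lemma continuous_extension_by_0:
  fixes g :: "'a::euclidean_space \<Rightarrow> real"
  assumes g: "continuous_on UNIV g" "\<And>x. 0 \<le> g x" "\<And>\<epsilon>. 0 < \<epsilon> \<Longrightarrow> compact {x. \<epsilon> \<le> g x}"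
  shows "continuous_on UNIV (\<lambda>u. if norm u < 1 then g (unsquash u) else 0)" (is "continuous_on UNIV ?G")
proof (intro continuous_at_imp_continuous_on ballI)
  fix u :: 'a
  show "isCont ?G u"
  proof (cases "norm u < 1")
    case True
    have "continuous_on (ball 0 1) (\<lambda>u. g (unsquash u))"
      using continuous_on_compose2[OF g(1) continuous_unsquash] by simp
    then have "continuous_on (ball 0 1) ?G"
      by (rule continuous_on_eq) simp
    then show ?thesis using True by (simp add: continuous_on_eq_continuous_at)
  next
    case False
    have "(?G \<longlongrightarrow> 0) (at u)"
    proof (rule tendstoI)
      fix \<epsilon> :: real assume \<epsilon>: "0 < \<epsilon>"
      define C where "C = squash ` {x. \<epsilon> \<le> g x}"
      have "compact C" unfolding C_def using continuous_squash g(3)[OF \<epsilon>] by (rule compact_continuous_image)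
      then have "open (- C)" by (simp add: compact_imp_closed open_Compl)
      moreover have "u \<in> - C" using False norm_squash by (auto simp: C_def)
      ultimately have "eventually (\<lambda>v. v \<in> - C) (at u)" by (metis eventually_at_topological)
      then show "eventually (\<lambda>v. dist (?G v) 0 < \<epsilon>) (at u)"
      proof eventually_elim
        fix v assume v: "v \<in> - C"
        show "dist (?G v) 0 < \<epsilon>"
        proof (cases "norm v < 1")
          case True
          have "\<not> \<epsilon> \<le> g (unsquash v)" using v squash_unsquash[OF True] unfolding C_def by force
          then show ?thesis using True g(2)[of "unsquash v"] by simp
        qed (use \<epsilon> in simp)
      qed
    qed
    then show ?thesis using False by (simp add: isCont_def)
  qed
qed

text \<open>The measures are carried over to the real line by \<psi>, where Helly's selection
  theorem applies. The limit is pulled back from the open set on which \<Phi> lies in the open unit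
  ball. What it charges elsewhere is mass lost at infinity, invisible to test functions that vanish
  at infinity.\<close>

theorem vague_compactness:
  fixes \<tau> :: "nat \<Rightarrow> 'a::euclidean_space measure"
  assumes s: "\<And>k. sets (\<tau> k) = sets borel" and m: "\<And>k. emeasure (\<tau> k) UNIV \<le> 1"
  obtains r \<tau>' where "strict_mono r" "sets \<tau>' = sets borel" "emeasure \<tau>' UNIV \<le> 1"
    "\<And>g. continuous_on UNIV g \<Longrightarrow> (\<And>x. 0 \<le> g x) \<Longrightarrow> (\<And>\<epsilon>. 0 < \<epsilon> \<Longrightarrow> compact {x. \<epsilon> \<le> g x}) \<Longrightarrow>
       (\<lambda>k. \<integral>\<^sup>+x. ennreal (g x) \<partial>\<tau> (r k)) \<longlonglongrightarrow> (\<integral>\<^sup>+x. ennreal (g x) \<partial>\<tau>')"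
proof -
  obtain \<psi> :: "'a \<Rightarrow> real" and \<Phi> :: "real \<Rightarrow> 'a" where pm [measurable]: "\<psi> \<in> borel_measurable borel"
    and p01: "\<And>x. 0 \<le> \<psi> x" "\<And>x. \<psi> x \<le> 1" and \<Phi>: "continuous_on UNIV \<Phi>" "\<And>x. \<Phi> (\<psi> x) = squash x" "norm (\<Phi> (- 1)) = 1"
    using real_code_exists by blast
  have [measurable]: "\<Phi> \<in> borel_measurable borel" using \<Phi>(1) by (rule borel_measurable_continuous_onI)
  have [measurable]: "\<psi> \<in> borel_measurable (\<tau> k)" for k using pm s[of k] by (simp cong: measurable_cong_sets)
  \<comment> \<open>The missing mass is placed at -1, so that all these measures are probability
    measures on one bounded interval and tightness is automatic.\<close>
  define \<mu> where "\<mu> k = measure_add (distr (\<tau> k) borel \<psi>) (density (return borel (- 1)) (\<lambda>_. 1 - emeasure (\<tau> k) UNIV))" for k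
  have s\<mu>: "sets (\<mu> k) = sets borel" for k by (simp add: \<mu>_def)
  have int: "(\<integral>\<^sup>+t. f t \<partial>\<mu> k) = (\<integral>\<^sup>+x. f (\<psi> x) \<partial>\<tau> k) + (1 - emeasure (\<tau> k) UNIV) * f (- 1)"
    if [measurable]: "f \<in> borel_measurable borel" for f k
  proof -
    have "(\<integral>\<^sup>+t. f t \<partial>\<mu> k) = (\<integral>\<^sup>+t. f t \<partial>distr (\<tau> k) borel \<psi>) + (\<integral>\<^sup>+t. f t \<partial>density (return borel (- 1)) (\<lambda>_. 1 - emeasure (\<tau> k) UNIV))"
      unfolding \<mu>_def by (intro nn_integral_measure_add) auto
    then show ?thesis by (simp add: nn_integral_distr nn_integral_density nn_integral_return)
  qed
  have em: "emeasure (\<mu> k) A = emeasure (\<tau> k) (\<psi> -` A) + (1 - emeasure (\<tau> k) UNIV) * indicator A (- 1)" if A [measurable]: "A \<in> sets borel" for A k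
  proof -
    have "\<psi> -` A \<in> sets (\<tau> k)" using measurable_sets_borel[OF pm A] s by simp
    moreover have "(\<integral>\<^sup>+x. indicator A (\<psi> x) \<partial>\<tau> k) = (\<integral>\<^sup>+x. indicator (\<psi> -` A) x \<partial>\<tau> k)"
      by (intro nn_integral_cong) (auto simp: indicator_def)
    ultimately show ?thesis using int[of "indicator A" k] by (simp add: s\<mu>)
  qed
  have rd: "real_distribution (\<mu> k)" for k
  proof -
    have "emeasure (\<mu> k) UNIV = 1" using m[of k] by (simp add: em add_diff_inverse_ennreal)
    then have "prob_space (\<mu> k)" using space_eq_UNIV[OF s\<mu>] by (intro prob_spaceI) simp
    then show ?thesis using s\<mu> space_eq_UNIV[OF s\<mu>] by (simp add: real_distribution_def real_distribution_axioms_def)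
  qed
  have "tight \<mu>"
    unfolding tight_def
  proof (intro conjI allI impI rd)
    fix \<epsilon> :: real assume \<epsilon>: "0 < \<epsilon>"
    show "\<exists>a b. a < b \<and> (\<forall>k. 1 - \<epsilon> < measure (\<mu> k) {a<..b})"
    proof (rule exI[of _ "-2"], rule exI[of _ 1], intro conjI allI)
      fix k
      have "\<psi> x \<in> {- 2<..1}" for x using p01(1)[of x] p01(2)[of x] by simp
      then have "\<psi> -` {- 2<..1} = UNIV" by blast
      then have "emeasure (\<mu> k) {- 2<..1} = 1" using m[of k] by (simp add: em add_diff_inverse_ennreal)
      then show "1 - \<epsilon> < measure (\<mu> k) {- 2<..1}" using \<epsilon> by (simp add: measure_def)
    qed simp
  qed
  then obtain r M where r: "strict_mono (r :: nat \<Rightarrow> nat)" and M: "real_distribution M" and conv: "weak_conv_m (\<mu> \<circ> r) M"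
    using tight_imp_convergent_subsubsequence[of \<mu> id] strict_mono_id by auto
  interpret M: real_distribution M by (rule M)
  define S where "S = {t. norm (\<Phi> t) < 1}"
  have S [measurable]: "S \<in> sets borel"
  proof -
    have "open S" unfolding S_def using \<Phi>(1) by (intro open_Collect_less continuous_intros)
    then show ?thesis by simp
  qed
  \<comment> \<open>The limit may charge numbers that are no codes, so the pull-back is defined
    through the continuous map \<Phi> and not through an inverse of \<psi>.\<close>
  define h where "h t = (if t \<in> S then unsquash (\<Phi> t) else 0)" for t
  have hm: "h \<in> borel_measurable borel"
    unfolding h_def unsquash_def by measurable
  have hmM [measurable]: "h \<in> borel_measurable M" using hm by (simp cong: measurable_cong_sets)
  have hmD: "h \<in> borel_measurable (density M (indicator S))" using hmM by simp
  define \<tau>' where "\<tau>' = distr (density M (indicator S)) borel h"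
  have s': "sets \<tau>' = sets borel" by (simp add: \<tau>'_def)
  have int': "(\<integral>\<^sup>+x. f x \<partial>\<tau>') = (\<integral>\<^sup>+t. indicator S t * f (h t) \<partial>M)" if [measurable]: "f \<in> borel_measurable borel" for f
    unfolding \<tau>'_def using hmD by (subst nn_integral_distr) (auto simp: nn_integral_density)
  show thesis
  proof (rule that[OF r s'])
    have "emeasure \<tau>' UNIV = (\<integral>\<^sup>+x. 1 \<partial>\<tau>')" by (simp add: space_eq_UNIV[OF s'])
    also have "\<dots> = (\<integral>\<^sup>+t. indicator S t * 1 \<partial>M)" by (rule int') simp
    also have "\<dots> \<le> (\<integral>\<^sup>+t. 1 \<partial>M)" by (intro nn_integral_mono) (simp add: indicator_def)
    also have "\<dots> = 1" using M.emeasure_space_1 by simp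
    finally show "emeasure \<tau>' UNIV \<le> 1" .
    fix g :: "'a \<Rightarrow> real"
    assume g: "continuous_on UNIV g" "\<And>x. 0 \<le> g x" "\<And>\<epsilon>. 0 < \<epsilon> \<Longrightarrow> compact {x. \<epsilon> \<le> g x}"
    have gm [measurable]: "g \<in> borel_measurable borel" using g(1) by (rule borel_measurable_continuous_onI)
    define G where "G u = (if norm u < 1 then g (unsquash u) else 0)" for u
    define f where "f t = G (\<Phi> t)" for t
    have G: "continuous_on UNIV G" unfolding G_def by (rule continuous_extension_by_0[OF g])
    have f: "continuous_on UNIV f" unfolding f_def using continuous_on_compose2[OF G \<Phi>(1)] by simp
    then have fm [measurable]: "f \<in> borel_measurable borel" by (rule borel_measurable_continuous_onI)
    have f0: "0 \<le> f t" for t using g(2) by (simp add: f_def G_def)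
    obtain B where B: "\<And>x. g x \<le> B" "0 \<le> B"
    proof -
      have "compact (g ` {x. 1 \<le> g x})" using g by (intro compact_continuous_image continuous_on_subset[OF g(1)]) auto
      then have "bdd_above (g ` {x. 1 \<le> g x})" by (intro bounded_imp_bdd_above compact_imp_bounded)
      then obtain b where b: "\<And>x. 1 \<le> g x \<Longrightarrow> g x \<le> b" by (auto simp: bdd_above_def)
      show thesis by (rule that[of "max 1 b"]) (use b in \<open>force simp: le_max_iff_disj\<close>)+
    qed
    have fB: "f t \<le> B" for t using B by (simp add: f_def G_def)
    have fint: "integrable N f" if "real_distribution N" for N
    proof -
      interpret N: real_distribution N by fact
      have [measurable_cong]: "sets N = sets borel" by simp
      show ?thesis using f0 fB by (intro N.integrable_const_bound[where B=B]) auto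
    qed
    have nn: "(\<integral>\<^sup>+t. ennreal (f t) \<partial>N) = ennreal (integral\<^sup>L N f)" if "real_distribution N" for N
      using fint[OF that] f0 by (intro nn_integral_eq_integral) auto
    have "(\<lambda>k. integral\<^sup>L ((\<mu> \<circ> r) k) f) \<longlonglongrightarrow> integral\<^sup>L M f"
    proof (rule weak_conv_imp_integral_bdd_continuous_conv[OF _ M conv])
      show "real_distribution ((\<mu> \<circ> r) k)" for k using rd by simp
      show "isCont f t" for t using f by (simp add: continuous_on_eq_continuous_at)
      show "norm (f t) \<le> B" for t using f0 fB by simp
    qed
    then have "(\<lambda>k. \<integral>\<^sup>+t. ennreal (f t) \<partial>\<mu> (r k)) \<longlonglongrightarrow> (\<integral>\<^sup>+t. ennreal (f t) \<partial>M)"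
      by (simp add: nn[OF rd] nn[OF M] tendsto_ennrealI)
    moreover have "(\<integral>\<^sup>+t. ennreal (f t) \<partial>\<mu> k) = (\<integral>\<^sup>+x. ennreal (g x) \<partial>\<tau> k)" for k
    proof -
      have "f (\<psi> x) = g x" "f (- 1) = 0" for x
        using \<Phi>(2,3) norm_squash[of x] by (simp_all add: f_def G_def)
      then show ?thesis using int[of "\<lambda>t. ennreal (f t)" k] by simp
    qed
    moreover have "(\<integral>\<^sup>+t. ennreal (f t) \<partial>M) = (\<integral>\<^sup>+x. ennreal (g x) \<partial>\<tau>')"
      by (simp add: int') (auto intro!: nn_integral_cong simp: f_def G_def h_def S_def indicator_def)
    ultimately show "(\<lambda>k. \<integral>\<^sup>+x. ennreal (g x) \<partial>\<tau> (r k)) \<longlonglongrightarrow> (\<integral>\<^sup>+x. ennreal (g x) \<partial>\<tau>')" by simp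
  qed
qed

section \<open>The energy distance\<close>

text \<open>The difference is taken in the reals because subtraction in \<open>ennreal\<close>
  truncates at 0. As \<open>enn2real\<close> sends \<top> to 0, the value is meaningful for finite
  arguments; \<open>heat_pot_finite\<close> supplies them.\<close>

definition sq_diff :: "ennreal \<Rightarrow> ennreal \<Rightarrow> ennreal" where
  "sq_diff a b = ennreal ((enn2real a - enn2real b)\<^sup>2)"

lemma borel_measurable_sq_diff [measurable (raw)]:
  assumes [measurable]: "f \<in> borel_measurable N" "g \<in> borel_measurable N"
  shows "(\<lambda>x. sq_diff (f x) (g x)) \<in> borel_measurable N"
  unfolding sq_diff_def by measurable

lemma sq_diff_add:
  assumes "a < \<top>" "b < \<top>"
  shows "sq_diff a b + 2 * (a * b) = a * a + b * b"
proof -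
  obtain r q where r: "a = ennreal r" "b = ennreal q" "0 \<le> r" "0 \<le> q"
    using assms by (metis ennreal_cases less_irrefl)
  have eqs: "sq_diff a b = ennreal ((r - q)\<^sup>2)" "2 * (a * b) = ennreal (2 * (r * q))"
    "a * a = ennreal (r * r)" "b * b = ennreal (q * q)"
    using r by (simp_all add: sq_diff_def ennreal_mult)
  have "ennreal ((r - q)\<^sup>2) + ennreal (2 * (r * q)) = ennreal ((r - q)\<^sup>2 + 2 * (r * q))"
    using r by (intro ennreal_plus[symmetric]) auto
  also have "(r - q)\<^sup>2 + 2 * (r * q) = r * r + q * q" by (simp add: power2_eq_square algebra_simps)
  also have "ennreal \<dots> = ennreal (r * r) + ennreal (q * q)" using r by (intro ennreal_plus) auto
  finally show ?thesis unfolding eqs .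
qed

lemma sq_le_sq_diff:
  assumes "a < \<top>" "b < \<top>"
  shows "b * b \<le> 2 * sq_diff a b + 2 * (a * a)"
proof -
  obtain r q where r: "a = ennreal r" "b = ennreal q" "0 \<le> r" "0 \<le> q"
    using assms by (metis ennreal_cases less_irrefl)
  have "2 * sq_diff a b = ennreal (2 * (r - q)\<^sup>2)" "2 * (a * a) = ennreal (2 * (r * r))" "b * b = ennreal (q * q)"
    using r by (simp_all add: sq_diff_def ennreal_mult)
  moreover have "q * q \<le> 2 * (r - q)\<^sup>2 + 2 * (r * r)"
    using zero_le_power2[of "2 * r - q"] by (simp add: power2_eq_square algebra_simps)
  ultimately show ?thesis using r by (simp add: ennreal_plus[symmetric] ennreal_leI del: ennreal_plus)
qed

text \<open>The parallelogram law for a - b and c - d. Their difference is written as (a + d) - (c +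
  b), so that only sums of the given quantities occur inside \<open>sq_diff\<close>.\<close>

lemma sq_diff_midpoint:
  assumes "a < \<top>" "b < \<top>" "c < \<top>" "d < \<top>"
  shows "2 * sq_diff ((a + c) / 2) ((b + d) / 2) + inverse 2 * sq_diff (a + d) (c + b) = sq_diff a b + sq_diff c d"
proof -
  obtain r q t u where r: "a = ennreal r" "b = ennreal q" "c = ennreal t" "d = ennreal u" "0 \<le> r" "0 \<le> q" "0 \<le> t" "0 \<le> u"
    using assms by (metis ennreal_cases less_irrefl)
  have h: "(ennreal x + ennreal y) / 2 = ennreal ((x + y) / 2)" if "0 \<le> x" "0 \<le> y" for x y
    using that divide_ennreal[of "x + y" 2] by simp
  have 1: "2 * sq_diff ((a + c) / 2) ((b + d) / 2) = ennreal (2 * ((r + t) / 2 - (q + u) / 2)\<^sup>2)"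
    using r by (simp add: h sq_diff_def ennreal_mult)
  have "inverse 2 = ennreal (1 / 2)" using inverse_ennreal[of 2] by (simp add: inverse_eq_divide)
  then have 2: "inverse 2 * sq_diff (a + d) (c + b) = ennreal (1 / 2 * ((r + u) - (t + q))\<^sup>2)"
    using r by (simp only: sq_diff_def ennreal_plus[symmetric] enn2real_ennreal add_nonneg_nonneg) (rule ennreal_mult[symmetric], auto)
  have 3: "sq_diff a b + sq_diff c d = ennreal ((r - q)\<^sup>2 + (t - u)\<^sup>2)"
    using r by (simp add: sq_diff_def)
  have "2 * ((r + t) / 2 - (q + u) / 2)\<^sup>2 + 1 / 2 * ((r + u) - (t + q))\<^sup>2 = (r - q)\<^sup>2 + (t - u)\<^sup>2"
    by (simp add: power2_eq_square field_simps)
  moreover have "ennreal (2 * ((r + t) / 2 - (q + u) / 2)\<^sup>2) + ennreal (1 / 2 * ((r + u) - (t + q))\<^sup>2)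
    = ennreal (2 * ((r + t) / 2 - (q + u) / 2)\<^sup>2 + 1 / 2 * ((r + u) - (t + q))\<^sup>2)"
    by (rule ennreal_plus[symmetric]) auto
  ultimately show ?thesis unfolding 1 2 3 by (simp only:)
qed

lemma heat_pot_finite:
  fixes M :: "'a::euclidean_space measure"
  assumes "finite_measure M" "sets M = sets borel" "0 < s"
  shows "heat_pot s M z < \<top>"
proof -
  interpret finite_measure M by fact
  show ?thesis using heat_pot_le[OF assms(2,3), of z] emeasure_finite[of UNIV, unfolded top.not_eq_extremum]
    by (auto intro!: le_less_trans[OF heat_pot_le[OF assms(2,3)]] simp: ennreal_mult_less_top)
qed

text \<open>Up to the factor \<open>riesz_const\<close>, the energy of the signed measure \<open>M - N\<close>.\<close>
definition energy_dist :: "real \<Rightarrow> 'a::euclidean_space measure \<Rightarrow> 'a measure \<Rightarrow> ennreal" where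
  "energy_dist \<alpha> M N = (\<integral>\<^sup>+s. \<integral>\<^sup>+z. sq_diff (heat_pot (s / 2) M z) (heat_pot (s / 2) N z) \<partial>lborel \<partial>riesz_time \<alpha>)"

lemma nn_integral_mono_times:
  assumes "\<And>s z. 0 < s \<Longrightarrow> f s z \<le> g s (z::'a::euclidean_space)"
  shows "(\<integral>\<^sup>+s. \<integral>\<^sup>+z. f s z \<partial>lborel \<partial>riesz_time \<alpha>) \<le> (\<integral>\<^sup>+s. \<integral>\<^sup>+z. g s z \<partial>lborel \<partial>riesz_time \<alpha>)"
  by (intro nn_integral_mono_AE, use AE_riesz_time[of \<alpha>] in eventually_elim)
     (intro nn_integral_mono assms)

lemma nn_integral_cong_times:
  assumes "\<And>s z. 0 < s \<Longrightarrow> f s z = g s (z::'a::euclidean_space)"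
  shows "(\<integral>\<^sup>+s. \<integral>\<^sup>+z. f s z \<partial>lborel \<partial>riesz_time \<alpha>) = (\<integral>\<^sup>+s. \<integral>\<^sup>+z. g s z \<partial>lborel \<partial>riesz_time \<alpha>)"
  by (intro nn_integral_cong_AE, use AE_riesz_time[of \<alpha>] in eventually_elim)
     (intro nn_integral_cong assms)

section \<open>Expansion and finiteness of the energy distance\<close>

locale two_measures =
  fixes \<alpha> :: real and M N :: "'a::euclidean_space measure"
  assumes \<alpha>: "0 < \<alpha>" "\<alpha> < real DIM('a)" and fin: "finite_measure M" "finite_measure N"
    and sb: "sets M = sets borel" "sets N = sets borel"
begin

lemma sf: "sigma_finite_measure M" "sigma_finite_measure N"
  using fin by (auto simp: finite_measure_def)

lemma hp_measurable:
  assumes "f \<in> borel_measurable K" "g \<in> borel_measurable K"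
  shows "(\<lambda>x. heat_pot (f x) M (g x)) \<in> borel_measurable K" "(\<lambda>x. heat_pot (f x) N (g x)) \<in> borel_measurable K"
  using borel_measurable_heat_pot[OF sf(1) sb(1) assms] borel_measurable_heat_pot[OF sf(2) sb(2) assms] .

lemma energy_dist_add:
  "energy_dist \<alpha> M N + 2 * (riesz_const \<alpha> TYPE('a) * mutual_energy \<alpha> M N)
    = riesz_const \<alpha> TYPE('a) * energy \<alpha> M + riesz_const \<alpha> TYPE('a) * energy \<alpha> N"
proof -
  note [measurable] = hp_measurable
  let ?M = "\<lambda>s z. heat_pot (s / 2) M z" and ?N = "\<lambda>s z. heat_pot (s / 2) N z"
  have "energy_dist \<alpha> M N + 2 * (riesz_const \<alpha> TYPE('a) * mutual_energy \<alpha> M N)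
    = (\<integral>\<^sup>+s. \<integral>\<^sup>+z. sq_diff (?M s z) (?N s z) + 2 * (?M s z * ?N s z) \<partial>lborel \<partial>riesz_time \<alpha>)"
    unfolding energy_dist_def mutual_energy_heat[OF \<alpha> sf sb] by (simp add: nn_integral_add nn_integral_cmult)
  also have "\<dots> = (\<integral>\<^sup>+s. \<integral>\<^sup>+z. ?M s z * ?M s z + ?N s z * ?N s z \<partial>lborel \<partial>riesz_time \<alpha>)"
    by (intro nn_integral_cong_times sq_diff_add heat_pot_finite fin sb) auto
  also have "\<dots> = riesz_const \<alpha> TYPE('a) * energy \<alpha> M + riesz_const \<alpha> TYPE('a) * energy \<alpha> N"
    unfolding mutual_energy_heat[OF \<alpha> sf(1) sf(1) sb(1) sb(1)] mutual_energy_heat[OF \<alpha> sf(2) sf(2) sb(2) sb(2)]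
    by (simp add: nn_integral_add)
  finally show ?thesis .
qed

text \<open>From b^2 \<le> 2 (a - b)^2 + 2 a^2. Nothing bounds the energy of the negative part
  beforehand; it is recovered from the finite objective and from the energy of the positive part,
  which \<xi> controls.\<close>

lemma energy_finite_of_dist:
  assumes "energy_dist \<alpha> M N < \<infinity>" "energy \<alpha> M < \<infinity>"
  shows "energy \<alpha> N < \<infinity>"
proof -
  note [measurable] = hp_measurable
  let ?M = "\<lambda>s z. heat_pot (s / 2) M z" and ?N = "\<lambda>s z. heat_pot (s / 2) N z"
  have "riesz_const \<alpha> TYPE('a) * energy \<alpha> N = (\<integral>\<^sup>+s. \<integral>\<^sup>+z. ?N s z * ?N s z \<partial>lborel \<partial>riesz_time \<alpha>)"
    by (rule mutual_energy_heat[OF \<alpha> sf(2) sf(2) sb(2) sb(2)])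
  also have "\<dots> \<le> (\<integral>\<^sup>+s. \<integral>\<^sup>+z. 2 * sq_diff (?M s z) (?N s z) + 2 * (?M s z * ?M s z) \<partial>lborel \<partial>riesz_time \<alpha>)"
    by (intro nn_integral_mono_times sq_le_sq_diff heat_pot_finite fin sb) auto
  also have "\<dots> = 2 * energy_dist \<alpha> M N + 2 * (riesz_const \<alpha> TYPE('a) * energy \<alpha> M)"
    unfolding energy_dist_def mutual_energy_heat[OF \<alpha> sf(1) sf(1) sb(1) sb(1)]
    by (simp add: nn_integral_add nn_integral_cmult)
  also have "\<dots> < \<infinity>" using assms riesz_const_finite[OF \<alpha>] by (simp add: ennreal_mult_less_top)
  finally show ?thesis using riesz_const_pos[of \<alpha>, where 'a='a] by (auto simp: ennreal_mult_less_top)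
qed

lemma energy_dist_finite:
  assumes "energy \<alpha> M < \<infinity>" "energy \<alpha> N < \<infinity>"
  shows "energy_dist \<alpha> M N < \<infinity>"
proof -
  have "energy_dist \<alpha> M N \<le> energy_dist \<alpha> M N + 2 * (riesz_const \<alpha> TYPE('a) * mutual_energy \<alpha> M N)" by simp
  also have "\<dots> < \<infinity>" unfolding energy_dist_add using assms riesz_const_finite[OF \<alpha>] by (simp add: ennreal_mult_less_top)
  finally show ?thesis .
qed

end

section \<open>Existence of a minimizer for the relaxed problem\<close>

text \<open>The integrand is \<open>h p + (1 - h) q\<close> rather than \<open>h f\<close> so that everything stays in \<open>ennreal\<close>: for a
  field \<open>f \<ge> -q\<close> and \<open>p = f + q\<close> the two differ by the constant \<open>\<integral> q d\<xi>\<close>.\<close>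
locale relaxed_problem =
  fixes \<alpha> :: real and \<xi> :: "'a::euclidean_space measure" and A :: "'a set" and p q :: "'a \<Rightarrow> ennreal"
  assumes \<alpha>: "0 < \<alpha>" "\<alpha> < real DIM('a)"
    and fin\<xi>: "finite_measure \<xi>" and sets\<xi>: "sets \<xi> = sets borel" and E\<xi>: "energy \<alpha> \<xi> < \<infinity>"
    and A: "closed A" "A \<noteq> {}"
    and p [measurable]: "p \<in> borel_measurable borel" and q [measurable]: "q \<in> borel_measurable borel"
    and q_fin: "(\<integral>\<^sup>+x. q x \<partial>\<xi>) < \<infinity>"
begin

definition \<sigma> :: "('a \<Rightarrow> real) \<Rightarrow> 'a measure" where
  "\<sigma> h = density \<xi> (\<lambda>x. ennreal (h x))"

definition dens :: "('a \<Rightarrow> real) \<Rightarrow> bool" where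
  "dens h \<longleftrightarrow> h \<in> borel_measurable borel \<and> (\<forall>x. 0 \<le> h x \<and> h x \<le> 1) \<and> (\<integral>\<^sup>+x. ennreal (h x) \<partial>\<xi>) = 1"

definition sub :: "'a measure \<Rightarrow> bool" where
  "sub \<tau> \<longleftrightarrow> sets \<tau> = sets borel \<and> emeasure \<tau> UNIV \<le> 1 \<and> (AE x in \<tau>. x \<in> A)"

definition lin :: "('a \<Rightarrow> real) \<Rightarrow> ennreal" where
  "lin h = (\<integral>\<^sup>+x. ennreal (h x) * p x + ennreal (1 - h x) * q x \<partial>\<xi>)"

text \<open>With the \<open>p\<close> and \<open>q\<close> that the locale \<open>condenser\<close>
  inserts, this is on admissible pairs the weighted energy, shifted by a constant and multiplied by
  \<open>riesz_const\<close>.\<close>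

definition obj :: "('a \<Rightarrow> real) \<Rightarrow> 'a measure \<Rightarrow> ennreal" where
  "obj h \<tau> = energy_dist \<alpha> (\<sigma> h) \<tau> + 2 * lin h"

lemma sets\<sigma>: "sets (\<sigma> h) = sets borel"
  by (simp add: \<sigma>_def sets\<xi>)

lemma finite\<sigma>: "dens h \<Longrightarrow> finite_measure (\<sigma> h)"
  using space_eq_UNIV[OF sets\<sigma>, of h] space_eq_UNIV[OF sets\<xi>]
  by (intro finite_measureI) (auto simp: \<sigma>_def dens_def emeasure_density sets\<xi> cong: measurable_cong_sets)

lemma finite_sub: "sub \<tau> \<Longrightarrow> finite_measure \<tau>"
  using space_eq_UNIV[of \<tau>] by (intro finite_measureI) (auto simp: sub_def top_unique)

lemma energy\<sigma>: "dens h \<Longrightarrow> energy \<alpha> (\<sigma> h) < \<infinity>"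
proof -
  assume h: "dens h"
  interpret finite_measure \<xi> by (rule fin\<xi>)
  have "sigma_finite_measure \<xi>" by unfold_locales
  moreover have "ennreal (h x) \<le> 1" for x using h by (auto simp: dens_def)
  ultimately have "energy \<alpha> (\<sigma> h) \<le> energy \<alpha> \<xi>"
    unfolding \<sigma>_def using h by (intro energy_density_le sets\<xi>) (auto simp: dens_def)
  then show ?thesis using E\<xi> by auto
qed

lemma two: "dens h \<Longrightarrow> sub \<tau> \<Longrightarrow> two_measures \<alpha> (\<sigma> h) \<tau>"
  by (simp add: two_measures_def \<alpha> finite\<sigma> finite_sub sets\<sigma>) (simp add: sub_def)

lemma heat_pot_\<sigma>:
  assumes "h \<in> borel_measurable borel"
  shows "heat_pot s (\<sigma> h) z = (\<integral>\<^sup>+y. ennreal (h y) * ennreal (heat s (z - y)) \<partial>\<xi>)"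
proof -
  note [measurable_cong] = sets\<xi>
  note [measurable] = assms
  show ?thesis unfolding heat_pot_def \<sigma>_def by (intro nn_integral_density) auto
qed

definition mid :: "'a measure \<Rightarrow> 'a measure \<Rightarrow> 'a measure" where
  "mid \<tau> \<tau>' = density (measure_add \<tau> \<tau>') (\<lambda>_. inverse 2)"

lemma nn_integral_mid:
  assumes "sets \<tau> = sets borel" "sets \<tau>' = sets borel" "f \<in> borel_measurable borel"
  shows "(\<integral>\<^sup>+x. f x \<partial>mid \<tau> \<tau>') = ((\<integral>\<^sup>+x. f x \<partial>\<tau>) + (\<integral>\<^sup>+x. f x \<partial>\<tau>')) / 2"
proof -
  have [measurable]: "f \<in> borel_measurable \<tau>" "f \<in> borel_measurable (measure_add \<tau> \<tau>')"
    using assms by (simp_all cong: measurable_cong_sets)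
  have "(\<integral>\<^sup>+x. f x \<partial>mid \<tau> \<tau>') = (\<integral>\<^sup>+x. inverse 2 * f x \<partial>measure_add \<tau> \<tau>')"
    unfolding mid_def by (intro nn_integral_density) auto
  also have "\<dots> = inverse 2 * (\<integral>\<^sup>+x. f x \<partial>measure_add \<tau> \<tau>')" by (intro nn_integral_cmult) auto
  also have "(\<integral>\<^sup>+x. f x \<partial>measure_add \<tau> \<tau>') = (\<integral>\<^sup>+x. f x \<partial>\<tau>) + (\<integral>\<^sup>+x. f x \<partial>\<tau>')"
    by (intro nn_integral_measure_add) (auto simp: assms)
  finally show ?thesis by (simp add: divide_ennreal_def mult.commute)
qed

lemma sub_mid: "sub \<tau> \<Longrightarrow> sub \<tau>' \<Longrightarrow> sub (mid \<tau> \<tau>')"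
proof -
  assume t: "sub \<tau>" "sub \<tau>'"
  then have s: "sets \<tau> = sets borel" "sets \<tau>' = sets borel" by (auto simp: sub_def)
  have sm: "sets (mid \<tau> \<tau>') = sets borel" by (simp add: mid_def s)
  have "emeasure (mid \<tau> \<tau>') UNIV = (\<integral>\<^sup>+x. 1 \<partial>mid \<tau> \<tau>')" by (simp add: space_eq_UNIV[OF sm])
  also have "\<dots> = (emeasure \<tau> UNIV + emeasure \<tau>' UNIV) / 2"
    by (subst nn_integral_mid[OF s]) (auto simp: space_eq_UNIV s)
  also have "\<dots> \<le> (1 + 1) / 2" using t by (intro divide_right_mono_ennreal add_mono) (auto simp: sub_def)
  finally have "emeasure (mid \<tau> \<tau>') UNIV \<le> 1" by simp
  moreover have "AE x in mid \<tau> \<tau>'. x \<in> A"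
  proof -
    have m: "indicator (- A) \<in> borel_measurable (borel :: 'a measure)" using A by auto
    have "(\<integral>\<^sup>+x. indicator (- A) x \<partial>\<tau>) = 0" "(\<integral>\<^sup>+x. indicator (- A) x \<partial>\<tau>') = 0"
      using t by (auto simp: sub_def nn_integral_0_iff_AE cong: measurable_cong_sets elim!: eventually_mono intro!: nn_integral_zero' )
    then have "(\<integral>\<^sup>+x. indicator (- A) x \<partial>mid \<tau> \<tau>') = 0" using nn_integral_mid[OF s m] by simp
    then have "AE x in mid \<tau> \<tau>'. indicator (- A) x = (0::ennreal)"
      using m sm by (subst (asm) nn_integral_0_iff_AE) (auto cong: measurable_cong_sets)
    then show ?thesis by eventually_elim (auto simp: indicator_def split: if_splits)
  qed
  ultimately show ?thesis using sm by (simp add: sub_def)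
qed

lemma dens_mid: "dens h \<Longrightarrow> dens h' \<Longrightarrow> dens (\<lambda>x. (h x + h' x) / 2)"
proof -
  assume h: "dens h" "dens h'"
  note [measurable_cong] = sets\<xi>
  have [measurable]: "h \<in> borel_measurable borel" "h' \<in> borel_measurable borel" using h by (auto simp: dens_def)
  have 0: "0 \<le> h x" "0 \<le> h' x" "h x \<le> 1" "h' x \<le> 1" for x using h by (auto simp: dens_def)
  have "(\<integral>\<^sup>+x. ennreal ((h x + h' x) / 2) \<partial>\<xi>) = (\<integral>\<^sup>+x. (ennreal (h x) + ennreal (h' x)) / 2 \<partial>\<xi>)"
    using 0 by (intro nn_integral_cong) (simp add: divide_ennreal[symmetric])
  also have "\<dots> = ((\<integral>\<^sup>+x. ennreal (h x) \<partial>\<xi>) + (\<integral>\<^sup>+x. ennreal (h' x) \<partial>\<xi>)) / 2"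
    by (simp add: nn_integral_divide nn_integral_add)
  also have "\<dots> = 1" using h by (simp add: dens_def)
  finally have "(\<integral>\<^sup>+x. ennreal ((h x + h' x) / 2) \<partial>\<xi>) = 1" .
  moreover have "h x + h' x \<le> 2" for x using 0(3)[of x] 0(4)[of x] by linarith
  ultimately show ?thesis using 0 by (auto simp: dens_def)
qed

text \<open>\<open>lin\<close> is affine and \<open>energy_dist\<close> obeys the parallelogram law.
  The defect is kept exactly: existence uses that it is nonnegative, uniqueness that it vanishes for
  two minimizers.\<close>

lemma obj_midpoint:
  assumes h: "dens h" "dens h'" and t: "sub \<tau>" "sub \<tau>'"
  shows "2 * obj (\<lambda>x. (h x + h' x) / 2) (mid \<tau> \<tau>')
      + inverse 2 * energy_dist \<alpha> (measure_add (\<sigma> h) \<tau>') (measure_add (\<sigma> h') \<tau>) = obj h \<tau> + obj h' \<tau>'"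
proof -
  note [measurable_cong] = sets\<xi>
  let ?h = "\<lambda>x. (h x + h' x) / 2"
  have hm [measurable]: "h \<in> borel_measurable borel" "h' \<in> borel_measurable borel" using h by (auto simp: dens_def)
  have h0: "0 \<le> h x" "0 \<le> h' x" "h x \<le> 1" "h' x \<le> 1" for x using h by (auto simp: dens_def)
  have half: "ennreal ((x + y) / 2) = (ennreal x + ennreal y) / 2" if "0 \<le> x" "0 \<le> y" for x y
    using that divide_ennreal[of "x + y" 2] by simp
  have s: "sets \<tau> = sets borel" "sets \<tau>' = sets borel" using t by (auto simp: sub_def)
  interpret H: two_measures \<alpha> "\<sigma> h" \<tau> using h t by (intro two)
  interpret H': two_measures \<alpha> "\<sigma> h'" \<tau>' using h t by (intro two)
  interpret Hm: two_measures \<alpha> "\<sigma> ?h" "mid \<tau> \<tau>'" using h t by (intro two dens_mid sub_mid)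
  note [measurable] = H.hp_measurable H'.hp_measurable Hm.hp_measurable
  have 1: "heat_pot s (\<sigma> ?h) z = (heat_pot s (\<sigma> h) z + heat_pot s (\<sigma> h') z) / 2" for s z
  proof -
    have "heat_pot s (\<sigma> ?h) z = (\<integral>\<^sup>+y. (ennreal (h y) * ennreal (heat s (z - y)) + ennreal (h' y) * ennreal (heat s (z - y))) / 2 \<partial>\<xi>)"
      using h0 by (subst heat_pot_\<sigma>) (auto simp: half divide_ennreal_def distrib_left distrib_right ac_simps intro!: nn_integral_cong)
    then show ?thesis by (simp add: nn_integral_divide nn_integral_add heat_pot_\<sigma>)
  qed
  have 2: "heat_pot s (mid \<tau> \<tau>') z = (heat_pot s \<tau> z + heat_pot s \<tau>' z) / 2" for s z
    unfolding heat_pot_def by (intro nn_integral_mid s) auto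
  let ?D = "energy_dist \<alpha> (measure_add (\<sigma> h) \<tau>') (measure_add (\<sigma> h') \<tau>)"
  have 3: "heat_pot s (measure_add (\<sigma> h) \<tau>') z = heat_pot s (\<sigma> h) z + heat_pot s \<tau>' z"
    "heat_pot s (measure_add (\<sigma> h') \<tau>) z = heat_pot s (\<sigma> h') z + heat_pot s \<tau> z" for s z
  proof -
    note [measurable_cong] = sets\<sigma>
    show "heat_pot s (measure_add (\<sigma> h) \<tau>') z = heat_pot s (\<sigma> h) z + heat_pot s \<tau>' z"
      "heat_pot s (measure_add (\<sigma> h') \<tau>) z = heat_pot s (\<sigma> h') z + heat_pot s \<tau> z"
      unfolding heat_pot_def by (intro nn_integral_measure_add; simp add: s sets\<sigma>)+
  qed
  have "2 * energy_dist \<alpha> (\<sigma> ?h) (mid \<tau> \<tau>') + inverse 2 * ?D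
    = (\<integral>\<^sup>+s. \<integral>\<^sup>+z. 2 * sq_diff (heat_pot (s / 2) (\<sigma> ?h) z) (heat_pot (s / 2) (mid \<tau> \<tau>') z)
        + inverse 2 * sq_diff (heat_pot (s / 2) (\<sigma> h) z + heat_pot (s / 2) \<tau>' z) (heat_pot (s / 2) (\<sigma> h') z + heat_pot (s / 2) \<tau> z) \<partial>lborel \<partial>riesz_time \<alpha>)"
    unfolding energy_dist_def 3 by (simp add: nn_integral_cmult nn_integral_add)
  also have "\<dots> = (\<integral>\<^sup>+s. \<integral>\<^sup>+z. sq_diff (heat_pot (s / 2) (\<sigma> h) z) (heat_pot (s / 2) \<tau> z) + sq_diff (heat_pot (s / 2) (\<sigma> h') z) (heat_pot (s / 2) \<tau>' z) \<partial>lborel \<partial>riesz_time \<alpha>)"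
    unfolding 1 2 by (intro nn_integral_cong_times sq_diff_midpoint heat_pot_finite H.fin H.sb H'.fin H'.sb) auto
  also have "\<dots> = energy_dist \<alpha> (\<sigma> h) \<tau> + energy_dist \<alpha> (\<sigma> h') \<tau>'"
    unfolding energy_dist_def by (simp add: nn_integral_add)
  finally have e: "2 * energy_dist \<alpha> (\<sigma> ?h) (mid \<tau> \<tau>') + inverse 2 * ?D = energy_dist \<alpha> (\<sigma> h) \<tau> + energy_dist \<alpha> (\<sigma> h') \<tau>'" .
  have "lin ?h = (\<integral>\<^sup>+x. ((ennreal (h x) * p x + ennreal (1 - h x) * q x) + (ennreal (h' x) * p x + ennreal (1 - h' x) * q x)) / 2 \<partial>\<xi>)"
    unfolding lin_def
  proof (intro nn_integral_cong)
    fix x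
    have "1 - (h x + h' x) / 2 = ((1 - h x) + (1 - h' x)) / 2" by (simp add: field_simps)
    then have "ennreal (1 - (h x + h' x) / 2) = (ennreal (1 - h x) + ennreal (1 - h' x)) / 2"
      using h0[of x] by (simp only: half)
    then show "ennreal ((h x + h' x) / 2) * p x + ennreal (1 - (h x + h' x) / 2) * q x
      = ((ennreal (h x) * p x + ennreal (1 - h x) * q x) + (ennreal (h' x) * p x + ennreal (1 - h' x) * q x)) / 2"
      using h0[of x] by (simp add: half divide_ennreal_def distrib_right distrib_left ac_simps)
  qed
  also have "\<dots> = (lin h + lin h') / 2"
    unfolding lin_def by (simp add: nn_integral_divide nn_integral_add)
  finally have "2 * lin ?h = 2 * ((lin h + lin h') / 2)" by simp
  also have "\<dots> = (lin h + lin h') * 2 / 2" by (simp only: ennreal_times_divide mult.commute)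
  also have "\<dots> = lin h + lin h'" by (rule mult_divide_eq_ennreal) auto
  finally have l: "2 * lin ?h = lin h + lin h'" .
  have "2 * obj ?h (mid \<tau> \<tau>') + inverse 2 * ?D
      = (2 * energy_dist \<alpha> (\<sigma> ?h) (mid \<tau> \<tau>') + inverse 2 * ?D) + 2 * (2 * lin ?h)"
    by (simp add: obj_def distrib_left ac_simps)
  also have "\<dots> = obj h \<tau> + obj h' \<tau>'" unfolding e l by (simp add: obj_def distrib_left ac_simps)
  finally show ?thesis .
qed

lemma obj_convex:
  assumes "dens h" "dens h'" "sub \<tau>" "sub \<tau>'"
  shows "2 * obj (\<lambda>x. (h x + h' x) / 2) (mid \<tau> \<tau>') \<le> obj h \<tau> + obj h' \<tau>'"
  unfolding obj_midpoint[OF assms, symmetric] by simp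

end

text \<open>Heat kernels are thereby admissible test functions for vague convergence, which makes
  heat potentials converge pointwise.\<close>

lemma compact_heat_superlevel:
  fixes z :: "'a::euclidean_space"
  assumes s: "0 < s" and \<epsilon>: "0 < \<epsilon>"
  shows "continuous_on UNIV (\<lambda>y. heat s (z - y))" "compact {y. \<epsilon> \<le> heat s (z - y)}"
proof -
  show c: "continuous_on UNIV (\<lambda>y. heat s (z - y))"
    unfolding heat_eq[OF s] using s by (intro continuous_intros) auto
  define C where "C = (1 / sqrt (pi * s)) ^ DIM('a)"
  have C: "C > 0" using s by (simp add: C_def)
  have "dist z y \<le> sqrt (s * C / \<epsilon>)" if "\<epsilon> \<le> heat s (z - y)" for y
  proof -
    define u where "u = (norm (z - y))\<^sup>2 / s"
    have u: "0 \<le> u" using s by (simp add: u_def)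
    have "\<epsilon> \<le> C * exp (- u)" using that s by (simp add: heat_eq C_def u_def)
    moreover have "u \<le> exp u" using exp_ge_add_one_self[of u] by linarith
    then have "u * exp (- u) \<le> exp u * exp (- u)" by (intro mult_right_mono) auto
    then have "u * exp (- u) \<le> 1" by (simp add: exp_minus)
    ultimately have "u * \<epsilon> \<le> u * (C * exp (- u))" using u by (intro mult_left_mono)
    also have "\<dots> \<le> C" using mult_left_mono[OF \<open>u * exp (- u) \<le> 1\<close>, of C] C by (simp add: ac_simps)
    finally have "u \<le> C / \<epsilon>" using \<epsilon> by (simp add: field_simps)
    then have "(norm (z - y))\<^sup>2 \<le> s * C / \<epsilon>" using s by (simp add: u_def field_simps)
    then show ?thesis unfolding dist_norm by (rule real_le_rsqrt)
  qed
  then have "bounded {y. \<epsilon> \<le> heat s (z - y)}" by (auto simp: bounded_def)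
  moreover have "closed {y. \<epsilon> \<le> heat s (z - y)}" using c by (intro closed_Collect_le continuous_intros)
  ultimately show "compact {y. \<epsilon> \<le> heat s (z - y)}" by (simp add: compact_eq_bounded_closed)
qed

text \<open>The field may be infinite. Multiplication by \<top> is not continuous at 0, but the
  lower estimate survives because \<top> * 0 = 0.\<close>

lemma liminf_mult_ge:
  assumes "(\<lambda>j. ennreal (a j)) \<longlonglongrightarrow> ennreal b"
  shows "ennreal b * c \<le> liminf (\<lambda>j. ennreal (a j) * c)"
proof (cases "c = \<top>")
  case False
  then have "(\<lambda>j. c * ennreal (a j)) \<longlonglongrightarrow> c * ennreal b"
    using assms by (intro ennreal_tendsto_cmult) (auto simp: less_top)
  then have "liminf (\<lambda>j. c * ennreal (a j)) = c * ennreal b" by (intro lim_imp_Liminf) auto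
  then show ?thesis by (simp add: mult.commute)
next
  case True
  show ?thesis
  proof (cases "ennreal b = 0")
    case False
    then have "eventually (\<lambda>j. 0 < ennreal (a j)) sequentially"
      using order_tendstoD(1)[OF assms, of 0] by (simp add: zero_less_iff_neq_zero)
    then have "eventually (\<lambda>j. \<top> \<le> ennreal (a j) * c) sequentially"
      by eventually_elim (simp add: True ennreal_mult_top)
    then have "\<top> \<le> liminf (\<lambda>j. ennreal (a j) * c)" by (intro Liminf_bounded)
    then show ?thesis by (simp add: top_unique)
  qed simp
qed

context relaxed_problem
begin

text \<open>Heat potentials converge, on the side of \<xi> by dominated convergence and on the other
  side by vague convergence, so Fatou applies to the energy; almost everywhere convergence of the
  densities lets it apply to \<open>lin\<close>. The mass 1 of the densities survives because \<xi>
  is finite.\<close>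

lemma obj_lsc:
  assumes H: "\<And>j. dens (H j)" and T: "\<And>j. sub (T j)" and hm [measurable]: "h \<in> borel_measurable borel"
    and h01: "\<And>x. 0 \<le> h x \<and> h x \<le> 1" and Hh: "AE x in \<xi>. (\<lambda>j. H j x) \<longlonglongrightarrow> h x"
    and \<tau>: "sets \<tau> = sets borel" "emeasure \<tau> UNIV \<le> 1"
    and vague: "\<And>g. continuous_on UNIV g \<Longrightarrow> (\<And>x. 0 \<le> g x) \<Longrightarrow> (\<And>\<epsilon>. 0 < \<epsilon> \<Longrightarrow> compact {x. \<epsilon> \<le> g x}) \<Longrightarrow>
       (\<lambda>j. \<integral>\<^sup>+x. ennreal (g x) \<partial>T j) \<longlonglongrightarrow> (\<integral>\<^sup>+x. ennreal (g x) \<partial>\<tau>)"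
  shows "dens h" "sub \<tau>" "obj h \<tau> \<le> liminf (\<lambda>j. obj (H j) (T j))"
proof -
  interpret \<xi>: finite_measure \<xi> by (rule fin\<xi>)
  note [measurable_cong] = sets\<xi>
  have Hm [measurable]: "H j \<in> borel_measurable borel" for j using H by (simp add: dens_def)
  have H01: "0 \<le> H j x" "H j x \<le> 1" for j x using H by (auto simp: dens_def)
  have conv: "(\<lambda>j. \<integral>\<^sup>+x. ennreal (H j x) * ennreal (f x) \<partial>\<xi>) \<longlonglongrightarrow> (\<integral>\<^sup>+x. ennreal (h x) * ennreal (f x) \<partial>\<xi>)"
    if [measurable]: "f \<in> borel_measurable borel" and f: "\<And>x. 0 \<le> f x" "\<And>x. f x \<le> b" for f b
  proof (rule nn_integral_dominated_convergence[where w="\<lambda>_. ennreal b"])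
    show "AE x in \<xi>. ennreal (H j x) * ennreal (f x) \<le> ennreal b" for j
    proof (intro AE_I2)
      fix x
      have "ennreal (H j x) * ennreal (f x) \<le> 1 * ennreal b"
        using H01[of j x] f[of x] by (intro mult_mono) (auto intro: ennreal_leI)
      then show "ennreal (H j x) * ennreal (f x) \<le> ennreal b" by simp
    qed
    show "(\<integral>\<^sup>+x. ennreal b \<partial>\<xi>) < \<infinity>"
      using \<xi>.emeasure_finite[of "space \<xi>", unfolded top.not_eq_extremum] by (simp add: ennreal_mult_less_top)
    show "AE x in \<xi>. (\<lambda>j. ennreal (H j x) * ennreal (f x)) \<longlonglongrightarrow> ennreal (h x) * ennreal (f x)"
      using Hh
    proof eventually_elim
      fix x assume "(\<lambda>j. H j x) \<longlonglongrightarrow> h x"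
      then have "(\<lambda>j. ennreal (H j x * f x)) \<longlonglongrightarrow> ennreal (h x * f x)"
        by (intro tendsto_ennrealI tendsto_mult_right)
      then show "(\<lambda>j. ennreal (H j x) * ennreal (f x)) \<longlonglongrightarrow> ennreal (h x) * ennreal (f x)"
        using H01 h01 f by (simp add: ennreal_mult)
    qed
  qed auto
  have "(\<lambda>j. \<integral>\<^sup>+x. ennreal (H j x) \<partial>\<xi>) \<longlonglongrightarrow> (\<integral>\<^sup>+x. ennreal (h x) \<partial>\<xi>)"
    using conv[of "\<lambda>_. 1" 1] by simp
  moreover have "(\<lambda>j. \<integral>\<^sup>+x. ennreal (H j x) \<partial>\<xi>) = (\<lambda>_. 1)" using H by (simp add: dens_def)
  ultimately have "(\<integral>\<^sup>+x. ennreal (h x) \<partial>\<xi>) = 1" using LIMSEQ_unique[OF _ tendsto_const] by simp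
  then show dh: "dens h" using h01 by (simp add: dens_def)
  show s\<tau>: "sub \<tau>"
  proof -
    obtain a where a: "a \<in> A" using A by blast
    \<comment> \<open>g is positive exactly off the closed set A and tends to 0 at infinity, as the
      square in the denominator beats the linear growth of the distance. Vague convergence therefore
      carries the condition of being carried by A to the limit.\<close>
    define g where "g x = infdist x A / (1 + norm x)\<^sup>2" for x
    have p: "0 < 1 + norm x" for x :: 'a by (simp add: add_pos_nonneg)
    have gc: "continuous_on UNIV g"
      unfolding g_def using p by (intro continuous_intros) (metis less_irrefl power_eq_0_iff)
    have g0: "0 \<le> g x" for x by (simp add: g_def infdist_nonneg)
    have bd: "compact {x. \<epsilon> \<le> g x}" if \<epsilon>: "0 < \<epsilon>" for \<epsilon>
    proof -
      have "norm x \<le> (1 + norm a) / \<epsilon>" if x: "\<epsilon> \<le> g x" for x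
      proof -
        have "infdist x A \<le> dist x a" using a by (rule infdist_le)
        also have "\<dots> \<le> norm x + norm a" unfolding dist_norm by (rule norm_triangle_ineq4)
        also have "\<dots> \<le> (1 + norm a) * (1 + norm x)" by (simp add: algebra_simps)
        finally have "infdist x A \<le> (1 + norm a) * (1 + norm x)" .
        moreover have "\<epsilon> * (1 + norm x)\<^sup>2 \<le> infdist x A" using x p[of x] by (simp add: g_def pos_le_divide_eq)
        ultimately have "(\<epsilon> * (1 + norm x)) * (1 + norm x) \<le> (1 + norm a) * (1 + norm x)" by (simp add: power2_eq_square mult.assoc)
        then have "\<epsilon> * (1 + norm x) \<le> 1 + norm a" using p[of x] by simp
        then have "1 + norm x \<le> (1 + norm a) / \<epsilon>" using \<epsilon> by (simp add: pos_le_divide_eq mult.commute)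
        then show ?thesis by simp
      qed
      then have "bounded {x. \<epsilon> \<le> g x}" by (auto simp: bounded_iff)
      moreover have "closed {x. \<epsilon> \<le> g x}" using gc by (intro closed_Collect_le continuous_intros)
      ultimately show ?thesis by (simp add: compact_eq_bounded_closed)
    qed
    have "(\<integral>\<^sup>+x. ennreal (g x) \<partial>T j) = 0" for j
    proof -
      have "(\<integral>\<^sup>+x. ennreal (g x) \<partial>T j) = (\<integral>\<^sup>+x. 0 \<partial>T j)"
      proof (intro nn_integral_cong_AE)
        have "AE x in T j. x \<in> A" using T by (simp add: sub_def)
        then show "AE x in T j. ennreal (g x) = 0" by eventually_elim (simp add: g_def)
      qed
      then show ?thesis by simp
    qed
    then have "(\<lambda>j. 0) \<longlonglongrightarrow> (\<integral>\<^sup>+x. ennreal (g x) \<partial>\<tau>)" using vague[OF gc g0 bd] by simp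
    then have "(\<integral>\<^sup>+x. ennreal (g x) \<partial>\<tau>) = 0" using LIMSEQ_unique tendsto_const by blast
    moreover have "g \<in> borel_measurable \<tau>"
      using borel_measurable_continuous_onI[OF gc] \<tau>(1) by (simp cong: measurable_cong_sets)
    ultimately have "AE x in \<tau>. ennreal (g x) = 0" by (subst (asm) nn_integral_0_iff_AE) auto
    then have "AE x in \<tau>. x \<in> A"
    proof eventually_elim
      fix x assume "ennreal (g x) = 0"
      then have "infdist x A = 0" using p[of x] infdist_nonneg[of x A] by (auto simp: g_def ennreal_eq_0_iff divide_le_0_iff)
      then show "x \<in> A" using A in_closed_iff_infdist_zero by blast
    qed
    then show ?thesis using \<tau> by (simp add: sub_def)
  qed
  interpret L: two_measures \<alpha> "\<sigma> h" \<tau> using dh s\<tau> by (rule two)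
  have TH: "two_measures \<alpha> (\<sigma> (H j)) (T j)" for j using H T by (rule two)
  have l\<sigma>: "(\<lambda>j. heat_pot s (\<sigma> (H j)) z) \<longlonglongrightarrow> heat_pot s (\<sigma> h) z" if "0 < s" for s z
    unfolding heat_pot_\<sigma>[OF Hm] heat_pot_\<sigma>[OF hm] by (rule conv) (auto intro: heat_le_0 that)
  have l\<tau>: "(\<lambda>j. heat_pot s (T j) z) \<longlonglongrightarrow> heat_pot s \<tau> z" if "0 < s" for s z
    unfolding heat_pot_def
    by (rule vague[OF compact_heat_superlevel(1)[OF that zero_less_one] heat_nonneg compact_heat_superlevel(2)[OF that]])
  have lsq: "(\<lambda>j. sq_diff (heat_pot s (\<sigma> (H j)) z) (heat_pot s (T j) z)) \<longlonglongrightarrow> sq_diff (heat_pot s (\<sigma> h) z) (heat_pot s \<tau> z)"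
    if "0 < s" for s z
    unfolding sq_diff_def
    using heat_pot_finite[OF L.fin(1) L.sb(1) that] heat_pot_finite[OF L.fin(2) L.sb(2) that] l\<sigma>[OF that] l\<tau>[OF that]
    by (intro tendsto_ennrealI tendsto_intros tendsto_enn2real) auto
  let ?q = "\<lambda>j s z. sq_diff (heat_pot (s / 2) (\<sigma> (H j)) z) (heat_pot (s / 2) (T j) z)"
  note [measurable] = two_measures.hp_measurable[OF TH]
  have "energy_dist \<alpha> (\<sigma> h) \<tau> = (\<integral>\<^sup>+s. \<integral>\<^sup>+z. liminf (\<lambda>j. ?q j s z) \<partial>lborel \<partial>riesz_time \<alpha>)"
    unfolding energy_dist_def by (intro nn_integral_cong_times lim_imp_Liminf[symmetric] lsq) auto
  also have "\<dots> \<le> (\<integral>\<^sup>+s. liminf (\<lambda>j. \<integral>\<^sup>+z. ?q j s z \<partial>lborel) \<partial>riesz_time \<alpha>)"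
    by (intro nn_integral_mono nn_integral_liminf) measurable
  also have "\<dots> \<le> liminf (\<lambda>j. energy_dist \<alpha> (\<sigma> (H j)) (T j))"
    unfolding energy_dist_def by (intro nn_integral_liminf) measurable
  finally have e: "energy_dist \<alpha> (\<sigma> h) \<tau> \<le> liminf (\<lambda>j. energy_dist \<alpha> (\<sigma> (H j)) (T j))" .
  have "lin h \<le> (\<integral>\<^sup>+x. liminf (\<lambda>j. ennreal (H j x) * p x + ennreal (1 - H j x) * q x) \<partial>\<xi>)"
    unfolding lin_def
  proof (intro nn_integral_mono_AE, use Hh in eventually_elim)
    fix x assume x: "(\<lambda>j. H j x) \<longlonglongrightarrow> h x"
    show "ennreal (h x) * p x + ennreal (1 - h x) * q x \<le> liminf (\<lambda>j. ennreal (H j x) * p x + ennreal (1 - H j x) * q x)"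
      by (intro liminf_add_ge liminf_mult_ge tendsto_ennrealI tendsto_intros x)
  qed
  also have "\<dots> \<le> liminf (\<lambda>j. lin (H j))" unfolding lin_def by (intro nn_integral_liminf) measurable
  finally have "2 * lin h \<le> liminf (\<lambda>j. 2 * lin (H j))" by (intro liminf_cmult_ge) auto
  with e show "obj h \<tau> \<le> liminf (\<lambda>j. obj (H j) (T j))"
    unfolding obj_def by (rule liminf_add_ge)
qed

section \<open>Strong convergence of densities\<close>

lemma dens_parallelogram:
  assumes h: "dens h" and h': "dens h'"
  shows "(LINT x|\<xi>. (h x - h' x)\<^sup>2) = 2 * (LINT x|\<xi>. (h x)\<^sup>2) + 2 * (LINT x|\<xi>. (h' x)\<^sup>2) - 4 * (LINT x|\<xi>. ((h x + h' x) / 2)\<^sup>2)"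
    "integrable \<xi> (\<lambda>x. (h x - h' x)\<^sup>2)" "integrable \<xi> (\<lambda>x. (h x)\<^sup>2)"
proof -
  interpret \<xi>: finite_measure \<xi> by (rule fin\<xi>)
  note [measurable_cong] = sets\<xi>
  have [measurable]: "h \<in> borel_measurable borel" "h' \<in> borel_measurable borel" using h h' by (auto simp: dens_def)
  have 0: "\<bar>h x\<bar> \<le> 1" "\<bar>h' x\<bar> \<le> 1" for x using h h' unfolding dens_def by (simp_all add: abs_of_nonneg)
  have int: "integrable \<xi> (\<lambda>x. (c * h x + d * h' x)\<^sup>2)" for c d :: real
  proof (rule \<xi>.integrable_const_bound[where B="(\<bar>c\<bar> + \<bar>d\<bar>)\<^sup>2"])
    have "\<bar>c * h x + d * h' x\<bar> \<le> \<bar>c\<bar> + \<bar>d\<bar>" for x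
    proof -
      have "\<bar>c * h x + d * h' x\<bar> \<le> \<bar>c\<bar> * \<bar>h x\<bar> + \<bar>d\<bar> * \<bar>h' x\<bar>" by (metis abs_mult abs_triangle_ineq)
      also have "\<dots> \<le> \<bar>c\<bar> * 1 + \<bar>d\<bar> * 1" using 0 by (intro add_mono mult_left_mono) auto
      finally show ?thesis by simp
    qed
    then show "AE x in \<xi>. norm ((c * h x + d * h' x)\<^sup>2) \<le> (\<bar>c\<bar> + \<bar>d\<bar>)\<^sup>2"
      by (intro AE_I2) (simp add: abs_le_square_iff[symmetric])
  qed measurable
  show "integrable \<xi> (\<lambda>x. (h x - h' x)\<^sup>2)" "integrable \<xi> (\<lambda>x. (h x)\<^sup>2)" using int[of 1 "-1"] int[of 1 0] by auto
  have i: "integrable \<xi> (\<lambda>x. (h x)\<^sup>2)" "integrable \<xi> (\<lambda>x. (h' x)\<^sup>2)" "integrable \<xi> (\<lambda>x. ((h x + h' x) / 2)\<^sup>2)"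
    using int[of 1 0] int[of 0 1] int[of "1 / 2" "1 / 2"] by (auto simp: add_divide_distrib)
  have "(LINT x|\<xi>. (h x - h' x)\<^sup>2) = (LINT x|\<xi>. (2 * (h x)\<^sup>2 + 2 * (h' x)\<^sup>2) - 4 * ((h x + h' x) / 2)\<^sup>2)"
    by (intro Bochner_Integration.integral_cong) (auto simp: power2_eq_square field_simps)
  also have "\<dots> = 2 * (LINT x|\<xi>. (h x)\<^sup>2) + 2 * (LINT x|\<xi>. (h' x)\<^sup>2) - 4 * (LINT x|\<xi>. ((h x + h' x) / 2)\<^sup>2)"
    using i by (simp del: power_divide)
  finally show "(LINT x|\<xi>. (h x - h' x)\<^sup>2) = 2 * (LINT x|\<xi>. (h x)\<^sup>2) + 2 * (LINT x|\<xi>. (h' x)\<^sup>2) - 4 * (LINT x|\<xi>. ((h x + h' x) / 2)\<^sup>2)" .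
qed

text \<open>The argument of Riesz and Fischer: along a rapidly Cauchy subsequence the consecutive
  differences are absolutely summable almost everywhere.\<close>

lemma subsequence_converges_AE:
  assumes H: "\<And>k. dens (H k)" and e: "e \<longlonglongrightarrow> (0::real)"
    and C: "\<And>k l. k \<le> l \<Longrightarrow> (LINT x|\<xi>. (H k x - H l x)\<^sup>2) \<le> e k"
  obtains r where "strict_mono r" "AE x in \<xi>. convergent (\<lambda>j. H (r j) x)"
proof -
  interpret \<xi>: finite_measure \<xi> by (rule fin\<xi>)
  note [measurable_cong] = sets\<xi>
  have [measurable]: "H k \<in> borel_measurable borel" for k using H by (auto simp: dens_def)
  have "\<forall>j. \<exists>K. \<forall>k\<ge>K. e k < (1 / 4) ^ j"
    using order_tendstoD(2)[OF e] by (auto simp: eventually_sequentially)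
  then obtain K where K: "\<And>j k. K j \<le> k \<Longrightarrow> e k < (1 / 4) ^ j" by metis
  \<comment> \<open>The summand j makes r strictly increasing, and the sum makes it dominate
    K.\<close>
  define r where "r j = j + (\<Sum>i\<le>j. K i)" for j
  have r: "strict_mono r" unfolding strict_mono_Suc_iff by (simp add: r_def)
  have rK: "K j \<le> r j" for j unfolding r_def by (simp add: trans_le_add2 member_le_sum)
  let ?D = "\<lambda>j x. H (r j) x - H (r (Suc j)) x"
  define B where "B = measure \<xi> (space \<xi>)"
  have D: "(\<integral>\<^sup>+x. ennreal \<bar>?D j x\<bar> \<partial>\<xi>) \<le> ennreal ((1 / 2) ^ j * (1 + B))" for j
  proof -
    \<comment> \<open>From (2 ^ j * |d| - 1)^2 \<ge> 0. The weights turn the bound (1/4) ^ j in L2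
      into one of order (1/2) ^ j in L1, which is summable; the finite mass B of \<xi> enters
      through the constant term.\<close>
    have le: "\<bar>d\<bar> \<le> 2 ^ j * d\<^sup>2 + (1 / 2) ^ j" for d :: real
    proof -
      have "0 \<le> (2 ^ j * \<bar>d\<bar> - 1)\<^sup>2" by simp
      then have "2 ^ j * (2 * \<bar>d\<bar>) \<le> 2 ^ j * (2 ^ j * d\<^sup>2 + (1 / 2) ^ j)"
        by (simp add: power2_eq_square algebra_simps power_divide abs_mult_self_eq)
      then have "2 * \<bar>d\<bar> \<le> 2 ^ j * d\<^sup>2 + (1 / 2) ^ j" by (simp del: power_divide)
      then show ?thesis by linarith
    qed
    note par = dens_parallelogram(2)[OF H[of "r j"] H[of "r (Suc j)"]]
    have "(\<integral>\<^sup>+x. ennreal \<bar>?D j x\<bar> \<partial>\<xi>) \<le> (\<integral>\<^sup>+x. ennreal (2 ^ j * (?D j x)\<^sup>2 + (1 / 2) ^ j) \<partial>\<xi>)"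
      using le by (intro nn_integral_mono ennreal_leI)
    also have "\<dots> = ennreal (LINT x|\<xi>. 2 ^ j * (?D j x)\<^sup>2 + (1 / 2) ^ j)"
      using par by (intro nn_integral_eq_integral) auto
    also have "(LINT x|\<xi>. 2 ^ j * (?D j x)\<^sup>2 + (1 / 2) ^ j) = 2 ^ j * (LINT x|\<xi>. (?D j x)\<^sup>2) + (1 / 2) ^ j * B"
      using par by (simp add: B_def)
    also have "\<dots> \<le> 2 ^ j * (1 / 4) ^ j + (1 / 2) ^ j * B"
    proof -
      have "r j < r (Suc j)" using r by (simp add: strict_mono_Suc_iff)
      then have "(LINT x|\<xi>. (?D j x)\<^sup>2) \<le> (1 / 4) ^ j"
        using C[of "r j" "r (Suc j)"] K[OF rK[of j]] by simp
      then show ?thesis by (intro add_right_mono mult_left_mono) auto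
    qed
    also have "(2 ^ j * (1 / 4) ^ j :: real) = (1 / 2) ^ j" by (simp add: power_mult_distrib[symmetric])
    finally show ?thesis by (simp add: distrib_left ennreal_leI)
  qed
  have "(\<integral>\<^sup>+x. (\<Sum>j. ennreal \<bar>?D j x\<bar>) \<partial>\<xi>) = (\<Sum>j. \<integral>\<^sup>+x. ennreal \<bar>?D j x\<bar> \<partial>\<xi>)"
    by (intro nn_integral_suminf) auto
  also have "\<dots> \<le> (\<Sum>j. ennreal ((1 / 2) ^ j * (1 + B)))" by (intro suminf_le D) auto
  also have "\<dots> < \<infinity>"
  proof -
    have "summable (\<lambda>j. (1 / 2) ^ j * (1 + B))" by (intro summable_mult2 summable_geometric) simp
    then show ?thesis by (subst suminf_ennreal2) (auto simp: B_def)
  qed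
  finally have "AE x in \<xi>. (\<Sum>j. ennreal \<bar>?D j x\<bar>) \<noteq> \<infinity>" by (intro nn_integral_PInf_AE) auto
  then have "AE x in \<xi>. convergent (\<lambda>j. H (r j) x)"
  proof eventually_elim
    fix x assume "(\<Sum>j. ennreal \<bar>?D j x\<bar>) \<noteq> \<infinity>"
    then have "summable (\<lambda>j. \<bar>?D j x\<bar>)" by (intro summable_suminf_not_top) auto
    then have "summable (\<lambda>j. ?D j x)" by (rule summable_rabs_cancel)
    then have "convergent (\<lambda>n. \<Sum>j<n. ?D j x)" by (simp add: summable_iff_convergent)
    moreover have "(\<lambda>n. \<Sum>j<n. ?D j x) = (\<lambda>n. H (r 0) x - H (r n) x)"
      by (intro ext sum_lessThan_telescope')
    ultimately have c: "convergent (\<lambda>n. H (r 0) x - H (r n) x)" by simp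
    from convergent_diff[OF convergent_const[of "H (r 0) x"] c]
    show "convergent (\<lambda>j. H (r j) x)" by simp
  qed
  then show thesis using that[OF r] by blast
qed

end

lemma parallelogram_bound:
  fixes x :: real
  assumes "x \<le> v + w" "y \<le> L + w" "v \<le> z"
  shows "2 * x + 2 * y - 4 * z \<le> 2 * (L - v) + 4 * w"
  using assms by (simp add: algebra_simps)

lemma variation_bound: "0 \<le> 2 * (t - s) + e \<Longrightarrow> e \<le> s - t \<Longrightarrow> s \<le> (t::real)"
  by (simp add: algebra_simps)

context relaxed_problem
begin

text \<open>Among nearly minimizing pairs those with nearly minimal \<open>L\<^sup>2(\<xi>)\<close> norm of the density are chosen:
  then the densities converge strongly, by the parallelogram law.\<close>
theorem exists_minimizer:
  assumes ne: "dens h0" "sub \<tau>0" "obj h0 \<tau>0 < \<infinity>"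
  obtains h \<tau> where "dens h" "sub \<tau>" "obj h \<tau> < \<infinity>" "\<And>h' \<tau>'. dens h' \<Longrightarrow> sub \<tau>' \<Longrightarrow> obj h \<tau> \<le> obj h' \<tau>'"
proof -
  interpret \<xi>: finite_measure \<xi> by (rule fin\<xi>)
  note [measurable_cong] = sets\<xi>
  define Adm where "Adm = {x. dens (fst x) \<and> sub (snd x)}"
  define I where "I = (INF x\<in>Adm. obj (fst x) (snd x))"
  have I_le: "I \<le> obj h' \<tau>'" if "dens h'" "sub \<tau>'" for h' \<tau>'
    unfolding I_def using that by (intro INF_lower2[of "(h', \<tau>')"]) (auto simp: Adm_def)
  have Ifin: "I < \<infinity>" using I_le[OF ne(1,2)] ne(3) by (rule le_less_trans)
  define N where "N h = (LINT x|\<xi>. (h x)\<^sup>2)" for h :: "'a \<Rightarrow> real"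
  define B where "B = measure \<xi> (space \<xi>)"
  have N0: "0 \<le> N h" for h by (simp add: N_def)
  have NB: "N h \<le> B" if "dens h" for h
  proof -
    have "N h \<le> (LINT x|\<xi>. 1)"
      unfolding N_def using dens_parallelogram(3)[OF that that] that
      by (intro integral_mono) (auto simp: dens_def power_le_one)
    then show ?thesis by (simp add: B_def)
  qed
  define S where "S k = {x \<in> Adm. obj (fst x) (snd x) \<le> I + ennreal (1 / real (Suc k))}" for k
  have Sne: "S k \<noteq> {}" for k
  proof -
    have "I + 0 < I + ennreal (1 / real (Suc k))"
      using Ifin by (subst ennreal_add_left_cancel_less) auto
    then have "(INF x\<in>Adm. obj (fst x) (snd x)) < I + ennreal (1 / real (Suc k))" by (simp add: I_def)
    then obtain x where "x \<in> Adm" "obj (fst x) (snd x) < I + ennreal (1 / real (Suc k))"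
      unfolding INF_less_iff by blast
    then have "x \<in> S k" by (simp add: S_def less_imp_le)
    then show ?thesis by blast
  qed
  have Smono: "S l \<subseteq> S k" if "k \<le> l" for k l
  proof
    fix x assume x: "x \<in> S l"
    have "ennreal (1 / real (Suc l)) \<le> ennreal (1 / real (Suc k))" using that by (intro ennreal_leI frac_le) auto
    then have "I + ennreal (1 / real (Suc l)) \<le> I + ennreal (1 / real (Suc k))" by (intro add_left_mono)
    with x show "x \<in> S k" by (auto simp: S_def intro: order_trans)
  qed
  \<comment> \<open>The classes S k shrink as k grows, so these infima increase; they are bounded by
    the mass of \<xi> and hence converge. This is what makes the error e k tend to 0.\<close>
  define n where "n k = (INF x\<in>S k. N (fst x))" for k
  have bdd: "bdd_below ((\<lambda>x. N (fst x)) ` S k)" for k using N0 by (auto simp: bdd_below_def)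
  have n_le: "n k \<le> N (fst x)" if "x \<in> S k" for x k unfolding n_def using bdd that by (rule cINF_lower)
  have "\<exists>x\<in>S k. N (fst x) < n k + 1 / real (Suc k)" for k
  proof -
    have "(INF x\<in>S k. N (fst x)) < n k + 1 / real (Suc k)" by (simp add: n_def)
    then show ?thesis using cINF_less_iff[OF Sne bdd] by blast
  qed
  then obtain X where X: "\<And>k. X k \<in> S k" "\<And>k. N (fst (X k)) < n k + 1 / real (Suc k)" by metis
  define H where "H k = fst (X k)" for k
  define T where "T k = snd (X k)" for k
  have HT: "dens (H k)" "sub (T k)" "obj (H k) (T k) \<le> I + ennreal (1 / real (Suc k))" for k
    using X(1)[of k] by (auto simp: S_def Adm_def H_def T_def)
  have ninc: "incseq n"
  proof (intro monoI)
    fix k l :: nat assume "k \<le> l"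
    then show "n k \<le> n l" unfolding n_def by (intro cINF_superset_mono Sne bdd Smono) auto
  qed
  have "n k \<le> B" for k using n_le[OF X(1)] NB[OF HT(1)] unfolding H_def by (rule order_trans)
  then obtain L where L: "n \<longlonglongrightarrow> L" "\<And>k. n k \<le> L" using incseq_convergent[OF ninc] by metis
  define e where "e k = 2 * (L - n k) + 4 * (1 / real (Suc k))" for k
  have "(\<lambda>k. 1 / real (Suc k)) \<longlonglongrightarrow> 0" using LIMSEQ_inverse_real_of_nat by (simp add: inverse_eq_divide)
  then have "e \<longlonglongrightarrow> 2 * (L - L) + 4 * 0" unfolding e_def by (intro tendsto_intros L)
  then have e0: "e \<longlonglongrightarrow> 0" by simp
  have C: "(LINT x|\<xi>. (H k x - H l x)\<^sup>2) \<le> e k" if kl: "k \<le> l" for k l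
  proof -
    \<comment> \<open>By \<open>obj_convex\<close> the midpoint of two members of S k is again a
      member, so its norm is at least n k; the parallelogram law then bounds the distance of the two
      densities.\<close>
    let ?m = "\<lambda>x. (H k x + H l x) / 2"
    have "2 * obj ?m (mid (T k) (T l)) \<le> obj (H k) (T k) + obj (H l) (T l)" by (intro obj_convex HT)
    also have "\<dots> \<le> (I + ennreal (1 / real (Suc k))) + (I + ennreal (1 / real (Suc k)))"
    proof (intro add_mono HT)
      have "X l \<in> S k" using Smono[OF kl] X(1) by blast
      then show "obj (H l) (T l) \<le> I + ennreal (1 / real (Suc k))" by (simp add: S_def H_def T_def)
    qed
    also have "\<dots> = 2 * (I + ennreal (1 / real (Suc k)))" by (simp only: mult_2)
    finally have "obj ?m (mid (T k) (T l)) \<le> I + ennreal (1 / real (Suc k))"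
      by (subst (asm) ennreal_mult_le_mult_iff) auto
    then have "(?m, mid (T k) (T l)) \<in> S k" by (simp add: S_def Adm_def dens_mid sub_mid HT)
    then have m: "n k \<le> N ?m" using n_le by fastforce
    have "1 / real (Suc l) \<le> 1 / real (Suc k)" using kl by (intro frac_le) auto
    then have "N (H k) \<le> n k + 1 / real (Suc k)" "N (H l) \<le> L + 1 / real (Suc k)"
      using X(2)[of k] X(2)[of l] L(2)[of l] unfolding H_def by linarith+
    from parallelogram_bound[OF this m] show ?thesis
      unfolding dens_parallelogram(1)[OF HT(1) HT(1)] N_def[symmetric] e_def .
  qed
  obtain r where r: "strict_mono r" "AE x in \<xi>. convergent (\<lambda>j. H (r j) x)"
    using subsequence_converges_AE[OF HT(1) e0 C] by blast
  \<comment> \<open>Clamping keeps the values in [0, 1] also where the limit does not exist;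
    \<open>dens\<close> demands the bounds at every point.\<close>
  define h where "h x = max 0 (min 1 (lim (\<lambda>j. H (r j) x)))" for x
  have Hm [measurable]: "H k \<in> borel_measurable borel" for k using HT(1) by (simp add: dens_def)
  have hm: "h \<in> borel_measurable borel" unfolding h_def by measurable
  have h01: "0 \<le> h x \<and> h x \<le> 1" for x by (auto simp: h_def)
  have Tr: "sets (T (r k)) = sets borel" "emeasure (T (r k)) UNIV \<le> 1" for k using HT(2) by (auto simp: sub_def)
  obtain r2 \<tau> where r2: "strict_mono r2" and \<tau>: "sets \<tau> = sets borel" "emeasure \<tau> UNIV \<le> 1"
    and vague: "\<And>g. continuous_on UNIV g \<Longrightarrow> (\<And>x. 0 \<le> g x) \<Longrightarrow> (\<And>\<epsilon>. 0 < \<epsilon> \<Longrightarrow> compact {x. \<epsilon> \<le> g x}) \<Longrightarrow>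
       (\<lambda>k. \<integral>\<^sup>+x. ennreal (g x) \<partial>T (r (r2 k))) \<longlonglongrightarrow> (\<integral>\<^sup>+x. ennreal (g x) \<partial>\<tau>)"
    by (rule vague_compactness[of "\<lambda>k. T (r k)", OF Tr]) blast
  have Hh: "AE x in \<xi>. (\<lambda>j. H (r (r2 j)) x) \<longlonglongrightarrow> h x"
    using r(2)
  proof eventually_elim
    fix x assume "convergent (\<lambda>j. H (r j) x)"
    then have l: "(\<lambda>j. H (r j) x) \<longlonglongrightarrow> lim (\<lambda>j. H (r j) x)" by (simp add: convergent_LIMSEQ_iff)
    have H01: "0 \<le> H k x" "H k x \<le> 1" for k using HT(1)[of k] by (auto simp: dens_def)
    have "0 \<le> lim (\<lambda>j. H (r j) x)" "lim (\<lambda>j. H (r j) x) \<le> 1"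
      using l H01 by (auto intro: LIMSEQ_le_const LIMSEQ_le_const2)
    then have "(\<lambda>j. H (r j) x) \<longlonglongrightarrow> h x" using l by (simp add: h_def)
    from LIMSEQ_subseq_LIMSEQ[OF this r2] show "(\<lambda>j. H (r (r2 j)) x) \<longlonglongrightarrow> h x" by (simp add: o_def)
  qed
  note lsc = obj_lsc[of "\<lambda>j. H (r (r2 j))" "\<lambda>j. T (r (r2 j))", OF HT(1) HT(2) hm h01 Hh \<tau> vague]
  have "obj h \<tau> \<le> liminf (\<lambda>j. obj (H (r (r2 j))) (T (r (r2 j))))" by (rule lsc(3))
  also have "\<dots> \<le> liminf (\<lambda>j. I + ennreal (1 / real (Suc j)))"
  proof (intro Liminf_mono always_eventually allI)
    fix j
    have "j \<le> r (r2 j)" using seq_suble[OF r(1), of "r2 j"] seq_suble[OF r2, of j] by simp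
    then have "X (r (r2 j)) \<in> S j" using Smono X(1) by blast
    then show "obj (H (r (r2 j))) (T (r (r2 j))) \<le> I + ennreal (1 / real (Suc j))" by (simp add: S_def H_def T_def)
  qed
  also have "\<dots> = I + ennreal 0"
  proof (intro lim_imp_Liminf tendsto_add tendsto_const tendsto_ennrealI)
    show "(\<lambda>j. 1 / real (Suc j)) \<longlonglongrightarrow> 0" using LIMSEQ_inverse_real_of_nat by (simp add: inverse_eq_divide)
  qed simp
  finally have le: "obj h \<tau> \<le> I" by simp
  show thesis
  proof (rule that[OF lsc(1,2)])
    show "obj h \<tau> < \<infinity>" using le Ifin by (rule le_less_trans)
    show "obj h \<tau> \<le> obj h' \<tau>'" if "dens h'" "sub \<tau>'" for h' \<tau>'
      using le I_le[OF that] by (rule order_trans)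
  qed
qed

text \<open>Adding a small multiple of \<open>\<theta>\<close> to \<open>\<tau>\<close> stays admissible as long as \<open>\<tau>\<close> has mass less than 1.\<close>
lemma minimizer_variation:
  assumes h: "dens h" and \<tau>: "sub \<tau>" "emeasure \<tau> UNIV < 1" and fin: "obj h \<tau> < \<infinity>"
    and min: "\<And>h' \<tau>'. dens h' \<Longrightarrow> sub \<tau>' \<Longrightarrow> obj h \<tau> \<le> obj h' \<tau>'"
    and \<theta>: "finite_measure \<theta>" "sets \<theta> = sets borel" "energy \<alpha> \<theta> < \<infinity>" "AE x in \<theta>. x \<in> A"
  shows "mutual_energy \<alpha> (\<sigma> h) \<theta> \<le> mutual_energy \<alpha> \<tau> \<theta>"
proof -
  interpret \<theta>: finite_measure \<theta> by (rule \<theta>(1))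
  have sf\<theta>: "sigma_finite_measure \<theta>" by unfold_locales
  interpret T: two_measures \<alpha> "\<sigma> h" \<tau> by (rule two[OF h \<tau>(1)])
  have E\<sigma>: "energy \<alpha> (\<sigma> h) < \<infinity>" by (rule energy\<sigma>[OF h])
  have ed: "energy_dist \<alpha> (\<sigma> h) \<tau> < \<infinity>" and lf: "2 * lin h < \<infinity>" using fin by (auto simp: obj_def)
  have E\<tau>: "energy \<alpha> \<tau> < \<infinity>" by (rule T.energy_finite_of_dist[OF ed E\<sigma>])
  define C where "C = enn2real (riesz_const \<alpha> TYPE('a))"
  have C: "riesz_const \<alpha> TYPE('a) = ennreal C" "C > 0"
    using riesz_const_finite[OF \<alpha>] riesz_const_pos[of \<alpha>, where 'a='a]
    by (auto simp: C_def enn2real_positive_iff less_top)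
  define a b c d s t where "a = enn2real (energy \<alpha> (\<sigma> h))" and "b = enn2real (energy \<alpha> \<tau>)"
    and "c = enn2real (energy \<alpha> \<theta>)" and "d = enn2real (mutual_energy \<alpha> (\<sigma> h) \<tau>)"
    and "s = enn2real (mutual_energy \<alpha> (\<sigma> h) \<theta>)" and "t = enn2real (mutual_energy \<alpha> \<tau> \<theta>)"
  have Mf: "mutual_energy \<alpha> (\<sigma> h) \<tau> < \<infinity>" "mutual_energy \<alpha> (\<sigma> h) \<theta> < \<infinity>" "mutual_energy \<alpha> \<tau> \<theta> < \<infinity>"
    by (rule mutual_energy_finite[OF \<alpha>]; simp add: T.sf sf\<theta> T.sb \<theta> E\<sigma>[simplified] E\<tau>[simplified] \<theta>(3)[simplified])+
  have eq: "energy \<alpha> (\<sigma> h) = ennreal a" "energy \<alpha> \<tau> = ennreal b" "energy \<alpha> \<theta> = ennreal c"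
    "mutual_energy \<alpha> (\<sigma> h) \<tau> = ennreal d" "mutual_energy \<alpha> (\<sigma> h) \<theta> = ennreal s" "mutual_energy \<alpha> \<tau> \<theta> = ennreal t"
    using E\<sigma> E\<tau> \<theta>(3) Mf by (auto simp: a_def b_def c_def d_def s_def t_def less_top)
  have nn: "0 \<le> a" "0 \<le> b" "0 \<le> c" "0 \<le> d" "0 \<le> s" "0 \<le> t" by (auto simp: a_def b_def c_def d_def s_def t_def)
  define m where "m = measure \<theta> UNIV"
  have em: "emeasure \<theta> UNIV = ennreal m" by (simp add: m_def \<theta>.emeasure_eq_measure)
  obtain m\<tau> where m\<tau>: "emeasure \<tau> UNIV = ennreal m\<tau>" "0 \<le> m\<tau>" using \<tau>(2) by (cases "emeasure \<tau> UNIV") (auto simp: top_unique)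
  then have m\<tau>1: "m\<tau> < 1" using \<tau>(2) by (simp add: ennreal_less_iff[of m\<tau> 1, simplified])
  \<comment> \<open>For \<epsilon> \<le> \<epsilon>0 the added mass \<epsilon> * m fits into the
    deficit 1 - m\<tau>; m + 1 in the denominator covers the case m = 0.\<close>
  define \<epsilon>0 where "\<epsilon>0 = (1 - m\<tau>) / (m + 1)"
  have m0: "m \<ge> 0" by (simp add: m_def)
  have \<epsilon>0: "\<epsilon>0 > 0" using m\<tau>1 m0 by (simp add: \<epsilon>0_def)
  \<comment> \<open>Passing from \<tau> to \<tau> + \<epsilon> \<theta> changes the objective by C *
    \<epsilon> * (2 * (t - s) + \<epsilon> * c), which cannot be negative.\<close>
  have key: "0 \<le> 2 * (t - s) + \<epsilon> * c" if \<epsilon>: "0 < \<epsilon>" "\<epsilon> \<le> \<epsilon>0" for \<epsilon>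
  proof -
    define \<theta>' where "\<theta>' = density \<theta> (\<lambda>_. ennreal \<epsilon>)"
    have s\<theta>': "sets \<theta>' = sets borel" by (simp add: \<theta>'_def \<theta>)
    have f\<theta>': "finite_measure \<theta>'"
      using space_eq_UNIV[OF s\<theta>'] \<theta>.emeasure_finite[of UNIV, unfolded top.not_eq_extremum]
      by (intro finite_measureI) (auto simp: \<theta>'_def emeasure_density_const \<theta> ennreal_mult_eq_top_iff)
    define \<tau>' where "\<tau>' = measure_add \<tau> \<theta>'"
    have s\<tau>': "sets \<tau>' = sets borel" by (simp add: \<tau>'_def T.sb)
    have nn': "(\<integral>\<^sup>+x. f x \<partial>\<tau>') = (\<integral>\<^sup>+x. f x \<partial>\<tau>) + ennreal \<epsilon> * (\<integral>\<^sup>+x. f x \<partial>\<theta>)" if f: "f \<in> borel_measurable borel" for f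
    proof -
      have [measurable]: "f \<in> borel_measurable \<tau>" "f \<in> borel_measurable \<theta>"
        using f T.sb \<theta>(2) by (simp_all cong: measurable_cong_sets)
      have "(\<integral>\<^sup>+x. f x \<partial>\<tau>') = (\<integral>\<^sup>+x. f x \<partial>\<tau>) + (\<integral>\<^sup>+x. f x \<partial>\<theta>')"
        unfolding \<tau>'_def by (intro nn_integral_measure_add) (auto simp: s\<theta>' T.sb)
      then show ?thesis unfolding \<theta>'_def by (simp add: nn_integral_density nn_integral_cmult)
    qed
    have "sub \<tau>'"
      unfolding sub_def
    proof (intro conjI s\<tau>')
      have "emeasure \<tau>' UNIV = emeasure \<tau> UNIV + ennreal \<epsilon> * emeasure \<theta> UNIV"
        using nn'[of "\<lambda>_. 1"] by (simp add: space_eq_UNIV T.sb \<theta> s\<tau>')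
      also have "\<dots> = ennreal (m\<tau> + \<epsilon> * m)" using m\<tau> em \<epsilon> m0 by (simp add: ennreal_mult)
      also have "m\<tau> + \<epsilon> * m \<le> 1"
      proof -
        have "\<epsilon> * m \<le> \<epsilon>0 * (m + 1)" using \<epsilon> m0 by (intro mult_mono) auto
        also have "\<dots> = 1 - m\<tau>" using m0 by (simp add: \<epsilon>0_def)
        finally show ?thesis by simp
      qed
      then have "ennreal (m\<tau> + \<epsilon> * m) \<le> 1" by (simp add: ennreal_le_1)
      finally show "emeasure \<tau>' UNIV \<le> 1" .
      have [measurable]: "A \<in> sets borel" using A by (simp add: borel_closed)
      have z: "(\<integral>\<^sup>+x. indicator (- A) x \<partial>M) = 0" if "AE x in M. x \<in> A" for M
      proof -
        have "(\<integral>\<^sup>+x. indicator (- A) x \<partial>M) = (\<integral>\<^sup>+x. 0 \<partial>M)"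
          by (intro nn_integral_cong_AE, use that in eventually_elim) simp
        then show ?thesis by simp
      qed
      have "AE x in \<tau>. x \<in> A" using \<tau>(1) by (simp add: sub_def)
      note z[OF this] z[OF \<theta>(4)]
      then have "(\<integral>\<^sup>+x. indicator (- A) x \<partial>\<tau>') = 0" by (subst nn') auto
      then have "AE x in \<tau>'. indicator (- A) x = (0::ennreal)"
        using s\<tau>' by (subst (asm) nn_integral_0_iff_AE) (auto cong: measurable_cong_sets)
      then show "AE x in \<tau>'. x \<in> A" by eventually_elim (auto simp: indicator_def split: if_splits)
    qed
    interpret T': two_measures \<alpha> "\<sigma> h" \<tau>' by (rule two[OF h \<open>sub \<tau>'\<close>])
    have Um: "riesz_pot \<alpha> \<theta> \<in> borel_measurable borel" "riesz_pot \<alpha> \<tau> \<in> borel_measurable borel"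
      using borel_measurable_riesz_pot[OF sf\<theta> \<theta>(2)] borel_measurable_riesz_pot[OF T.sf(2) T.sb(2)] by simp_all
    have pot: "riesz_pot \<alpha> \<tau>' x = riesz_pot \<alpha> \<tau> x + ennreal \<epsilon> * riesz_pot \<alpha> \<theta> x" for x
      unfolding riesz_pot_def by (rule nn') measurable
    have m1: "mutual_energy \<alpha> (\<sigma> h) \<tau>' = ennreal (d + \<epsilon> * s)"
    proof -
      note [measurable_cong] = T.sb(1) note [measurable] = Um
      have "mutual_energy \<alpha> (\<sigma> h) \<tau>' = mutual_energy \<alpha> (\<sigma> h) \<tau> + ennreal \<epsilon> * mutual_energy \<alpha> (\<sigma> h) \<theta>"
        unfolding mutual_energy_pot pot by (simp add: nn_integral_add nn_integral_cmult)
      then show ?thesis using eq nn \<epsilon> by (simp add: ennreal_mult)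
    qed
    have m2: "energy \<alpha> \<tau>' = ennreal (b + 2 * \<epsilon> * t + \<epsilon> * \<epsilon> * c)"
    proof -
      note [measurable_cong] = T.sb \<theta>(2) note [measurable] = Um
      have "energy \<alpha> \<tau>' = mutual_energy \<alpha> \<tau> \<tau> + ennreal \<epsilon> * mutual_energy \<alpha> \<tau> \<theta> +
         ennreal \<epsilon> * (mutual_energy \<alpha> \<theta> \<tau> + ennreal \<epsilon> * mutual_energy \<alpha> \<theta> \<theta>)"
        unfolding mutual_energy_pot pot by (subst nn') (auto simp: nn_integral_add nn_integral_cmult)
      also have "mutual_energy \<alpha> \<theta> \<tau> = mutual_energy \<alpha> \<tau> \<theta>"
        by (intro mutual_energy_commute sf\<theta> T.sf T.sb \<theta>)
      finally have "energy \<alpha> \<tau>' = ennreal (b + \<epsilon> * t + \<epsilon> * (t + \<epsilon> * c))"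
        using eq nn \<epsilon> by (simp add: ennreal_mult)
      then show ?thesis by (simp add: algebra_simps)
    qed
    have "energy_dist \<alpha> (\<sigma> h) \<tau> + 2 * lin h \<le> energy_dist \<alpha> (\<sigma> h) \<tau>' + 2 * lin h"
      using min[OF h \<open>sub \<tau>'\<close>] by (simp add: obj_def)
    then have le: "energy_dist \<alpha> (\<sigma> h) \<tau> \<le> energy_dist \<alpha> (\<sigma> h) \<tau>'"
      using lf by (auto simp: add.commute[of _ "2 * lin h"] ennreal_add_left_cancel_le)
    have "energy_dist \<alpha> (\<sigma> h) \<tau>' < \<infinity>" by (intro T'.energy_dist_finite E\<sigma>) (simp add: m2)
    then obtain x' where x': "energy_dist \<alpha> (\<sigma> h) \<tau>' = ennreal x'" "0 \<le> x'" by (cases "energy_dist \<alpha> (\<sigma> h) \<tau>'") auto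
    obtain x where x: "energy_dist \<alpha> (\<sigma> h) \<tau> = ennreal x" "0 \<le> x" using ed by (cases "energy_dist \<alpha> (\<sigma> h) \<tau>") auto
    have n2: "0 \<le> d + \<epsilon> * s" "0 \<le> b + 2 * \<epsilon> * t + \<epsilon> * \<epsilon> * c" using nn \<epsilon> by auto
    have "ennreal (x + 2 * (C * d)) = ennreal (C * a + C * b)"
      using T.energy_dist_add x nn C by (simp add: eq ennreal_mult)
    then have 1: "x + 2 * (C * d) = C * a + C * b" using x nn C by (subst (asm) ennreal_inj) auto
    have "ennreal (x' + 2 * (C * (d + \<epsilon> * s))) = ennreal (C * a + C * (b + 2 * \<epsilon> * t + \<epsilon> * \<epsilon> * c))"
      using T'.energy_dist_add x' nn n2 C unfolding m1 m2 x'(1) eq C(1)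
      by (simp add: ennreal_mult[symmetric] ennreal_plus[symmetric] ennreal_mult'[symmetric] del: ennreal_plus flip: ennreal_numeral)
    then have 2: "x' + 2 * (C * (d + \<epsilon> * s)) = C * a + C * (b + 2 * \<epsilon> * t + \<epsilon> * \<epsilon> * c)"
      using x' n2 nn C by (subst (asm) ennreal_inj) auto
    have "x \<le> x'" using le x x' by simp
    then have "0 \<le> (C * \<epsilon>) * (2 * (t - s) + \<epsilon> * c)" using 1 2 by (simp add: algebra_simps)
    then show ?thesis using mult_pos_pos[OF C(2) \<epsilon>(1)] by (auto simp: zero_le_mult_iff)
  qed
  have "s \<le> t"
  proof (rule ccontr)
    assume "\<not> s \<le> t"
    then have st: "s - t > 0" by simp
    \<comment> \<open>So small that \<epsilon> * c \<le> s - t, which contradicts \<open>key\<close>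
      if s > t.\<close>
    define \<epsilon> where "\<epsilon> = min \<epsilon>0 ((s - t) / (c + 1))"
    have \<epsilon>: "0 < \<epsilon>" "\<epsilon> \<le> \<epsilon>0" using st \<epsilon>0 nn by (auto simp: \<epsilon>_def)
    have "\<epsilon> * c \<le> (s - t) / (c + 1) * (c + 1)" using nn st by (intro mult_mono) (auto simp: \<epsilon>_def)
    also have "\<dots> = s - t" using nn by simp
    finally show False using variation_bound[OF key[OF \<epsilon>]] st by simp
  qed
  then show ?thesis by (simp add: eq ennreal_leI)
qed

end

section \<open>Thinness at infinity\<close>

lemma riesz_kernel_le:
  fixes x y :: "'a::euclidean_space"
  assumes "\<alpha> < real DIM('a)" "0 < l" "l \<le> norm (x - y)"
  shows "riesz_kernel \<alpha> x y \<le> ennreal (l powr - (real DIM('a) - \<alpha>))"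
proof -
  have "norm (x - y) powr - (real DIM('a) - \<alpha>) \<le> l powr - (real DIM('a) - \<alpha>)"
    using assms by (intro powr_mono2') auto
  then show ?thesis using assms by (auto simp: riesz_kernel_def intro!: ennreal_leI)
qed

lemma riesz_kernel_ge:
  fixes x y :: "'a::euclidean_space"
  assumes "\<alpha> < real DIM('a)" "norm (x - y) \<le> l"
  shows "ennreal (l powr - (real DIM('a) - \<alpha>)) \<le> riesz_kernel \<alpha> x y"
proof (cases "x = y")
  case False
  then have "l powr - (real DIM('a) - \<alpha>) \<le> norm (x - y) powr - (real DIM('a) - \<alpha>)"
    using assms by (intro powr_mono2') auto
  then show ?thesis using False by (simp add: riesz_kernel_def ennreal_leI)
qed (simp add: riesz_kernel_def)

section \<open>Inversion in the unit sphere and the Wiener pieces\<close>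

lemma norm_unit_inversion: "norm (unit_inversion x) = 1 / norm x"
  by (cases "x = 0") (simp_all add: unit_inversion_def power2_eq_square field_simps)

lemma unit_inversion_involution: "unit_inversion (unit_inversion x) = x"
proof (cases "x = 0")
  case False
  have "unit_inversion (unit_inversion x) = unit_inversion x /\<^sub>R (1 / norm x)\<^sup>2"
    by (simp only: unit_inversion_def[of "unit_inversion x"] norm_unit_inversion)
  also have "\<dots> = x"
    using False by (simp add: unit_inversion_def power_one_over)
  finally show ?thesis .
qed (simp add: unit_inversion_def)

lemma unit_inversion_eq_0 [simp]: "unit_inversion x = 0 \<longleftrightarrow> x = 0"
  by (auto simp: unit_inversion_def)

lemma norm_unit_inversion_diff:
  fixes x y :: "'a::euclidean_space"
  assumes "x \<noteq> 0" "y \<noteq> 0"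
  shows "norm (unit_inversion x - unit_inversion y) = norm (x - y) / (norm x * norm y)"
proof -
  define a b c where "a = norm x" and "b = norm y" and "c = x \<bullet> y"
  have a: "x \<bullet> x = a\<^sup>2" "y \<bullet> y = b\<^sup>2" "a > 0" "b > 0" using assms by (auto simp: a_def b_def power2_norm_eq_inner)
  define i j where "i = inverse (a\<^sup>2)" and "j = inverse (b\<^sup>2)"
  have u: "unit_inversion x = i *\<^sub>R x" "unit_inversion y = j *\<^sub>R y"
    by (simp_all add: unit_inversion_def i_def j_def a_def b_def)
  have "(norm (unit_inversion x - unit_inversion y))\<^sup>2 = i * i * a\<^sup>2 - 2 * i * j * c + j * j * b\<^sup>2"
    unfolding power2_norm_eq_inner u
    by (simp add: inner_diff_left inner_diff_right a inner_commute[of y x] c_def[symmetric] algebra_simps)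
  also have "\<dots> = (a\<^sup>2 - 2 * c + b\<^sup>2) / (a * b)\<^sup>2"
    using a(3,4) by (simp add: i_def j_def field_simps power2_eq_square)
  also have "a\<^sup>2 - 2 * c + b\<^sup>2 = (norm (x - y))\<^sup>2"
    unfolding power2_norm_eq_inner by (simp add: inner_diff_left inner_diff_right a inner_commute[of y x] c_def)
  also have "\<dots> / (a * b)\<^sup>2 = (norm (x - y) / (a * b))\<^sup>2" by (simp add: power_divide)
  finally show ?thesis using a by (simp add: a_def b_def)
qed

lemma riesz_kernel_unit_inversion:
  fixes x y :: "'a::euclidean_space"
  assumes "\<alpha> < real DIM('a)" "x \<noteq> 0" "y \<noteq> 0"
  shows "riesz_kernel \<alpha> (unit_inversion x) (unit_inversion y)
    = ennreal ((norm x * norm y) powr (real DIM('a) - \<alpha>)) * riesz_kernel \<alpha> x y"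
proof (cases "x = y")
  case True
  then show ?thesis using assms by (simp add: riesz_kernel_def ennreal_mult_top)
next
  case False
  then have ne: "unit_inversion x \<noteq> unit_inversion y" by (metis unit_inversion_involution)
  have "norm (unit_inversion x - unit_inversion y) powr (\<alpha> - real DIM('a))
     = norm (x - y) powr (\<alpha> - real DIM('a)) / (norm x * norm y) powr (\<alpha> - real DIM('a))"
    by (simp add: norm_unit_inversion_diff assms powr_divide)
  also have "\<dots> = (norm x * norm y) powr (real DIM('a) - \<alpha>) * norm (x - y) powr (\<alpha> - real DIM('a))"
    using powr_minus[of "norm x * norm y" "\<alpha> - real DIM('a)"] by (simp add: divide_inverse mult.commute)
  finally show ?thesis using False ne by (simp add: riesz_kernel_def ennreal_mult)
qed

lemma emeasure_completion_carrier:
  assumes "AE x in M. x \<in> B" "space M = UNIV"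
  shows "emeasure (completion M) B = emeasure M UNIV"
proof -
  obtain N where N: "N \<in> null_sets M" "{x \<in> space M. x \<notin> B} \<subseteq> N" using assms(1) by (auto simp: eventually_ae_filter)
  have "- B \<subseteq> N" using N assms(2) by auto
  then have nb: "- B \<in> null_sets (completion M)" using null_sets_completionI[OF N(1)] by (metis null_sets_completion_subset)
  then have "space (completion M) - (- B) \<in> sets (completion M)" by (intro sets.Diff sets.top null_setsD2)
  then have B: "B \<in> sets (completion M)" using assms(2) by simp
  have "emeasure (completion M) (B \<union> - B) = emeasure (completion M) B" using B nb by (rule emeasure_Un_null_set)
  moreover have "UNIV \<in> sets M" using sets.top[of M] assms(2) by simp
  ultimately show ?thesis by simp
qed

text \<open>The test measure is the inversion of the part of \<open>M\<close> where its potential is at most twice its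
  mean value.\<close>
lemma inversion_test_measure:
  fixes M :: "'a::euclidean_space measure"
  assumes \<alpha>: "\<alpha> < real DIM('a)" and r: "0 < R" "0 < R'"
    and M: "M \<in> finite_energy_pos \<alpha> B" "emeasure (completion M) B = 1" and c: "energy \<alpha> M < ennreal c"
    and B: "\<And>x. x \<in> B \<Longrightarrow> unit_inversion x \<in> A \<and> 1 / R' \<le> norm x \<and> norm x \<le> 1 / R"
  obtains \<theta> where "finite_measure \<theta>" "sets \<theta> = sets borel" "energy \<alpha> \<theta> < \<infinity>"
    "AE x in \<theta>. x \<in> A \<and> R \<le> norm x \<and> norm x \<le> R'" "1 / 2 \<le> emeasure \<theta> UNIV"
    "\<And>y. y \<noteq> 0 \<Longrightarrow> riesz_pot \<alpha> \<theta> y \<le> ennreal (2 powr (real DIM('a) - \<alpha>) * (2 * c) * (norm y * R) powr - (real DIM('a) - \<alpha>))"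
proof -
  define g where "g = real DIM('a) - \<alpha>"
  have g: "0 < g" using \<alpha> by (simp add: g_def)
  have pr: "pos_radon \<alpha> M" and car: "AE x in M. x \<in> B" using M(1) by (auto simp: finite_energy_pos_def carried_by_def)
  note M' = pos_radonD[OF pr]
  note [measurable_cong] = M'(1)
  note Um [measurable] = borel_measurable_riesz_pot[OF M'(3,1)]
  have c0: "0 < c" using c by (metis ennreal_neg linorder_not_le not_less_zero)
  have M1: "emeasure M UNIV = 1" using emeasure_completion_carrier[OF car M'(2)] M(2) by simp
  define S where "S = {x. riesz_pot \<alpha> M x \<le> ennreal (2 * c)}"
  have cS: "closed S" unfolding S_def by (rule closed_riesz_pot_le[OF \<alpha> M'(1)])
  have Sb [measurable]: "S \<in> sets borel" using cS by (rule borel_closed)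
  \<comment> \<open>Chebyshev: the mean of the potential is the energy, which is below c, so less
    than half of the unit mass lies where the potential exceeds 2 * c.\<close>
  have half: "1 / 2 \<le> emeasure M S"
  proof (rule ccontr)
    assume "\<not> ?thesis"
    then have lt: "emeasure M S < 1 / 2" by simp
    have "emeasure M S + emeasure M (- S) = emeasure M (S \<union> - S)"
      by (intro plus_emeasure) (auto simp: M')
    then have sum: "emeasure M S + emeasure M (- S) = 1" using M1 by simp
    have h: "1 / 2 + 1 / 2 = (1::ennreal)"
      using ennreal_plus[of "1/2" "1/2"] divide_ennreal[of 1 2] by simp
    have ge: "1 / 2 \<le> emeasure M (- S)"
    proof (rule ccontr)
      assume "\<not> ?thesis"
      then have "emeasure M S + emeasure M (- S) < 1 / 2 + 1 / 2" using lt by (intro add_strict_mono) auto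
      then show False using sum h by simp
    qed
    have "ennreal c = ennreal c * 2 / 2" by (rule mult_divide_eq_ennreal[symmetric]) auto
    also have "\<dots> = ennreal (2 * c) * 1 / 2" using c0 by (simp add: ennreal_mult mult.commute)
    also have "\<dots> = ennreal (2 * c) * (1 / 2)" by (rule ennreal_times_divide[symmetric])
    also have "\<dots> \<le> ennreal (2 * c) * emeasure M (- S)" using ge by (intro mult_left_mono) auto
    also have "\<dots> = (\<integral>\<^sup>+x. ennreal (2 * c) * indicator (- S) x \<partial>M)" by (subst nn_integral_cmult_indicator) (auto simp: M')
    also have "\<dots> \<le> (\<integral>\<^sup>+x. riesz_pot \<alpha> M x \<partial>M)"
      by (intro nn_integral_mono) (auto simp: S_def indicator_def)
    also have "\<dots> < ennreal c" using c by (simp add: mutual_energy_pot)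
    finally show False by simp
  qed
  define N where "N = density M (indicator S)"
  have sN [measurable_cong]: "sets N = sets borel" by (simp add: N_def M')
  \<comment> \<open>On S the restricted potential is at most 2 * c; the weak maximum principle
    extends this to the whole space at the cost of the factor 2 powr g.\<close>
  have Nle: "riesz_pot \<alpha> N x \<le> ennreal (2 powr g * (2 * c))" for x
  proof -
    have "riesz_pot \<alpha> N x \<le> ennreal (2 powr (real DIM('a) - \<alpha>)) * ennreal (2 * c)"
    proof (rule weak_max_principle[OF \<alpha> sN cS])
      show "AE y in N. y \<in> S" unfolding N_def by (subst AE_density_indicator) (auto simp: M')
      show "riesz_pot \<alpha> N y \<le> ennreal (2 * c)" if "y \<in> S" for y
        using riesz_pot_restrict_le[OF M'(1) Sb, of \<alpha> y] that by (auto simp: N_def S_def intro: order_trans)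
    qed
    then show ?thesis using c0 by (simp add: g_def ennreal_mult)
  qed
  have Nmass: "emeasure N UNIV = emeasure M S"
    unfolding N_def by (subst emeasure_density) (auto simp: M')
  have im: "unit_inversion \<in> borel_measurable (borel :: 'a measure)" unfolding unit_inversion_def[abs_def] by measurable
  have [measurable]: "unit_inversion \<in> borel_measurable N" using im by (simp cong: measurable_cong_sets)
  define \<theta> where "\<theta> = distr N borel unit_inversion"
  have s\<theta>: "sets \<theta> = sets borel" by (simp add: \<theta>_def)
  have m\<theta>: "emeasure \<theta> UNIV = emeasure M S"
    unfolding \<theta>_def using Nmass space_eq_UNIV[OF sN] by (subst emeasure_distr) auto
  have fin: "finite_measure \<theta>"
  proof (rule finite_measureI)
    have "emeasure M S \<le> emeasure M UNIV" by (intro emeasure_mono) (auto simp: M')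
    then show "emeasure \<theta> (space \<theta>) \<noteq> \<infinity>" using m\<theta> M1 space_eq_UNIV[OF s\<theta>] by (auto simp: top_unique)
  qed
  have NB: "AE x in N. x \<in> B" unfolding N_def by (subst AE_density_indicator) (use car in \<open>auto simp: M' elim: eventually_mono\<close>)
  have AE\<theta>: "AE x in \<theta>. P x" if "\<And>x. x \<in> B \<Longrightarrow> P (unit_inversion x)" for P
  proof -
    obtain E where E: "E \<in> null_sets N" "{x \<in> space N. x \<notin> B} \<subseteq> E" using NB by (auto simp: eventually_ae_filter)
    have inv: "unit_inversion -` (unit_inversion -` E) = E" by (auto simp: unit_inversion_involution)
    have Eb: "E \<in> sets borel" using E(1) sN by auto
    have m: "unit_inversion -` E \<in> sets borel" using measurable_sets_borel[OF im Eb] by simp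
    have "emeasure \<theta> (unit_inversion -` E) = emeasure N E"
      unfolding \<theta>_def using m space_eq_UNIV[OF sN] by (subst emeasure_distr) (auto simp: inv)
    then have "unit_inversion -` E \<in> null_sets \<theta>" using E m by (auto simp: null_sets_def s\<theta>)
    moreover have "{x \<in> space \<theta>. \<not> P x} \<subseteq> unit_inversion -` E"
    proof
      fix x assume "x \<in> {x \<in> space \<theta>. \<not> P x}"
      then have "unit_inversion x \<notin> B" using that[of "unit_inversion x"] by (auto simp: unit_inversion_involution)
      then show "x \<in> unit_inversion -` E" using E(2) space_eq_UNIV[OF sN] by auto
    qed
    ultimately show ?thesis by (rule AE_I')
  qed
  \<comment> \<open>Under the inversion the kernel acquires the factor (|x| / |y|) powr g, and |x|
    \<le> 1 / R on the carrier of N.\<close>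
  have pot: "riesz_pot \<alpha> \<theta> y \<le> ennreal (2 powr g * (2 * c) * (norm y * R) powr - g)" if y: "y \<noteq> 0" for y
  proof -
    have "riesz_pot \<alpha> \<theta> y = (\<integral>\<^sup>+x. riesz_kernel \<alpha> y (unit_inversion x) \<partial>N)"
      unfolding riesz_pot_def \<theta>_def by (subst nn_integral_distr) auto
    also have "\<dots> \<le> (\<integral>\<^sup>+x. ennreal ((norm y * R) powr - g) * riesz_kernel \<alpha> (unit_inversion y) x \<partial>N)"
    proof (intro nn_integral_mono_AE, use NB in eventually_elim)
      fix x assume x: "x \<in> B"
      then have n: "0 < norm x" "norm x \<le> 1 / R" using B[OF x] r by (auto intro: less_le_trans[of 0 "1 / R'"])
      have "riesz_kernel \<alpha> y (unit_inversion x) = riesz_kernel \<alpha> (unit_inversion (unit_inversion y)) (unit_inversion x)"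
        by (simp add: unit_inversion_involution)
      also have "\<dots> = ennreal ((norm (unit_inversion y) * norm x) powr g) * riesz_kernel \<alpha> (unit_inversion y) x"
        unfolding g_def using y n by (intro riesz_kernel_unit_inversion \<alpha>) auto
      also have "(norm (unit_inversion y) * norm x) powr g \<le> (1 / norm y * (1 / R)) powr g"
      proof (rule powr_mono2)
        show "norm (unit_inversion y) * norm x \<le> 1 / norm y * (1 / R)"
          unfolding norm_unit_inversion using n(2) by (rule mult_left_mono) simp
      qed (use g in auto)
      then have "ennreal ((norm (unit_inversion y) * norm x) powr g) * riesz_kernel \<alpha> (unit_inversion y) x
         \<le> ennreal ((1 / norm y * (1 / R)) powr g) * riesz_kernel \<alpha> (unit_inversion y) x"
        by (intro mult_right_mono ennreal_leI) auto
      also have "(1 / norm y * (1 / R)) powr g = (norm y * R) powr - g"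
        using y r by (simp add: powr_minus inverse_powr[symmetric] divide_inverse)
      finally show "riesz_kernel \<alpha> y (unit_inversion x) \<le> ennreal ((norm y * R) powr - g) * riesz_kernel \<alpha> (unit_inversion y) x" .
    qed
    also have "\<dots> = ennreal ((norm y * R) powr - g) * riesz_pot \<alpha> N (unit_inversion y)"
      unfolding riesz_pot_def by (intro nn_integral_cmult) auto
    also have "\<dots> \<le> ennreal ((norm y * R) powr - g) * ennreal (2 powr g * (2 * c))" by (intro mult_left_mono Nle) auto
    also have "\<dots> = ennreal (2 powr g * (2 * c) * (norm y * R) powr - g)" using c0 by (simp add: ennreal_mult'[symmetric] mult.commute)
    finally show ?thesis .
  qed
  have supp: "AE x in \<theta>. x \<in> A \<and> R \<le> norm x \<and> norm x \<le> R'"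
  proof (rule AE\<theta>)
    fix x assume x: "x \<in> B"
    then have n: "0 < norm x" "norm x \<le> 1 / R" "1 / R' \<le> norm x" using B[OF x] r by (auto intro: less_le_trans[of 0 "1 / R'"])
    have "R \<le> 1 / norm x" "1 / norm x \<le> R'" using n r by (auto simp: field_simps)
    then show "unit_inversion x \<in> A \<and> R \<le> norm (unit_inversion x) \<and> norm (unit_inversion x) \<le> R'"
      using B[OF x] by (simp add: norm_unit_inversion)
  qed
  have "energy \<alpha> \<theta> \<le> (\<integral>\<^sup>+x. ennreal (2 powr g * (2 * c) * (R * R) powr - g) \<partial>\<theta>)"
    unfolding mutual_energy_pot
  proof (intro nn_integral_mono_AE, use supp in eventually_elim)
    fix y assume "y \<in> A \<and> R \<le> norm y \<and> norm y \<le> R'"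
    then have y: "y \<noteq> 0" "R \<le> norm y" using r by auto
    have "(norm y * R) powr - g \<le> (R * R) powr - g" using y r g by (intro powr_mono2') auto
    then show "riesz_pot \<alpha> \<theta> y \<le> ennreal (2 powr g * (2 * c) * (R * R) powr - g)"
      using pot[OF y(1)] c0 by (auto intro!: order_trans[OF pot[OF y(1)]] ennreal_leI mult_left_mono)
  qed
  also have "\<dots> < \<infinity>"
    using finite_measure.emeasure_finite[OF fin, of "space \<theta>", unfolded top.not_eq_extremum] by (simp add: ennreal_mult_less_top)
  finally have E: "energy \<alpha> \<theta> < \<infinity>" .
  show thesis
    by (rule that[OF fin s\<theta> E supp]) (use half m\<theta> pot g_def in auto)
qed

text \<open>In the unit ball the kernel is at least 2 powr (\<alpha> - n), which bounds all
  competing energies away from 0. This makes each single term of the Wiener series finite.\<close>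

lemma capacity_finite_of_bounded:
  fixes B :: "'a::euclidean_space set"
  assumes \<alpha>: "\<alpha> < real DIM('a)" and B: "B \<subseteq> cball 0 1"
  shows "capacity \<alpha> B < \<infinity>"
proof -
  let ?e = "ennreal (2 powr - (real DIM('a) - \<alpha>))"
  have "?e \<le> energy \<alpha> M" if M: "M \<in> finite_energy_pos \<alpha> B" "emeasure (completion M) B = 1" for M
  proof -
    have pr: "pos_radon \<alpha> M" and car: "AE x in M. x \<in> B" using M(1) by (auto simp: finite_energy_pos_def carried_by_def)
    note M' = pos_radonD[OF pr]
    have 1: "emeasure M UNIV = 1" using emeasure_completion_carrier[OF car M'(2)] M(2) by simp
    have "?e \<le> riesz_pot \<alpha> M x" if x: "x \<in> B" for x
    proof -
      have "?e = (\<integral>\<^sup>+y. ?e \<partial>M)" by (simp add: M' 1)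
      also have "\<dots> \<le> riesz_pot \<alpha> M x"
        unfolding riesz_pot_def
      proof (intro nn_integral_mono_AE, use car in eventually_elim)
        fix y assume "y \<in> B"
        then have "norm x \<le> 1" "norm y \<le> 1" using x B by auto
        then have "norm (x - y) \<le> 2" using norm_triangle_ineq4[of x y] by linarith
        then show "?e \<le> riesz_kernel \<alpha> x y" by (rule riesz_kernel_ge[OF \<alpha>])
      qed
      finally show ?thesis .
    qed
    then have "(\<integral>\<^sup>+x. ?e \<partial>M) \<le> energy \<alpha> M"
      unfolding mutual_energy_pot by (intro nn_integral_mono_AE, use car in eventually_elim) auto
    then show ?thesis by (simp add: M' 1)
  qed
  then have "?e \<le> (INF M\<in>{M \<in> finite_energy_pos \<alpha> B. emeasure (completion M) B = 1}. energy \<alpha> M)"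
    by (intro INF_greatest) auto
  moreover have "?e \<noteq> 0" by simp
  ultimately have "(INF M\<in>{M \<in> finite_energy_pos \<alpha> B. emeasure (completion M) B = 1}. energy \<alpha> M) \<noteq> 0" by (metis le_zero_eq)
  then have "capacity \<alpha> B \<noteq> \<top>" unfolding capacity_def ennreal_inverse_eq_top_iff .
  then show ?thesis by (simp add: less_top)
qed

text \<open>The core of the argument: outside the annulus \<open>{y. a R \<le> |y| \<le> R'/a}\<close> the measure \<open>\<tau>\<close> contributes at
  most \<open>(m + \<delta>) |x|\<^sup>-\<^sup>g\<close> to its potential on \<open>{x. R \<le> |x| \<le> R'}\<close>, whereas \<open>\<sigma>\<close> contributes at least
  \<open>(m + 2\<delta>) |x|\<^sup>-\<^sup>g\<close>.\<close>
lemma annulus_mass_bound: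
  fixes \<alpha> :: real and \<sigma> \<tau> :: "'a::euclidean_space measure"
  defines "g \<equiv> real DIM('a) - \<alpha>"
  assumes \<alpha>: "\<alpha> < real DIM('a)" and \<sigma>: "finite_measure \<sigma>" "sets \<sigma> = sets borel"
    and \<tau>: "finite_measure \<tau>" "sets \<tau> = sets borel" "emeasure \<tau> UNIV = ennreal m" "0 \<le> m"
    and test: "\<And>\<theta>. finite_measure \<theta> \<Longrightarrow> sets \<theta> = sets borel \<Longrightarrow> energy \<alpha> \<theta> < \<infinity> \<Longrightarrow> AE x in \<theta>. x \<in> A \<Longrightarrow>
       mutual_energy \<alpha> \<sigma> \<theta> \<le> mutual_energy \<alpha> \<tau> \<theta>"
    and R: "0 < R" "R \<le> R'" and a: "0 < a" "a < 1" and \<delta>: "0 < \<delta>"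
    and m: "m * (1 - a) powr - g \<le> m + \<delta>"
    and \<rho>: "0 \<le> \<rho>" "m + 2 * \<delta> \<le> measure \<sigma> (cball 0 \<rho>) * (1 + \<rho> / R) powr - g"
    and M: "M \<in> finite_energy_pos \<alpha> B" "emeasure (completion M) B = 1" and c: "energy \<alpha> M < ennreal c"
    and B: "\<And>x. x \<in> B \<Longrightarrow> unit_inversion x \<in> A \<and> 1 / R' \<le> norm x \<and> norm x \<le> 1 / R"
  shows "\<delta> * (R' powr - g / 2) \<le> 2 powr g * (2 * c) * (a * R * R) powr - g * measure \<tau> {y. a * R \<le> norm y \<and> norm y \<le> R' / a}"
proof -
  have g: "0 < g" using \<alpha> by (simp add: g_def)
  have c0: "0 < c" using c by (metis ennreal_neg linorder_not_le not_less_zero)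
  obtain \<theta> where \<theta>: "finite_measure \<theta>" "sets \<theta> = sets borel" "energy \<alpha> \<theta> < \<infinity>"
    and supp: "AE x in \<theta>. x \<in> A \<and> R \<le> norm x \<and> norm x \<le> R'" and half: "1 / 2 \<le> emeasure \<theta> UNIV"
    and pot: "\<And>y. y \<noteq> 0 \<Longrightarrow> riesz_pot \<alpha> \<theta> y \<le> ennreal (2 powr g * (2 * c) * (norm y * R) powr - g)"
    by (rule inversion_test_measure[OF \<alpha> R(1) less_le_trans[OF R] M c B, folded g_def]) (assumption, rule that)
  interpret \<theta>: finite_measure \<theta> by (rule \<theta>(1))
  interpret \<sigma>: finite_measure \<sigma> by (rule \<sigma>(1))
  interpret \<tau>: finite_measure \<tau> by (rule \<tau>(1))
  have sf: "sigma_finite_measure \<theta>" "sigma_finite_measure \<sigma>" "sigma_finite_measure \<tau>" by unfold_locales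
  note [measurable_cong] = \<theta>(2) \<sigma>(2) \<tau>(2)
  define N where "N = {y :: 'a. a * R \<le> norm y \<and> norm y \<le> R' / a}"
  have "closed N" unfolding N_def by (intro closed_Collect_conj closed_Collect_le continuous_intros)
  then have N [measurable]: "N \<in> sets borel" by (rule borel_closed)
  define \<tau>N where "\<tau>N = density \<tau> (indicator N)"
  have s\<tau>N [measurable_cong]: "sets \<tau>N = sets borel" by (simp add: \<tau>N_def \<tau>)
  have f\<tau>N: "finite_measure \<tau>N"
    unfolding \<tau>N_def using \<tau>.emeasure_finite[of N, unfolded top.not_eq_extremum] N by (intro finite_density_compact \<tau>) auto
  have sfN: "sigma_finite_measure \<tau>N" using f\<tau>N by (simp add: finite_measure_def)
  note [measurable] = borel_measurable_riesz_pot[OF sf(1) \<theta>(2)] borel_measurable_riesz_pot[OF sf(2) \<sigma>(2)]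
    borel_measurable_riesz_pot[OF sf(3) \<tau>(2)] borel_measurable_riesz_pot[OF sfN s\<tau>N]
  define w where "w x = ennreal (norm x powr - g)" for x :: 'a
  have [measurable]: "w \<in> borel_measurable borel" unfolding w_def by measurable
  define W where "W = (\<integral>\<^sup>+x. w x \<partial>\<theta>)"
  \<comment> \<open>For y in the ball of radius \<rho>, |x - y| \<le> |x| + \<rho> \<le> |x| * (1 +
    \<rho> / R).\<close>
  have lower: "ennreal (m + 2 * \<delta>) * w x \<le> riesz_pot \<alpha> \<sigma> x" if x: "R \<le> norm x" for x
  proof -
    let ?s = "measure \<sigma> (cball 0 \<rho>)"
    have n: "0 < norm x" using x R by linarith
    have "norm x + \<rho> = norm x * (1 + \<rho> / norm x)" using n by (simp add: field_simps)
    also have "\<dots> \<le> norm x * (1 + \<rho> / R)" using x R n \<rho> by (intro mult_left_mono add_left_mono divide_left_mono mult_pos_pos) auto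
    finally have le: "(norm x * (1 + \<rho> / R)) powr - g \<le> (norm x + \<rho>) powr - g"
      using add_pos_nonneg[OF n \<rho>(1)] g by (intro powr_mono2') auto
    have "(m + 2 * \<delta>) * norm x powr - g \<le> ?s * (1 + \<rho> / R) powr - g * norm x powr - g"
      using \<rho> by (intro mult_right_mono) auto
    also have "\<dots> = ?s * (norm x * (1 + \<rho> / R)) powr - g" using n R \<rho> by (simp add: powr_mult)
    also have "\<dots> \<le> ?s * (norm x + \<rho>) powr - g" using le by (intro mult_left_mono) auto
    finally have "ennreal ((m + 2 * \<delta>) * norm x powr - g) \<le> ennreal (?s * (norm x + \<rho>) powr - g)" by (rule ennreal_leI)
    also have "\<dots> = (\<integral>\<^sup>+y. ennreal ((norm x + \<rho>) powr - g) * indicator (cball 0 \<rho>) y \<partial>\<sigma>)"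
      by (subst nn_integral_cmult_indicator) (auto simp: \<sigma>.emeasure_eq_measure ennreal_mult mult.commute \<sigma>)
    also have "\<dots> \<le> riesz_pot \<alpha> \<sigma> x"
      unfolding riesz_pot_def
    proof (intro nn_integral_mono)
      fix y
      show "ennreal ((norm x + \<rho>) powr - g) * indicator (cball 0 \<rho>) y \<le> riesz_kernel \<alpha> x y"
        using riesz_kernel_ge[OF \<alpha>, of x y "norm x + \<rho>"] norm_triangle_ineq4[of x y]
        by (cases "norm y \<le> \<rho>") (auto simp: g_def)
    qed
    finally show ?thesis using \<tau>(4) \<delta> by (simp add: w_def ennreal_mult)
  qed
  \<comment> \<open>Off N one has |x - y| \<ge> (1 - a) * |x|: either |y| < a * R \<le> a * |x|, or
    |x| \<le> R' < a * |y|.\<close>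
  have upper: "riesz_pot \<alpha> \<tau> x \<le> riesz_pot \<alpha> \<tau>N x + ennreal (m + \<delta>) * w x" if x: "R \<le> norm x" "norm x \<le> R'" for x
  proof -
    have n: "0 < norm x" using x R by linarith
    have "riesz_pot \<alpha> \<tau> x \<le> (\<integral>\<^sup>+y. indicator N y * riesz_kernel \<alpha> x y + ennreal (((1 - a) * norm x) powr - g) \<partial>\<tau>)"
      unfolding riesz_pot_def
    proof (intro nn_integral_mono)
      fix y
      show "riesz_kernel \<alpha> x y \<le> indicator N y * riesz_kernel \<alpha> x y + ennreal (((1 - a) * norm x) powr - g)"
      proof (cases "y \<in> N")
        case False
        have "(1 - a) * norm x \<le> norm (x - y)"
        proof (cases "norm y < a * R")
          case True
          have "a * R \<le> a * norm x" using x a by (intro mult_left_mono) auto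
          then show ?thesis using True norm_triangle_ineq2[of x y] by (simp add: algebra_simps)
        next
          case Far: False
          then have "R' / a < norm y" using False by (auto simp: N_def)
          then have "norm x < a * norm y" using x a by (simp add: field_simps)
          then have "norm x * (1 - a) < a * norm y * (1 - a)" using a by (intro mult_strict_right_mono) auto
          also have "\<dots> \<le> 1 * norm y * (1 - a)" using a by (intro mult_right_mono) auto
          also have "\<dots> = norm y - a * norm y" by (simp add: algebra_simps)
          also have "\<dots> < norm y - norm x" using \<open>norm x < a * norm y\<close> by simp
          also have "\<dots> \<le> norm (x - y)" using norm_triangle_ineq2[of y x] by (simp add: norm_minus_commute)
          finally show ?thesis by (simp add: mult.commute)
        qed
        then have "riesz_kernel \<alpha> x y \<le> ennreal (((1 - a) * norm x) powr - g)"
          unfolding g_def using a n by (intro riesz_kernel_le \<alpha>) auto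
        then show ?thesis by (simp add: add_increasing)
      qed simp
    qed
    also have "\<dots> = riesz_pot \<alpha> \<tau>N x + ennreal (((1 - a) * norm x) powr - g) * ennreal m"
      unfolding \<tau>N_def by (simp add: nn_integral_add riesz_pot_density \<tau> space_eq_UNIV[OF \<tau>(2)])
    also have "ennreal (((1 - a) * norm x) powr - g) * ennreal m = ennreal (m * (1 - a) powr - g) * w x"
      using a \<tau>(4) by (simp add: w_def powr_mult ennreal_mult[symmetric] ennreal_mult'[symmetric] ac_simps)
    also have "riesz_pot \<alpha> \<tau>N x + \<dots> \<le> riesz_pot \<alpha> \<tau>N x + ennreal (m + \<delta>) * w x"
      using m by (intro add_left_mono mult_right_mono ennreal_leI) auto
    finally show ?thesis .
  qed
  have Wfin: "W < \<infinity>"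
  proof -
    have "W \<le> (\<integral>\<^sup>+x. ennreal (R powr - g) \<partial>\<theta>)"
      unfolding W_def
    proof (intro nn_integral_mono_AE, use supp in eventually_elim)
      fix x assume "x \<in> A \<and> R \<le> norm x \<and> norm x \<le> R'"
      then show "w x \<le> ennreal (R powr - g)" unfolding w_def using R g by (intro ennreal_leI powr_mono2') auto
    qed
    also have "\<dots> < \<infinity>" using \<theta>.emeasure_finite[of "space \<theta>", unfolded top.not_eq_extremum] by (simp add: ennreal_mult_less_top)
    finally show ?thesis .
  qed
  have Wlow: "ennreal (R' powr - g / 2) \<le> W"
  proof -
    have "ennreal (R' powr - g / 2) = ennreal (R' powr - g) * (1 / 2)"
      using divide_ennreal[of "R' powr - g" 2] by (simp add: ennreal_times_divide)
    also have "\<dots> \<le> ennreal (R' powr - g) * emeasure \<theta> UNIV" using half by (intro mult_left_mono) auto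
    also have "\<dots> = (\<integral>\<^sup>+x. ennreal (R' powr - g) \<partial>\<theta>)" by (simp add: space_eq_UNIV[OF \<theta>(2)])
    also have "\<dots> \<le> W"
      unfolding W_def
    proof (intro nn_integral_mono_AE, use supp in eventually_elim)
      fix x assume "x \<in> A \<and> R \<le> norm x \<and> norm x \<le> R'"
      then show "ennreal (R' powr - g) \<le> w x" unfolding w_def using R g by (intro ennreal_leI powr_mono2') auto
    qed
    finally show ?thesis .
  qed
  have A\<theta>: "AE x in \<theta>. x \<in> A" using supp by eventually_elim auto
  define X where "X = (\<integral>\<^sup>+x. riesz_pot \<alpha> \<tau>N x \<partial>\<theta>)"
  have "ennreal (m + 2 * \<delta>) * W = (\<integral>\<^sup>+x. ennreal (m + 2 * \<delta>) * w x \<partial>\<theta>)"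
    unfolding W_def by (intro nn_integral_cmult[symmetric]) auto
  also have "\<dots> \<le> (\<integral>\<^sup>+x. riesz_pot \<alpha> \<sigma> x \<partial>\<theta>)"
    by (intro nn_integral_mono_AE, use supp in eventually_elim) (auto intro: lower)
  also have "\<dots> = mutual_energy \<alpha> \<sigma> \<theta>"
    using mutual_energy_commute[OF sf(1,2) \<theta>(2) \<sigma>(2), of \<alpha>] by (simp add: mutual_energy_pot)
  also have "\<dots> \<le> mutual_energy \<alpha> \<tau> \<theta>" by (rule test[OF \<theta> A\<theta>])
  also have "\<dots> = (\<integral>\<^sup>+x. riesz_pot \<alpha> \<tau> x \<partial>\<theta>)"
    using mutual_energy_commute[OF sf(1,3) \<theta>(2) \<tau>(2), of \<alpha>] by (simp add: mutual_energy_pot)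
  also have "\<dots> \<le> (\<integral>\<^sup>+x. riesz_pot \<alpha> \<tau>N x + ennreal (m + \<delta>) * w x \<partial>\<theta>)"
    by (intro nn_integral_mono_AE, use supp in eventually_elim) (auto intro: upper)
  also have "\<dots> = X + ennreal (m + \<delta>) * W" unfolding X_def W_def by (simp add: nn_integral_add nn_integral_cmult)
  finally have "ennreal (m + 2 * \<delta>) * W \<le> X + ennreal (m + \<delta>) * W" .
  moreover have "ennreal (m + 2 * \<delta>) * W = ennreal (m + \<delta>) * W + ennreal \<delta> * W"
  proof -
    have "ennreal (m + 2 * \<delta>) = ennreal ((m + \<delta>) + \<delta>)" by (simp only: mult_2 add.assoc)
    also have "\<dots> = ennreal (m + \<delta>) + ennreal \<delta>" using \<tau>(4) \<delta> by (intro ennreal_plus) auto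
    finally show ?thesis by (simp only: distrib_right)
  qed
  ultimately have "ennreal (m + \<delta>) * W + ennreal \<delta> * W \<le> ennreal (m + \<delta>) * W + X" by (simp add: add.commute)
  moreover have "ennreal (m + \<delta>) * W \<noteq> \<infinity>" using Wfin by (simp add: ennreal_mult_eq_top_iff)
  ultimately have \<delta>W: "ennreal \<delta> * W \<le> X" by (auto simp: ennreal_add_left_cancel_le)
  let ?c = "2 powr g * (2 * c) * (a * R * R) powr - g"
  \<comment> \<open>By symmetry the contribution of the annulus is an integral of the potential of
    \<theta> over N, where |y| \<ge> a * R makes the pointwise bound uniform.\<close>
  have "X = (\<integral>\<^sup>+y. riesz_pot \<alpha> \<theta> y \<partial>\<tau>N)"
    using mutual_energy_commute[OF sf(1) sfN \<theta>(2) s\<tau>N, of \<alpha>] by (simp add: mutual_energy_pot X_def)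
  also have "\<dots> \<le> (\<integral>\<^sup>+y. ennreal ?c \<partial>\<tau>N)"
    unfolding \<tau>N_def
  proof (intro nn_integral_mono_AE, subst AE_density_indicator, simp add: \<tau>, intro AE_I2 impI)
    fix y assume y: "y \<in> N"
    then have y0: "y \<noteq> 0" "a * R \<le> norm y" using a R by (auto simp: N_def mult_le_0_iff)
    have "(norm y * R) powr - g \<le> (a * R * R) powr - g" using y0 a R g by (intro powr_mono2') auto
    then have "2 powr g * (2 * c) * (norm y * R) powr - g \<le> ?c" using c0 by (intro mult_left_mono) auto
    then show "riesz_pot \<alpha> \<theta> y \<le> ennreal ?c" by (rule order_trans[OF pot[OF y0(1)] ennreal_leI])
  qed
  also have "\<dots> = ennreal ?c * emeasure \<tau>N UNIV" by (simp add: space_eq_UNIV[OF s\<tau>N])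
  also have "emeasure \<tau>N UNIV = ennreal (measure \<tau> N)"
    unfolding \<tau>N_def by (subst emeasure_density) (auto simp: \<tau> \<tau>.emeasure_eq_measure)
  finally have "X \<le> ennreal (?c * measure \<tau> N)" using c0 by (simp add: ennreal_mult'')
  moreover have "ennreal (\<delta> * (R' powr - g / 2)) \<le> ennreal \<delta> * W"
  proof -
    have "ennreal (\<delta> * (R' powr - g / 2)) = ennreal \<delta> * ennreal (R' powr - g / 2)"
      using \<delta> by (intro ennreal_mult) auto
    then show ?thesis using mult_left_mono[OF Wlow, of "ennreal \<delta>"] by simp
  qed
  ultimately have "ennreal (\<delta> * (R' powr - g / 2)) \<le> ennreal (?c * measure \<tau> N)"
    using \<delta>W by (meson order_trans)
  then show ?thesis using c0 unfolding N_def by (subst (asm) ennreal_le_iff) auto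
qed

text \<open>The annuli follow a geometric scale of ratio 1 / q and are widened by the factor q ^ j
  on either side, so the indices of two annuli with a common point differ by at most 2 * j +
  1.\<close>

lemma annulus_overlap:
  fixes \<tau> :: "'a::euclidean_space measure"
  assumes \<tau>: "sets \<tau> = sets borel" and q: "0 < q" "q < (1::real)"
  shows "(\<Sum>k. emeasure \<tau> {y. q ^ j * (1 / q ^ Suc k) \<le> norm y \<and> norm y \<le> 1 / q ^ Suc (Suc k) / q ^ j})
    \<le> of_nat (2 * j + 2) * emeasure \<tau> UNIV"
proof -
  define N where "N k = {y :: 'a. q ^ j * (1 / q ^ Suc k) \<le> norm y \<and> norm y \<le> 1 / q ^ Suc (Suc k) / q ^ j}" for k
  note [measurable_cong] = \<tau>
  have "closed (N k)" for k unfolding N_def by (intro closed_Collect_conj closed_Collect_le continuous_intros)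
  then have [measurable]: "N k \<in> sets borel" for k by (rule borel_closed)
  have close: "l \<le> k + (2 * j + 1)" if "y \<in> N k" "y \<in> N l" for y k l
  proof -
    have "q ^ j * (1 / q ^ Suc l) \<le> 1 / q ^ Suc (Suc k) / q ^ j" using that unfolding N_def by auto
    then have "q ^ j * q ^ Suc (Suc k) * q ^ j \<le> q ^ Suc l" using q by (simp add: field_simps)
    then have "q ^ (j + Suc (Suc k) + j) \<le> q ^ Suc l" by (simp only: power_add)
    then have "Suc l \<le> j + Suc (Suc k) + j" using q by (subst (asm) power_decreasing_iff) auto
    then show ?thesis by simp
  qed
  have count: "(\<Sum>k<n. indicator (N k) y) \<le> (of_nat (2 * j + 2) :: ennreal)" for n y
  proof -
    define K where "K = {k. k < n \<and> y \<in> N k}"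
    have cK: "card K \<le> 2 * j + 2"
    proof (cases "K = {}")
      case False
      have fin: "finite K" by (simp add: K_def)
      have "Min K \<in> K" using fin False by (rule Min_in)
      then have "K \<subseteq> {Min K..Min K + (2 * j + 1)}"
        using close fin by (auto simp: K_def)
      then have "card K \<le> card {Min K..Min K + (2 * j + 1)}" by (intro card_mono) auto
      then show ?thesis by simp
    qed simp
    have eq: "(\<Sum>k<n. indicator (N k) y) = (of_nat (card K) :: ennreal)"
    proof -
      have "(\<Sum>k<n. indicator (N k) y) = (\<Sum>k\<in>K. (1::ennreal))"
        unfolding K_def by (intro sum.mono_neutral_cong_right) (auto simp: indicator_def)
      then show ?thesis by simp
    qed
    show ?thesis unfolding eq by (rule of_nat_mono[OF cK])
  qed
  have "(\<Sum>k. emeasure \<tau> (N k)) = (\<Sum>k. \<integral>\<^sup>+y. indicator (N k) y \<partial>\<tau>)" by (simp add: \<tau>)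
  also have "\<dots> = (\<integral>\<^sup>+y. (\<Sum>k. indicator (N k) y) \<partial>\<tau>)" by (intro nn_integral_suminf[symmetric]) auto
  also have "\<dots> \<le> (\<integral>\<^sup>+y. of_nat (2 * j + 2) \<partial>\<tau>)"
    by (intro nn_integral_mono) (auto simp only: suminf_eq_SUP intro!: SUP_least count)
  also have "\<dots> = of_nat (2 * j + 2) * emeasure \<tau> UNIV" by (simp add: space_eq_UNIV[OF \<tau>])
  finally show ?thesis by (simp only: N_def)
qed

text \<open>A lower bound for every competing energy on the k-th piece is an upper bound for its
  capacity. \<open>annulus_mass_bound\<close> supplies it in terms of the mass of \<tau> in the
  widened annulus, and \<open>annulus_overlap\<close> sums these masses.\<close>

lemma thin_of_mass_deficit:
  fixes \<alpha> q :: real and \<sigma> \<tau> :: "'a::euclidean_space measure"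
  assumes \<alpha>: "\<alpha> < real DIM('a)" and q: "0 < q" "q < 1"
    and \<sigma>: "finite_measure \<sigma>" "sets \<sigma> = sets borel" "emeasure \<sigma> UNIV = 1"
    and \<tau>: "finite_measure \<tau>" "sets \<tau> = sets borel" "emeasure \<tau> UNIV < 1"
    and test: "\<And>\<theta>. finite_measure \<theta> \<Longrightarrow> sets \<theta> = sets borel \<Longrightarrow> energy \<alpha> \<theta> < \<infinity> \<Longrightarrow> AE x in \<theta>. x \<in> A \<Longrightarrow>
       mutual_energy \<alpha> \<sigma> \<theta> \<le> mutual_energy \<alpha> \<tau> \<theta>"
  shows "thin_at_infinity \<alpha> q A"
proof -
  interpret \<sigma>: finite_measure \<sigma> by (rule \<sigma>(1))
  interpret \<tau>: finite_measure \<tau> by (rule \<tau>(1))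
  define g where "g = real DIM('a) - \<alpha>"
  have g: "0 < g" using \<alpha> by (simp add: g_def)
  obtain m where m: "emeasure \<tau> UNIV = ennreal m" "0 \<le> m" using \<tau>(3) by (cases "emeasure \<tau> UNIV") (auto simp: top_unique)
  then have m1: "m < 1" using \<tau>(3) by (simp add: ennreal_less_iff[of m 1, simplified])
  \<comment> \<open>The deficit is split in three: one part pays for the distortion of the kernel
    off the annulus, one for the truncation of \<sigma> to a ball, and one remains as the gap
    between \<sigma> and \<tau>.\<close>
  define \<delta> where "\<delta> = (1 - m) / 3"
  have "3 * \<delta> = 1 - m" by (simp add: \<delta>_def)
  then have \<delta>: "0 < \<delta>" "m + 3 * \<delta> = 1" using m1 by linarith+
  have ql: "(\<lambda>k. q ^ k) \<longlonglongrightarrow> 0" using q by (intro LIMSEQ_realpow_zero) auto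
  have "(\<lambda>k. m * (1 - q ^ k) powr - g) \<longlonglongrightarrow> m * (1 - 0) powr - g"
    by (intro tendsto_intros ql) auto
  then have "(\<lambda>k. m * (1 - q ^ k) powr - g) \<longlonglongrightarrow> m" by simp
  then have "eventually (\<lambda>k. m * (1 - q ^ k) powr - g < m + \<delta>) sequentially"
    using \<delta> by (intro order_tendstoD(2)) auto
  then have "eventually (\<lambda>k. m * (1 - q ^ k) powr - g < m + \<delta> \<and> 1 \<le> k) sequentially"
    using eventually_ge_at_top[of 1] by eventually_elim auto
  then obtain j where j: "m * (1 - q ^ j) powr - g < m + \<delta>" "1 \<le> j" by (auto simp: eventually_sequentially)
  \<comment> \<open>The widening is a power of q, so that the widened annuli fit the scale of the
    Wiener pieces.\<close>
  define a where "a = q ^ j"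
  have a: "0 < a" "a < 1" using q j by (auto simp: a_def power_less_one_iff)
  have \<sigma>1: "measure \<sigma> UNIV = 1" using \<sigma>(3) by (simp add: measure_def)
  have "(\<lambda>i. measure \<sigma> (cball 0 (real i))) \<longlonglongrightarrow> measure \<sigma> (\<Union>i. cball 0 (real i))"
    by (rule \<sigma>.finite_Lim_measure_incseq) (auto simp: \<sigma> incseq_def)
  moreover have "(\<Union>i. cball (0::'a) (real i)) = UNIV" by (auto simp: real_arch_simple)
  ultimately have "(\<lambda>i. measure \<sigma> (cball 0 (real i))) \<longlonglongrightarrow> 1" using \<sigma>1 by simp
  then have "eventually (\<lambda>i. m + 2 * \<delta> < measure \<sigma> (cball 0 (real i))) sequentially"
    using \<delta> by (intro order_tendstoD(1)) auto
  then obtain i where i: "m + 2 * \<delta> < measure \<sigma> (cball 0 (real i))" by (auto simp: eventually_sequentially)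
  define s where "s = measure \<sigma> (cball 0 (real i))"
  have "(\<lambda>k. s * (1 + real i * q ^ k) powr - g) \<longlonglongrightarrow> s * (1 + real i * 0) powr - g"
    by (intro tendsto_intros ql) auto
  then have "(\<lambda>k. s * (1 + real i * q ^ k) powr - g) \<longlonglongrightarrow> s" by simp
  then have "eventually (\<lambda>k. m + 2 * \<delta> < s * (1 + real i * q ^ k) powr - g) sequentially"
    using i by (intro order_tendstoD(1)) (auto simp: s_def)
  then obtain k0 where k0: "\<And>k. k0 \<le> k \<Longrightarrow> m + 2 * \<delta> < s * (1 + real i * q ^ k) powr - g"
    by (auto simp: eventually_sequentially)
  define F where "F = {0} \<union> unit_inversion ` (A - {0})"
  define B where "B k = {x \<in> F. q ^ (Suc k + 1) < norm (x - 0) \<and> norm (x - 0) \<le> q ^ Suc k}" for k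
  define N where "N k = {y :: 'a. q ^ j * (1 / q ^ Suc k) \<le> norm y \<and> norm y \<le> 1 / q ^ Suc (Suc k) / q ^ j}" for k
  \<comment> \<open>The constants of \<open>annulus_mass_bound\<close> after R' = R / q and
    cancellation of R powr - g. The 4 comes from the level 2 * c in the choice of the test measure
    and from its mass being at least 1 / 2.\<close>
  define D where "D = 4 * 2 powr g * a powr - g * q powr - g / \<delta>"
  have D: "D > 0" using \<delta> a q by (simp add: D_def)
  define f where "f k = capacity \<alpha> (B k) * ennreal (q powr (- real (Suc k) * (real DIM('a) - \<alpha>)))" for k
  have Bin: "unit_inversion x \<in> A \<and> 1 / (1 / q ^ Suc (Suc k)) \<le> norm x \<and> norm x \<le> 1 / (1 / q ^ Suc k)" if "x \<in> B k" for x k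
  proof -
    have n: "q ^ Suc (Suc k) < norm x" "norm x \<le> q ^ Suc k" "x \<in> F" using that by (auto simp: B_def)
    have "0 < q ^ Suc (Suc k)" using q by simp
    then have "x \<noteq> 0" using n by auto
    then obtain y where "y \<in> A" "x = unit_inversion y" using n by (auto simp: F_def)
    then show ?thesis using n by (simp add: unit_inversion_involution less_imp_le)
  qed
  have main: "f k \<le> ennreal D * emeasure \<tau> (N k)" if k: "k0 \<le> k" for k
  proof -
    define R where "R = 1 / q ^ Suc k"
    define R' where "R' = 1 / q ^ Suc (Suc k)"
    have R: "0 < R" "R' = R / q" using q by (auto simp: R_def R'_def)
    have "R * q \<le> R * 1" using q R(1) by (intro mult_left_mono) auto
    then have RR: "R \<le> R'" unfolding R(2) using q by (simp add: pos_le_divide_eq)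
    have \<rho>: "m + 2 * \<delta> \<le> measure \<sigma> (cball 0 (real i)) * (1 + real i / R) powr - g"
      using k0[of "Suc k"] k by (simp add: s_def R_def)
    let ?t = "measure \<tau> (N k)"
    have Neq: "N k = {y. a * R \<le> norm y \<and> norm y \<le> R' / a}" by (simp add: N_def a_def R_def R'_def)
    \<comment> \<open>The estimate of \<open>annulus_mass_bound\<close>, solved for R powr g; this
      power is exactly the weight of the k-th Wiener term.\<close>
    have bound: "R powr g \<le> c * (D * ?t)"
      if M: "M \<in> finite_energy_pos \<alpha> (B k)" "emeasure (completion M) (B k) = 1" and c: "energy \<alpha> M < ennreal c" for M c
    proof -
      have "\<delta> * (R' powr - g / 2) \<le> 2 powr g * (2 * c) * (a * R * R) powr - g * measure \<tau> {y. a * R \<le> norm y \<and> norm y \<le> R' / a}"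
        unfolding g_def
        by (rule annulus_mass_bound[OF \<alpha> \<sigma>(1,2) \<tau>(1,2) m test R(1) RR a \<delta>(1) _ _ _ M c])
           (use j \<rho> Bin in \<open>auto simp: a_def g_def R_def R'_def\<close>)
      then have e: "\<delta> * (R' powr - g / 2) \<le> 2 powr g * (2 * c) * (a * R * R) powr - g * ?t" by (simp only: Neq)
      have 1: "R' powr - g = R powr - g * q powr g"
      proof -
        have "R' powr - g = R powr - g / q powr - g" unfolding R(2) using R(1) q by (subst powr_divide) auto
        then show ?thesis by (simp add: powr_minus divide_simps)
      qed
      have 2: "(a * R * R) powr - g = a powr - g * R powr - g * R powr - g"
        using R a by (simp add: powr_mult)
      have "R powr - g * (\<delta> * q powr g / 2) \<le> R powr - g * (2 powr g * (2 * c) * a powr - g * R powr - g * ?t)"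
        using e unfolding 1 2 by (simp add: ac_simps)
      then have "\<delta> * q powr g / 2 \<le> 2 powr g * (2 * c) * a powr - g * R powr - g * ?t" using R by simp
      then have "(2 / (\<delta> * q powr g) * R powr g) * (\<delta> * q powr g / 2) \<le> (2 / (\<delta> * q powr g) * R powr g) * (2 powr g * (2 * c) * a powr - g * R powr - g * ?t)"
        using \<delta> by (intro mult_left_mono) auto
      also have "(2 / (\<delta> * q powr g) * R powr g) * (\<delta> * q powr g / 2) = R powr g" using \<delta> q by simp
      also have "(2 / (\<delta> * q powr g) * R powr g) * (2 powr g * (2 * c) * a powr - g * R powr - g * ?t) = c * (D * ?t)"
        using R q by (simp add: D_def powr_minus divide_inverse)
      finally show ?thesis .
    qed
    define e where "e = (INF M\<in>{M \<in> finite_energy_pos \<alpha> (B k). emeasure (completion M) (B k) = 1}. energy \<alpha> M)"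
    have cap: "capacity \<alpha> (B k) = inverse e" by (simp add: capacity_def e_def)
    have Rg: "q powr (- real (Suc k) * (real DIM('a) - \<alpha>)) = R powr g"
    proof -
      have "R = q powr (- real (Suc k))" unfolding powr_minus_divide R_def using powr_realpow[of q "Suc k"] q by metis
      then show ?thesis by (simp add: powr_powr g_def)
    qed
    have tau: "emeasure \<tau> (N k) = ennreal ?t" by (rule \<tau>.emeasure_eq_measure)
    \<comment> \<open>Without competitors of finite energy e = \<top> and the term is 0. Otherwise c
      decreases to the infimum; the value 0 of the infimum is excluded because it would force R powr
      g \<le> 0.\<close>
    show ?thesis
    proof (cases e)
      case top
      then show ?thesis by (simp add: f_def cap)
    next
      case (real e')
      have all: "R powr g \<le> c * (D * ?t)" if "e' < c" for c
      proof -
        have "e < ennreal c" using real that by (simp add: ennreal_less_iff)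
        then obtain M where "M \<in> finite_energy_pos \<alpha> (B k)" "emeasure (completion M) (B k) = 1" "energy \<alpha> M < ennreal c"
          unfolding e_def INF_less_iff by blast
        then show ?thesis by (rule bound)
      qed
      have Dt: "0 \<le> D * ?t" using D by simp
      have le: "R powr g \<le> e' * (D * ?t)"
      proof (rule field_le_epsilon)
        fix \<epsilon> :: real assume \<epsilon>: "0 < \<epsilon>"
        have "R powr g \<le> (e' + \<epsilon> / (D * ?t + 1)) * (D * ?t)" using Dt \<epsilon> by (intro all) auto
        also have "\<dots> = e' * (D * ?t) + \<epsilon> * ((D * ?t) / (D * ?t + 1))" using Dt by (simp add: distrib_right)
        also have "\<dots> \<le> e' * (D * ?t) + \<epsilon> * 1" using Dt \<epsilon> by (intro add_left_mono mult_left_mono) auto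
        finally show "R powr g \<le> e' * (D * ?t) + \<epsilon>" by simp
      qed
      have "0 < R powr g" using R by simp
      then have e0: "0 < e'" using le real(1) by (metis less_eq_real_def mult_eq_0_iff not_le)
      have "f k = ennreal (inverse e' * R powr g)"
        unfolding f_def cap Rg using real e0 by (simp add: inverse_ennreal ennreal_mult)
      also have "inverse e' * R powr g \<le> D * ?t" using le e0 by (simp add: field_simps)
      then have "ennreal (inverse e' * R powr g) \<le> ennreal (D * ?t)" by (rule ennreal_leI)
      also have "\<dots> = ennreal D * emeasure \<tau> (N k)" using D by (simp add: tau ennreal_mult)
      finally show ?thesis .
    qed
  qed
  have f_fin: "f k < \<infinity>" for k
  proof -
    have "q ^ Suc k \<le> 1" using q by (intro power_le_one) auto
    then have "B k \<subseteq> cball 0 1" by (auto simp: B_def)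
    from capacity_finite_of_bounded[OF \<alpha> this] show ?thesis by (simp add: f_def ennreal_mult_less_top)
  qed
  \<comment> \<open>The estimate \<open>main\<close> begins at k0; the finitely many earlier terms
    are kept as they are and are finite by \<open>f_fin\<close>.\<close>
  have "(\<Sum>k. f k) \<le> (\<Sum>k. (if k < k0 then f k else 0) + ennreal D * emeasure \<tau> (N k))"
    using main by (intro suminf_le) (auto simp: not_less add_increasing2)
  also have "\<dots> = (\<Sum>k. if k < k0 then f k else 0) + (\<Sum>k. ennreal D * emeasure \<tau> (N k))"
    by (intro suminf_add[symmetric]) auto
  also have "(\<Sum>k. if k < k0 then f k else 0) = (\<Sum>k<k0. f k)"
    by (subst suminf_finite[of "{..<k0}"]) auto
  also have "(\<Sum>k. ennreal D * emeasure \<tau> (N k)) = ennreal D * (\<Sum>k. emeasure \<tau> (N k))"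
    by (rule ennreal_suminf_cmult)
  also have "(\<Sum>k<k0. f k) + ennreal D * (\<Sum>k. emeasure \<tau> (N k)) \<le> (\<Sum>k<k0. f k) + ennreal D * (of_nat (2 * j + 2) * emeasure \<tau> UNIV)"
    using annulus_overlap[OF \<tau>(2) q, of j] unfolding N_def by (intro add_left_mono mult_left_mono) auto
  also have "\<dots> < \<infinity>"
  proof -
    have "ennreal D * (of_nat (2 * j + 2) * emeasure \<tau> UNIV) < \<top>"
      unfolding ennreal_mult_less_top using of_nat_less_top[of "2 * j + 2"] m by simp
    then show ?thesis using f_fin by (simp add: less_top[symmetric])
  qed
  finally have "(\<Sum>k. f k) < \<infinity>" .
  then have "irregular_point \<alpha> q F 0"
    unfolding irregular_point_def f_def B_def by (auto simp: F_def)
  then show ?thesis by (simp add: thin_at_infinity_def F_def)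
qed

section \<open>Uniqueness\<close>

text \<open>Indicators of open sets are increasing limits of continuous functions made from the
  distance to the complement, and open sets form an intersection-stable generator.\<close>

lemma finite_measure_eqI_continuous:
  fixes M N :: "'a::euclidean_space measure"
  assumes M: "finite_measure M" "sets M = sets borel" and N: "finite_measure N" "sets N = sets borel"
    and eq: "\<And>g. continuous_on UNIV g \<Longrightarrow> (\<And>x. 0 \<le> g x \<and> g x \<le> 1) \<Longrightarrow> (\<integral>\<^sup>+x. ennreal (g x) \<partial>M) = (\<integral>\<^sup>+x. ennreal (g x) \<partial>N)"
  shows "M = N"
proof -
  interpret M: finite_measure M by (rule M(1))
  have op: "emeasure M U = emeasure N U" if U: "open U" for U
  proof (cases "U = UNIV")
    case True
    then show ?thesis using eq[of "\<lambda>_. 1"] by (simp add: space_eq_UNIV M N)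
  next
    case False
    define g where "g n x = min 1 (real n * infdist x (- U))" for n x
    have ne: "- U \<noteq> {}" "closed (- U)" using False U by (auto simp: closed_Compl)
    have gc: "continuous_on UNIV (g n)" for n unfolding g_def by (intro continuous_intros)
    have g01: "0 \<le> g n x \<and> g n x \<le> 1" for n x by (auto simp: g_def infdist_nonneg)
    have ginc: "incseq (\<lambda>n x. ennreal (g n x))"
      unfolding g_def by (intro incseq_SucI le_funI ennreal_leI min.mono mult_right_mono) (auto simp: infdist_nonneg)
    have sup: "(SUP n. ennreal (g n x)) = indicator U x" for x
    proof (cases "x \<in> U")
      case True
      then have "infdist x (- U) \<noteq> 0" using in_closed_iff_infdist_zero[OF ne(2,1), of x] by auto
      then have pos: "0 < infdist x (- U)" using infdist_nonneg[of x "- U"] by linarith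
      obtain n where "1 < real n * infdist x (- U)" using reals_Archimedean3[OF pos] by blast
      then have "g n x = 1" by (simp add: g_def)
      then have "1 \<le> (SUP n. ennreal (g n x))" by (intro SUP_upper2[of n]) auto
      moreover have "(SUP n. ennreal (g n x)) \<le> 1" using g01 by (intro SUP_least) auto
      ultimately have "(SUP n. ennreal (g n x)) = 1" by (rule antisym[rotated])
      then show ?thesis using True by simp
    next
      case False
      then have "infdist x (- U) = 0" using in_closed_iff_infdist_zero[OF ne(2,1), of x] by auto
      then have "g n x = 0" for n by (simp add: g_def)
      then show ?thesis using False by simp
    qed
    have "emeasure K U = (SUP n. \<integral>\<^sup>+x. ennreal (g n x) \<partial>K)" if K: "sets K = sets borel" for K
    proof -
      note [measurable_cong] = K
      have [measurable]: "g n \<in> borel_measurable borel" for n using gc by (rule borel_measurable_continuous_onI)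
      have "emeasure K U = (\<integral>\<^sup>+x. (SUP n. ennreal (g n x)) \<partial>K)" unfolding sup using U K by simp
      also have "\<dots> = (SUP n. \<integral>\<^sup>+x. ennreal (g n x) \<partial>K)"
        using ginc by (intro nn_integral_monotone_convergence_SUP) auto
      finally show ?thesis .
    qed
    then show ?thesis using M(2) N(2) eq[OF gc g01] by simp
  qed
  show ?thesis
  proof (rule measure_eqI_generator_eq[where E="{S. open S}" and \<Omega>=UNIV and A="\<lambda>_. UNIV"])
    show "Int_stable {S::'a set. open S}" by (auto simp: Int_stable_def)
    show "sets M = sigma_sets UNIV {S. open S}" "sets N = sigma_sets UNIV {S. open S}"
      using M N by (auto simp: borel_def)
    show "emeasure M UNIV \<noteq> \<infinity>" by simp
  qed (use op in auto)
qed

lemma heat_avg_tendsto: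
  fixes g :: "'a::euclidean_space \<Rightarrow> real"
  assumes gc: "continuous_on UNIV g" and g01: "\<And>x. 0 \<le> g x \<and> g x \<le> 1"
    and s: "\<And>k. 0 < s k" "s \<longlonglongrightarrow> 0"
  shows "(\<lambda>k. heat_avg (s k) (\<lambda>x. ennreal (g x)) x) \<longlonglongrightarrow> ennreal (g x)"
proof -
  have [measurable]: "g \<in> borel_measurable borel" using gc by (rule borel_measurable_continuous_onI)
  have "(\<lambda>k. \<integral>\<^sup>+y. ennreal (heat 1 y) * ennreal (g (x - sqrt (s k) *\<^sub>R y)) \<partial>lborel) \<longlonglongrightarrow> (\<integral>\<^sup>+y. ennreal (heat 1 (y::'a)) * ennreal (g x) \<partial>lborel)"
  proof (rule nn_integral_dominated_convergence[where w="\<lambda>y::'a. ennreal (heat 1 y)"])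
    show "(\<integral>\<^sup>+y. ennreal (heat 1 (y::'a)) \<partial>lborel) < \<infinity>" by (simp add: nn_integral_heat)
    show "AE y in lborel. ennreal (heat 1 y) * ennreal (g (x - sqrt (s k) *\<^sub>R y)) \<le> ennreal (heat 1 y)" for k
      using g01 by (intro AE_I2) (auto simp: ennreal_mult'[symmetric] mult_left_le intro!: ennreal_leI)
    show "AE y in lborel. (\<lambda>k. ennreal (heat 1 y) * ennreal (g (x - sqrt (s k) *\<^sub>R y))) \<longlonglongrightarrow> ennreal (heat 1 y) * ennreal (g x)"
    proof (intro AE_I2 ennreal_tendsto_cmult tendsto_ennrealI)
      fix y :: 'a
      have "(\<lambda>k. x - sqrt (s k) *\<^sub>R y) \<longlonglongrightarrow> x - sqrt 0 *\<^sub>R y" by (intro tendsto_intros s)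
      then have l: "(\<lambda>k. x - sqrt (s k) *\<^sub>R y) \<longlonglongrightarrow> x" by simp
      show "(\<lambda>k. g (x - sqrt (s k) *\<^sub>R y)) \<longlonglongrightarrow> g x"
        using continuous_on_tendsto_compose[OF gc l] by simp
    qed simp
  qed auto
  moreover have "(\<integral>\<^sup>+y. ennreal (heat 1 (y::'a)) * ennreal (g x) \<partial>lborel) = ennreal (g x)"
    by (subst nn_integral_multc) (auto simp: nn_integral_heat)
  ultimately show ?thesis using s by (simp add: heat_avg_rescale)
qed

text \<open>A bounded continuous function is the limit of its heat averages as the time tends to 0.
  Suitable times with equal heat potentials exist because \<open>riesz_time\<close> charges every
  interval of small times.\<close>

lemma heat_pot_injective:
  fixes M N :: "'a::euclidean_space measure"
  assumes \<alpha>: "0 < \<alpha>" and M: "finite_measure M" "sets M = sets borel" and N: "finite_measure N" "sets N = sets borel"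
    and eq: "AE s in riesz_time \<alpha>. AE z in lborel. heat_pot (s / 2) M z = heat_pot (s / 2) N z"
  shows "M = N"
proof (rule finite_measure_eqI_continuous[OF M N])
  fix g :: "'a \<Rightarrow> real" assume gc: "continuous_on UNIV g" and g01: "\<And>x. 0 \<le> g x \<and> g x \<le> 1"
  have gm [measurable]: "g \<in> borel_measurable borel" using gc by (rule borel_measurable_continuous_onI)
  let ?P = "\<lambda>s. AE z in lborel. heat_pot (s / 2) M z = heat_pot (s / 2) N z"
  have "\<exists>s. 0 < s \<and> s < t \<and> ?P s" if t: "0 < t" for t
  proof (rule ccontr)
    assume no: "\<not> ?thesis"
    have "AE s in riesz_time \<alpha>. indicator {..<t} s = (0::ennreal)"
      using eq AE_riesz_time[of \<alpha>] by eventually_elim (use no in \<open>auto simp: indicator_def\<close>)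
    then have "(\<integral>\<^sup>+s. indicator {..<t} s \<partial>riesz_time \<alpha>) = (\<integral>\<^sup>+s. 0 \<partial>riesz_time \<alpha>)" by (rule nn_integral_cong_AE)
    then show False using riesz_time_initial(1)[OF \<alpha> t] by simp
  qed
  then have "\<exists>s. \<forall>k::nat. 0 < s k \<and> s k < 1 / real (Suc k) \<and> ?P (s k)" by (intro choice allI) auto
  then obtain s where s: "\<And>k::nat. 0 < s k" "\<And>k. s k < 1 / real (Suc k)" "\<And>k. ?P (s k)" by blast
  have inv0: "(\<lambda>k. 1 / real (Suc k)) \<longlonglongrightarrow> 0" using LIMSEQ_inverse_real_of_nat by (simp add: inverse_eq_divide)
  have "s \<longlonglongrightarrow> 0"
    by (rule tendsto_sandwich[OF _ _ tendsto_const inv0]) (use s in \<open>auto intro!: eventuallyI less_imp_le\<close>)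
  then have s0: "(\<lambda>k. s k / 2) \<longlonglongrightarrow> 0" using tendsto_divide[OF _ tendsto_const[of "2::real"]] by fastforce
  have sp: "0 < s k / 2" for k using s by simp
  have lim: "(\<lambda>k. \<integral>\<^sup>+x. heat_avg (s k / 2) (\<lambda>x. ennreal (g x)) x \<partial>K) \<longlonglongrightarrow> (\<integral>\<^sup>+x. ennreal (g x) \<partial>K)"
    if K: "finite_measure K" "sets K = sets borel" for K
  proof (rule nn_integral_dominated_convergence[where w="\<lambda>_. 1"])
    note [measurable_cong] = K(2)
    show "(\<lambda>x. heat_avg (s k / 2) (\<lambda>x. ennreal (g x)) x) \<in> borel_measurable K" for k by measurable
    show "(\<lambda>x. ennreal (g x)) \<in> borel_measurable K" by measurable
    show "AE x in K. heat_avg (s k / 2) (\<lambda>x. ennreal (g x)) x \<le> 1" for k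
    proof (intro AE_I2)
      fix x
      have "heat_avg (s k / 2) (\<lambda>x. ennreal (g x)) x \<le> heat_avg (s k / 2) (\<lambda>_. 1) x"
        using g01 by (intro heat_avg_mono) auto
      then show "heat_avg (s k / 2) (\<lambda>x. ennreal (g x)) x \<le> 1" using sp by (simp add: heat_avg_const)
    qed
    show "(\<integral>\<^sup>+x. 1 \<partial>K) < \<infinity>" using finite_measure.emeasure_finite[OF K(1), of "space K", unfolded top.not_eq_extremum] by simp
  qed (auto intro!: AE_I2 heat_avg_tendsto gc g01 sp s0)
  have "(\<integral>\<^sup>+x. heat_avg (s k / 2) (\<lambda>x. ennreal (g x)) x \<partial>M) = (\<integral>\<^sup>+x. heat_avg (s k / 2) (\<lambda>x. ennreal (g x)) x \<partial>N)" for k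
  proof -
    have sf: "sigma_finite_measure M" "sigma_finite_measure N" using M N by (auto simp: finite_measure_def)
    have "(\<integral>\<^sup>+x. heat_avg (s k / 2) (\<lambda>x. ennreal (g x)) x \<partial>M) = (\<integral>\<^sup>+z. heat_pot (s k / 2) M z * ennreal (g z) \<partial>lborel)"
      unfolding heat_avg_def by (intro heat_pot_pairing sf M) auto
    also have "\<dots> = (\<integral>\<^sup>+z. heat_pot (s k / 2) N z * ennreal (g z) \<partial>lborel)"
      by (intro nn_integral_cong_AE, use s(3)[of k] in eventually_elim) simp
    also have "\<dots> = (\<integral>\<^sup>+x. heat_avg (s k / 2) (\<lambda>x. ennreal (g x)) x \<partial>N)"
      unfolding heat_avg_def by (intro heat_pot_pairing[symmetric] sf N) auto
    finally show ?thesis .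
  qed
  then show "(\<integral>\<^sup>+x. ennreal (g x) \<partial>M) = (\<integral>\<^sup>+x. ennreal (g x) \<partial>N)"
    using lim[OF M] lim[OF N] LIMSEQ_unique by auto
qed

lemma finite_measure_add:
  assumes "finite_measure M" "finite_measure N" "sets N = sets M"
  shows "finite_measure (measure_add M N)"
proof (rule finite_measureI)
  have "emeasure (measure_add M N) (space M) = emeasure M (space M) + emeasure N (space M)"
    by (rule emeasure_measure_add[OF assms(3)]) simp
  then show "emeasure (measure_add M N) (space (measure_add M N)) \<noteq> \<infinity>"
    using finite_measure.emeasure_finite[OF assms(1)] finite_measure.emeasure_finite[OF assms(2)] by simp
qed

context relaxed_problem
begin

text \<open>The midpoint cannot beat the minimum, so the defect in \<open>obj_midpoint\<close> is 0.
  This defect is the energy distance of the crosswise sums, and heat potentials determine a finite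
  measure.\<close>

lemma minimizers_eq:
  assumes h: "dens h" "dens h'" and t: "sub \<tau>" "sub \<tau>'" and obj_fin: "obj h \<tau> < \<infinity>"
    and min: "\<And>h' \<tau>'. dens h' \<Longrightarrow> sub \<tau>' \<Longrightarrow> obj h \<tau> \<le> obj h' \<tau>'" and eq: "obj h' \<tau>' = obj h \<tau>"
  shows "measure_add (\<sigma> h) \<tau>' = measure_add (\<sigma> h') \<tau>"
proof -
  have s: "sets \<tau> = sets borel" "sets \<tau>' = sets borel" using t by (auto simp: sub_def)
  let ?M = "measure_add (\<sigma> h) \<tau>'" and ?N = "measure_add (\<sigma> h') \<tau>"
  let ?D = "energy_dist \<alpha> ?M ?N"
  have M: "finite_measure ?M" "sets ?M = sets borel" and N: "finite_measure ?N" "sets ?N = sets borel"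
    by (simp_all add: finite_measure_add finite\<sigma> finite_sub[OF t(1)] finite_sub[OF t(2)] h sets\<sigma> s)
  interpret two_measures \<alpha> ?M ?N by (simp add: two_measures_def \<alpha> M N sets\<sigma>)
  note [measurable] = hp_measurable
  have "2 * obj h \<tau> + inverse 2 * ?D \<le> 2 * obj (\<lambda>x. (h x + h' x) / 2) (mid \<tau> \<tau>') + inverse 2 * ?D"
    by (intro add_right_mono mult_left_mono min dens_mid sub_mid h t) auto
  also have "\<dots> = 2 * obj h \<tau> + 0" unfolding obj_midpoint[OF h t] eq by (simp add: mult_2)
  finally have "2 * obj h \<tau> = \<infinity> \<or> inverse 2 * ?D \<le> 0" unfolding ennreal_add_left_cancel_le .
  moreover have "2 * obj h \<tau> \<noteq> \<infinity>" using obj_fin by (simp add: ennreal_mult_eq_top_iff)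
  ultimately have "inverse 2 * ?D \<le> 0" by blast
  then have "?D = 0" by auto
  then have "(\<integral>\<^sup>+s. \<integral>\<^sup>+z. sq_diff (heat_pot (s / 2) ?M z) (heat_pot (s / 2) ?N z) \<partial>lborel \<partial>riesz_time \<alpha>) = 0"
    by (simp add: energy_dist_def)
  then have "AE s in riesz_time \<alpha>. (\<integral>\<^sup>+z. sq_diff (heat_pot (s / 2) ?M z) (heat_pot (s / 2) ?N z) \<partial>lborel) = 0"
    by (subst (asm) nn_integral_0_iff_AE) auto
  then have "AE s in riesz_time \<alpha>. AE z in lborel. heat_pot (s / 2) ?M z = heat_pot (s / 2) ?N z"
    using AE_riesz_time[of \<alpha>]
  proof eventually_elim
    fix s :: real
    assume z: "(\<integral>\<^sup>+z. sq_diff (heat_pot (s / 2) ?M z) (heat_pot (s / 2) ?N z) \<partial>lborel) = 0" and s: "0 < s"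
    then have "AE z in lborel. sq_diff (heat_pot (s / 2) ?M z) (heat_pot (s / 2) ?N z) = 0"
      by (subst (asm) nn_integral_0_iff_AE) auto
    then show "AE z in lborel. heat_pot (s / 2) ?M z = heat_pot (s / 2) ?N z"
    proof eventually_elim
      fix z assume "sq_diff (heat_pot (s / 2) ?M z) (heat_pot (s / 2) ?N z) = 0"
      then have "enn2real (heat_pot (s / 2) ?M z) = enn2real (heat_pot (s / 2) ?N z)"
        by (auto simp: sq_diff_def ennreal_eq_0_iff)
      moreover have "heat_pot (s / 2) ?M z < \<top>" "heat_pot (s / 2) ?N z < \<top>"
        using heat_pot_finite[OF M, of "s / 2"] heat_pot_finite[OF N, of "s / 2"] s by simp_all
      ultimately show "heat_pot (s / 2) ?M z = heat_pot (s / 2) ?N z" by (metis ennreal_enn2real)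
    qed
  qed
  then show ?thesis by (rule heat_pot_injective[OF \<alpha>(1) M N])
qed

end

text \<open>The Radon-Nikodym derivative is at most 1 only almost everywhere; it is truncated
  because \<open>dens\<close> demands the bounds everywhere.\<close>

lemma density_of_le:
  fixes \<mu> \<xi> :: "'a::euclidean_space measure"
  assumes \<xi>: "finite_measure \<xi>" "sets \<xi> = sets borel" and \<mu>: "sets \<mu> = sets borel"
    and le: "\<And>B. B \<in> sets borel \<Longrightarrow> emeasure \<mu> B \<le> emeasure \<xi> B"
  obtains h :: "'a \<Rightarrow> real" where "h \<in> borel_measurable borel" "\<And>x. 0 \<le> h x \<and> h x \<le> 1" "\<mu> = density \<xi> (\<lambda>x. ennreal (h x))"
proof -
  interpret \<xi>: finite_measure \<xi> by (rule \<xi>(1))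
  have "absolutely_continuous \<xi> \<mu>"
    unfolding absolutely_continuous_def
  proof
    fix N assume "N \<in> null_sets \<xi>"
    then show "N \<in> null_sets \<mu>" using le[of N] by (auto simp: null_sets_def \<xi> \<mu>)
  qed
  then obtain f where f: "f \<in> borel_measurable \<xi>" "density \<xi> f = \<mu>"
    using \<xi>.Radon_Nikodym[of \<mu>] \<xi> \<mu> by auto
  have fb [measurable]: "f \<in> borel_measurable borel" using f(1) \<xi>(2) by (simp cong: measurable_cong_sets)
  note [measurable_cong] = \<xi>(2)
  have "AE x in \<xi>. f x \<le> 1"
  proof -
    define B where "B = {x \<in> space borel. 1 < f x}"
    have B [measurable]: "B \<in> sets borel" unfolding B_def by measurable
    have "(\<integral>\<^sup>+x. (f x - 1) * indicator B x \<partial>\<xi>) + emeasure \<xi> B = (\<integral>\<^sup>+x. (f x - 1) * indicator B x + indicator B x \<partial>\<xi>)"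
      by (subst nn_integral_add) (auto simp: \<xi>)
    also have "\<dots> = (\<integral>\<^sup>+x. f x * indicator B x \<partial>\<xi>)"
      by (intro nn_integral_cong) (auto simp: B_def indicator_def diff_add_cancel_ennreal)
    also have "\<dots> = emeasure \<mu> B" unfolding f(2)[symmetric] by (subst emeasure_density) (auto simp: \<xi>)
    also have "\<dots> \<le> 0 + emeasure \<xi> B" using le[OF B] by simp
    finally have "emeasure \<xi> B + (\<integral>\<^sup>+x. (f x - 1) * indicator B x \<partial>\<xi>) \<le> emeasure \<xi> B + 0" by (simp add: add.commute)
    then have "(\<integral>\<^sup>+x. (f x - 1) * indicator B x \<partial>\<xi>) = 0" by (auto simp: ennreal_add_left_cancel_le)
    then have "AE x in \<xi>. (f x - 1) * indicator B x = 0" by (subst (asm) nn_integral_0_iff_AE) auto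
    then show ?thesis
    proof eventually_elim
      fix x assume "(f x - 1) * indicator B x = 0"
      then show "f x \<le> 1" by (cases "x \<in> B") (auto simp: B_def not_less ennreal_minus_eq_0)
    qed
  qed
  define h where "h x = enn2real (min 1 (f x))" for x
  have hf: "ennreal (h x) = min 1 (f x)" for x
  proof -
    have "min 1 (f x) \<le> 1" by simp
    then show ?thesis unfolding h_def by (intro ennreal_enn2real) (simp add: min_less_iff_disj)
  qed
  have "h x \<le> 1" for x
    unfolding h_def by (intro enn2real_leI) auto
  moreover have "\<mu> = density \<xi> (\<lambda>x. ennreal (h x))"
    unfolding f(2)[symmetric] hf using \<open>AE x in \<xi>. f x \<le> 1\<close>
    by (intro density_cong) (auto simp: min_def elim!: eventually_mono)
  moreover have "h \<in> borel_measurable borel" unfolding h_def by measurable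
  ultimately show thesis by (intro that[of h]) (auto simp: h_def)
qed

section \<open>The constrained weighted problem\<close>

text \<open>f is arbitrary on Z, so its measurability rests on the fact that all subsets of Z are
  measurable for the completion.\<close>

lemma completion_eq_off_null:
  fixes f \<phi> :: "'a \<Rightarrow> ereal"
  assumes \<phi>: "\<phi> \<in> borel_measurable M" and Z: "Z \<in> null_sets M" and eq: "\<And>x. x \<notin> Z \<Longrightarrow> f x = \<phi> x"
  shows "f \<in> borel_measurable (completion M)" "AE x in completion M. f x = \<phi> x"
proof -
  have Zc: "Z \<in> null_sets (completion M)" using Z by (rule null_sets_completionI)
  show "f \<in> borel_measurable (completion M)"
  proof (rule measurableI)
    fix S :: "ereal set" assume S: "S \<in> sets borel"
    have 1: "f -` S \<inter> space M \<inter> Z \<in> sets (completion M)"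
      using null_sets_completion_subset[OF _ Zc, of "f -` S \<inter> space M \<inter> Z"] by auto
    have "\<phi> -` S \<inter> space M - Z \<in> sets M" using measurable_sets[OF \<phi> S] Z by auto
    from sets.Un[OF sets_completionI_sets[OF this] 1] have "(\<phi> -` S \<inter> space M - Z) \<union> (f -` S \<inter> space M \<inter> Z) \<in> sets (completion M)" .
    moreover have "f -` S \<inter> space M = (\<phi> -` S \<inter> space M - Z) \<union> (f -` S \<inter> space M \<inter> Z)" using eq by auto
    ultimately show "f -` S \<inter> space (completion M) \<in> sets (completion M)" by simp
  qed simp
  show "AE x in completion M. f x = \<phi> x" using AE_not_in[OF Zc] by eventually_elim (rule eq)
qed

text \<open>The hypothesis is the equality of the signed measures S - T and S' - T' written without
  subtraction. On A only T and T' survive, off A only S and S'.\<close>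

lemma singular_add_cancel:
  fixes S S' T T' :: "'a::topological_space measure"
  assumes s: "sets S = sets borel" "sets S' = sets borel" "sets T = sets borel" "sets T' = sets borel"
    and A [measurable]: "A \<in> sets borel"
    and S: "AE x in S. x \<notin> A" "AE x in S'. x \<notin> A" and T: "AE x in T. x \<in> A" "AE x in T'. x \<in> A"
    and eq: "measure_add S T' = measure_add S' T"
  shows "S = S'" "T = T'"
proof -
  have e: "emeasure S B + emeasure T' B = emeasure S' B + emeasure T B" if "B \<in> sets borel" for B
    using arg_cong[OF eq, of "\<lambda>M. emeasure M B"] that s by (simp add: emeasure_measure_add)
  have off: "emeasure K (B - A) = emeasure K B" "emeasure K (B \<inter> A) = 0" if "AE x in K. x \<notin> A" "sets K = sets borel" "B \<in> sets borel" for K B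
  proof -
    show "emeasure K (B - A) = emeasure K B"
      by (rule emeasure_eq_AE) (use that A in \<open>auto elim!: eventually_mono\<close>)
    have "emeasure K (B \<inter> A) = emeasure K {}"
      by (rule emeasure_eq_AE) (use that A in \<open>auto elim!: eventually_mono\<close>)
    then show "emeasure K (B \<inter> A) = 0" by simp
  qed
  have on: "emeasure K (B \<inter> A) = emeasure K B" "emeasure K (B - A) = 0" if "AE x in K. x \<in> A" "sets K = sets borel" "B \<in> sets borel" for K B
  proof -
    show "emeasure K (B \<inter> A) = emeasure K B"
      by (rule emeasure_eq_AE) (use that A in \<open>auto elim!: eventually_mono\<close>)
    have "emeasure K (B - A) = emeasure K {}"
      by (rule emeasure_eq_AE) (use that A in \<open>auto elim!: eventually_mono\<close>)
    then show "emeasure K (B - A) = 0" by simp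
  qed
  show "S = S'"
  proof (rule measure_eqI)
    fix B assume "B \<in> sets S"
    then have B: "B \<in> sets borel" using s by simp
    show "emeasure S B = emeasure S' B"
      using e[of "B - A"] B A off(1)[OF S(1) s(1) B] off(1)[OF S(2) s(2) B] on(2)[OF T(1) s(3) B] on(2)[OF T(2) s(4) B] by simp
  qed (simp add: s)
  show "T = T'"
  proof (rule measure_eqI)
    fix B assume "B \<in> sets T"
    then have B: "B \<in> sets borel" using s by simp
    show "emeasure T B = emeasure T' B"
      using e[of "B \<inter> A"] B A off(2)[OF S(1) s(1) B] off(2)[OF S(2) s(2) B] on(1)[OF T(1) s(3) B] on(1)[OF T(2) s(4) B] by simp
  qed (simp add: s)
qed

text \<open>The data delivered by \<open>regular_field\<close>; from here on the two cases of the
  external field are no longer distinguished.\<close>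

locale condenser =
  fixes \<alpha> :: real and \<xi> :: "'a::euclidean_space measure" and A1 A2 Z :: "'a set"
    and f \<phi> :: "'a \<Rightarrow> ereal" and \<psi> :: "'a \<Rightarrow> real"
  assumes \<alpha>: "0 < \<alpha>" "\<alpha> < real DIM('a)"
    and A2: "closed A2" "A2 \<noteq> {}" and A1: "A1 \<in> sets borel" and disj: "A1 \<inter> A2 = {}"
    and \<xi>: "pos_radon \<alpha> \<xi>" "energy \<alpha> \<xi> < \<infinity>" "finite_measure \<xi>" "AE x in \<xi>. x \<in> A1"
    and Z: "polar \<alpha> Z" and \<phi> [measurable]: "\<phi> \<in> borel_measurable borel" and \<psi> [measurable]: "\<psi> \<in> borel_measurable borel"
    and \<psi>_nonneg: "\<And>x. 0 \<le> \<psi> x" and \<psi>_fin: "(\<integral>\<^sup>+x. ennreal (\<psi> x) \<partial>\<xi>) < \<infinity>"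
    and \<phi>_ge: "\<And>x. ereal (- \<psi> x) \<le> \<phi> x" and \<phi>_A2: "\<And>x. x \<in> A2 \<Longrightarrow> \<phi> x = 0" and f_eq: "\<And>x. x \<notin> Z \<Longrightarrow> f x = \<phi> x"
begin

definition C :: real where "C = enn2real (riesz_const \<alpha> TYPE('a))"
text \<open>The sum is nonnegative by \<open>\<phi>_ge\<close>, so the truncation in
  \<open>e2ennreal\<close> changes nothing.\<close>

definition F :: "'a \<Rightarrow> ennreal" where "F x = e2ennreal (\<phi> x + ereal (\<psi> x))"
definition \<Psi> :: real where "\<Psi> = (LINT x|\<xi>. \<psi> x)"

lemma C: "0 < C" "ennreal C = riesz_const \<alpha> TYPE('a)"
  using riesz_const_pos[of \<alpha>, where 'a='a] riesz_const_finite[OF \<alpha>] by (auto simp: C_def enn2real_positive_iff)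

lemma F_measurable [measurable]: "F \<in> borel_measurable borel"
  unfolding F_def by measurable

text \<open>The field terms receive the factor C because \<open>energy_dist\<close> is the energy
  multiplied by it.\<close>

sublocale relaxed_problem \<alpha> \<xi> A2 "\<lambda>x. ennreal C * F x" "\<lambda>x. ennreal C * ennreal (\<psi> x)"
proof (rule relaxed_problem.intro)
  show "(\<integral>\<^sup>+x. ennreal C * ennreal (\<psi> x) \<partial>\<xi>) < \<infinity>"
    using \<psi>_fin pos_radonD(1)[OF \<xi>(1)] by (subst nn_integral_cmult) (auto simp: ennreal_mult_less_top)
qed (use \<alpha> \<xi> A2 pos_radonD(1)[OF \<xi>(1)] in simp_all)

lemma abs_le_F: "e2ennreal \<bar>\<phi> x\<bar> \<le> F x + ennreal (\<psi> x)"
  and F_le_abs: "F x \<le> e2ennreal \<bar>\<phi> x\<bar> + ennreal (\<psi> x)"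
  and F_real: "\<bar>\<phi> x\<bar> \<noteq> \<infinity> \<Longrightarrow> F x = ennreal (real_of_ereal (\<phi> x) + \<psi> x) \<and> 0 \<le> real_of_ereal (\<phi> x) + \<psi> x
        \<and> e2ennreal \<bar>\<phi> x\<bar> = ennreal \<bar>real_of_ereal (\<phi> x)\<bar>"
  using \<phi>_ge[of x] \<psi>_nonneg[of x]
  by (cases "\<phi> x"; auto simp: F_def ennreal_plus[symmetric] intro!: ennreal_leI simp del: ennreal_plus)+

lemma integral_split:
  assumes h: "dens h"
  shows "(\<integral>\<^sup>+x. ennreal (\<psi> x) \<partial>\<sigma> h) + (\<integral>\<^sup>+x. ennreal (1 - h x) * ennreal (\<psi> x) \<partial>\<xi>) = ennreal \<Psi>"
    and "lin h = ennreal C * ((\<integral>\<^sup>+x. F x \<partial>\<sigma> h) + (\<integral>\<^sup>+x. ennreal (1 - h x) * ennreal (\<psi> x) \<partial>\<xi>))"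
proof -
  note [measurable_cong] = sets\<xi>
  have [measurable]: "h \<in> borel_measurable borel" and h01: "0 \<le> h x" "h x \<le> 1" for x using h by (auto simp: dens_def)
  have "(\<integral>\<^sup>+x. ennreal (\<psi> x) \<partial>\<sigma> h) + (\<integral>\<^sup>+x. ennreal (1 - h x) * ennreal (\<psi> x) \<partial>\<xi>)
    = (\<integral>\<^sup>+x. ennreal (h x) * ennreal (\<psi> x) + ennreal (1 - h x) * ennreal (\<psi> x) \<partial>\<xi>)"
    by (simp add: \<sigma>_def nn_integral_density nn_integral_add)
  also have "\<dots> = (\<integral>\<^sup>+x. ennreal (\<psi> x) \<partial>\<xi>)"
  proof (intro nn_integral_cong)
    fix x
    have "ennreal (h x) + ennreal (1 - h x) = 1" using h01[of x] by (simp add: ennreal_plus[symmetric] del: ennreal_plus)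
    then show "ennreal (h x) * ennreal (\<psi> x) + ennreal (1 - h x) * ennreal (\<psi> x) = ennreal (\<psi> x)"
      by (simp add: distrib_right[symmetric])
  qed
  also have "\<dots> = ennreal \<Psi>"
    unfolding \<Psi>_def using \<psi>_fin \<psi>_nonneg by (intro nn_integral_eq_integral integrableI_nonneg) auto
  finally show "(\<integral>\<^sup>+x. ennreal (\<psi> x) \<partial>\<sigma> h) + (\<integral>\<^sup>+x. ennreal (1 - h x) * ennreal (\<psi> x) \<partial>\<xi>) = ennreal \<Psi>" .
  have "lin h = (\<integral>\<^sup>+x. ennreal C * (ennreal (h x) * F x + ennreal (1 - h x) * ennreal (\<psi> x)) \<partial>\<xi>)"
    unfolding lin_def by (intro nn_integral_cong) (simp add: distrib_left ac_simps)
  also have "\<dots> = ennreal C * ((\<integral>\<^sup>+x. F x \<partial>\<sigma> h) + (\<integral>\<^sup>+x. ennreal (1 - h x) * ennreal (\<psi> x) \<partial>\<xi>))"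
    by (simp add: \<sigma>_def nn_integral_density nn_integral_add nn_integral_cmult)
  finally show "lin h = ennreal C * ((\<integral>\<^sup>+x. F x \<partial>\<sigma> h) + (\<integral>\<^sup>+x. ennreal (1 - h x) * ennreal (\<psi> x) \<partial>\<xi>))" .
qed

lemma lin_finite_iff:
  assumes h: "dens h"
  shows "lin h < \<infinity> \<longleftrightarrow> (\<integral>\<^sup>+x. e2ennreal \<bar>\<phi> x\<bar> \<partial>\<sigma> h) < \<infinity>"
proof -
  note [measurable_cong] = sets\<sigma>[of h]
  have fin: "(\<integral>\<^sup>+x. ennreal (\<psi> x) \<partial>\<sigma> h) < \<top>" "(\<integral>\<^sup>+x. ennreal (1 - h x) * ennreal (\<psi> x) \<partial>\<xi>) < \<top>"
    using integral_split(1)[OF h] ennreal_less_top[of \<Psi>] by (metis ennreal_add_eq_top less_top)+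
  have a: "(\<integral>\<^sup>+x. e2ennreal \<bar>\<phi> x\<bar> \<partial>\<sigma> h) \<le> (\<integral>\<^sup>+x. F x \<partial>\<sigma> h) + (\<integral>\<^sup>+x. ennreal (\<psi> x) \<partial>\<sigma> h)"
    by (subst nn_integral_add[symmetric]) (auto intro!: nn_integral_mono abs_le_F)
  have b: "(\<integral>\<^sup>+x. F x \<partial>\<sigma> h) \<le> (\<integral>\<^sup>+x. e2ennreal \<bar>\<phi> x\<bar> \<partial>\<sigma> h) + (\<integral>\<^sup>+x. ennreal (\<psi> x) \<partial>\<sigma> h)"
    by (subst nn_integral_add[symmetric]) (auto intro!: nn_integral_mono F_le_abs)
  have "lin h < \<top> \<longleftrightarrow> (\<integral>\<^sup>+x. F x \<partial>\<sigma> h) < \<top>"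
    unfolding integral_split(2)[OF h] ennreal_mult_less_top using fin C(1) by auto
  also have "\<dots> \<longleftrightarrow> (\<integral>\<^sup>+x. e2ennreal \<bar>\<phi> x\<bar> \<partial>\<sigma> h) < \<top>"
  proof
    assume "(\<integral>\<^sup>+x. F x \<partial>\<sigma> h) < \<top>"
    then show "(\<integral>\<^sup>+x. e2ennreal \<bar>\<phi> x\<bar> \<partial>\<sigma> h) < \<top>" using fin(1) by (intro le_less_trans[OF a]) simp
  next
    assume "(\<integral>\<^sup>+x. e2ennreal \<bar>\<phi> x\<bar> \<partial>\<sigma> h) < \<top>"
    then show "(\<integral>\<^sup>+x. F x \<partial>\<sigma> h) < \<top>" using fin(1) by (intro le_less_trans[OF b]) simp
  qed
  finally show ?thesis by simp
qed

lemma lin_eq: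
  assumes h: "dens h" and fin: "(\<integral>\<^sup>+x. e2ennreal \<bar>\<phi> x\<bar> \<partial>\<sigma> h) < \<infinity>"
  shows "lin h = ennreal (C * ((LINT x|\<sigma> h. real_of_ereal (\<phi> x)) + \<Psi>))"
    and "0 \<le> (LINT x|\<sigma> h. real_of_ereal (\<phi> x)) + \<Psi>"
proof -
  note [measurable_cong] = sets\<sigma>[of h]
  let ?I = "LINT x|\<sigma> h. real_of_ereal (\<phi> x)" and ?P = "LINT x|\<sigma> h. \<psi> x"
  let ?R = "\<integral>\<^sup>+x. ennreal (1 - h x) * ennreal (\<psi> x) \<partial>\<xi>"
  have \<Psi>0: "0 \<le> \<Psi>" unfolding \<Psi>_def using \<psi>_nonneg by (intro integral_nonneg_AE) auto
  have fins: "(\<integral>\<^sup>+x. ennreal (\<psi> x) \<partial>\<sigma> h) < \<infinity>"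
    using integral_split(1)[OF h] ennreal_less_top[of \<Psi>] by (metis ennreal_add_eq_top less_top infinity_ennreal_def)
  have i\<psi>: "integrable (\<sigma> h) \<psi>" using fins \<psi>_nonneg by (intro integrableI_nonneg) auto
  have "AE x in \<sigma> h. e2ennreal \<bar>\<phi> x\<bar> \<noteq> \<infinity>" using fin by (intro nn_integral_noteq_infinite) auto
  then have real: "AE x in \<sigma> h. \<bar>\<phi> x\<bar> \<noteq> \<infinity>" by eventually_elim auto
  have i\<phi>: "integrable (\<sigma> h) (\<lambda>x. real_of_ereal (\<phi> x))"
  proof (rule integrableI_bounded)
    have "(\<integral>\<^sup>+x. ennreal (norm (real_of_ereal (\<phi> x))) \<partial>\<sigma> h) = (\<integral>\<^sup>+x. e2ennreal \<bar>\<phi> x\<bar> \<partial>\<sigma> h)"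
      by (intro nn_integral_cong_AE, use real in eventually_elim) (simp add: F_real)
    then show "(\<integral>\<^sup>+x. ennreal (norm (real_of_ereal (\<phi> x))) \<partial>\<sigma> h) < \<infinity>" using fin by simp
  qed measurable
  have nn: "AE x in \<sigma> h. 0 \<le> real_of_ereal (\<phi> x) + \<psi> x" using real by eventually_elim (simp add: F_real)
  have "(\<integral>\<^sup>+x. F x \<partial>\<sigma> h) = (\<integral>\<^sup>+x. ennreal (real_of_ereal (\<phi> x) + \<psi> x) \<partial>\<sigma> h)"
    by (intro nn_integral_cong_AE, use real in eventually_elim) (simp add: F_real)
  also have "\<dots> = ennreal (LINT x|\<sigma> h. real_of_ereal (\<phi> x) + \<psi> x)"
    using nn i\<phi> i\<psi> by (intro nn_integral_eq_integral) auto
  also have "(LINT x|\<sigma> h. real_of_ereal (\<phi> x) + \<psi> x) = ?I + ?P" using i\<phi> i\<psi> by simp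
  finally have F: "(\<integral>\<^sup>+x. F x \<partial>\<sigma> h) = ennreal (?I + ?P)" .
  have IP: "0 \<le> ?I + ?P" using integral_nonneg_AE[OF nn] i\<phi> i\<psi> by simp
  have P: "(\<integral>\<^sup>+x. ennreal (\<psi> x) \<partial>\<sigma> h) = ennreal ?P" using i\<psi> \<psi>_nonneg by (intro nn_integral_eq_integral) auto
  have P0: "0 \<le> ?P" using \<psi>_nonneg by (intro integral_nonneg_AE) auto
  have s: "ennreal ?P + ?R = ennreal \<Psi>" using integral_split(1)[OF h] unfolding P .
  then have "?R < \<top>" using ennreal_less_top[of \<Psi>] by (metis ennreal_add_eq_top less_top)
  then obtain r where r: "?R = ennreal r" "0 \<le> r" by (cases ?R) auto
  have "ennreal (?P + r) = ennreal \<Psi>" using s r P0 by simp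
  then have \<Psi>: "\<Psi> = ?P + r" using \<Psi>0 P0 r by (subst (asm) ennreal_inj) auto
  show "0 \<le> ?I + \<Psi>" using IP r \<Psi> by simp
  have "lin h = ennreal C * ennreal ((?I + ?P) + r)"
    unfolding integral_split(2)[OF h] F r(1) using IP r by simp
  then show "lin h = ennreal (C * (?I + \<Psi>))" using IP r C(1) by (simp add: \<Psi> ennreal_mult add.assoc)
qed

lemma energy_dist_eq:
  assumes h: "dens h" and \<tau>: "sub \<tau>" "energy \<alpha> \<tau> < \<infinity>"
  shows "energy_dist \<alpha> (\<sigma> h) \<tau> = ennreal (C * signed_energy \<alpha> (\<sigma> h, \<tau>))" and "0 \<le> signed_energy \<alpha> (\<sigma> h, \<tau>)"
proof -
  interpret T: two_measures \<alpha> "\<sigma> h" \<tau> by (rule two[OF h \<tau>(1)])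
  have E\<sigma>: "energy \<alpha> (\<sigma> h) < \<infinity>" by (rule energy\<sigma>[OF h])
  have X: "mutual_energy \<alpha> (\<sigma> h) \<tau> < \<infinity>" by (rule mutual_energy_finite[OF \<alpha> T.sf T.sb E\<sigma> \<tau>(2)])
  have sym: "mutual_energy \<alpha> \<tau> (\<sigma> h) = mutual_energy \<alpha> (\<sigma> h) \<tau>" by (rule mutual_energy_commute[OF T.sf(2,1) T.sb(2,1)])
  have fin_real: "\<exists>r. e = ennreal r \<and> 0 \<le> r" if "e < \<infinity>" for e :: ennreal
    using that by (cases e) auto
  obtain a where a: "energy \<alpha> (\<sigma> h) = ennreal a" "0 \<le> a" using fin_real[OF E\<sigma>] by blast
  obtain b where b: "mutual_energy \<alpha> (\<sigma> h) \<tau> = ennreal b" "0 \<le> b" using fin_real[OF X] by blast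
  obtain c where c: "energy \<alpha> \<tau> = ennreal c" "0 \<le> c" using fin_real[OF \<tau>(2)] by blast
  obtain d where d: "energy_dist \<alpha> (\<sigma> h) \<tau> = ennreal d" "0 \<le> d"
    using fin_real[OF T.energy_dist_finite[OF E\<sigma> \<tau>(2)]] by blast
  have "ennreal d + 2 * (ennreal C * ennreal b) = ennreal C * ennreal a + ennreal C * ennreal c"
    using T.energy_dist_add unfolding a b c d C(2)[symmetric] .
  moreover have "2 * (ennreal C * ennreal b) = ennreal (2 * (C * b))" using C(1) b(2) by (simp add: ennreal_mult)
  moreover have "ennreal C * ennreal a = ennreal (C * a)" "ennreal C * ennreal c = ennreal (C * c)"
    using C(1) a(2) c(2) by (auto intro!: ennreal_mult[symmetric])
  moreover have nn: "0 \<le> 2 * (C * b)" "0 \<le> C * a" "0 \<le> C * c" using C(1) a(2) b(2) c(2) by auto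
  ultimately have "ennreal (d + 2 * (C * b)) = ennreal (C * a + C * c)"
    by (simp only: ennreal_plus[OF d(2) nn(1)] ennreal_plus[OF nn(2,3)])
  then have "d + 2 * (C * b) = C * a + C * c" using d(2) nn by (subst (asm) ennreal_inj) (rule add_nonneg_nonneg, assumption+)+
  then have d': "d = C * (a - b - b + c)" by (simp add: algebra_simps)
  have se: "signed_energy \<alpha> (\<sigma> h, \<tau>) = a - b - b + c" using a b c by (simp add: signed_energy_def sym)
  show "energy_dist \<alpha> (\<sigma> h) \<tau> = ennreal (C * signed_energy \<alpha> (\<sigma> h, \<tau>))" unfolding d(1) d' se ..
  show "0 \<le> signed_energy \<alpha> (\<sigma> h, \<tau>)" using d(2) C(1) unfolding d' se by (simp add: zero_le_mult_iff)
qed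

end

section \<open>Admissible measures as pairs of the relaxed problem\<close>

context condenser
begin

lemma A2_borel [measurable]: "A2 \<in> sets borel"
  using A2(1) by (rule borel_closed)

lemma Z_null:
  assumes "pos_radon \<alpha> M" "energy \<alpha> M < \<infinity>"
  shows "Z \<in> null_sets M"
  using Z assms pos_radonD(1)[OF assms(1)] by (auto simp: polar_def null_sets_def)

lemma ereal_integral_eq:
  assumes M: "pos_radon \<alpha> M" "energy \<alpha> M < \<infinity>"
  shows "ereal_integral M f = (LINT x|M. real_of_ereal (\<phi> x))"
proof -
  have \<phi>M [measurable]: "\<phi> \<in> borel_measurable M" using pos_radonD(1)[OF M(1)] by (simp cong: measurable_cong_sets)
  have off: "f \<in> borel_measurable (completion M)" "AE x in completion M. f x = \<phi> x"
    by (rule completion_eq_off_null[OF \<phi>M Z_null[OF M]], erule f_eq)+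
  have "ereal_integral M f = (LINT x|completion M. real_of_ereal (\<phi> x))"
    unfolding ereal_integral_def
  proof (rule integral_cong_AE)
    show "(\<lambda>x. real_of_ereal (f x)) \<in> borel_measurable (completion M)" using off(1) by measurable
    show "(\<lambda>x. real_of_ereal (\<phi> x)) \<in> borel_measurable (completion M)"
      by (rule measurable_completion) measurable
    show "AE x in completion M. real_of_ereal (f x) = real_of_ereal (\<phi> x)"
      using off(2) by eventually_elim simp
  qed
  also have "\<dots> = (LINT x|M. real_of_ereal (\<phi> x))" by (rule integral_completion) measurable
  finally show ?thesis .
qed

lemma pos_radon_\<sigma>: "dens h \<Longrightarrow> pos_radon \<alpha> (\<sigma> h)"
  unfolding \<sigma>_def by (rule pos_radon_density(1)[OF \<xi>(1), of _ 1]) (auto simp: dens_def)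

lemma AE_\<sigma>: "dens h \<Longrightarrow> AE x in \<sigma> h. x \<in> A1"
  using \<xi>(4) unfolding \<sigma>_def dens_def
  by (subst AE_density) (auto elim!: eventually_mono simp: sets\<xi> cong: measurable_cong_sets)

lemma emeasure_\<sigma>_UNIV: "dens h \<Longrightarrow> emeasure (\<sigma> h) UNIV = 1"
  using space_eq_UNIV[OF sets\<xi>] unfolding \<sigma>_def dens_def
  by (subst emeasure_density) (auto simp: sets\<xi> cong: measurable_cong_sets)

text \<open>If the potential were infinite everywhere, a measure of mass 1 would have infinite
  energy.\<close>

lemma pos_radon_sub:
  assumes \<tau>: "sub \<tau>" "emeasure \<tau> UNIV = 1" "energy \<alpha> \<tau> < \<infinity>"
  shows "pos_radon \<alpha> \<tau>"
proof -
  have s: "sets \<tau> = sets borel" using \<tau>(1) by (simp add: sub_def)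
  interpret finite_measure \<tau> by (rule finite_sub[OF \<tau>(1)])
  have "\<exists>x. riesz_pot \<alpha> \<tau> x < \<infinity>"
  proof (rule ccontr)
    assume "\<not> ?thesis"
    then have "riesz_pot \<alpha> \<tau> x = \<infinity>" for x by (simp add: less_top[symmetric])
    then have "energy \<alpha> \<tau> = (\<integral>\<^sup>+x. \<infinity> \<partial>\<tau>)" unfolding mutual_energy_def riesz_pot_def by simp
    also have "\<dots> = \<infinity>" using \<tau>(2) space_eq_UNIV[OF s] by simp
    finally show False using \<tau>(3) by simp
  qed
  then show ?thesis using s by (auto simp: pos_radon_def less_top[symmetric])
qed

lemma emeasure_eq_UNIV_of_AE:
  assumes "AE x in M. x \<in> B" "sets M = sets borel" "B \<in> sets borel"
  shows "emeasure M B = emeasure M (UNIV::'a set)"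
  by (rule emeasure_eq_AE) (use assms in \<open>auto elim!: eventually_mono\<close>)

lemma abs_field_A2:
  assumes "sets \<tau> = sets borel" "AE x in \<tau>. x \<in> A2"
  shows "(\<integral>\<^sup>+x. e2ennreal \<bar>\<phi> x\<bar> \<partial>\<tau>) = 0"
proof -
  have "(\<integral>\<^sup>+x. e2ennreal \<bar>\<phi> x\<bar> \<partial>\<tau>) = (\<integral>\<^sup>+x. 0 \<partial>\<tau>)"
    by (intro nn_integral_cong_AE, use assms(2) in eventually_elim) (simp add: \<phi>_A2 e2ennreal_neg)
  then show ?thesis by simp
qed

lemma total_var_integrable_iff:
  assumes \<mu>: "\<mu> \<in> finite_energy \<alpha>" and c: "AE x in neg_part \<mu>. x \<in> A2"
  shows "ereal_integrable (total_var \<mu>) f \<longleftrightarrow> (\<integral>\<^sup>+x. e2ennreal \<bar>\<phi> x\<bar> \<partial>pos_part \<mu>) < \<infinity>"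
proof -
  note pr = energy_total_var_finite[OF \<mu>]
  note s = pos_radonD(1)[OF pr(1)] pos_radonD(1)[OF pr(2)]
  have \<phi>p [measurable]: "\<phi> \<in> borel_measurable (pos_part \<mu>)" using s by (simp cong: measurable_cong_sets)
  have Zt: "Z \<in> null_sets (total_var \<mu>)"
    using Z_null[OF pr(1,3)] Z_null[OF pr(2,4)] s Z
    by (auto simp: total_var_def null_sets_def emeasure_measure_add polar_def)
  have \<phi>t: "\<phi> \<in> borel_measurable (total_var \<mu>)" using s by (simp add: total_var_def cong: measurable_cong_sets)
  have off: "f \<in> borel_measurable (completion (total_var \<mu>))" "AE x in completion (total_var \<mu>). f x = \<phi> x"
    by (rule completion_eq_off_null[OF \<phi>t Zt], erule f_eq)+
  have "(\<integral>\<^sup>+x. e2ennreal \<bar>f x\<bar> \<partial>completion (total_var \<mu>)) = (\<integral>\<^sup>+x. e2ennreal \<bar>\<phi> x\<bar> \<partial>completion (total_var \<mu>))"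
    by (intro nn_integral_cong_AE, use off(2) in eventually_elim) simp
  also have "\<dots> = (\<integral>\<^sup>+x. e2ennreal \<bar>\<phi> x\<bar> \<partial>pos_part \<mu>) + (\<integral>\<^sup>+x. e2ennreal \<bar>\<phi> x\<bar> \<partial>neg_part \<mu>)"
    unfolding nn_integral_completion total_var_def by (rule nn_integral_measure_add) (use s in auto)
  also have "\<dots> = (\<integral>\<^sup>+x. e2ennreal \<bar>\<phi> x\<bar> \<partial>pos_part \<mu>)" using abs_field_A2[OF s(2) c] by simp
  finally show ?thesis using off(1) by (simp add: ereal_integrable_def)
qed

lemma admissible_pair:
  assumes h: "dens h" and \<tau>: "sub \<tau>" "emeasure \<tau> UNIV = 1" and obj: "obj h \<tau> < \<infinity>"
  shows "(\<sigma> h, \<tau>) \<in> admissible \<alpha> f \<xi> A1 A2"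
proof -
  interpret T: two_measures \<alpha> "\<sigma> h" \<tau> by (rule two[OF h \<tau>(1)])
  have E\<sigma>: "energy \<alpha> (\<sigma> h) < \<infinity>" by (rule energy\<sigma>[OF h])
  have obj': "energy_dist \<alpha> (\<sigma> h) \<tau> < \<infinity>" "lin h < \<infinity>"
    using obj by (auto simp: obj_def less_top[symmetric] ennreal_mult_eq_top_iff)
  have E\<tau>: "energy \<alpha> \<tau> < \<infinity>" by (rule T.energy_finite_of_dist[OF obj'(1) E\<sigma>])
  note p\<sigma> = pos_radon_\<sigma>[OF h] and p\<tau> = pos_radon_sub[OF \<tau> E\<tau>]
  have c\<tau>: "AE x in \<tau>. x \<in> A2" using \<tau>(1) by (simp add: sub_def)
  have zero: "emeasure (\<sigma> h) A2 = 0" "emeasure \<tau> (- A2) = 0"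
  proof -
    have "emeasure (\<sigma> h) A2 = emeasure (\<sigma> h) {}"
      using AE_\<sigma>[OF h] disj by (intro emeasure_eq_AE) (auto elim!: eventually_mono simp: T.sb)
    then show "emeasure (\<sigma> h) A2 = 0" by simp
    have "emeasure \<tau> (- A2) = emeasure \<tau> {}"
      using c\<tau> by (intro emeasure_eq_AE) (auto elim!: eventually_mono simp: T.sb intro!: borel_comp)
    then show "emeasure \<tau> (- A2) = 0" by simp
  qed
  have "signed_radon \<alpha> (\<sigma> h, \<tau>)"
    unfolding signed_radon_def using p\<sigma> p\<tau> zero by (auto intro!: bexI[of _ "- A2"] borel_comp)
  moreover have "energy \<alpha> (total_var (\<sigma> h, \<tau>)) < \<infinity>"
    unfolding total_var_def using energy_measure_add[OF T.sf T.sb, of \<alpha>]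
      mutual_energy_finite[OF \<alpha> T.sf T.sb E\<sigma> E\<tau>] mutual_energy_finite[OF \<alpha> T.sf(2,1) T.sb(2,1) E\<tau> E\<sigma>] E\<sigma> E\<tau>
    by (simp add: less_top[symmetric])
  ultimately have fe: "(\<sigma> h, \<tau>) \<in> finite_energy \<alpha>" by (simp add: finite_energy_def)
  have "emeasure (\<sigma> h) B \<le> emeasure \<xi> B" if B: "B \<in> sets borel" for B
  proof -
    have "emeasure (\<sigma> h) B = (\<integral>\<^sup>+x. ennreal (h x) * indicator B x \<partial>\<xi>)"
      unfolding \<sigma>_def using h B by (intro emeasure_density) (auto simp: dens_def sets\<xi> cong: measurable_cong_sets)
    also have "\<dots> \<le> (\<integral>\<^sup>+x. indicator B x \<partial>\<xi>)"
      using h by (intro nn_integral_mono) (auto simp: dens_def indicator_def)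
    also have "\<dots> = emeasure \<xi> B" using B by (simp add: sets\<xi>)
    finally show ?thesis .
  qed
  moreover have "ereal_integrable (total_var (\<sigma> h, \<tau>)) f"
    using total_var_integrable_iff[OF fe, unfolded snd_conv, OF c\<tau>] lin_finite_iff[OF h] obj'(2) by simp
  moreover have "emeasure (\<sigma> h) A1 = 1" "emeasure \<tau> A2 = 1"
    using emeasure_eq_UNIV_of_AE[OF AE_\<sigma>[OF h] T.sb(1) A1] emeasure_\<sigma>_UNIV[OF h]
      emeasure_eq_UNIV_of_AE[OF c\<tau> T.sb(2) A2_borel] \<tau>(2) by simp_all
  ultimately show ?thesis
    using fe AE_\<sigma>[OF h] c\<tau>
    unfolding admissible_def unit_condenser_measures_def carried_by_def mem_Collect_eq fst_conv snd_conv by blast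
qed

text \<open>Shifted by 2 * \<Psi>, the weighted energy is nonnegative, so that comparing objectives
  in \<open>ennreal\<close> amounts to comparing real weighted energies.\<close>

lemma admissible_obj:
  assumes d: "dens h" and sb: "sub \<tau>" and adm: "(\<sigma> h, \<tau>) \<in> admissible \<alpha> f \<xi> A1 A2"
  shows "obj h \<tau> = ennreal (C * (weighted_energy \<alpha> f (\<sigma> h, \<tau>) + 2 * \<Psi>))"
    and "0 \<le> weighted_energy \<alpha> f (\<sigma> h, \<tau>) + 2 * \<Psi>"
proof -
  define \<mu> where "\<mu> = (\<sigma> h, \<tau>)"
  have fe: "\<mu> \<in> finite_energy \<alpha>" and int: "ereal_integrable (total_var \<mu>) f"
    and c: "AE x in neg_part \<mu>. x \<in> A2"
    using adm unfolding \<mu>_def by (auto simp: admissible_def unit_condenser_measures_def carried_by_def)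
  note pr = energy_total_var_finite[OF fe]
  have E\<tau>: "energy \<alpha> \<tau> < \<infinity>" using pr(4) by (simp add: \<mu>_def)
  have fin: "(\<integral>\<^sup>+x. e2ennreal \<bar>\<phi> x\<bar> \<partial>\<sigma> h) < \<infinity>" using total_var_integrable_iff[OF fe c] int by (simp add: \<mu>_def)
  note ed = energy_dist_eq[OF d sb E\<tau>] and l = lin_eq[OF d fin]
  have "ereal_integral \<tau> f = (LINT x|\<tau>. real_of_ereal (\<phi> x))"
    by (rule ereal_integral_eq) (use pr in \<open>simp_all add: \<mu>_def\<close>)
  also have "\<dots> = 0"
    by (rule integral_eq_zero_AE, use c[unfolded \<mu>_def snd_conv] in eventually_elim) (simp add: \<phi>_A2)
  finally have z: "ereal_integral \<tau> f = 0" .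
  have "sintegral \<mu> f = (LINT x|\<sigma> h. real_of_ereal (\<phi> x))"
    using ereal_integral_eq[OF pr(1,3)] by (simp add: sintegral_def \<mu>_def z)
  then have w: "C * (weighted_energy \<alpha> f \<mu> + 2 * \<Psi>)
      = C * signed_energy \<alpha> (\<sigma> h, \<tau>) + 2 * (C * ((LINT x|\<sigma> h. real_of_ereal (\<phi> x)) + \<Psi>))"
    and w0: "weighted_energy \<alpha> f \<mu> + 2 * \<Psi> = signed_energy \<alpha> (\<sigma> h, \<tau>) + 2 * ((LINT x|\<sigma> h. real_of_ereal (\<phi> x)) + \<Psi>)"
    by (simp_all add: weighted_energy_def \<mu>_def algebra_simps)
  have nn: "0 \<le> C * signed_energy \<alpha> (\<sigma> h, \<tau>)" "0 \<le> C * ((LINT x|\<sigma> h. real_of_ereal (\<phi> x)) + \<Psi>)"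
    using C(1) ed(2) l(2) by simp_all
  show "obj h \<tau> = ennreal (C * (weighted_energy \<alpha> f (\<sigma> h, \<tau>) + 2 * \<Psi>))"
    unfolding obj_def ed(1) l(1) w[unfolded \<mu>_def] using nn by (simp add: ennreal_mult)
  show "0 \<le> weighted_energy \<alpha> f (\<sigma> h, \<tau>) + 2 * \<Psi>" unfolding w0[unfolded \<mu>_def] using ed(2) l(2) by simp
qed

lemma admissibleE:
  assumes "\<mu> \<in> admissible \<alpha> f \<xi> A1 A2"
  obtains h \<tau> where "dens h" "sub \<tau>" "emeasure \<tau> UNIV = 1" "\<mu> = (\<sigma> h, \<tau>)"
proof -
  have fe: "\<mu> \<in> finite_energy \<alpha>" and c: "AE x in pos_part \<mu>. x \<in> A1" "AE x in neg_part \<mu>. x \<in> A2"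
    and mass: "emeasure (pos_part \<mu>) A1 = 1" "emeasure (neg_part \<mu>) A2 = 1"
    and le: "\<And>B. B \<in> sets borel \<Longrightarrow> emeasure (pos_part \<mu>) B \<le> emeasure \<xi> B"
    using assms by (auto simp: admissible_def unit_condenser_measures_def carried_by_def)
  note pr = energy_total_var_finite[OF fe]
  note s = pos_radonD(1)[OF pr(1)] pos_radonD(1)[OF pr(2)]
  obtain h where h: "h \<in> borel_measurable borel" "\<And>x. 0 \<le> h x \<and> h x \<le> 1" "pos_part \<mu> = density \<xi> (\<lambda>x. ennreal (h x))"
    by (rule density_of_le[OF \<xi>(3) sets\<xi> s(1)], erule le, rule that)
  define \<tau> where "\<tau> = neg_part \<mu>"
  have \<mu>: "\<mu> = (\<sigma> h, \<tau>)" using h(3) by (simp add: \<sigma>_def \<tau>_def prod_eq_iff)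
  have "emeasure (pos_part \<mu>) UNIV = 1" using emeasure_eq_UNIV_of_AE[OF c(1) s(1) A1] mass by simp
  moreover have "emeasure (pos_part \<mu>) UNIV = (\<integral>\<^sup>+x. ennreal (h x) * indicator UNIV x \<partial>\<xi>)"
    unfolding h(3) using h(1) by (intro emeasure_density) (auto simp: sets\<xi> cong: measurable_cong_sets)
  ultimately have d: "dens h" using h(1,2) by (simp add: dens_def)
  have m: "emeasure \<tau> UNIV = 1" using emeasure_eq_UNIV_of_AE[OF c(2) s(2) A2_borel] mass by (simp add: \<tau>_def)
  have sb: "sub \<tau>" using m s(2) c(2) by (simp add: sub_def \<tau>_def)
  show thesis by (rule that[OF d sb m \<mu>])
qed

lemma unique_minimizer:
  assumes q: "0 < q" "q < 1" and thick: "\<not> thin_at_infinity \<alpha> q A2"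
    and fin: "weighted_energy_inf \<alpha> f \<xi> A1 A2 < \<infinity>"
  shows "\<exists>!\<mu>. \<mu> \<in> admissible \<alpha> f \<xi> A1 A2 \<and> ereal (weighted_energy \<alpha> f \<mu>) = weighted_energy_inf \<alpha> f \<xi> A1 A2"
proof -
  \<comment> \<open>The infimum over the empty set is \<infinity>, so the hypothesis on the infimum
    provides a competitor.\<close>
  have "admissible \<alpha> f \<xi> A1 A2 \<noteq> {}"
  proof
    assume "admissible \<alpha> f \<xi> A1 A2 = {}"
    with fin show False by (simp add: weighted_energy_inf_def top_ereal_def)
  qed
  then obtain \<mu>0 where "\<mu>0 \<in> admissible \<alpha> f \<xi> A1 A2" by blast
  moreover from this obtain h0 \<tau>0 where "dens h0" "sub \<tau>0" "\<mu>0 = (\<sigma> h0, \<tau>0)" by (rule admissibleE)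
  ultimately have 0: "dens h0" "sub \<tau>0" "obj h0 \<tau>0 < \<infinity>" using admissible_obj(1)[of h0 \<tau>0] by simp_all
  obtain h \<tau> where m: "dens h" "sub \<tau>" "obj h \<tau> < \<infinity>"
    and min: "\<And>h' \<tau>'. dens h' \<Longrightarrow> sub \<tau>' \<Longrightarrow> obj h \<tau> \<le> obj h' \<tau>'"
    by (rule exists_minimizer[OF 0], rule that)
  have s: "sets \<tau> = sets borel" "emeasure \<tau> UNIV \<le> 1" "AE x in \<tau>. x \<in> A2" using m(2) by (auto simp: sub_def)
  have mass: "emeasure \<tau> UNIV = 1"
  proof (rule ccontr)
    assume "emeasure \<tau> UNIV \<noteq> 1"
    then have lt: "emeasure \<tau> UNIV < 1" using s(2) by (simp add: order_less_le)
    have "thin_at_infinity \<alpha> q A2"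
      by (rule thin_of_mass_deficit[OF \<alpha>(2) q finite\<sigma>[OF m(1)] sets\<sigma> emeasure_\<sigma>_UNIV[OF m(1)] finite_sub[OF m(2)] s(1) lt])
         (rule minimizer_variation[OF m(1,2) lt m(3) min])
    then show False using thick by simp
  qed
  have adm: "(\<sigma> h, \<tau>) \<in> admissible \<alpha> f \<xi> A1 A2" by (rule admissible_pair[OF m(1,2) mass m(3)])
  let ?w = "weighted_energy \<alpha> f"
  note obj_min = admissible_obj[OF m(1,2) adm]
  have le: "?w (\<sigma> h, \<tau>) \<le> ?w \<mu>" if "\<mu> \<in> admissible \<alpha> f \<xi> A1 A2" for \<mu>
    using that
  proof (rule admissibleE)
    fix h' \<tau>' assume h': "dens h'" "sub \<tau>'" and e: "\<mu> = (\<sigma> h', \<tau>')"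
    note o = admissible_obj[OF h' that[unfolded e], folded e]
    have "ennreal (C * (?w (\<sigma> h, \<tau>) + 2 * \<Psi>)) \<le> ennreal (C * (?w \<mu> + 2 * \<Psi>))"
      using min[OF h'] unfolding obj_min(1) o(1) .
    then have "C * (?w (\<sigma> h, \<tau>) + 2 * \<Psi>) \<le> C * (?w \<mu> + 2 * \<Psi>)"
      using o(2) C(1) by (subst (asm) ennreal_le_iff) auto
    then show ?thesis using C(1) by simp
  qed
  have inf: "weighted_energy_inf \<alpha> f \<xi> A1 A2 = ereal (?w (\<sigma> h, \<tau>))"
    unfolding weighted_energy_inf_def by (rule antisym[OF INF_lower[OF adm] INF_greatest]) (simp add: le)
  show ?thesis
  proof (rule ex1I[of _ "(\<sigma> h, \<tau>)"])
    show "(\<sigma> h, \<tau>) \<in> admissible \<alpha> f \<xi> A1 A2 \<and> ereal (?w (\<sigma> h, \<tau>)) = weighted_energy_inf \<alpha> f \<xi> A1 A2"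
      using adm inf by simp
  next
    fix \<mu> assume "\<mu> \<in> admissible \<alpha> f \<xi> A1 A2 \<and> ereal (?w \<mu>) = weighted_energy_inf \<alpha> f \<xi> A1 A2"
    then have \<mu>: "\<mu> \<in> admissible \<alpha> f \<xi> A1 A2" and w: "?w \<mu> = ?w (\<sigma> h, \<tau>)" by (auto simp: inf)
    from \<mu> show "\<mu> = (\<sigma> h, \<tau>)"
    proof (rule admissibleE)
      fix h' \<tau>' assume h': "dens h'" "sub \<tau>'" and e: "\<mu> = (\<sigma> h', \<tau>')"
      have oe: "obj h' \<tau>' = obj h \<tau>"
        unfolding obj_min(1) admissible_obj(1)[OF h' \<mu>[unfolded e]] w[unfolded e] ..
      have eq: "measure_add (\<sigma> h) \<tau>' = measure_add (\<sigma> h') \<tau>"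
        by (rule minimizers_eq[OF m(1) h'(1) m(2) h'(2) m(3) _ oe]) (rule min)
      have s': "sets \<tau>' = sets borel" "AE x in \<tau>'. x \<in> A2" using h'(2) by (auto simp: sub_def)
      have off: "AE x in \<sigma> k. x \<notin> A2" if "dens k" for k
        using AE_\<sigma>[OF that] by eventually_elim (use disj in auto)
      show "\<mu> = (\<sigma> h, \<tau>)"
        using singular_add_cancel[OF sets\<sigma> sets\<sigma> s(1) s'(1) A2_borel off[OF m(1)] off[OF h'(1)] s(3) s'(2) eq] e by simp
    qed
  qed
qed

end

theorem theorem6p1:
  fixes \<alpha> q :: real
    and D A1 A2 :: "'a::euclidean_space set"
    and f :: "'a \<Rightarrow> ereal"
    and \<xi> :: "'a measure"
  assumes "DIM('a) \<ge> 3"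
    and "0 < \<alpha>" and "\<alpha> \<le> 2"
    and "0 < q" and "q < 1"
    and "open D" and "connected D" and "D \<noteq> {}"
    and "closedin (top_of_set D) A1"
    and "A2 = - D"
    and "capacity \<alpha> A1 > 0" and "capacity \<alpha> A2 > 0"
    and "\<not> thin_at_infinity \<alpha> q A2"
    and "field_case_I \<alpha> A2 f \<or> field_case_II \<alpha> D f"
    and "\<xi> \<in> constraints \<alpha> A1"
    and "weighted_energy_inf \<alpha> f \<xi> A1 A2 < \<infinity>"
    and "emeasure \<xi> A1 < \<infinity>"
  shows "\<exists>!\<mu>. \<mu> \<in> admissible \<alpha> f \<xi> A1 A2 \<and>
           ereal (weighted_energy \<alpha> f \<mu>) = weighted_energy_inf \<alpha> f \<xi> A1 A2"
proof -
  have dim: "\<alpha> < real DIM('a)" using assms(1,3) by linarith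
  have \<xi>: "pos_radon \<alpha> \<xi>" "energy \<alpha> \<xi> < \<infinity>" "AE x in \<xi>. x \<in> A1"
    using assms(15) by (auto simp: constraints_def finite_energy_pos_def carried_by_def)
  note s = pos_radonD(1,2)[OF \<xi>(1)]
  obtain T where T: "closed T" "A1 = D \<inter> T" using assms(9) by (auto simp: closedin_closed)
  have A1: "A1 \<in> sets borel" unfolding T(2) using T(1) assms(6) by (intro sets.Int borel_open borel_closed)
  have "emeasure \<xi> (space \<xi>) = emeasure \<xi> A1"
    by (rule emeasure_eq_AE) (use \<xi>(3) A1 s in \<open>auto elim!: eventually_mono\<close>)
  then have fin: "finite_measure \<xi>" using assms(17) by (intro finite_measureI) simp
  have A2: "closed A2" "A1 \<inter> A2 = {}" using assms(6,10) T(2) by (auto simp: closed_def)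
  \<comment> \<open>The empty set is compact and therefore thin at infinity.\<close>
  have "A2 \<noteq> {}" using assms(13) by (auto simp: thin_at_infinity_def)
  obtain \<phi> :: "'a \<Rightarrow> ereal" and \<psi> :: "'a \<Rightarrow> real" and Z where field:
    "polar \<alpha> Z" "\<phi> \<in> borel_measurable borel" "\<psi> \<in> borel_measurable borel"
    "\<And>x. 0 \<le> \<psi> x" "(\<integral>\<^sup>+x. ennreal (\<psi> x) \<partial>\<xi>) < \<infinity>" "\<And>x. ereal (- \<psi> x) \<le> \<phi> x"
    "\<And>x. x \<in> A2 \<Longrightarrow> \<phi> x = 0" "\<And>x. x \<notin> Z \<Longrightarrow> f x = \<phi> x"
    by (rule regular_field[OF assms(2,3) dim assms(6,10,14) \<xi>(1,2)]) (rule that)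
  interpret condenser \<alpha> \<xi> A1 A2 Z f \<phi> \<psi>
    by (rule condenser.intro) (fact assms(2) dim A2 \<open>A2 \<noteq> {}\<close> A1 \<xi> fin field)+
  show ?thesis by (rule unique_minimizer[OF assms(4,5,13,16)])
qed



end
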